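(* Let $M$ be a $C^\infty$ manifold, $S\subset M$ a closed submanifold, and $H$ a Lie group acting smoothly on $M$ such that $\ell_hS\subset S$ for every $h\in H$, where $\ell_h:M\to M$ denotes translation by $h$. Let $\mathcal E\to M$ be an $H$-equivariant vector bundle, $dh$ a smooth measure on $H$, and $\Omega\subset H$ a compact measurable subset. If $\sigma\in C^{-\infty}(M,\mathcal E)$ vanishes to order $k\ge0$ along $S$, then so does $\int_\Omega\ell_h\sigma\,dh\in C^{-\infty}(M,\mathcal E)$.
   Context: Distributions on a manifold $M$ are the dual of compactly supported smooth complex measures; locally $L^1$ functions are distributions. Let $\mathcal I_S$ be the ideal sheaf of smooth functions vanishing on $S$; a smooth function vanishes to order $k$ on $S$ if it lies in $\mathcal I_S^{\,k}$. A linear differential operator $D$ with $C^\infty$ coefficients is tangential to $S$ if $D\,\mathcal I_S^{\,k}\subset\mathcal I_S^{\,k}$ for every $k\in\mathbb N$. A distribution $\sigma$ on $M$ vanishes to order $k\ge0$ along $S$ if every $p\in S$ has an open neighborhood $U_p$ in $M$ on which $\sigma=\sum_{1\le j\le N}f_jD_jh_j$, with $h_j\in L^\infty_{\rm loc}(U_p)$, $D_j$ differential operators on $U_p$ tangential to $S\cap U_p$, and $f_j\in C^\infty(U_p)$ vanishing to order $k$ on $S$. An $H$-equivariant vector bundle is a vector bundle $\mathcal E\to M$ to which the action of $H$ on $M$ lifts (smoothly and linearly on fibers). $C^{-\infty}(M,\mathcal E)$ is the space of $\mathcal E$-valued distributions; in a local trivialization of $\mathcal E$ such a distribution is an $r$-tuple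 of scalar distributions, $r=\operatorname{rank}\mathcal E$, and it vanishes to order $k$ along $S$ if, locally, all these components do. $H$ acts on $C^{-\infty}(M,\mathcal E)$ by translation, also denoted $\ell_h$, and $\int_\Omega\ell_h\sigma\,dh$ is the (weak) integral of the continuous family $h\mapsto\ell_h\sigma$ over $\Omega$. *)

theory Defs
  imports "HOL-Analysis.Analysis" "HOL-Algebra.Group_Action"
begin

section \<open>Smooth functions on coordinate spaces\<close>

text \<open>
  The model space of a manifold is the coordinate subspace \<open>span B\<close> of a Euclidean space, with
  \<open>B \<subseteq> Basis\<close>; the dimension is \<open>card B\<close>.  Taking \<open>B = Basis\<close> gives the whole space.  General
  \<open>B\<close> is allowed because \<open>Basis\<close> is never empty, whereas manifolds of dimension \<open>0\<close> (for instance
  discrete groups) have to be included.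
\<close>

definition partial_deriv :: "'e::real_normed_vector \<Rightarrow> ('e \<Rightarrow> 'f::real_normed_vector) \<Rightarrow> 'e \<Rightarrow> 'f" where
  "partial_deriv b g x = vector_derivative (\<lambda>t::real. g (x + t *\<^sub>R b)) (at 0)"

definition iter_partial :: "'e::real_normed_vector list \<Rightarrow> ('e \<Rightarrow> 'f::real_normed_vector) \<Rightarrow> 'e \<Rightarrow> 'f" where
  "iter_partial bs g = foldr partial_deriv bs g"

text \<open>
  Meant for \<open>W\<close> open in \<open>span B\<close>; then the values of \<open>g\<close> outside \<open>W\<close> are irrelevant.
\<close>

primrec k_smooth :: "nat \<Rightarrow> 'e::real_normed_vector set \<Rightarrow> 'e set \<Rightarrow> ('e \<Rightarrow> 'f::real_normed_vector) \<Rightarrow> bool" where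
  "k_smooth 0 B W g \<longleftrightarrow> continuous_on W g"
| "k_smooth (Suc k) B W g \<longleftrightarrow> continuous_on W g \<and>
     (\<forall>b\<in>B. (\<forall>x\<in>W. (\<lambda>t::real. g (x + t *\<^sub>R b)) differentiable (at 0)) \<and>
            k_smooth k B W (partial_deriv b g))"

definition smooth :: "'e::real_normed_vector set \<Rightarrow> 'e set \<Rightarrow> ('e \<Rightarrow> 'f::real_normed_vector) \<Rightarrow> bool" where
  "smooth B W g \<longleftrightarrow> (\<forall>k. k_smooth k B W g)"

text \<open>Leibniz formula for the determinant of the matrix \<open>\<langle>\<partial>\<^sub>b \<psi>, b'\<rangle>\<close>, \<open>b, b' \<in> B\<close>.\<close>

definition jacobian :: "'e::euclidean_space set \<Rightarrow> ('e \<Rightarrow> 'e) \<Rightarrow> 'e \<Rightarrow> real" where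
  "jacobian B \<psi> x =
     (\<Sum>p | p permutes B. of_int (sign p) * (\<Prod>b\<in>B. partial_deriv b \<psi> x \<bullet> p b))"

text \<open>Lebesgue measure of \<open>span B\<close>; cf. \<open>lborel_eq\<close> for \<open>B = Basis\<close>.\<close>

definition coord_lborel :: "'e::euclidean_space set \<Rightarrow> 'e measure" where
  "coord_lborel B = distr (\<Pi>\<^sub>M b\<in>B. lborel) borel (\<lambda>f. \<Sum>b\<in>B. f b *\<^sub>R b)"


section \<open>Manifolds, submanifolds, Lie groups\<close>

text \<open>A chart is a domain together with a coordinate map, whose values off the domain are irrelevant.\<close>

type_synonym ('m, 'e) chart = "'m set \<times> ('m \<Rightarrow> 'e)"

definition chart_map :: "'e::euclidean_space set \<Rightarrow> ('m::topological_space, 'e) chart \<Rightarrow> bool" where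
  "chart_map B = (\<lambda>(U, \<phi>). open U \<and> openin (top_of_set (span B)) (\<phi> ` U) \<and>
     homeomorphism U (\<phi> ` U) \<phi> (inv_into U \<phi>))"

definition smooth_transition ::
  "'e::euclidean_space set \<Rightarrow> ('m, 'e) chart \<Rightarrow> ('m, 'e) chart \<Rightarrow> bool" where
  "smooth_transition B = (\<lambda>(U, \<phi>) (V, \<psi>). smooth B (\<phi> ` (U \<inter> V)) (\<psi> \<circ> inv_into U \<phi>))"

text \<open>The manifold is the whole type; \<open>\<A>\<close> is a maximal atlas.\<close>

definition smooth_manifold ::
  "'e::euclidean_space set \<Rightarrow> ('m::{t2_space, second_countable_topology}, 'e) chart set \<Rightarrow> bool" where
  "smooth_manifold B \<A> \<longleftrightarrow> B \<subseteq> Basis \<and>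
     (\<forall>c\<in>\<A>. chart_map B c) \<and> (\<Union>c\<in>\<A>. fst c) = UNIV \<and>
     (\<forall>c\<in>\<A>. \<forall>d\<in>\<A>. smooth_transition B c d) \<and>
     (\<forall>c. chart_map B c \<longrightarrow>
        (\<forall>d\<in>\<A>. smooth_transition B c d \<and> smooth_transition B d c) \<longrightarrow> c \<in> \<A>)"

definition smooth_fun ::
  "'e::real_normed_vector set \<Rightarrow> ('m, 'e) chart set \<Rightarrow> 'm set \<Rightarrow> ('m \<Rightarrow> 'f::real_normed_vector) \<Rightarrow> bool" where
  "smooth_fun B \<A> W f \<longleftrightarrow> (\<forall>(U, \<phi>)\<in>\<A>. smooth B (\<phi> ` (U \<inter> W)) (f \<circ> inv_into U \<phi>))"

definition smooth_map ::
  "'e::real_normed_vector set \<Rightarrow> ('m::topological_space, 'e) chart set \<Rightarrow>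
   ('n::topological_space, 'f::real_normed_vector) chart set \<Rightarrow> ('m \<Rightarrow> 'n) \<Rightarrow> bool" where
  "smooth_map B \<A> \<N> f \<longleftrightarrow> continuous_on UNIV f \<and>
     (\<forall>(V, \<psi>)\<in>\<N>. smooth_fun B \<A> (f -` V) (\<psi> \<circ> f))"

definition prod_basis :: "'e::real_vector set \<Rightarrow> 'f::real_vector set \<Rightarrow> ('e \<times> 'f) set" where
  "prod_basis B C = (\<lambda>b. (b, 0)) ` B \<union> (\<lambda>c. (0, c)) ` C"

definition prod_atlas ::
  "('m, 'e) chart set \<Rightarrow> ('n, 'f) chart set \<Rightarrow> ('m \<times> 'n, 'e \<times> 'f) chart set" where
  "prod_atlas \<A> \<N> = {(U \<times> V, map_prod \<phi> \<psi>) | U \<phi> V \<psi>. (U, \<phi>) \<in> \<A> \<and> (V, \<psi>) \<in> \<N>}"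

definition closed_submanifold ::
  "'e::euclidean_space set \<Rightarrow> ('m::topological_space, 'e) chart set \<Rightarrow> 'm set \<Rightarrow> bool" where
  "closed_submanifold B \<A> S \<longleftrightarrow> closed S \<and>
     (\<exists>d. \<forall>p\<in>S. \<exists>(U, \<phi>)\<in>\<A>. p \<in> U \<and>
        (\<exists>J\<subseteq>B. card J = d \<and> \<phi> ` (S \<inter> U) = \<phi> ` U \<inter> span J))"

definition Lie_group ::
  "'a::euclidean_space set \<Rightarrow> ('h::{t2_space, second_countable_topology}, 'a) chart set \<Rightarrow>
   'h monoid \<Rightarrow> bool" where
  "Lie_group C \<H> H \<longleftrightarrow> group H \<and> carrier H = UNIV \<and> smooth_manifold C \<H> \<and>
     smooth_map (prod_basis C C) (prod_atlas \<H> \<H>) \<H> (\<lambda>(g, h). g \<otimes>\<^bsub>H\<^esub> h) \<and>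
     smooth_map C \<H> \<H> (\<lambda>h. inv\<^bsub>H\<^esub> h)"

definition smooth_action ::
  "'a::euclidean_space set \<Rightarrow> ('h::topological_space, 'a) chart set \<Rightarrow> 'h monoid \<Rightarrow>
   'e::euclidean_space set \<Rightarrow> ('m::topological_space, 'e) chart set \<Rightarrow> ('h \<Rightarrow> 'm \<Rightarrow> 'm) \<Rightarrow> bool" where
  "smooth_action C \<H> H B \<A> act \<longleftrightarrow> group_action H UNIV act \<and>
     smooth_map (prod_basis C B) (prod_atlas \<H> \<A>) \<A> (\<lambda>(h, x). act h x)"

definition smooth_measure ::
  "'a::euclidean_space set \<Rightarrow> ('h::topological_space, 'a) chart set \<Rightarrow> 'h measure \<Rightarrow> bool" where
  "smooth_measure C \<H> \<mu> \<longleftrightarrow> sets \<mu> = sets borel \<and>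
     (\<forall>(U, \<phi>)\<in>\<H>. \<exists>\<rho>::'h \<Rightarrow> real. smooth_fun C \<H> U \<rho> \<and> (\<forall>x\<in>U. 0 \<le> \<rho> x) \<and>
        (\<forall>A\<in>sets borel. A \<subseteq> U \<longrightarrow>
           emeasure \<mu> A = (\<integral>\<^sup>+y\<in>\<phi> ` A. ennreal (\<rho> (inv_into U \<phi> y)) \<partial>coord_lborel C)))"


section \<open>Equivariant vector bundles\<close>

text \<open>
  A complex vector bundle of rank \<open>r\<close> is given by its projection \<open>\<pi>\<close>, defined on the total space
  (the whole type \<open>'b\<close>), and a bundle atlas.  A local trivialization \<open>(T, \<Phi>)\<close> over the open set \<open>T\<close>
  maps \<open>e\<close> with \<open>\<pi> e \<in> T\<close> to \<open>(\<pi> e, \<Phi> e)\<close>, where the fibre coordinate \<open>\<Phi> e\<close> lies in the copy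
  \<open>fibre_space r\<close> of \<open>\<complex>\<^sup>r\<close>.  The linear structure of the fibres and the smooth structure of the total
  space are those transported by the trivializations.
\<close>

type_synonym ('m, 'b) triv = "'m set \<times> ('b \<Rightarrow> nat \<Rightarrow> complex)"

definition fibre_space :: "nat \<Rightarrow> (nat \<Rightarrow> complex) set" where
  "fibre_space r = {v. \<forall>i\<ge>r. v i = 0}"

definition vector_bundle ::
  "'e::euclidean_space set \<Rightarrow> ('m::topological_space, 'e) chart set \<Rightarrow> nat \<Rightarrow> ('b \<Rightarrow> 'm) \<Rightarrow>
   ('m, 'b) triv set \<Rightarrow> bool" where
  "vector_bundle B \<A> r \<pi> \<T> \<longleftrightarrow> (\<Union>t\<in>\<T>. fst t) = UNIV \<and>
     (\<forall>(T, \<Phi>)\<in>\<T>. open T \<and> bij_betw (\<lambda>e. (\<pi> e, \<Phi> e)) (\<pi> -` T) (T \<times> fibre_space r)) \<and>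
     (\<forall>(T, \<Phi>)\<in>\<T>. \<forall>(T', \<Phi>')\<in>\<T>. \<exists>g::nat \<Rightarrow> nat \<Rightarrow> 'm \<Rightarrow> complex.
        (\<forall>i<r. \<forall>j<r. smooth_fun B \<A> (T \<inter> T') (g i j)) \<and>
        (\<forall>e. \<pi> e \<in> T \<inter> T' \<longrightarrow> (\<forall>i<r. \<Phi>' e i = (\<Sum>j<r. g i j (\<pi> e) * \<Phi> e j))))"

text \<open>
  The action on the base lifts to an action \<open>lift\<close> on the total space which in local
  trivializations is given by a matrix depending smoothly on \<open>(h, x)\<close>.
\<close>

definition equivariant_bundle ::
  "'a::euclidean_space set \<Rightarrow> ('h::topological_space, 'a) chart set \<Rightarrow> 'h monoid \<Rightarrow>
   'e::euclidean_space set \<Rightarrow> ('m::topological_space, 'e) chart set \<Rightarrow> ('h \<Rightarrow> 'm \<Rightarrow> 'm) \<Rightarrow>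
   nat \<Rightarrow> ('b \<Rightarrow> 'm) \<Rightarrow> ('m, 'b) triv set \<Rightarrow> ('h \<Rightarrow> 'b \<Rightarrow> 'b) \<Rightarrow> bool" where
  "equivariant_bundle C \<H> H B \<A> act r \<pi> \<T> lift \<longleftrightarrow>
     vector_bundle B \<A> r \<pi> \<T> \<and> group_action H UNIV lift \<and>
     (\<forall>h e. \<pi> (lift h e) = act h (\<pi> e)) \<and>
     (\<forall>(T, \<Phi>)\<in>\<T>. \<forall>(T', \<Phi>')\<in>\<T>. \<exists>a::nat \<Rightarrow> nat \<Rightarrow> 'h \<times> 'm \<Rightarrow> complex.
        (\<forall>i<r. \<forall>j<r. smooth_fun (prod_basis C B) (prod_atlas \<H> \<A>)
           {(h, x). x \<in> T \<and> act h x \<in> T'} (a i j)) \<and>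
        (\<forall>h e. \<pi> e \<in> T \<and> act h (\<pi> e) \<in> T' \<longrightarrow>
           (\<forall>i<r. \<Phi>' (lift h e) i = (\<Sum>j<r. a i j (h, \<pi> e) * \<Phi> e j))))"

definition frame :: "('b \<Rightarrow> 'm) \<Rightarrow> ('m, 'b) triv \<Rightarrow> nat \<Rightarrow> 'm \<Rightarrow> 'b" where
  "frame \<pi> t i x = (THE e. \<pi> e = x \<and> snd t e = (\<lambda>j. if j = i then 1 else 0))"


section \<open>Smooth complex measures and scalar distributions\<close>

text \<open>
  A smooth complex measure is represented by its densities \<open>\<omega> c\<close> with respect to Lebesgue measure in
  the charts \<open>c\<close>, as functions on the chart domains, extended by \<open>0\<close> so that the representation is
  unique.  \<open>density_factor B c c' x\<close> is the factor \<open>|det \<partial>\<phi> / \<partial>\<phi>'|\<close> by which they transform.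
\<close>

definition density_factor ::
  "'e::euclidean_space set \<Rightarrow> ('m, 'e) chart \<Rightarrow> ('m, 'e) chart \<Rightarrow> 'm \<Rightarrow> real" where
  "density_factor B = (\<lambda>(U, \<phi>) (U', \<phi>') x. \<bar>jacobian B (\<phi> \<circ> inv_into U' \<phi>') (\<phi>' x)\<bar>)"

text \<open>Smooth complex measures on \<open>M\<close> whose support is compact and contained in the open set \<open>W\<close>.\<close>

definition test_measures ::
  "'e::euclidean_space set \<Rightarrow> ('m::topological_space, 'e) chart set \<Rightarrow> 'm set \<Rightarrow>
   (('m, 'e) chart \<Rightarrow> 'm \<Rightarrow> complex) set" where
  "test_measures B \<A> W = {\<omega>.
     (\<forall>c x. c \<notin> \<A> \<or> x \<notin> fst c \<longrightarrow> \<omega> c x = 0) \<and>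
     (\<forall>c\<in>\<A>. smooth_fun B \<A> (fst c) (\<omega> c)) \<and>
     (\<forall>c\<in>\<A>. \<forall>c'\<in>\<A>. \<forall>x\<in>fst c \<inter> fst c'.
        \<omega> c' x = of_real (density_factor B c c' x) * \<omega> c x) \<and>
     compact (closure {x. \<exists>c. \<omega> c x \<noteq> 0}) \<and> closure {x. \<exists>c. \<omega> c x \<noteq> 0} \<subseteq> W}"

text \<open>
  Total mass of a compactly supported complex measure \<open>\<omega>\<close> given by its densities in charts: cut the
  support into finitely many Borel pieces lying in chart domains; the result is independent of the
  choices.
\<close>

definition has_total_mass ::
  "'e::euclidean_space set \<Rightarrow> ('m::topological_space, 'e) chart set \<Rightarrow>
   (('m, 'e) chart \<Rightarrow> 'm \<Rightarrow> complex) \<Rightarrow> complex \<Rightarrow> bool" where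
  "has_total_mass B \<A> \<omega> z \<longleftrightarrow> (\<exists>(N::nat) U \<phi> A.
     (\<forall>j<N. (U j, \<phi> j) \<in> \<A> \<and> A j \<in> sets borel \<and> A j \<subseteq> U j \<and>
        set_integrable (coord_lborel B) (\<phi> j ` A j) (\<lambda>y. \<omega> (U j, \<phi> j) (inv_into (U j) (\<phi> j) y))) \<and>
     disjoint_family_on A {..<N} \<and>
     (\<forall>c\<in>\<A>. \<forall>x\<in>fst c. x \<notin> (\<Union>j<N. A j) \<longrightarrow> \<omega> c x = 0) \<and>
     z = (\<Sum>j<N. LINT y:\<phi> j ` A j|coord_lborel B. \<omega> (U j, \<phi> j) (inv_into (U j) (\<phi> j) y)))"

definition measure_pairing ::
  "'e::euclidean_space set \<Rightarrow> ('m::topological_space, 'e) chart set \<Rightarrow>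
   ('m \<Rightarrow> complex) \<Rightarrow> (('m, 'e) chart \<Rightarrow> 'm \<Rightarrow> complex) \<Rightarrow> complex" where
  "measure_pairing B \<A> f \<omega> = (THE z. has_total_mass B \<A> (\<lambda>c x. f x * \<omega> c x) z)"

definition Linf_loc ::
  "'e::euclidean_space set \<Rightarrow> ('m::topological_space, 'e) chart set \<Rightarrow> 'm set \<Rightarrow> ('m \<Rightarrow> complex) set" where
  "Linf_loc B \<A> W = {h. h \<in> borel_measurable (restrict_space borel W) \<and>
     (\<forall>K. compact K \<and> K \<subseteq> W \<longrightarrow> (\<exists>R. \<forall>(U, \<phi>)\<in>\<A>.
        AE y in coord_lborel B. y \<in> \<phi> ` (U \<inter> K) \<longrightarrow> cmod (h (inv_into U \<phi> y)) \<le> R))}"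


section \<open>Differential operators and vanishing along a submanifold\<close>

text \<open>
  Sections over \<open>W\<close> of the \<open>k\<close>-th power of the ideal sheaf of \<open>S\<close>.  The coefficients \<open>a j\<close> make
  the \<open>0\<close>-th power the sheaf of all smooth functions.
\<close>

definition ideal_power ::
  "'e::euclidean_space set \<Rightarrow> ('m::topological_space, 'e) chart set \<Rightarrow> 'm set \<Rightarrow> nat \<Rightarrow> 'm set \<Rightarrow>
   ('m \<Rightarrow> complex) set" where
  "ideal_power B \<A> S k W = {f. smooth_fun B \<A> W f \<and>
     (\<forall>p\<in>W. \<exists>V. open V \<and> p \<in> V \<and> V \<subseteq> W \<and>
        (\<exists>(N::nat) a g.
           (\<forall>j<N. smooth_fun B \<A> V (a j) \<and>
              (\<forall>i<k. smooth_fun B \<A> V (g j i) \<and> (\<forall>x\<in>S \<inter> V. g j i x = 0))) \<and>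
           (\<forall>x\<in>V. f x = (\<Sum>j<N. a j x * (\<Prod>i<k. g j i x)))))}"

text \<open>
  An operator on \<open>U\<close> acts on smooth functions on every open \<open>W \<subseteq> U\<close>.  Multi-indices are
  represented by lists of coordinate directions.
\<close>

definition diff_operator ::
  "'e::euclidean_space set \<Rightarrow> ('m::topological_space, 'e) chart set \<Rightarrow> 'm set \<Rightarrow>
   (('m \<Rightarrow> complex) \<Rightarrow> 'm \<Rightarrow> complex) \<Rightarrow> bool" where
  "diff_operator B \<A> U D \<longleftrightarrow> (\<exists>m::nat. \<forall>(V, \<phi>)\<in>\<A>. \<exists>a::'e list \<Rightarrow> 'm \<Rightarrow> complex.
     (\<forall>bs. set bs \<subseteq> B \<and> length bs \<le> m \<longrightarrow> smooth_fun B \<A> (U \<inter> V) (a bs)) \<and>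
     (\<forall>W f. open W \<and> W \<subseteq> U \<and> smooth_fun B \<A> W f \<longrightarrow>
        (\<forall>x\<in>W \<inter> V. D f x =
           (\<Sum>bs | set bs \<subseteq> B \<and> length bs \<le> m.
              a bs x * iter_partial bs (f \<circ> inv_into V \<phi>) (\<phi> x)))))"

definition tangential ::
  "'e::euclidean_space set \<Rightarrow> ('m::topological_space, 'e) chart set \<Rightarrow> 'm set \<Rightarrow> 'm set \<Rightarrow>
   (('m \<Rightarrow> complex) \<Rightarrow> 'm \<Rightarrow> complex) \<Rightarrow> bool" where
  "tangential B \<A> S U D \<longleftrightarrow>
     (\<forall>k W. open W \<and> W \<subseteq> U \<longrightarrow> (\<forall>f\<in>ideal_power B \<A> S k W. D f \<in> ideal_power B \<A> S k W))"

definition transpose_operator ::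
  "'e::euclidean_space set \<Rightarrow> ('m::topological_space, 'e) chart set \<Rightarrow> 'm set \<Rightarrow>
   (('m \<Rightarrow> complex) \<Rightarrow> 'm \<Rightarrow> complex) \<Rightarrow>
   (('m, 'e) chart \<Rightarrow> 'm \<Rightarrow> complex) \<Rightarrow> (('m, 'e) chart \<Rightarrow> 'm \<Rightarrow> complex)" where
  "transpose_operator B \<A> U D \<omega> = (THE \<omega>'. \<omega>' \<in> test_measures B \<A> U \<and>
     (\<forall>f. smooth_fun B \<A> U f \<longrightarrow> measure_pairing B \<A> (D f) \<omega> = measure_pairing B \<A> f \<omega>'))"

text \<open>
  The distribution \<open>f D h\<close> on \<open>U\<close>: a locally bounded \<open>h\<close> is the distribution \<open>\<omega> \<mapsto> \<integral> h \<omega>\<close>, the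
  operator \<open>D\<close> acts on distributions by duality through its transpose, and so does multiplication
  by \<open>f\<close>.
\<close>

definition fDh_distribution ::
  "'e::euclidean_space set \<Rightarrow> ('m::topological_space, 'e) chart set \<Rightarrow> 'm set \<Rightarrow>
   ('m \<Rightarrow> complex) \<Rightarrow> (('m \<Rightarrow> complex) \<Rightarrow> 'm \<Rightarrow> complex) \<Rightarrow> ('m \<Rightarrow> complex) \<Rightarrow>
   (('m, 'e) chart \<Rightarrow> 'm \<Rightarrow> complex) \<Rightarrow> complex" where
  "fDh_distribution B \<A> U f D h \<omega> =
     measure_pairing B \<A> h (transpose_operator B \<A> U D (\<lambda>c x. f x * \<omega> c x))"

text \<open>\<open>u\<close> is a scalar distribution on the open set \<open>W\<close>, i.e. a functional on \<open>test_measures B \<A> W\<close>.\<close>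

definition scalar_vanishes ::
  "'e::euclidean_space set \<Rightarrow> ('m::topological_space, 'e) chart set \<Rightarrow> 'm set \<Rightarrow> nat \<Rightarrow> 'm set \<Rightarrow>
   ((('m, 'e) chart \<Rightarrow> 'm \<Rightarrow> complex) \<Rightarrow> complex) \<Rightarrow> bool" where
  "scalar_vanishes B \<A> S k W u \<longleftrightarrow>
     (\<forall>p\<in>S \<inter> W. \<exists>U. open U \<and> p \<in> U \<and> U \<subseteq> W \<and>
        (\<exists>(N::nat) f D h.
           (\<forall>j<N. f j \<in> ideal_power B \<A> S k U \<and>
              diff_operator B \<A> U (D j) \<and> tangential B \<A> S U (D j) \<and>
              h j \<in> Linf_loc B \<A> U) \<and>
           (\<forall>\<omega>\<in>test_measures B \<A> U.
              u \<omega> = (\<Sum>j<N. fDh_distribution B \<A> U (f j) (D j) (h j) \<omega>))))"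


section \<open>Bundle-valued distributions\<close>

text \<open>
  Compactly supported smooth measures with values in the dual bundle: \<open>\<tau> c e\<close> is the value on \<open>e\<close>,
  linear on the fibres, of the density in the chart \<open>c\<close>.
\<close>

definition bundle_test_measures ::
  "'e::euclidean_space set \<Rightarrow> ('m::topological_space, 'e) chart set \<Rightarrow> nat \<Rightarrow> ('b \<Rightarrow> 'm) \<Rightarrow>
   ('m, 'b) triv set \<Rightarrow> (('m, 'e) chart \<Rightarrow> 'b \<Rightarrow> complex) set" where
  "bundle_test_measures B \<A> r \<pi> \<T> = {\<tau>.
     (\<forall>c e. c \<notin> \<A> \<or> \<pi> e \<notin> fst c \<longrightarrow> \<tau> c e = 0) \<and>
     (\<forall>c\<in>\<A>. \<forall>t\<in>\<T>.
        (\<forall>i<r. smooth_fun B \<A> (fst c \<inter> fst t) (\<lambda>x. \<tau> c (frame \<pi> t i x))) \<and>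
        (\<forall>e. \<pi> e \<in> fst c \<inter> fst t \<longrightarrow> \<tau> c e = (\<Sum>i<r. snd t e i * \<tau> c (frame \<pi> t i (\<pi> e))))) \<and>
     (\<forall>c\<in>\<A>. \<forall>c'\<in>\<A>. \<forall>e. \<pi> e \<in> fst c \<inter> fst c' \<longrightarrow>
        \<tau> c' e = of_real (density_factor B c c' (\<pi> e)) * \<tau> c e) \<and>
     compact (closure {\<pi> e | e. \<exists>c. \<tau> c e \<noteq> 0})}"

text \<open>Convergence to \<open>0\<close>: supports in a fixed compact set, all derivatives locally uniformly.\<close>

definition bundle_test_null ::
  "'e::euclidean_space set \<Rightarrow> ('m::topological_space, 'e) chart set \<Rightarrow> nat \<Rightarrow> ('b \<Rightarrow> 'm) \<Rightarrow>
   ('m, 'b) triv set \<Rightarrow> (nat \<Rightarrow> ('m, 'e) chart \<Rightarrow> 'b \<Rightarrow> complex) \<Rightarrow> bool" where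
  "bundle_test_null B \<A> r \<pi> \<T> \<tau> \<longleftrightarrow>
     (\<exists>K. compact K \<and> (\<forall>n c e. \<tau> n c e \<noteq> 0 \<longrightarrow> \<pi> e \<in> K)) \<and>
     (\<forall>(U, \<phi>)\<in>\<A>. \<forall>t\<in>\<T>. \<forall>L i bs. compact L \<and> L \<subseteq> U \<inter> fst t \<and> i < r \<and> set bs \<subseteq> B \<longrightarrow>
        uniform_limit (\<phi> ` L)
          (\<lambda>n. iter_partial bs (\<lambda>y. \<tau> n (U, \<phi>) (frame \<pi> t i (inv_into U \<phi> y)))) (\<lambda>_. 0) sequentially)"

text \<open>
  \<open>C\<^sup>-\<^sup>\<infinity>(M, \<E>)\<close>.  On the LF-space of test measures, continuity of a linear functional is the same as
  sequential continuity at \<open>0\<close>.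
\<close>

definition bundle_distributions ::
  "'e::euclidean_space set \<Rightarrow> ('m::topological_space, 'e) chart set \<Rightarrow> nat \<Rightarrow> ('b \<Rightarrow> 'm) \<Rightarrow>
   ('m, 'b) triv set \<Rightarrow> ((('m, 'e) chart \<Rightarrow> 'b \<Rightarrow> complex) \<Rightarrow> complex) set" where
  "bundle_distributions B \<A> r \<pi> \<T> = {\<sigma>.
     (\<forall>\<tau>\<in>bundle_test_measures B \<A> r \<pi> \<T>. \<forall>\<tau>'\<in>bundle_test_measures B \<A> r \<pi> \<T>.
        \<sigma> (\<lambda>c e. \<tau> c e + \<tau>' c e) = \<sigma> \<tau> + \<sigma> \<tau>') \<and>
     (\<forall>\<tau>\<in>bundle_test_measures B \<A> r \<pi> \<T>. \<forall>z. \<sigma> (\<lambda>c e. z * \<tau> c e) = z * \<sigma> \<tau>) \<and>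
     (\<forall>\<tau>. (\<forall>n. \<tau> n \<in> bundle_test_measures B \<A> r \<pi> \<T>) \<and> bundle_test_null B \<A> r \<pi> \<T> \<tau> \<longrightarrow>
        (\<lambda>n. \<sigma> (\<tau> n)) \<longlonglongrightarrow> 0)}"

text \<open>
  The \<open>i\<close>-th component in the trivialization \<open>(T, \<Phi>)\<close>, a scalar distribution on \<open>T\<close>: pair with the
  scalar measure times the \<open>i\<close>-th coordinate functional of the fibre.
\<close>

definition component ::
  "('b \<Rightarrow> 'm) \<Rightarrow> ('m, 'b) triv \<Rightarrow> nat \<Rightarrow> ((('m, 'e) chart \<Rightarrow> 'b \<Rightarrow> complex) \<Rightarrow> complex) \<Rightarrow>
   (('m, 'e) chart \<Rightarrow> 'm \<Rightarrow> complex) \<Rightarrow> complex" where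
  "component \<pi> t i \<sigma> \<omega> = \<sigma> (\<lambda>c e. \<omega> c (\<pi> e) * snd t e i)"

definition vanishes_along ::
  "'e::euclidean_space set \<Rightarrow> ('m::topological_space, 'e) chart set \<Rightarrow> nat \<Rightarrow> ('b \<Rightarrow> 'm) \<Rightarrow>
   ('m, 'b) triv set \<Rightarrow> 'm set \<Rightarrow> nat \<Rightarrow> ((('m, 'e) chart \<Rightarrow> 'b \<Rightarrow> complex) \<Rightarrow> complex) \<Rightarrow> bool" where
  "vanishes_along B \<A> r \<pi> \<T> S k \<sigma> \<longleftrightarrow>
     (\<forall>t\<in>\<T>. \<forall>i<r. scalar_vanishes B \<A> S k (fst t) (component \<pi> t i \<sigma>))"

text \<open>
  Translation is dual to the pullback of test measures.  In the chart \<open>(U, \<phi>)\<close> the pullback by the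
  diffeomorphism \<open>act h\<close> has the density which the original measure has in the transported chart
  \<open>(h U, \<phi> \<circ> h\<^sup>-\<^sup>1)\<close>, so no Jacobian appears.
\<close>

definition pullback_test ::
  "'h monoid \<Rightarrow> ('h \<Rightarrow> 'm \<Rightarrow> 'm) \<Rightarrow> ('h \<Rightarrow> 'b \<Rightarrow> 'b) \<Rightarrow> 'h \<Rightarrow>
   (('m, 'e) chart \<Rightarrow> 'b \<Rightarrow> complex) \<Rightarrow> (('m, 'e) chart \<Rightarrow> 'b \<Rightarrow> complex)" where
  "pullback_test H act lift h \<tau> = (\<lambda>(U, \<phi>) e. \<tau> (act h ` U, \<phi> \<circ> act (inv\<^bsub>H\<^esub> h)) (lift h e))"

definition translate ::
  "'h monoid \<Rightarrow> ('h \<Rightarrow> 'm \<Rightarrow> 'm) \<Rightarrow> ('h \<Rightarrow> 'b \<Rightarrow> 'b) \<Rightarrow> 'h \<Rightarrow>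
   ((('m, 'e) chart \<Rightarrow> 'b \<Rightarrow> complex) \<Rightarrow> complex) \<Rightarrow> ((('m, 'e) chart \<Rightarrow> 'b \<Rightarrow> complex) \<Rightarrow> complex)" where
  "translate H act lift h \<sigma> = (\<lambda>\<tau>. \<sigma> (pullback_test H act lift h \<tau>))"

definition weak_integral :: "'h measure \<Rightarrow> 'h set \<Rightarrow> ('h \<Rightarrow> 't \<Rightarrow> complex) \<Rightarrow> 't \<Rightarrow> complex" where
  "weak_integral \<mu> \<Omega> F = (\<lambda>\<tau>. LINT h:\<Omega>|\<mu>. F h \<tau>)"

end

theory Submission
  imports Defs
begin

text \<open>
  In a chart adapted to \<open>S\<close> an operator \<open>D\<close> is tangential iff its coefficient at a derivative of
  normal order \<open>j\<close> vanishes to order \<open>j\<close> on \<open>S\<close>.  For \<open>H\<close>-translates this holds jointly in the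
  coordinates of \<open>h\<close> and of the point: the expression \<open>f D\<close>, translated by \<open>h\<close>, has coefficients which
  for each \<open>h\<close> vanish to order \<open>k + j\<close> on \<open>S\<close>, because \<open>act h\<close> preserves \<open>S\<close>, and which are smooth in
  all variables; by Hadamard's lemma they are therefore combinations of monomials of degree \<open>k + j\<close> in
  the normal coordinates of the point, with coefficients smooth in all variables.  By Leibniz' rule
  these smooth coefficients move to the right of the derivatives, next to \<open>h_j\<close>, while the monomials
  and derivatives do not depend on \<open>h\<close>.  So integrating over \<open>h\<close> acts only on bounded functions
  (Fubini), and the result is again a sum \<open>f D h\<close> of the required form.  Compactness of \<open>\<Omega>\<close> reduces the
  integral over \<open>\<Omega>\<close> to finitely many coordinate neighbourhoods.
\<close>

section \<open>Calculus in coordinate subspaces\<close>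

text \<open>Operators act on distributions through a transpose that is given only by a description:
  its existence comes from integration by parts in a chart, its uniqueness from the fact that smooth
  functions separate test measures. The coefficients of an operator at a point z are read off from
  its values on monomials in x - z; a binomial expansion into monomials in x and in z leaves only
  values on monomials in x, and tangentiality controls those. The order count survives the Leibniz
  rule because a part v of a multi-index cs has at most as many normal entries as cs: the k + |cs|_N
  normal factors that stay under the derivative v number at least k + |v|_N. The given L^infinity
  functions are bounded only off a null set, which moves with h; they are truncated to functions
  bounded everywhere before Fubini is applied. That the integral is a distribution at all rests on
  pullback being continuous jointly in the group element and the test measure, which makes the
  estimates uniform over a compact set.\<close>

abbreviation "pd == partial_deriv"
abbreviation "ipd == iter_partial"

abbreviation span_open :: "'e::euclidean_space set => 'e set => bool" where
 "span_open B W == openin (top_of_set (span B)) W"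

lemma sum_Basis_inner:
 assumes "F <= Basis" "b \<in> Basis"
 shows "(\<Sum>c\<in>F. f c *\<^sub>R c) \<bullet> b = (if b \<in> F then f b else 0)"
proof -
 have "finite F" using assms(1) finite_subset[OF _ finite_Basis] by blast
 have "(\<Sum>c\<in>F. f c *\<^sub>R c) \<bullet> b = (\<Sum>c\<in>F. f c * (c \<bullet> b))"
  by (simp add: inner_sum_left)
 also have "... = (\<Sum>c\<in>F. if c = b then f c else 0)"
  using assms by (intro sum.cong) (auto simp: inner_Basis)
 finally show ?thesis using \<open>finite F\<close> by simp
qed

lemma span_Basis_eq:
 assumes "B <= Basis"
 shows "x \<in> span B \<longleftrightarrow> (ALL b:Basis - B. x \<bullet> b = 0)"
proof
 assume "x \<in> span B"
 thus "ALL b:Basis - B. x \<bullet> b = 0"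
 proof (induction rule: span_induct_alt)
  case base
  thus ?case by simp
 next
  case (step c a y)
  thus ?case using assms by (auto simp: inner_add_left inner_Basis)
 qed
next
 assume *: "ALL b:Basis - B. x \<bullet> b = 0"
 have "x = (\<Sum>b\<in>Basis. (x \<bullet> b) *\<^sub>R b)" by (simp add: euclidean_representation)
 also have "... = (\<Sum>b\<in>B. (x \<bullet> b) *\<^sub>R b)"
  using * assms by (intro sum.mono_neutral_right) auto
 also have "... \<in> span B" by (intro span_sum span_scale span_base)
 finally show "x \<in> span B" .
qed

lemma span_representation:
 assumes "B <= Basis" "x \<in> span B"
 shows "(\<Sum>b\<in>B. (x \<bullet> b) *\<^sub>R b) = x"
proof -
 have "x = (\<Sum>b\<in>Basis. (x \<bullet> b) *\<^sub>R b)" by (simp add: euclidean_representation)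
 also have "... = (\<Sum>b\<in>B. (x \<bullet> b) *\<^sub>R b)"
  using assms span_Basis_eq[OF assms(1)] by (intro sum.mono_neutral_right) auto
 finally show ?thesis ..
qed

lemma finite_Basis_subset: "B <= Basis ==> finite B"
 using finite_subset finite_Basis by blast

text \<open>A direction in \<open>B\<close> does not leave \<open>span B\<close>, so a short segment
  through \<open>x\<close> stays in \<open>W\<close>. This is why partial derivatives on a
  relatively open set depend only on the values there.\<close>

lemma span_open_line:
 assumes "span_open B W" "b \<in> B" "x \<in> W"
 shows "\<forall>\<^sub>F t in nhds (0::real). x + t *\<^sub>R b \<in> W"
proof -
 obtain T where T: "open T" "W = span B \<inter> T" using assms(1) unfolding openin_open by auto
 have "((%t::real. x + t *\<^sub>R b) \<longlongrightarrow> x) (nhds 0)"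
  by (rule tendsto_eq_intros refl filterlim_ident)+ simp
 hence "\<forall>\<^sub>F t in nhds 0. x + t *\<^sub>R b \<in> T" using T assms(3) topological_tendstoD by blast
 moreover have "x + t *\<^sub>R b \<in> span B" for t
  using assms T span_add[OF _ span_scale[OF span_base[OF assms(2)]]] by auto
 ultimately show ?thesis using T by (auto elim: eventually_mono)
qed

lemma span_open_subset: "span_open B W ==> W <= span B"
 by (simp add: openin_imp_subset)

section \<open>Partial derivatives and finite differentiability classes\<close>

lemma partial_derivI:
 "((%t::real. g (x + t *\<^sub>R b)) has_vector_derivative D) (at 0) ==> pd b g x = D"
 unfolding partial_deriv_def by (rule vector_derivative_at)

lemma partial_deriv_works:
 "(%t::real. g (x + t *\<^sub>R b)) differentiable at 0 ==>
 ((%t::real. g (x + t *\<^sub>R b)) has_vector_derivative pd b g x) (at 0)"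
 unfolding partial_deriv_def by (simp add: vector_derivative_works)

lemma line_eq_eventually:
 assumes "span_open B W" "b \<in> B" "x \<in> W" "!!y. y \<in> W ==> g y = g' y"
 shows "\<forall>\<^sub>F t in nhds (0::real). g (x + t *\<^sub>R b) = g' (x + t *\<^sub>R b)"
 using span_open_line[OF assms(1-3)] by (rule eventually_mono) (use assms(4) in auto)

lemma has_vector_derivative_line_cong:
 assumes "span_open B W" "b \<in> B" "x \<in> W" "!!y. y \<in> W ==> g y = g' y"
 shows "((%t::real. g (x + t *\<^sub>R b)) has_vector_derivative D) (at 0) \<longleftrightarrow>
    ((%t::real. g' (x + t *\<^sub>R b)) has_vector_derivative D) (at 0)"
 using line_eq_eventually[OF assms(1-3,4)] assms(3,4)
 by (intro has_vector_derivative_cong_ev) (auto elim!: eventually_mono)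

lemma partial_deriv_cong:
 assumes "span_open B W" "b \<in> B" "x \<in> W" "!!y. y \<in> W ==> g y = g' y"
 shows "pd b g x = pd b g' x"
 unfolding partial_deriv_def vector_derivative_def
 by (subst has_vector_derivative_line_cong[OF assms]) auto

lemma differentiable_line_iff:
 "(%t::real. g (x + t *\<^sub>R b)) differentiable at 0 \<longleftrightarrow>
 (EX D. ((%t::real. g (x + t *\<^sub>R b)) has_vector_derivative D) (at 0))"
 using vector_derivative_works differentiableI_vector by blast

lemma k_smooth_cong:
 assumes "span_open B W" "!!y. y \<in> W ==> g y = g' y"
 shows "k_smooth k B W g \<longleftrightarrow> k_smooth k B W g'"
 using assms(2)
proof (induction k arbitrary: g g')
 case 0
 thus ?case using continuous_on_cong by auto
next
 case (Suc k)
 have "continuous_on W g \<longleftrightarrow> continuous_on W g'" using Suc.prems by (intro continuous_on_cong) auto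
 moreover have "k_smooth k B W (pd b g) \<longleftrightarrow> k_smooth k B W (pd b g')" if "b \<in> B" for b
  by (intro Suc.IH partial_deriv_cong[OF assms(1) that]) (use Suc.prems in auto)
 moreover have "(%t::real. g (x + t *\<^sub>R b)) differentiable at 0 \<longleftrightarrow> (%t::real. g' (x + t *\<^sub>R b)) differentiable at 0"
  if "b \<in> B" "x \<in> W" for b x
  unfolding differentiable_line_iff using has_vector_derivative_line_cong[OF assms(1) that] Suc.prems by blast
 ultimately show ?case by auto
qed

text \<open>The induction step takes any family \<open>g'\<close> of directional derivatives:
  product and chain rule supply formulas for them, and the induction hypothesis applies to the
  formulas.\<close>

lemma k_smooth_SucI:
 assumes "span_open B W" "continuous_on W g"
  "!!b x. b \<in> B ==> x \<in> W ==> ((%t::real. g (x + t *\<^sub>R b)) has_vector_derivative g' b x) (at 0)"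
  "!!b. b \<in> B ==> k_smooth k B W (g' b)"
 shows "k_smooth (Suc k) B W g"
proof -
 have "k_smooth k B W (pd b g)" if "b \<in> B" for b
  using k_smooth_cong[OF assms(1), of "pd b g" "g' b" k] assms(3,4) that
  by (simp add: partial_derivI)
 moreover have "(%t::real. g (x + t *\<^sub>R b)) differentiable at 0" if "b \<in> B" "x \<in> W" for b x
  using assms(3)[OF that] by (rule differentiableI_vector)
 ultimately show ?thesis using assms(2) by simp
qed

lemma k_smooth_continuous: "k_smooth k B W g ==> continuous_on W g"
 by (cases k) auto

lemma k_smooth_SucD: "k_smooth (Suc k) B W g ==> k_smooth k B W g"
proof (induction k arbitrary: g)
 case (Suc k)
 hence "ALL b:B. k_smooth k B W (pd b g)" by auto
 with Suc.prems show ?case by auto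
qed auto

lemma k_smooth_partial:
 "k_smooth (Suc k) B W g ==> b \<in> B ==> k_smooth k B W (pd b g)"
 by simp

lemma k_smooth_has_partial:
 "k_smooth (Suc k) B W g ==> b \<in> B ==> x \<in> W ==>
 ((%t::real. g (x + t *\<^sub>R b)) has_vector_derivative pd b g x) (at 0)"
 by (simp add: partial_deriv_works)

lemma k_smooth_subset: "k_smooth k B W g ==> W' <= W ==> k_smooth k B W' g"
 by (induction k arbitrary: g) (auto intro: continuous_on_subset)

lemma continuous_on_local:
 assumes "!!x. x \<in> W ==> EX W'. x \<in> W' & span_open B W' & continuous_on W' g" "W <= span B"
 shows "continuous_on W g"
 unfolding continuous_on_eq_continuous_within
proof
 fix x assume "x \<in> W"
 then obtain W' where W': "x \<in> W'" "span_open B W'" "continuous_on W' g" using assms(1) by blast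
 then obtain T where T: "open T" "W' = span B \<inter> T" unfolding openin_open by auto
 have "at x within (W \<inter> W') = at x within W"
  using T W'(1) assms(2) by (intro at_within_nhd[of _ T]) auto
 moreover have "continuous (at x within W \<inter> W') g"
  using W' \<open>x \<in> W\<close> continuous_on_subset[OF W'(3), of "W \<inter> W'"]
  by (auto simp: continuous_on_eq_continuous_within)
 ultimately show "continuous (at x within W) g" by simp
qed

lemma k_smooth_local:
 assumes "!!x. x \<in> W ==> EX W'. x \<in> W' & span_open B W' & k_smooth k B W' g" "W <= span B"
 shows "k_smooth k B W g"
 using assms(1)
proof (induction k arbitrary: g)
 case 0
 thus ?case using continuous_on_local[OF _ assms(2), of g] by simp
next
 case (Suc k)
 have "continuous_on W g"
  by (rule continuous_on_local[OF _ assms(2)]) (use Suc.prems in force)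
 moreover have "k_smooth k B W (pd b g)" if "b \<in> B" for b
  by (rule Suc.IH) (use Suc.prems that in force)
 moreover have "(%t::real. g (x + t *\<^sub>R b)) differentiable at 0" if "b \<in> B" "x \<in> W" for b x
  using Suc.prems[OF that(2)] that by auto
 ultimately show ?case by auto
qed

lemma k_smooth_const: "span_open B W ==> k_smooth k B W (%x. c)"
proof (induction k arbitrary: c)
 case (Suc k)
 thus ?case by (intro k_smooth_SucI[where g' = "%_ _. 0"]) auto
qed auto

lemma k_smooth_bounded_linear:
 assumes "bounded_linear L" "span_open B W"
 shows "k_smooth k B W L"
proof (cases k)
 case 0
 thus ?thesis using assms by (simp add: linear_continuous_on)
next
 case (Suc k')
 have "((%t::real. L (x + t *\<^sub>R b)) has_vector_derivative L b) (at 0)" for b x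
 proof -
  have "((%t::real. x + t *\<^sub>R b) has_vector_derivative b) (at 0)"
   by (auto intro!: derivative_eq_intros)
  thus ?thesis by (rule bounded_linear.has_vector_derivative[OF assms(1)])
 qed
 thus ?thesis unfolding Suc
  by (rule k_smooth_SucI[OF assms(2) linear_continuous_on[OF assms(1)], where g' = "%b _. L b", OF _ k_smooth_const[OF assms(2)]])
qed

lemma k_smooth_linear_comp:
 assumes "bounded_linear L" "span_open B W" "k_smooth k B W g"
 shows "k_smooth k B W (%x. L (g x))"
 using assms(3)
proof (induction k arbitrary: g)
 case 0
 thus ?case using bounded_linear.continuous_on[OF assms(1)] by simp
next
 case (Suc k)
 show ?case
 proof (rule k_smooth_SucI[OF assms(2), where g' = "%b x. L (pd b g x)"])
  show "continuous_on W (%x. L (g x))"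
   using assms(1) k_smooth_continuous[OF Suc.prems] by (rule bounded_linear.continuous_on)
  fix b assume b: "b \<in> B"
  thus "k_smooth k B W (%x. L (pd b g x))" using Suc by simp
  fix x assume "x \<in> W"
  show "((%t. L (g (x + t *\<^sub>R b))) has_vector_derivative L (pd b g x)) (at 0)"
   by (rule bounded_linear.has_vector_derivative[OF assms(1) k_smooth_has_partial[OF Suc.prems b \<open>x \<in> W\<close>]])
 qed
qed

lemma k_smooth_add:
 assumes "span_open B W" "k_smooth k B W f" "k_smooth k B W g"
 shows "k_smooth k B W (%x. f x + g x)"
 using assms(2,3)
proof (induction k arbitrary: f g)
 case 0
 thus ?case by (auto intro: continuous_intros)
next
 case (Suc k)
 show ?case
 proof (rule k_smooth_SucI[OF assms(1), where g' = "%b x. pd b f x + pd b g x"])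
  show "continuous_on W (%x. f x + g x)"
   using Suc.prems[THEN k_smooth_continuous] by (intro continuous_intros)
  fix b assume b: "b \<in> B"
  thus "k_smooth k B W (%x. pd b f x + pd b g x)" using Suc by simp
  fix x assume "x \<in> W"
  show "((%t. f (x + t *\<^sub>R b) + g (x + t *\<^sub>R b)) has_vector_derivative
    pd b f x + pd b g x) (at 0)"
   by (rule has_vector_derivative_add k_smooth_has_partial Suc.prems b \<open>x \<in> W\<close>)+
 qed
qed

lemma k_smooth_sum:
 assumes "span_open B W" "!!i. i \<in> I ==> k_smooth k B W (f i)"
 shows "k_smooth k B W (%x. \<Sum>i\<in>I. f i x)"
 using assms(2)
 by (induction I rule: infinite_finite_induct) (auto intro: k_smooth_const k_smooth_add assms(1))

text \<open>One bilinear version serves products, scalar multiples and inner products alike.\<close>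

lemma k_smooth_bilinear:
 assumes "bounded_bilinear p" "span_open B W" "k_smooth k B W f" "k_smooth k B W g"
 shows "k_smooth k B W (%x. p (f x) (g x))"
 using assms(3,4)
proof (induction k arbitrary: f g)
 case 0
 thus ?case using bounded_bilinear.continuous_on[OF assms(1)] by simp
next
 case (Suc k)
 show ?case
 proof (rule k_smooth_SucI[OF assms(2), where g' = "%b x. p (f x) (pd b g x) + p (pd b f x) (g x)"])
  show "continuous_on W (%x. p (f x) (g x))"
   using assms(1) Suc.prems[THEN k_smooth_continuous] by (rule bounded_bilinear.continuous_on)
  fix b assume "b \<in> B"
  thus "k_smooth k B W (%x. p (f x) (pd b g x) + p (pd b f x) (g x))"
   using Suc.prems[THEN k_smooth_SucD] Suc by (intro k_smooth_add assms(2) Suc.IH) auto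
  fix x assume "x \<in> W"
  show "((%t. p (f (x + t *\<^sub>R b)) (g (x + t *\<^sub>R b))) has_vector_derivative
      p (f x) (pd b g x) + p (pd b f x) (g x)) (at 0)"
   using bounded_bilinear.has_vector_derivative[OF assms(1)
     k_smooth_has_partial[OF Suc.prems(1) \<open>b \<in> B\<close> \<open>x \<in> W\<close>] k_smooth_has_partial[OF Suc.prems(2) \<open>b \<in> B\<close> \<open>x \<in> W\<close>]]
   by simp
 qed
qed

lemma openin_INT_Int:
 assumes "finite I" "!!i. i \<in> I ==> openin T (A i)" "openin T W"
 shows "openin T ((\<Inter>i\<in>I. A i) \<inter> W)"
 using assms(1,2)
proof (induction I rule: finite_induct)
 case empty
 thus ?case using assms(3) by simp
next
 case (insert i I)
 hence "openin T (A i \<inter> ((\<Inter>i\<in>I. A i) \<inter> W))" by (intro openin_Int[of _ "A i" "_ \<inter> W"]) auto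
 thus ?case by (simp add: Int_assoc)
qed

section \<open>Total derivatives and the chain rule\<close>

lemma small_ball_span_open:
 assumes "finite B" "span_open B W" "x \<in> W" "!!b. b \<in> B ==> continuous_on W (D b)" "e > 0"
 shows "EX d>0. ALL z:span B. norm (z - x) < d --> z \<in> W & (ALL b:B. norm (D b z - D b x :: 'f::real_normed_vector) <= e)"
proof -
 have "openin (top_of_set (span B)) (W \<inter> D b -` ball (D b x) e)" if "b \<in> B" for b
  using continuous_openin_preimage_gen[OF assms(4)[OF that], of "ball (D b x) e"] assms(2) openin_trans by blast
 hence "span_open B ((\<Inter>b\<in>B. W \<inter> D b -` ball (D b x) e) \<inter> W)" (is "span_open B ?V")
  by (rule openin_INT_Int[OF assms(1) _ assms(2)])
 moreover have "x \<in> ?V" using assms(3,5) by auto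
 ultimately have "EX d>0. ball x d \<inter> span B <= ?V"
  by (simp only: openin_contains_ball)
 then obtain d where d: "d > 0" "ball x d \<inter> span B <= ?V" by (elim exE conjE)
 show ?thesis
 proof (intro exI[of _ d] conjI ballI impI d(1))
  fix z assume z: "z \<in> span B" "norm (z - x) < d"
  hence "z \<in> ball x d \<inter> span B" by (simp add: dist_norm norm_minus_commute)
  hence zV: "z \<in> ?V" using d(2) by (rule rev_subsetD)
  thus "z \<in> W" by (rule IntD2)
  fix b assume "b \<in> B"
  hence "D b z \<in> ball (D b x) e" using INT_D[OF IntD1[OF zV]] by simp
  thus "norm (D b z - D b x) <= e" by (simp add: dist_norm norm_minus_commute)
 qed
qed

lemma shifted_line_has_vector_derivative:
 fixes g :: "'e::real_normed_vector => 'f::real_normed_vector"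
 assumes "((%t::real. g (x + s *\<^sub>R b + t *\<^sub>R b)) has_vector_derivative D) (at 0)"
 shows "((%t::real. g (x + t *\<^sub>R b)) has_vector_derivative D) (at s)"
proof -
 have *: "((%t::real. g (x + s *\<^sub>R b + t *\<^sub>R b)) has_vector_derivative D) (at (s - s))" using assms by simp
 have "((%t. t - s) has_vector_derivative 1) (at s)" by (auto intro!: derivative_eq_intros)
 moreover have "(%t::real. g (x + s *\<^sub>R b + t *\<^sub>R b)) \<circ> (%t. t - s) = (%t. g (x + t *\<^sub>R b))"
  by (simp add: fun_eq_iff scaleR_left_diff_distrib)
 ultimately show ?thesis using vector_diff_chain_at[of "%t. t - s" 1 s, OF _ *] by simp
qed

text \<open>The mean value inequality on a symmetric interval, which avoids distinguishing the sign
  of \<open>v\<close>.\<close>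

lemma vector_derivative_bound:
 fixes f :: "real => 'f::real_normed_vector"
 assumes "!!t. \<bar>t\<bar> <= \<bar>v\<bar> ==> (f has_vector_derivative f' t) (at t)"
  "!!t. \<bar>t\<bar> <= \<bar>v\<bar> ==> norm (f' t) <= M"
 shows "norm (f v - f 0) <= M * \<bar>v\<bar>"
proof -
 have "norm (f v - f 0) <= M * norm (v - 0)"
 proof (rule differentiable_bound[of "{-\<bar>v\<bar>..\<bar>v\<bar>}" f "%t h. h *\<^sub>R f' t"])
  fix t assume "t \<in> {-\<bar>v\<bar>..\<bar>v\<bar>}"
  hence t: "\<bar>t\<bar> <= \<bar>v\<bar>" by auto
  show "(f has_derivative (%h. h *\<^sub>R f' t)) (at t within {-\<bar>v\<bar>..\<bar>v\<bar>})"
   using assms(1)[OF t] unfolding has_vector_derivative_def by (rule has_derivative_at_withinI)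
  show "onorm (%h. h *\<^sub>R f' t) <= M"
   using assms(2)[OF t] by (intro onorm_le) (simp add: mult.commute[of M] mult_left_mono)
 qed auto
 thus ?thesis by simp
qed

text \<open>Moving from \<open>x\<close> to \<open>y\<close> one coordinate at a time splits the
  increment into one-variable increments, each controlled by the mean value inequality and the
  continuity of the partial derivatives.\<close>

lemma k_smooth_has_derivative:
 fixes g :: "'e::euclidean_space => 'f::real_normed_vector"
 assumes B: "B <= Basis" and W: "span_open B W" and g: "k_smooth (Suc k) B W g" and x: "x \<in> W"
 shows "(g has_derivative (%v. \<Sum>b\<in>B. (v \<bullet> b) *\<^sub>R pd b g x)) (at x within span B)"
 unfolding has_derivative_within_alt
proof (intro conjI allI impI)
 show "bounded_linear (%v. \<Sum>b\<in>B. (v \<bullet> b) *\<^sub>R pd b g x)"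
  by (intro bounded_linear_sum bounded_linear_scaleR_const bounded_linear_inner_left)
 fix e :: real assume "e > 0"
 \<comment> \<open>Each of the \<open>card B\<close> coordinate moves is allowed the error
   \<open>e'\<close>; the \<open>+ 1\<close> keeps the quotient meaningful for empty
   \<open>B\<close>.\<close>
 define e' where "e' = e / (card B + 1)"
 have e': "e' > 0" using \<open>e > 0\<close> by (simp add: e'_def add_nonneg_pos)
 have cont: "continuous_on W (pd b g)" if "b \<in> B" for b
  using k_smooth_partial[OF g that] k_smooth_continuous by blast
 obtain d where d: "d > 0" "!!z. z \<in> span B ==> norm (z - x) < d ==> z \<in> W"
  "!!z b. z \<in> span B ==> norm (z - x) < d ==> b \<in> B ==> norm (pd b g z - pd b g x) <= e'"
  using small_ball_span_open[OF finite_Basis_subset[OF B] W x, of "%b. pd b g" e'] cont e' by blast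
 have xs: "x \<in> span B" using x W span_open_subset by blast
 show "EX d>0. ALL y:span B. norm (y - x) < d -->
     norm (g y - g x - (\<Sum>b\<in>B. ((y - x) \<bullet> b) *\<^sub>R pd b g x)) <= e * norm (y - x)"
 proof (intro exI[of _ d] conjI ballI impI d(1))
  fix y assume y: "y \<in> span B" "norm (y - x) < d"
  \<comment> \<open>The point reached when only the coordinates in \<open>F\<close> have been moved.
    Its difference from \<open>x\<close> is dominated componentwise by \<open>y - x\<close>, so the
    whole path stays in the ball.\<close>
  define p where "p F = x + (\<Sum>b\<in>F. ((y - x) \<bullet> b) *\<^sub>R b)" for F
  have near: "p F + t *\<^sub>R b \<in> span B & norm (p F + t *\<^sub>R b - x) < d"
   if "F <= B" "b \<in> B" "b ~: F" "\<bar>t\<bar> <= \<bar>(y - x) \<bullet> b\<bar>" for F b t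
  proof
   show "p F + t *\<^sub>R b \<in> span B"
    unfolding p_def using that by (intro span_add xs span_sum span_scale span_base) auto
   have "norm (p F + t *\<^sub>R b - x) <= norm (y - x)"
   proof (rule norm_le_componentwise)
    fix c :: 'e assume c: "c \<in> Basis"
    have "F <= Basis" "b \<in> Basis" using that B by auto
    hence "(p F + t *\<^sub>R b - x) \<bullet> c = (if c \<in> F then (y - x) \<bullet> c else 0) + (if c = b then t else 0)"
     using sum_Basis_inner[OF \<open>F <= Basis\<close> c, of "%b. (y - x) \<bullet> b"] c
     by (simp add: p_def inner_add_left inner_diff_left inner_Basis)
    thus "\<bar>(p F + t *\<^sub>R b - x) \<bullet> c\<bar> <= \<bar>(y - x) \<bullet> c\<bar>" using that by auto
   qed
   thus "norm (p F + t *\<^sub>R b - x) < d" using y by simp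
  qed
  have claim: "norm (g (p F) - g x - (\<Sum>b\<in>F. ((y - x) \<bullet> b) *\<^sub>R pd b g x)) <= e' * (\<Sum>b\<in>F. \<bar>(y - x) \<bullet> b\<bar>)"
   if "finite F" "F <= B" for F
   using that
  proof (induction F rule: finite_induct)
   case empty
   thus ?case by (simp add: p_def)
  next
   case (insert b F)
   let ?v = "(y - x) \<bullet> b"
   \<comment> \<open>With the linear term subtracted, the derivative is a difference of two values
     of \<open>pd b g\<close>, hence at most \<open>e'\<close> on the ball.\<close>
   define ph where "ph t = g (p F + t *\<^sub>R b) - t *\<^sub>R pd b g x" for t
   have b: "b \<in> B" "F <= B" using insert by auto
   have "norm (ph ?v - ph 0) <= e' * \<bar>?v\<bar>"
   proof (rule vector_derivative_bound[where f' = "%t. pd b g (p F + t *\<^sub>R b) - pd b g x"])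
    fix t assume t: "\<bar>t\<bar> <= \<bar>?v\<bar>"
    note n = near[OF b(2,1) insert.hyps(2) t]
    have "((%t. g (p F + t *\<^sub>R b)) has_vector_derivative pd b g (p F + t *\<^sub>R b)) (at t)"
     by (rule shifted_line_has_vector_derivative[OF k_smooth_has_partial[OF g b(1) d(2)[OF conjunct1[OF n] conjunct2[OF n]]]])
    thus "(ph has_vector_derivative pd b g (p F + t *\<^sub>R b) - pd b g x) (at t)"
     unfolding ph_def by (auto intro!: derivative_eq_intros has_vector_derivative_diff)
    show "norm (pd b g (p F + t *\<^sub>R b) - pd b g x) <= e'"
     using n d(3) b by auto
   qed
   moreover have "p (insert b F) = p F + ?v *\<^sub>R b" using insert.hyps by (simp add: p_def algebra_simps)
   ultimately have *: "norm (g (p (insert b F)) - ?v *\<^sub>R pd b g x - g (p F)) <= e' * \<bar>?v\<bar>"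
    by (simp add: ph_def)
   have IH: "norm (g (p F) - g x - (\<Sum>b\<in>F. ((y - x) \<bullet> b) *\<^sub>R pd b g x)) <= e' * (\<Sum>b\<in>F. \<bar>(y - x) \<bullet> b\<bar>)"
    using insert.IH b by simp
   have "g (p (insert b F)) - g x - (\<Sum>b\<in>insert b F. ((y - x) \<bullet> b) *\<^sub>R pd b g x) =
    (g (p (insert b F)) - ?v *\<^sub>R pd b g x - g (p F)) +
    (g (p F) - g x - (\<Sum>b\<in>F. ((y - x) \<bullet> b) *\<^sub>R pd b g x))"
    using insert.hyps by simp
   also have "norm ... <= e' * \<bar>?v\<bar> + e' * (\<Sum>b\<in>F. \<bar>(y - x) \<bullet> b\<bar>)"
    by (rule order_trans[OF norm_triangle_ineq add_mono[OF * IH]])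
   also have "... = e' * (\<Sum>b\<in>insert b F. \<bar>(y - x) \<bullet> b\<bar>)"
    using insert.hyps by (simp add: distrib_left)
   finally show ?case .
  qed
  have "p B = y" unfolding p_def
   using span_representation[OF B span_diff[OF y(1) xs]] by simp
  hence "norm (g y - g x - (\<Sum>b\<in>B. ((y - x) \<bullet> b) *\<^sub>R pd b g x)) <= e' * (\<Sum>b\<in>B. \<bar>(y - x) \<bullet> b\<bar>)"
   using claim[OF finite_Basis_subset[OF B] order_refl] by simp
  also have "(\<Sum>b\<in>B. \<bar>(y - x) \<bullet> b\<bar>) <= (\<Sum>b\<in>B. norm (y - x))"
   using B by (intro sum_mono) (auto intro: Basis_le_norm)
  hence "e' * (\<Sum>b\<in>B. \<bar>(y - x) \<bullet> b\<bar>) <= e' * (card B * norm (y - x))"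
   using e' by (intro mult_left_mono) auto
  also have "... <= e * norm (y - x)"
  proof -
   have "e' * card B <= e" using \<open>e > 0\<close> by (simp add: e'_def field_simps)
   from mult_right_mono[OF this norm_ge_zero[of "y - x"]] show ?thesis by (simp add: mult.assoc)
  qed
  finally show "norm (g y - g x - (\<Sum>b\<in>B. ((y - x) \<bullet> b) *\<^sub>R pd b g x)) <= e * norm (y - x)" .
 qed
qed

lemma compose_has_partial:
 fixes g :: "'e::euclidean_space => 'f::euclidean_space" and f :: "'f => 'g::real_normed_vector"
 assumes "C <= Basis" "span_open B W" "span_open C V" "g ` W <= V"
  "k_smooth (Suc k) B W g" "k_smooth (Suc l) C V f" "b \<in> B" "x \<in> W"
 shows "((%t::real. f (g (x + t *\<^sub>R b))) has_vector_derivative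
  (\<Sum>c\<in>C. (pd b g x \<bullet> c) *\<^sub>R pd c f (g x))) (at 0)"
proof -
 \<comment> \<open>The derivative of \<open>f\<close> is known only within \<open>span C\<close>, so
   the curve is restricted to parameters for which \<open>x + t b\<close> remains in
   \<open>W\<close>.\<close>
 obtain N where N: "open N" "0 \<in> N" "!!t. t \<in> N ==> x + t *\<^sub>R b \<in> W"
  using span_open_line[OF assms(2,7,8)] unfolding eventually_nhds by blast
 let ?gm = "%t::real. g (x + t *\<^sub>R b)"
 have "(?gm has_derivative (%h. h *\<^sub>R pd b g x)) (at 0 within N)"
  using k_smooth_has_partial[OF assms(5,7,8)] unfolding has_vector_derivative_def
  by (rule has_derivative_at_withinI)
 moreover have "?gm ` N <= span C" using N(3) assms(3,4) span_open_subset by blast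
 hence "(f has_derivative (%v. \<Sum>c\<in>C. (v \<bullet> c) *\<^sub>R pd c f (g x))) (at (g x) within (?gm ` N))"
  by (rule has_derivative_subset[OF k_smooth_has_derivative[OF assms(1,3,6)], rotated]) (use assms(4,8) in auto)
 hence "(f has_derivative (%v. \<Sum>c\<in>C. (v \<bullet> c) *\<^sub>R pd c f (g x))) (at (?gm 0) within (?gm ` N))"
  by simp
 ultimately have "(f \<circ> ?gm has_derivative (%v. \<Sum>c\<in>C. (v \<bullet> c) *\<^sub>R pd c f (g x)) \<circ> (%h. h *\<^sub>R pd b g x)) (at 0 within N)"
  by (rule diff_chain_within)
 thus ?thesis unfolding has_vector_derivative_def at_within_open[OF N(2,1)]
  by (simp add: o_def scaleR_sum_right)
qed

lemma k_smooth_compose: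
 fixes g :: "'e::euclidean_space => 'f::euclidean_space" and f :: "'f => 'g::real_normed_vector"
 assumes "C <= Basis" "span_open B W" "span_open C V" "g ` W <= V"
  "k_smooth k B W g" "k_smooth k C V f"
 shows "k_smooth k B W (%x. f (g x))"
 using assms(5,6)
proof (induction k arbitrary: f)
 case 0
 thus ?case using assms(4) by (auto intro: continuous_on_compose2)
next
 case (Suc k)
 show ?case
 proof (rule k_smooth_SucI[OF assms(2), where g' = "%b x. \<Sum>c\<in>C. (pd b g x \<bullet> c) *\<^sub>R pd c f (g x)"])
  show "continuous_on W (%x. f (g x))"
   using Suc.prems[THEN k_smooth_continuous] assms(4) by (auto intro: continuous_on_compose2)
  fix b assume b: "b \<in> B"
  show "k_smooth k B W (%x. \<Sum>c\<in>C. (pd b g x \<bullet> c) *\<^sub>R pd c f (g x))"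
  proof (intro k_smooth_sum assms(2) k_smooth_bilinear[OF bounded_bilinear_scaleR])
   fix c assume c: "c \<in> C"
   show "k_smooth k B W (%x. pd b g x \<bullet> c)"
    by (rule k_smooth_linear_comp[OF bounded_linear_inner_left assms(2) k_smooth_partial[OF Suc.prems(1) b]])
   show "k_smooth k B W (%x. pd c f (g x))"
    by (rule Suc.IH[OF k_smooth_SucD[OF Suc.prems(1)] k_smooth_partial[OF Suc.prems(2) c]])
  qed
  fix x assume "x \<in> W"
  thus "((%t. f (g (x + t *\<^sub>R b))) has_vector_derivative
      (\<Sum>c\<in>C. (pd b g x \<bullet> c) *\<^sub>R pd c f (g x))) (at 0)"
   using compose_has_partial[OF assms(1-4) Suc.prems b] by blast
 qed
qed

text \<open>Two applications of the mean value inequality, first along \<open>a\<close> and then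
  along \<open>b\<close>. The second difference on the left is symmetric in the two directions while
  the derivative compared with it is not, and this yields the symmetry of second
  derivatives.\<close>

lemma mixed_difference_bound:
 fixes g :: "'e::euclidean_space => 'f::real_normed_vector"
 assumes B: "B <= Basis" and W: "span_open B W" and g: "k_smooth (Suc (Suc k)) B W g"
  and x: "x \<in> W" and ab: "a \<in> B" "b \<in> B" and e: "e > 0"
 shows "EX d>0. ALL s t. 0 < s & s < d & 0 < t & t < d -->
  norm (g (x + s *\<^sub>R a + t *\<^sub>R b) - g (x + s *\<^sub>R a) - g (x + t *\<^sub>R b) + g x
   - (s * t) *\<^sub>R pd b (pd a g) x) <= e * s * t"
proof -
 let ?A = "pd b (pd a g)"
 have ga: "k_smooth (Suc k) B W (pd a g)" using g ab by simp
 have "continuous_on W ?A" using k_smooth_partial[OF ga ab(2)] k_smooth_continuous by blast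
 then obtain d where d: "d > 0" "!!z. z \<in> span B ==> norm (z - x) < d ==> z \<in> W"
  "!!z. z \<in> span B ==> norm (z - x) < d ==> norm (?A z - ?A x) <= e"
  using small_ball_span_open[OF finite_Basis_subset[OF B] W x, of "%_. ?A" e] ab e by blast
 have n1: "norm a = 1" "norm b = 1" using ab B by auto
 have near: "x + s *\<^sub>R a + t *\<^sub>R b \<in> span B & norm (x + s *\<^sub>R a + t *\<^sub>R b - x) < d"
  if "\<bar>s\<bar> < d/2" "\<bar>t\<bar> < d/2" for s t
 proof
  show "x + s *\<^sub>R a + t *\<^sub>R b \<in> span B"
   using ab x span_open_subset[OF W] by (intro span_add span_scale span_base[of a] span_base[of b]) auto
  have "norm (s *\<^sub>R a + t *\<^sub>R b) <= \<bar>s\<bar> + \<bar>t\<bar>" using norm_triangle_ineq[of "s *\<^sub>R a" "t *\<^sub>R b"] n1 by simp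
  thus "norm (x + s *\<^sub>R a + t *\<^sub>R b - x) < d" using that by (simp add: add.assoc)
 qed
 have inW: "x + s *\<^sub>R a + t *\<^sub>R b \<in> W" if "\<bar>s\<bar> < d/2" "\<bar>t\<bar> < d/2" for s t
  using near[OF that] d(2) by blast
 show ?thesis
 proof (intro exI[of _ "d/2"] conjI allI impI)
  show "d / 2 > 0" using d by simp
  fix s t assume st: "0 < s & s < d/2 & 0 < t & t < d/2"
  define u where "u ta = g (x + t *\<^sub>R b + ta *\<^sub>R a) - g (x + ta *\<^sub>R a) - ta *\<^sub>R (t *\<^sub>R ?A x)" for ta
  have "norm (u s - u 0) <= (e * t) * \<bar>s\<bar>"
  proof (rule vector_derivative_bound[where f' = "%ta. pd a g (x + t *\<^sub>R b + ta *\<^sub>R a) - pd a g (x + ta *\<^sub>R a) - t *\<^sub>R ?A x"])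
   fix ta assume "\<bar>ta\<bar> <= \<bar>s\<bar>"
   hence ta: "\<bar>ta\<bar> < d/2" using st by auto
   have 1: "x + t *\<^sub>R b + ta *\<^sub>R a \<in> W" using inW[OF ta, of t] st by (simp add: algebra_simps)
   have 2: "x + ta *\<^sub>R a \<in> W" using inW[OF ta, of 0] st d by simp
   have "((%ta. g (x + t *\<^sub>R b + ta *\<^sub>R a)) has_vector_derivative pd a g (x + t *\<^sub>R b + ta *\<^sub>R a)) (at ta)"
    by (rule shifted_line_has_vector_derivative[OF k_smooth_has_partial[OF g ab(1) 1]])
   moreover have "((%ta. g (x + ta *\<^sub>R a)) has_vector_derivative pd a g (x + ta *\<^sub>R a)) (at ta)"
    by (rule shifted_line_has_vector_derivative[OF k_smooth_has_partial[OF g ab(1) 2]])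
   moreover have "((%ta. ta *\<^sub>R (t *\<^sub>R ?A x)) has_vector_derivative t *\<^sub>R ?A x) (at ta)"
    by (auto intro!: derivative_eq_intros)
   ultimately show "(u has_vector_derivative pd a g (x + t *\<^sub>R b + ta *\<^sub>R a) - pd a g (x + ta *\<^sub>R a) - t *\<^sub>R ?A x) (at ta)"
    unfolding u_def by (intro has_vector_derivative_diff)
   define w where "w th = pd a g (x + ta *\<^sub>R a + th *\<^sub>R b) - th *\<^sub>R ?A x" for th
   have "norm (w t - w 0) <= e * \<bar>t\<bar>"
   proof (rule vector_derivative_bound[where f' = "%th. ?A (x + ta *\<^sub>R a + th *\<^sub>R b) - ?A x"])
    fix th assume "\<bar>th\<bar> <= \<bar>t\<bar>"
    hence th: "\<bar>th\<bar> < d/2" using st by auto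
    have "((%th. pd a g (x + ta *\<^sub>R a + th *\<^sub>R b)) has_vector_derivative ?A (x + ta *\<^sub>R a + th *\<^sub>R b)) (at th)"
     by (rule shifted_line_has_vector_derivative[OF k_smooth_has_partial[OF ga ab(2) inW[OF ta th]]])
    moreover have "((%th. th *\<^sub>R ?A x) has_vector_derivative ?A x) (at th)"
     by (auto intro!: derivative_eq_intros)
    ultimately show "(w has_vector_derivative ?A (x + ta *\<^sub>R a + th *\<^sub>R b) - ?A x) (at th)"
     unfolding w_def by (intro has_vector_derivative_diff)
    show "norm (?A (x + ta *\<^sub>R a + th *\<^sub>R b) - ?A x) <= e" using near[OF ta th] d(3) by blast
   qed
   moreover have "w t - w 0 = pd a g (x + t *\<^sub>R b + ta *\<^sub>R a) - pd a g (x + ta *\<^sub>R a) - t *\<^sub>R ?A x"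
    by (simp add: w_def algebra_simps)
   ultimately show "norm (pd a g (x + t *\<^sub>R b + ta *\<^sub>R a) - pd a g (x + ta *\<^sub>R a) - t *\<^sub>R ?A x) <= e * t"
    using st by simp
  qed
  moreover have "u s - u 0 = g (x + s *\<^sub>R a + t *\<^sub>R b) - g (x + s *\<^sub>R a) - g (x + t *\<^sub>R b) + g x - (s * t) *\<^sub>R ?A x"
   by (simp add: u_def algebra_simps)
  ultimately show "norm (g (x + s *\<^sub>R a + t *\<^sub>R b) - g (x + s *\<^sub>R a) - g (x + t *\<^sub>R b) + g x - (s * t) *\<^sub>R ?A x) <= e * s * t"
   using st by (simp add: algebra_simps)
 qed
qed

lemma partial_deriv_commute:
 fixes g :: "'e::euclidean_space => 'f::real_normed_vector"
 assumes B: "B <= Basis" and W: "span_open B W" and g: "k_smooth (Suc (Suc k)) B W g"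
  and x: "x \<in> W" and ab: "a \<in> B" "b \<in> B"
 shows "pd a (pd b g) x = pd b (pd a g) x" (is "?A1 = ?A2")
proof (rule ccontr)
 assume ne: "?A1 ~= ?A2"
 \<comment> \<open>Both mixed derivatives approximate the same second difference, scaled by
   \<open>s * s\<close>, up to \<open>e\<close>. They would then differ by at most
   \<open>2 * e\<close>, whereas their distance is \<open>4 * e\<close>.\<close>
 define e where "e = norm (?A1 - ?A2) / 4"
 have e: "e > 0" using ne by (simp add: e_def)
 obtain d1 where d1: "d1 > 0" "!!s t. 0 < s & s < d1 & 0 < t & t < d1 ==>
  norm (g (x + s *\<^sub>R a + t *\<^sub>R b) - g (x + s *\<^sub>R a) - g (x + t *\<^sub>R b) + g x - (s * t) *\<^sub>R ?A2) <= e * s * t"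
  using mixed_difference_bound[OF B W g x ab e] by blast
 obtain d2 where d2: "d2 > 0" "!!s t. 0 < s & s < d2 & 0 < t & t < d2 ==>
  norm (g (x + s *\<^sub>R b + t *\<^sub>R a) - g (x + s *\<^sub>R b) - g (x + t *\<^sub>R a) + g x - (s * t) *\<^sub>R ?A1) <= e * s * t"
  using mixed_difference_bound[OF B W g x ab(2,1) e] by blast
 define s where "s = min d1 d2 / 2"
 have s: "0 < s" "s < d1" "s < d2" using d1(1) d2(1) by (auto simp: s_def min_def)
 let ?D = "g (x + s *\<^sub>R a + s *\<^sub>R b) - g (x + s *\<^sub>R a) - g (x + s *\<^sub>R b) + g x"
 have 1: "norm (?D - (s * s) *\<^sub>R ?A2) <= e * s * s" using d1(2)[of s s] s by simp
 have "x + s *\<^sub>R b + s *\<^sub>R a = x + s *\<^sub>R a + s *\<^sub>R b" by (simp only: ac_simps)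
 hence "g (x + s *\<^sub>R b + s *\<^sub>R a) - g (x + s *\<^sub>R b) - g (x + s *\<^sub>R a) + g x = ?D"
  by (simp only:) (simp add: algebra_simps)
 with d2(2)[of s s] s have 2: "norm (?D - (s * s) *\<^sub>R ?A1) <= e * s * s" by (simp only: simp_thms)
 have "(s * s) *\<^sub>R (?A1 - ?A2) = (?D - (s * s) *\<^sub>R ?A2) - (?D - (s * s) *\<^sub>R ?A1)"
  by (simp only: scaleR_diff_right) simp
 hence le: "norm ((s * s) *\<^sub>R (?A1 - ?A2)) <= e * s * s + e * s * s"
  by (simp only:) (rule order_trans[OF norm_triangle_ineq4 add_mono[OF 1 2]])
 have eq: "norm ((s * s) *\<^sub>R (?A1 - ?A2)) = (s * s) * (4 * e)" unfolding e_def by simp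
 define q where "q = s * s"
 have "q > 0" using s by (simp add: q_def)
 have "q * (4 * e) <= q * (2 * e)" using le unfolding eq q_def by (simp add: algebra_simps)
 with \<open>q > 0\<close> have "4 * e <= 2 * e" by (simp only: mult_le_cancel_left_pos)
 thus False using e by simp
qed

section \<open>The algebra of smooth functions\<close>

lemma smoothI: "(!!k. k_smooth k B W g) ==> smooth B W g"
 by (simp add: smooth_def)

lemma smoothD: "smooth B W g ==> k_smooth k B W g"
 by (simp add: smooth_def)

lemma smooth_continuous: "smooth B W g ==> continuous_on W g"
 using smoothD k_smooth_continuous by blast

lemma smooth_cong:
 "span_open B W ==> (!!y. y \<in> W ==> g y = g' y) ==> smooth B W g \<longleftrightarrow> smooth B W g'"
 unfolding smooth_def using k_smooth_cong[of B W g g'] by simp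

lemma smooth_subset: "smooth B W g ==> W' <= W ==> smooth B W' g"
 unfolding smooth_def using k_smooth_subset by blast

lemma smooth_local:
 assumes "W <= span B" "!!x. x \<in> W ==> EX W'. x \<in> W' & span_open B W' & smooth B W' g"
 shows "smooth B W g"
proof (rule smoothI, rule k_smooth_local[OF _ assms(1)])
 fix k x assume "x \<in> W"
 thus "EX W'. x \<in> W' & span_open B W' & k_smooth k B W' g" using assms(2) smoothD by meson
qed

lemma smooth_partial: "smooth B W g ==> b \<in> B ==> smooth B W (pd b g)"
 using smoothD k_smooth_partial smoothI by metis

lemma smooth_has_partial:
 "smooth B W g ==> b \<in> B ==> x \<in> W ==>
 ((%t::real. g (x + t *\<^sub>R b)) has_vector_derivative pd b g x) (at 0)"
 using k_smooth_has_partial smoothD by blast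

lemma smooth_const: "span_open B W ==> smooth B W (%x. c)"
 by (rule smoothI) (rule k_smooth_const)

lemma smooth_bounded_linear: "bounded_linear L ==> span_open B W ==> smooth B W L"
 by (rule smoothI) (rule k_smooth_bounded_linear)

lemma smooth_linear_comp:
 "bounded_linear L ==> span_open B W ==> smooth B W g ==> smooth B W (%x. L (g x))"
 by (rule smoothI) (rule k_smooth_linear_comp[OF _ _ smoothD])

lemma smooth_add:
 "span_open B W ==> smooth B W f ==> smooth B W g ==> smooth B W (%x. f x + g x)"
 by (rule smoothI) (rule k_smooth_add[OF _ smoothD smoothD])

lemma smooth_sum:
 assumes "span_open B W" "!!i. i \<in> I ==> smooth B W (f i)"
 shows "smooth B W (%x. \<Sum>i\<in>I. f i x)"
 by (rule smoothI, rule k_smooth_sum[OF assms(1)]) (rule smoothD[OF assms(2)])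

lemma smooth_mult:
 fixes f g :: "_ => 'f::real_normed_algebra"
 shows "span_open B W ==> smooth B W f ==> smooth B W g ==> smooth B W (%x. f x * g x)"
 by (rule smoothI) (rule k_smooth_bilinear[OF bounded_bilinear_mult _ smoothD smoothD])

lemma smooth_cmult:
 fixes g :: "_ => 'f::real_normed_algebra"
 shows "span_open B W ==> smooth B W g ==> smooth B W (%x. c * g x)"
 by (rule smooth_mult[OF _ smooth_const])

lemma smooth_prod:
 fixes f :: "_ => _ => 'f::{real_normed_algebra_1,comm_ring_1}"
 assumes "span_open B W" "!!i. i \<in> I ==> smooth B W (f i)"
 shows "smooth B W (%x. \<Prod>i\<in>I. f i x)"
 using assms(2)
proof (induction I rule: infinite_finite_induct)
 case (insert i I)
 thus ?case by (simp add: smooth_mult[OF assms(1)])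
qed (simp_all add: smooth_const[OF assms(1)])

lemma smooth_minus:
 fixes g :: "_ => 'f::real_normed_vector"
 shows "span_open B W ==> smooth B W g ==> smooth B W (%x. - g x)"
 by (rule smooth_linear_comp[OF bounded_linear_minus[OF bounded_linear_ident]])

lemma smooth_diff:
 fixes f g :: "_ => 'f::real_normed_vector"
 assumes "span_open B W" "smooth B W f" "smooth B W g"
 shows "smooth B W (%x. f x - g x)"
 using smooth_add[OF assms(1,2) smooth_minus[OF assms(1,3)]] by simp

lemma smooth_of_real:
 fixes g :: "_ => real"
 shows "span_open B W ==> smooth B W g ==> smooth B W (%x. of_real (g x) :: complex)"
 by (rule smooth_linear_comp[OF bounded_linear_of_real])

lemma smooth_inner_const: "span_open B W ==> smooth B W g ==> smooth B W (%x. g x \<bullet> c)"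
 by (rule smooth_linear_comp[OF bounded_linear_inner_left])

lemma smooth_ident: "span_open B W ==> smooth B W (%x. x)"
 by (rule smooth_bounded_linear[OF bounded_linear_ident])

lemma smooth_coord: "span_open B W ==> smooth B W (%x. of_real (x \<bullet> c) :: complex)"
 by (intro smooth_of_real smooth_inner_const smooth_ident)

lemma smooth_compose:
 fixes g :: "'e::euclidean_space => 'f::euclidean_space" and f :: "'f => 'g::real_normed_vector"
 assumes "C <= Basis" "span_open B W" "span_open C V" "g ` W <= V" "smooth B W g" "smooth C V f"
 shows "smooth B W (%x. f (g x))"
 by (rule smoothI, rule k_smooth_compose[OF assms(1-4) smoothD[OF assms(5)] smoothD[OF assms(6)]])

lemma smooth_compose_partial:
 fixes g :: "'e::euclidean_space => 'f::euclidean_space" and f :: "'f => 'g::real_normed_vector"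
 assumes "C <= Basis" "span_open B W" "span_open C V" "g ` W <= V" "smooth B W g" "smooth C V f"
  "b \<in> B" "x \<in> W"
 shows "pd b (%x. f (g x)) x = (\<Sum>c\<in>C. (pd b g x \<bullet> c) *\<^sub>R pd c f (g x))"
 by (rule partial_derivI, rule compose_has_partial[OF assms(1-4) smoothD[OF assms(5)] smoothD[OF assms(6)] assms(7,8)])

lemma span_open_preimage:
 assumes "span_open B W" "continuous_on W g" "g ` W <= span C" "span_open C V"
 shows "span_open B (W \<inter> g -` V)"
proof -
 obtain T where T: "open T" "V = span C \<inter> T" using assms(4) unfolding openin_open by auto
 have "W \<inter> g -` V = W \<inter> g -` T" using T assms(3) by auto
 moreover have "openin (top_of_set W) (W \<inter> g -` T)"
  by (rule continuous_openin_preimage_gen[OF assms(2) T(1)])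
 ultimately show ?thesis using assms(1) openin_trans by metis
qed

lemma partial_const: "pd b (%x. c) x = 0"
 by (rule partial_derivI) simp

lemma partial_add:
 assumes "smooth B W f" "smooth B W g" "b \<in> B" "x \<in> W"
 shows "pd b (%x. f x + g x) x = pd b f x + pd b g x"
 by (rule partial_derivI, rule has_vector_derivative_add; rule smooth_has_partial[OF _ assms(3,4)]; fact)

lemma partial_sum:
 fixes f :: "_ => _ => 'f::real_normed_vector"
 assumes "!!i. i \<in> I ==> smooth B W (f i)" "b \<in> B" "x \<in> W"
 shows "pd b (%x. \<Sum>i\<in>I. f i x) x = (\<Sum>i\<in>I. pd b (f i) x)"
 by (rule partial_derivI, rule has_vector_derivative_sum, rule smooth_has_partial[OF _ assms(2,3)], rule assms(1))

lemma partial_mult: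
 fixes f g :: "_ => 'f::real_normed_algebra"
 assumes "smooth B W f" "smooth B W g" "b \<in> B" "x \<in> W"
 shows "pd b (%x. f x * g x) x = f x * pd b g x + pd b f x * g x"
 using has_vector_derivative_mult[OF smooth_has_partial[OF assms(1,3,4)] smooth_has_partial[OF assms(2,3,4)]]
 by (intro partial_derivI) simp

lemma partial_cmult:
 fixes g :: "_ => 'f::real_normed_algebra"
 assumes "smooth B W g" "b \<in> B" "x \<in> W"
 shows "pd b (%x. c * g x) x = c * pd b g x"
 by (rule partial_derivI, rule bounded_linear.has_vector_derivative[OF bounded_linear_mult_right smooth_has_partial[OF assms]])

lemma partial_bounded_linear:
 assumes "bounded_linear L"
 shows "pd b L x = L b"
proof (rule partial_derivI, rule bounded_linear.has_vector_derivative[OF assms])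
 show "((%t::real. x + t *\<^sub>R b) has_vector_derivative b) (at 0)"
  by (auto intro!: derivative_eq_intros)
qed

lemma partial_linear_comp:
 assumes "bounded_linear L" "smooth B W g" "b \<in> B" "x \<in> W"
 shows "pd b (%x. L (g x)) x = L (pd b g x)"
 by (rule partial_derivI, rule bounded_linear.has_vector_derivative[OF assms(1) smooth_has_partial[OF assms(2-)]])

lemma partial_coord: "pd b (%x. of_real (x \<bullet> c) :: complex) x = of_real (b \<bullet> c)"
 by (rule partial_bounded_linear[OF bounded_linear_compose[OF bounded_linear_of_real bounded_linear_inner_left]])

subsection \<open>Iterated partial derivatives\<close>

lemma iter_partial_Nil [simp]: "ipd [] g = g"
 by (simp add: iter_partial_def)

lemma iter_partial_Cons [simp]: "ipd (b # bs) g = pd b (ipd bs g)"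
 by (simp add: iter_partial_def)

lemma iter_partial_append: "ipd (bs @ cs) g = ipd bs (ipd cs g)"
 by (simp add: iter_partial_def)

lemma iter_partial_cong:
 assumes "span_open B W" "set bs <= B" "x \<in> W" "!!y. y \<in> W ==> g y = g' y"
 shows "ipd bs g x = ipd bs g' x"
 using assms(2,3)
proof (induction bs arbitrary: x)
 case (Cons b bs)
 thus ?case using partial_deriv_cong[OF assms(1), of b x "ipd bs g" "ipd bs g'"] by simp
qed (use assms(4) in simp)

lemma smooth_iter_partial: "smooth B W g ==> set bs <= B ==> smooth B W (ipd bs g)"
 by (induction bs) (auto intro: smooth_partial)

lemma iter_partial_move:
 assumes "B <= Basis" "span_open B W" "smooth B W g" "set bs <= B" "b \<in> B" "x \<in> W" "set cs <= B"
 shows "ipd (bs @ b # cs) g x = ipd (b # bs @ cs) g x"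
 using assms(4,6)
proof (induction bs arbitrary: x)
 case (Cons a bs)
 have sm: "smooth B W (ipd (bs @ cs) g)" using Cons.prems assms(7) by (intro smooth_iter_partial assms(3)) auto
 have "ipd ((a # bs) @ b # cs) g x = pd a (ipd (b # bs @ cs) g) x"
  using Cons partial_deriv_cong[OF assms(2), of a x "ipd (bs @ b # cs) g" "ipd (b # bs @ cs) g"] by simp
 also have "... = pd b (pd a (ipd (bs @ cs) g)) x"
  using partial_deriv_commute[OF assms(1,2) smoothD[OF sm], of x a b] Cons.prems assms(5) by simp
 finally show ?case by simp
qed simp

text \<open>Repeated exchange of adjacent derivatives. That only the multiset of directions matters
  is what allows lists to play the role of multi-indices.\<close>

lemma iter_partial_perm:
 assumes "B <= Basis" "span_open B W" "smooth B W g" "set bs <= B" "x \<in> W" "mset bs = mset cs"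
 shows "ipd bs g x = ipd cs g x"
 using assms(4-)
proof (induction bs arbitrary: cs x)
 case (Cons b bs)
 have "b \<in> set cs" using Cons.prems(3) by (metis list.set_intros(1) mset_eq_setD)
 then obtain c1 c2 where cs: "cs = c1 @ b # c2" by (meson split_list)
 have setc: "set cs <= B" using Cons.prems(1,3) mset_eq_setD by metis
 have m: "mset bs = mset (c1 @ c2)" using Cons.prems(3) cs by simp
 have "ipd (b # bs) g x = ipd (b # c1 @ c2) g x"
  using partial_deriv_cong[OF assms(2), of b x "ipd bs g" "ipd (c1 @ c2) g"]
   Cons.IH[OF _ _ m] Cons.prems by simp
 also have "... = ipd cs g x"
  unfolding cs using iter_partial_move[OF assms(1-3), of c1 b x c2] setc cs Cons.prems by simp
 finally show ?case .
qed simp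

lemma iter_partial_sum:
 fixes f :: "_ => _ => 'f::real_normed_vector"
 assumes "span_open B W" "!!i. i \<in> I ==> smooth B W (f i)" "set bs <= B" "x \<in> W"
 shows "ipd bs (%x. \<Sum>i\<in>I. f i x) x = (\<Sum>i\<in>I. ipd bs (f i) x)"
 using assms(3,4)
proof (induction bs arbitrary: x)
 case (Cons b bs)
 have "ipd (b # bs) (%x. \<Sum>i\<in>I. f i x) x = pd b (%x. \<Sum>i\<in>I. ipd bs (f i) x) x"
  using partial_deriv_cong[OF assms(1), of b x "ipd bs (%x. \<Sum>i\<in>I. f i x)" "%x. \<Sum>i\<in>I. ipd bs (f i) x"]
   Cons by simp
 also have "... = (\<Sum>i\<in>I. pd b (ipd bs (f i)) x)"
  by (rule partial_sum[OF smooth_iter_partial[OF assms(2)]]) (use Cons.prems in auto)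
 finally show ?case by simp
qed simp

lemma iter_partial_cmult:
 fixes g :: "_ => 'f::real_normed_algebra"
 assumes "span_open B W" "smooth B W g" "set bs <= B" "x \<in> W"
 shows "ipd bs (%x. c * g x) x = c * ipd bs g x"
 using assms(3,4)
proof (induction bs arbitrary: x)
 case (Cons b bs)
 have "ipd (b # bs) (%x. c * g x) x = pd b (%x. c * ipd bs g x) x"
  using partial_deriv_cong[OF assms(1), of b x "ipd bs (%x. c * g x)" "%x. c * ipd bs g x"]
   Cons by simp
 also have "... = c * pd b (ipd bs g) x"
  by (rule partial_cmult[OF smooth_iter_partial[OF assms(2)]]) (use Cons.prems in auto)
 finally show ?case by simp
qed simp

text \<open>The pairs of complementary subsequences that index the Leibniz rule. A list rather than
  a set is used so that equal pairs arising from repeated directions keep their multiplicity, which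
  replaces binomial coefficients.\<close>

fun splits :: "'a list => ('a list \<times> 'a list) list" where
 "splits [] = [([], [])]"
| "splits (b # bs) = map (%(u, v). (b # u, v)) (splits bs) @ map (%(u, v). (u, b # v)) (splits bs)"

lemma splits_mset: "(u, v) \<in> set (splits bs) ==> mset u + mset v = mset bs"
 by (induction bs arbitrary: u v) auto

lemma splits_set: "(u, v) \<in> set (splits bs) ==> set u <= set bs & set v <= set bs"
 by (induction bs arbitrary: u v) fastforce+

lemma smooth_sum_list:
 fixes f :: "_ => _ => 'f::real_normed_vector"
 assumes "span_open B W" "!!i. i \<in> set xs ==> smooth B W (f i)"
 shows "smooth B W (%x. \<Sum>i\<leftarrow>xs. f i x)"
 using assms(2) by (induction xs) (auto intro: smooth_const[OF assms(1)] smooth_add[OF assms(1)])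

lemma partial_sum_list:
 fixes f :: "_ => _ => 'f::real_normed_vector"
 assumes "span_open B W" "!!i. i \<in> set xs ==> smooth B W (f i)" "b \<in> B" "x \<in> W"
 shows "pd b (%x. \<Sum>i\<leftarrow>xs. f i x) x = (\<Sum>i\<leftarrow>xs. pd b (f i) x)"
 using assms(2)
proof (induction xs)
 case (Cons a xs)
 hence "smooth B W (%x. \<Sum>i\<leftarrow>xs. f i x)" by (intro smooth_sum_list[OF assms(1)]) simp
 with Cons show ?case using partial_add[OF _ _ assms(3,4), of "f a"] by simp
qed (simp add: partial_const)

lemma iter_partial_mult:
 fixes f g :: "_ => 'f::{real_normed_algebra, comm_ring}"
 assumes "span_open B W" "smooth B W f" "smooth B W g" "set bs <= B" "x \<in> W"
 shows "ipd bs (%x. f x * g x) x = (\<Sum>(u, v)\<leftarrow>splits bs. ipd u f x * ipd v g x)"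
 using assms(4,5)
proof (induction bs arbitrary: x)
 case (Cons b bs)
 have sm: "smooth B W (ipd u f)" "smooth B W (ipd v g)" if "(u, v) \<in> set (splits bs)" for u v
  using splits_set[OF that] Cons.prems by (auto intro!: smooth_iter_partial assms(2,3))
 have sm2: "smooth B W (%x. case i of (u, v) => ipd u f x * ipd v g x)" if "i \<in> set (splits bs)" for i
  using sm that by (cases i) (simp add: smooth_mult[OF assms(1)])
 have b: "b \<in> B" "set bs <= B" using Cons.prems by auto
 have "ipd (b # bs) (%x. f x * g x) x =
   pd b (%x. \<Sum>(u, v)\<leftarrow>splits bs. ipd u f x * ipd v g x) x"
  unfolding iter_partial_Cons by (rule partial_deriv_cong[OF assms(1) b(1) Cons.prems(2)]) (rule Cons.IH[OF b(2)])
 also have "... = (\<Sum>i\<leftarrow>splits bs. pd b (%x. case i of (u, v) => ipd u f x * ipd v g x) x)"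
  by (rule partial_sum_list[OF assms(1) sm2 b(1) Cons.prems(2)])
 also have "... = (\<Sum>(u, v)\<leftarrow>splits bs. ipd (b # u) f x * ipd v g x + ipd u f x * ipd (b # v) g x)"
 proof (rule arg_cong[of _ _ sum_list], rule map_cong[OF refl])
  fix i assume "i \<in> set (splits bs)"
  moreover obtain u v where "i = (u, v)" by (rule prod.exhaust)
  ultimately have i: "i = (u, v)" "(u, v) \<in> set (splits bs)" by simp_all
  show "pd b (%x. case i of (u, v) => ipd u f x * ipd v g x) x =
   (case i of (u, v) => ipd (b # u) f x * ipd v g x + ipd u f x * ipd (b # v) g x)"
   using partial_mult[OF sm[OF i(2)] b(1) Cons.prems(2)] by (simp add: i add.commute)
 qed
 also have "... = (\<Sum>(u, v)\<leftarrow>splits (b # bs). ipd u f x * ipd v g x)"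
  by (simp add: case_prod_unfold sum_list_addf o_def)
 finally show ?case .
qed simp

lemma finite_lists_le: "finite B ==> finite {bs. set bs <= B & length bs <= n}"
 by (rule finite_lists_length_le)

lemma lists_le_Suc:
 "{cs. set cs <= C & length cs <= Suc n} = insert [] ((%(c, cs). c # cs) ` (C \<times> {cs. set cs <= C & length cs <= n}))"
 (is "?L = ?R")
proof (rule Set.set_eqI)
 fix x show "x \<in> ?L \<longleftrightarrow> x \<in> ?R" by (cases x) auto
qed

subsection \<open>Powers of the ideal of a coordinate subspace\<close>

text \<open>\<open>N\<close> is the set of normal directions: the submanifold is \<open>x \<bullet> b = 0\<close> for \<open>b \<in> N\<close>.\<close>

primrec nideal :: "'e::euclidean_space set => 'e set => nat => 'e set => ('e => complex) => bool" where
 "nideal B N 0 W F \<longleftrightarrow> smooth B W F"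
| "nideal B N (Suc n) W F \<longleftrightarrow> (EX G. (ALL b:N. nideal B N n W (G b)) &
  (ALL x:W. F x = (\<Sum>b\<in>N. of_real (x \<bullet> b) * G b x)))"

lemma nideal_SucE:
 assumes "nideal B N (Suc n) W F"
 obtains G where "!!b. b \<in> N ==> nideal B N n W (G b)"
  "!!x. x \<in> W ==> F x = (\<Sum>b\<in>N. of_real (x \<bullet> b) * G b x)"
 using assms that unfolding nideal.simps by blast

definition monom :: "'e::euclidean_space list => 'e => complex" where
 "monom cs x = (\<Prod>c\<leftarrow>cs. of_real (x \<bullet> c))"

lemma monom_simps [simp]:
 "monom [] x = 1" "monom (c # cs) x = of_real (x \<bullet> c) * monom cs x"
 "monom (cs @ ds) x = monom cs x * monom ds x"
 by (simp_all add: monom_def)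

lemma smooth_monom: "span_open B W ==> smooth B W (monom cs)"
proof (induction cs)
 case Nil
 thus ?case using smooth_const[of B W 1] by (simp add: monom_def)
next
 case (Cons c cs)
 have "monom (c # cs) = (%x. of_real (x \<bullet> c) * monom cs x)" by (simp add: fun_eq_iff)
 thus ?case using Cons by (simp add: smooth_mult smooth_coord)
qed

lemma nideal_cong:
 assumes "span_open B W" "!!x. x \<in> W ==> F x = F' x"
 shows "nideal B N n W F \<longleftrightarrow> nideal B N n W F'"
 using smooth_cong[OF assms] assms(2) by (cases n) auto

lemma nideal_smooth: "span_open B W ==> nideal B N n W F ==> smooth B W F"
proof (induction n arbitrary: F)
 case (Suc n)
 obtain G where G: "!!b. b \<in> N ==> nideal B N n W (G b)" "!!x. x \<in> W ==> F x = (\<Sum>b\<in>N. of_real (x \<bullet> b) * G b x)"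
  by (rule nideal_SucE[OF Suc.prems(2)], rule that, blast+)
 have "smooth B W (%x. \<Sum>b\<in>N. of_real (x \<bullet> b) * G b x)"
  by (intro smooth_sum smooth_mult smooth_coord Suc.prems(1) Suc.IH G(1))
 thus ?case by (subst smooth_cong[OF Suc.prems(1) G(2)])
qed simp

lemma nideal_subset: "nideal B N n W F ==> W' <= W ==> nideal B N n W' F"
proof (induction n arbitrary: F)
 case 0
 thus ?case using smooth_subset by auto
next
 case (Suc n)
 obtain G where G: "!!b. b \<in> N ==> nideal B N n W (G b)" "!!x. x \<in> W ==> F x = (\<Sum>b\<in>N. of_real (x \<bullet> b) * G b x)"
  by (rule nideal_SucE[OF Suc.prems(1)], rule that, blast+)
 show ?case unfolding nideal.simps
  by (rule exI[of _ G]) (use Suc G in blast)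
qed

lemma nideal_zero: "span_open B W ==> nideal B N n W (%x. 0)"
proof (induction n)
 case 0
 thus ?case by (simp add: smooth_const)
next
 case (Suc n)
 show ?case unfolding nideal.simps
  by (rule exI[of _ "%_ _. 0"]) (use Suc in simp)
qed

lemma nideal_mult_smooth:
 "span_open B W ==> smooth B W a ==> nideal B N n W F ==> nideal B N n W (%x. a x * F x)"
proof (induction n arbitrary: F)
 case 0
 thus ?case by (simp add: smooth_mult)
next
 case (Suc n)
 obtain G where G: "!!b. b \<in> N ==> nideal B N n W (G b)" "!!x. x \<in> W ==> F x = (\<Sum>b\<in>N. of_real (x \<bullet> b) * G b x)"
  by (rule nideal_SucE[OF Suc.prems(3)], rule that, blast+)
 show ?case unfolding nideal.simps
 proof (rule exI[of _ "%b x. a x * G b x"], intro conjI ballI)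
  fix x assume "x \<in> W"
  thus "a x * F x = (\<Sum>b\<in>N. of_real (x \<bullet> b) * (a x * G b x))"
   by (simp add: G(2) sum_distrib_left mult_ac)
 qed (rule Suc.IH[OF Suc.prems(1,2) G(1)])
qed

lemma nideal_add:
 "span_open B W ==> nideal B N n W F ==> nideal B N n W F' ==> nideal B N n W (%x. F x + F' x)"
proof (induction n arbitrary: F F')
 case 0
 thus ?case by (simp add: smooth_add)
next
 case (Suc n)
 obtain G where G: "!!b. b \<in> N ==> nideal B N n W (G b)" "!!x. x \<in> W ==> F x = (\<Sum>b\<in>N. of_real (x \<bullet> b) * G b x)"
  by (rule nideal_SucE[OF Suc.prems(2)], rule that, blast+)
 obtain G' where G': "!!b. b \<in> N ==> nideal B N n W (G' b)" "!!x. x \<in> W ==> F' x = (\<Sum>b\<in>N. of_real (x \<bullet> b) * G' b x)"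
  by (rule nideal_SucE[OF Suc.prems(3)], rule that, blast+)
 show ?case unfolding nideal.simps
 proof (rule exI[of _ "%b x. G b x + G' b x"], intro conjI ballI)
  fix x assume "x \<in> W"
  thus "F x + F' x = (\<Sum>b\<in>N. of_real (x \<bullet> b) * (G b x + G' b x))"
   by (simp add: G(2) G'(2) sum.distrib distrib_left)
 qed (rule Suc.IH[OF Suc.prems(1) G(1) G'(1)])
qed

lemma nideal_sum:
 assumes "span_open B W" "!!i. i \<in> I ==> nideal B N n W (F i)"
 shows "nideal B N n W (%x. \<Sum>i\<in>I. F i x)"
 using assms(2)
proof (induction I rule: infinite_finite_induct)
 case (insert i I)
 thus ?case by (simp add: nideal_add[OF assms(1)])
qed (simp_all add: nideal_zero[OF assms(1)])

lemma nideal_coord_mult: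
 assumes "span_open B W" "finite N" "b \<in> N" "nideal B N n W F"
 shows "nideal B N (Suc n) W (%x. of_real (x \<bullet> b) * F x)"
 unfolding nideal.simps
proof (rule exI[of _ "%c. if c = b then F else (%_. 0)"], intro conjI ballI)
 fix c show "nideal B N n W (if c = b then F else (%_. 0))" using assms nideal_zero[OF assms(1)] by simp
next
 fix x
 have "(\<Sum>c\<in>N. of_real (x \<bullet> c) * (if c = b then F else (%_. 0)) x) = (\<Sum>c\<in>N. if c = b then of_real (x \<bullet> c) * F x else 0)"
  by (intro sum.cong) auto
 also have "... = of_real (x \<bullet> b) * F x" using assms by simp
 finally show "of_real (x \<bullet> b) * F x = (\<Sum>c\<in>N. of_real (x \<bullet> c) * (if c = b then F else (%_. 0)) x)" ..
qed

lemma nideal_SucD: "span_open B W ==> nideal B N (Suc n) W F ==> nideal B N n W F"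
proof (induction n arbitrary: F)
 case 0
 thus ?case using nideal_smooth[of B W N "Suc 0" F] by simp
next
 case (Suc n)
 obtain G where G: "!!b. b \<in> N ==> nideal B N (Suc n) W (G b)" "!!x. x \<in> W ==> F x = (\<Sum>b\<in>N. of_real (x \<bullet> b) * G b x)"
  by (rule nideal_SucE[OF Suc.prems(2)], rule that, blast+)
 show ?case unfolding nideal.simps
  by (rule exI[of _ G]) (use Suc.IH[OF Suc.prems(1) G(1)] G(2) in simp)
qed

lemma nideal_antimono: "span_open B W ==> m <= n ==> nideal B N n W F ==> nideal B N m W F"
proof (induction "n - m" arbitrary: n)
 case (Suc d)
 then obtain n' where n': "n = Suc n'" "m <= n'" "d = n' - m" by (cases n) auto
 thus ?case using Suc.hyps(1)[of n'] nideal_SucD[of B W N n' F] Suc.prems by blast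
qed simp

lemma nideal_mult:
 assumes "span_open B W" "nideal B N m W F" "nideal B N n W F'"
 shows "nideal B N (m + n) W (%x. F x * F' x)"
 using assms(2)
proof (induction m arbitrary: F)
 case 0
 thus ?case using nideal_mult_smooth[OF assms(1) _ assms(3)] by simp
next
 case (Suc m)
 obtain G where G: "!!b. b \<in> N ==> nideal B N m W (G b)" "!!x. x \<in> W ==> F x = (\<Sum>b\<in>N. of_real (x \<bullet> b) * G b x)"
  by (rule nideal_SucE[OF Suc.prems(1)], rule that, blast+)
 show ?case unfolding nideal.simps add_Suc
 proof (rule exI[of _ "%b x. G b x * F' x"], intro conjI ballI)
  fix x assume "x \<in> W"
  thus "F x * F' x = (\<Sum>b\<in>N. of_real (x \<bullet> b) * (G b x * F' x))"
   by (simp add: G(2) sum_distrib_right mult.assoc)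
 qed (rule Suc.IH[OF G(1)])
qed

lemma nideal_monom: "span_open B W ==> finite N ==> set cs <= N ==> nideal B N (length cs) W (monom cs)"
proof (induction cs)
 case Nil
 thus ?case using smooth_const[of B W 1] by (simp add: monom_def)
next
 case (Cons c cs)
 have "monom (c # cs) = (%x. of_real (x \<bullet> c) * monom cs x)" by (simp add: fun_eq_iff)
 thus ?case using Cons nideal_coord_mult[of B W N c "length cs" "monom cs"] by simp
qed

lemma partial_coord_sum:
 fixes G :: "'e::euclidean_space => 'e => complex"
 assumes "span_open B W" "!!c. c \<in> N ==> smooth B W (G c)" "b \<in> B" "x \<in> W"
  "!!x. x \<in> W ==> F x = (\<Sum>c\<in>N. of_real (x \<bullet> c) * G c x)"
 shows "pd b F x = (\<Sum>c\<in>N. of_real (x \<bullet> c) * pd b (G c) x + of_real (b \<bullet> c) * G c x)"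
proof -
 have "pd b F x = pd b (%x. \<Sum>c\<in>N. of_real (x \<bullet> c) * G c x) x"
  by (rule partial_deriv_cong[OF assms(1,3,4,5)])
 also have "... = (\<Sum>c\<in>N. pd b (%x. of_real (x \<bullet> c) * G c x) x)"
  by (rule partial_sum[OF _ assms(3,4)]) (rule smooth_mult[OF assms(1) smooth_coord[OF assms(1)] assms(2)])
 also have "... = (\<Sum>c\<in>N. of_real (x \<bullet> c) * pd b (G c) x + of_real (b \<bullet> c) * G c x)"
 proof (rule sum.cong[OF refl])
  fix c assume "c \<in> N"
  thus "pd b (%x. of_real (x \<bullet> c) * G c x) x = of_real (x \<bullet> c) * pd b (G c) x + of_real (b \<bullet> c) * G c x"
   using partial_mult[OF smooth_coord[OF assms(1)] assms(2) assms(3,4), of c c] by (simp add: partial_coord)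
 qed
 finally show ?thesis .
qed

text \<open>By the product rule, each term loses either one coordinate factor or, inductively, one
  order of its cofactor.\<close>

lemma nideal_partial:
 assumes "span_open B W" "finite N" "b \<in> B" "nideal B N (Suc n) W F"
 shows "nideal B N n W (pd b F)"
 using assms(4)
proof (induction n arbitrary: F)
 case 0
 have "smooth B W F" by (rule nideal_smooth[OF assms(1) 0])
 thus ?case using smooth_partial[OF _ assms(3)] by simp
next
 case (Suc n)
 obtain G where G: "!!b. b \<in> N ==> nideal B N (Suc n) W (G b)" "!!x. x \<in> W ==> F x = (\<Sum>b\<in>N. of_real (x \<bullet> b) * G b x)"
  by (rule nideal_SucE[OF Suc.prems], rule that, blast+)
 have "nideal B N (Suc n) W (%x. \<Sum>c\<in>N. of_real (x \<bullet> c) * pd b (G c) x + of_real (b \<bullet> c) * G c x)"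
  by (intro nideal_sum nideal_add nideal_coord_mult nideal_mult_smooth smooth_const assms(1,2) Suc.IH G(1))
 thus ?case
  by (subst nideal_cong[OF assms(1) partial_coord_sum[OF assms(1) nideal_smooth[OF assms(1) G(1)] assms(3) _ G(2)]])
qed

text \<open>The normal coordinates are constant in a direction outside \<open>N\<close>, so only the
  cofactors are differentiated and no order is lost.\<close>

lemma nideal_tangential:
 assumes "span_open B W" "B <= Basis" "N <= B" "b \<in> B - N" "nideal B N n W F"
 shows "nideal B N n W (pd b F)"
 using assms(5)
proof (induction n arbitrary: F)
 case 0
 thus ?case using smooth_partial[of B W F b] assms(4) by simp
next
 case (Suc n)
 obtain G where G: "!!b. b \<in> N ==> nideal B N n W (G b)" "!!x. x \<in> W ==> F x = (\<Sum>b\<in>N. of_real (x \<bullet> b) * G b x)"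
  by (rule nideal_SucE[OF Suc.prems(1)], rule that, blast+)
 have b: "b \<in> B" using assms(4) by simp
 have orth: "b \<bullet> c = 0" if "c \<in> N" for c
  using assms(2,3,4) that inner_Basis[of b c] by (cases "b = c") auto
 show ?case unfolding nideal.simps
 proof (rule exI[of _ "%c. pd b (G c)"], intro conjI ballI)
  fix x assume x: "x \<in> W"
  have "pd b F x = (\<Sum>c\<in>N. of_real (x \<bullet> c) * pd b (G c) x + of_real (b \<bullet> c) * G c x)"
   by (rule partial_coord_sum[OF assms(1) nideal_smooth[OF assms(1) G(1)] b x G(2)])
  also have "... = (\<Sum>c\<in>N. of_real (x \<bullet> c) * pd b (G c) x)"
   by (intro sum.cong) (auto simp: orth)
  finally show "pd b F x = (\<Sum>c\<in>N. of_real (x \<bullet> c) * pd b (G c) x)" .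
 qed (rule Suc.IH[OF G(1)])
qed

text \<open>The normal order of a derivative: only directions in \<open>N\<close> cost order of
  vanishing.\<close>

abbreviation ncount :: "'e set => 'e list => nat" where
 "ncount N bs == length (filter (%b. b \<in> N) bs)"

lemma nideal_iter_partial:
 assumes "span_open B W" "B <= Basis" "N <= B" "set bs <= B" "nideal B N (n + ncount N bs) W F"
 shows "nideal B N n W (ipd bs F)"
 using assms(4,5)
proof (induction bs arbitrary: n)
 case (Cons b bs)
 have fin: "finite N" using assms(2,3) finite_Basis_subset by blast
 show ?case
 proof (cases "b \<in> N")
  case True
  hence "nideal B N (Suc n) W (ipd bs F)" using Cons.IH[of "Suc n"] Cons.prems by (simp del: nideal.simps)
  thus ?thesis using nideal_partial[OF assms(1) fin] Cons.prems by simp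
 next
  case False
  hence "nideal B N n W (ipd bs F)" using Cons.IH[of n] Cons.prems by (simp del: nideal.simps)
  thus ?thesis using nideal_tangential[OF assms(1-3)] Cons.prems False by simp
 qed
qed simp

lemma lists_eq_Suc:
 "{cs. set cs <= N & length cs = Suc n} = (%(c, cs). c # cs) ` (N \<times> {cs. set cs <= N & length cs = n})"
 (is "?L = ?R")
proof (rule Set.set_eqI)
 fix x show "x \<in> ?L \<longleftrightarrow> x \<in> ?R" by (cases x) auto
qed

text \<open>Iterating the recursive definition collects the coordinate factors into monomials.
  Applied later in product coordinates, it yields coefficients that are smooth in the group variable
  as well.\<close>

lemma nideal_expand:
 assumes "span_open B W" "nideal B N n W F"
 shows "EX e. (ALL cs. smooth B W (e cs)) &
  (ALL x:W. F x = (\<Sum>cs | set cs <= N & length cs = n. e cs x * monom cs x))"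
 using assms(2)
proof (induction n arbitrary: F)
 case 0
 have "{cs. set cs <= N & length cs = 0} = {[]}" by auto
 thus ?case using 0 by (intro exI[of _ "%_. F"]) simp
next
 case (Suc n)
 let ?L = "{cs. set cs <= N & length cs = n}"
 obtain G where G: "!!b. b \<in> N ==> nideal B N n W (G b)" "!!x. x \<in> W ==> F x = (\<Sum>b\<in>N. of_real (x \<bullet> b) * G b x)"
  by (rule nideal_SucE[OF Suc.prems], rule that, blast+)
 have "ALL b:N. EX e. (ALL cs. smooth B W (e cs)) & (ALL x:W. G b x = (\<Sum>cs\<in>?L. e cs x * monom cs x))"
  using Suc.IH[OF G(1)] by blast
 from bchoice[OF this] obtain e where e: "!!b cs. b \<in> N ==> smooth B W (e b cs)"
  "!!b x. b \<in> N ==> x \<in> W ==> G b x = (\<Sum>cs\<in>?L. e b cs x * monom cs x)" by blast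
 \<comment> \<open>The sum uses \<open>e'\<close> only on lists of length \<open>Suc n\<close> with
   entries in \<open>N\<close>; the value zero elsewhere keeps it smooth for all lists.\<close>
 define e' where "e' cs = (case cs of [] => (%_. 0) | c # cs' => if c \<in> N then e c cs' else (%_. 0))" for cs
 show ?case
 proof (intro exI[of _ e'] conjI allI ballI)
  fix cs show "smooth B W (e' cs)"
   by (cases cs) (auto simp: e'_def intro: e(1) smooth_const[OF assms(1)])
 next
  fix x assume x: "x \<in> W"
  have inj: "inj_on (%(c, cs). c # cs) (N \<times> ?L)" by (auto simp: inj_on_def)
  have "F x = (\<Sum>b\<in>N. \<Sum>cs\<in>?L. e b cs x * monom (b # cs) x)"
   unfolding G(2)[OF x]
   by (intro sum.cong[OF refl]) (simp add: e(2)[OF _ x] sum_distrib_left mult_ac)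
  also have "... = (\<Sum>(b, cs)\<in>N \<times> ?L. e b cs x * monom (b # cs) x)"
   by (rule sum.cartesian_product)
  also have "... = (\<Sum>(b, cs)\<in>N \<times> ?L. e' (b # cs) x * monom (b # cs) x)"
   by (intro sum.cong refl) (auto simp: e'_def)
  also have "... = (\<Sum>cs | set cs <= N & length cs = Suc n. e' cs x * monom cs x)"
   unfolding lists_eq_Suc by (subst sum.reindex[OF inj]) (simp add: case_prod_unfold o_def)
  finally show "F x = (\<Sum>cs | set cs <= N & length cs = Suc n. e' cs x * monom cs x)" .
 qed
qed

text \<open>Substitution is multiplicative, so it is enough that the normal coordinates of the
  target pull back into the ideal of the source.\<close>

lemma nideal_compose:
 fixes Ps :: "'e::euclidean_space => 'f::euclidean_space"
 assumes "C <= Basis" "span_open B W" "span_open C V" "Ps ` W <= V" "smooth B W Ps"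
  "!!b. b \<in> N' ==> nideal B N 1 W (%x. of_real (Ps x \<bullet> b))" "nideal C N' n V F"
 shows "nideal B N n W (%x. F (Ps x))"
 using assms(7)
proof (induction n arbitrary: F)
 case 0
 thus ?case using smooth_compose[OF assms(1-5), of F] by simp
next
 case (Suc n)
 obtain G where G: "!!b. b \<in> N' ==> nideal C N' n V (G b)" "!!x. x \<in> V ==> F x = (\<Sum>b\<in>N'. of_real (x \<bullet> b) * G b x)"
  by (rule nideal_SucE[OF Suc.prems(1)], rule that, blast+)
 have "nideal B N (1 + n) W (%x. \<Sum>b\<in>N'. of_real (Ps x \<bullet> b) * G b (Ps x))"
  by (intro nideal_sum nideal_mult assms(2,6) Suc.IH[OF G(1)])
 moreover have "F (Ps x) = (\<Sum>b\<in>N'. of_real (Ps x \<bullet> b) * G b (Ps x))" if "x \<in> W" for x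
  using G(2) assms(4) that by blast
 ultimately show ?case
  using nideal_cong[OF assms(2), of "%x. F (Ps x)" "%x. \<Sum>b\<in>N'. of_real (Ps x \<bullet> b) * G b (Ps x)" N "Suc n"]
  by (simp del: nideal.simps)
qed

lemma iter_partial_compose_nideal:
 fixes Ps :: "'e::euclidean_space => 'f::euclidean_space" and q :: "'e => complex"
 assumes "B <= Basis" "C <= Basis" "span_open B W" "smooth B W Ps" "Ps ` W <= span C"
  and N: "N <= B" and PsN: "!!c. c \<in> M ==> nideal B N 1 W (%x. of_real (Ps x \<bullet> c))" and q: "smooth B W q" and "set bs <= B"
 shows "EX G. (ALL cs. nideal B N (ncount M cs - ncount N bs) W (G cs)) &
  (ALL T V x. span_open C V & smooth C V T & x \<in> W & Ps x \<in> V -->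
   ipd bs (%x. q x * T (Ps x)) x =
   (\<Sum>cs | set cs <= C & length cs <= length bs. G cs x * ipd cs T (Ps x)))"
 using assms(9)
proof (induction bs)
 case Nil
 show ?case
 proof (intro exI[of _ "%cs x. if cs = [] then q x else 0"] conjI allI impI)
  fix T :: "'f => complex" and V x
  have "{cs. set cs <= C & length cs <= length ([] :: 'e list)} = {[]}" by auto
  thus "ipd [] (%x. q x * T (Ps x)) x =
   (\<Sum>cs | set cs <= C & length cs <= length ([] :: 'e list). (if cs = [] then q x else 0) * ipd cs T (Ps x))" by simp
 next
  fix cs
  show "nideal B N (ncount M cs - ncount N ([] :: 'e list)) W (%x. if cs = [] then q x else 0)"
   by (cases "cs = []") (simp_all add: q nideal_zero assms(3))
 qed
next
 case (Cons b bs)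
 let ?n = "length bs"
 let ?L = "%n. {cs. set cs <= C & length cs <= n}"
 have b: "b \<in> B" "set bs <= B" using Cons.prems by auto
 have finC: "finite C" using finite_Basis_subset[OF assms(2)] .
 obtain G where Gn: "!!cs. nideal B N (ncount M cs - ncount N bs) W (G cs)" and
  G2: "!!T V x. span_open C V ==> smooth C V T ==> x \<in> W ==> Ps x \<in> V ==>
   ipd bs (%x. q x * T (Ps x)) x = (\<Sum>cs\<in>?L ?n. G cs x * ipd cs T (Ps x))"
  using Cons.IH[OF b(2)] by blast
 note G = nideal_smooth[OF assms(3) Gn] G2
 have finN: "finite N" using N finite_Basis_subset[OF assms(1)] finite_subset by blast
 \<comment> \<open>The new derivative falls either on the coefficient, keeping \<open>cs\<close>, or
   on the derivative of \<open>T\<close>, prepending a direction \<open>c\<close> with the factor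
   from the chain rule. The length test restricts the first kind to lists of the previous
   sum.\<close>
 define G' where "G' cs x = (if length cs <= ?n then pd b (G cs) x else 0) +
  (case cs of [] => 0 | c # cs' => of_real (pd b Ps x \<bullet> c) * G cs' x)" for cs x
 show ?case
 proof (intro exI[of _ G'] conjI allI impI)
  fix cs
  let ?n' = "ncount M cs - ncount N (b # bs)"
  have 1: "nideal B N ?n' W (%x. if length cs <= ?n then pd b (G cs) x else 0)"
  proof (cases "length cs <= ?n")
   case True
   have "nideal B N ?n' W (pd b (G cs))"
   proof (cases "b \<in> N")
    case bN: True
    show ?thesis
    \<comment> \<open>Subtraction is truncated: at zero only smoothness is claimed, so there is no
      order to lose.\<close>
    proof (cases "ncount M cs - ncount N bs")
     case 0
     thus ?thesis using smooth_partial[OF G(1) b(1)] bN by simp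
    next
     case (Suc m)
     hence "?n' = m" using bN by simp
     thus ?thesis using nideal_partial[OF assms(3) finN b(1)] Gn[of cs] Suc by (simp only:)
    qed
   next
    case False
    thus ?thesis using nideal_tangential[OF assms(3,1) N _ Gn[of cs], of b] b(1) by simp
   qed
   thus ?thesis using True by simp
  qed (simp add: nideal_zero[OF assms(3)])
  have 2: "nideal B N ?n' W (%x. case cs of [] => 0 | c # cs' => of_real (pd b Ps x \<bullet> c) * G cs' x)"
  proof (cases cs)
   case (Cons c cs')
   have s: "smooth B W (%x. of_real (pd b Ps x \<bullet> c) :: complex)"
    by (intro smooth_of_real smooth_inner_const smooth_partial assms(3,4) b(1))
   have "nideal B N ?n' W (%x. of_real (pd b Ps x \<bullet> c) * G cs' x)"
   \<comment> \<open>Only a tangential derivative that produces a normal one has to gain an order.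
     It does, since tangential derivatives of \<open>Ps . c\<close> still vanish on the submanifold;
     in the other cases the count of \<open>G cs'\<close> already suffices.\<close>
   proof (cases "c \<in> M & b ~: N")
    case True
    have bl: "bounded_linear (%v. of_real (v \<bullet> c) :: complex)"
     by (rule bounded_linear_compose[OF bounded_linear_of_real bounded_linear_inner_left])
    have "nideal B N 1 W (pd b (%x. of_real (Ps x \<bullet> c)))"
     using True b(1) by (intro nideal_tangential[OF assms(3,1) N _ PsN]) auto
    hence "nideal B N 1 W (%x. of_real (pd b Ps x \<bullet> c))"
     by (subst (asm) nideal_cong[OF assms(3) partial_linear_comp[OF bl assms(4) b(1)]])
    from nideal_mult[OF assms(3) this Gn[of cs']]
    show ?thesis by (rule nideal_antimono[OF assms(3), rotated]) (use True in \<open>simp add: Cons\<close>)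
   next
    case False
    have "nideal B N (ncount M cs' - ncount N bs) W (%x. of_real (pd b Ps x \<bullet> c) * G cs' x)"
     by (rule nideal_mult_smooth[OF assms(3) s Gn])
    thus ?thesis by (rule nideal_antimono[OF assms(3), rotated]) (use False in \<open>auto simp: Cons\<close>)
   qed
   thus ?thesis by (simp add: Cons)
  qed (simp add: smooth_const[OF assms(3)])
  show "nideal B N ?n' W (G' cs)" unfolding G'_def by (rule nideal_add[OF assms(3) 1 2])
 next
  fix T :: "'f => complex" and V x
  assume "span_open C V & smooth C V T & x \<in> W & Ps x \<in> V"
  hence V: "span_open C V" "smooth C V T" and x: "x \<in> W" "Ps x \<in> V" by auto
  define W' where "W' = W \<inter> Ps -` V"
  have W': "span_open B W'" unfolding W'_def
   by (rule span_open_preimage[OF assms(3) smooth_continuous[OF assms(4)] assms(5) V(1)])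
  have sub: "W' <= W" "Ps ` W' <= V" "x \<in> W'" using x by (auto simp: W'_def)
  have sT: "smooth C V (ipd cs T)" if "cs \<in> ?L n" for cs n
   using that by (intro smooth_iter_partial V(2)) auto
  have sTP: "smooth B W' (%x. ipd cs T (Ps x))" if "cs \<in> ?L n" for cs n
   by (rule smooth_compose[OF assms(2) W' V(1) sub(2) smooth_subset[OF assms(4) sub(1)] sT[OF that]])
  have sG: "smooth B W' (G cs)" for cs by (rule smooth_subset[OF G(1) sub(1)])
  have "ipd (b # bs) (%x. q x * T (Ps x)) x = pd b (%x. \<Sum>cs\<in>?L ?n. G cs x * ipd cs T (Ps x)) x"
   unfolding iter_partial_Cons
   by (rule partial_deriv_cong[OF W' b(1) sub(3)]) (rule G(2)[OF V], auto simp: W'_def)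
  also have "... = (\<Sum>cs\<in>?L ?n. pd b (%x. G cs x * ipd cs T (Ps x)) x)"
   by (rule partial_sum[OF smooth_mult[OF W' sG sTP] b(1) sub(3)])
  also have "... = (\<Sum>cs\<in>?L ?n. G cs x * (\<Sum>c\<in>C. (pd b Ps x \<bullet> c) *\<^sub>R ipd (c # cs) T (Ps x))
    + pd b (G cs) x * ipd cs T (Ps x))"
  proof (rule sum.cong[OF refl])
   fix cs assume cs: "cs \<in> ?L ?n"
   show "pd b (%x. G cs x * ipd cs T (Ps x)) x =
    G cs x * (\<Sum>c\<in>C. (pd b Ps x \<bullet> c) *\<^sub>R ipd (c # cs) T (Ps x))
    + pd b (G cs) x * ipd cs T (Ps x)"
    using partial_mult[OF sG sTP[OF cs] b(1) sub(3), of cs]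
     smooth_compose_partial[OF assms(2) W' V(1) sub(2) smooth_subset[OF assms(4) sub(1)] sT[OF cs] b(1) sub(3)]
    by simp
  qed
  also have "... = (\<Sum>cs\<in>?L ?n. \<Sum>c\<in>C. of_real (pd b Ps x \<bullet> c) * G cs x * ipd (c # cs) T (Ps x))
    + (\<Sum>cs\<in>?L ?n. pd b (G cs) x * ipd cs T (Ps x))"
   by (simp add: sum.distrib sum_distrib_left scaleR_conv_of_real mult_ac)
  also have "(\<Sum>cs\<in>?L ?n. \<Sum>c\<in>C. of_real (pd b Ps x \<bullet> c) * G cs x * ipd (c # cs) T (Ps x)) =
    (\<Sum>cs\<in>?L (Suc ?n). (case cs of [] => 0 | c # cs' => of_real (pd b Ps x \<bullet> c) * G cs' x) * ipd cs T (Ps x))"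
  proof -
   have inj: "inj_on (%(c, cs). c # cs) (C \<times> ?L ?n)" by (auto simp: inj_on_def)
   have fin: "finite ((%(c, cs). c # cs) ` (C \<times> ?L ?n))" using finite_lists_le[OF finC] finC by auto
   have "(\<Sum>cs\<in>?L (Suc ?n). (case cs of [] => 0 | c # cs' => of_real (pd b Ps x \<bullet> c) * G cs' x) * ipd cs T (Ps x))
    = (\<Sum>(c, cs)\<in>C \<times> ?L ?n. of_real (pd b Ps x \<bullet> c) * G cs x * ipd (c # cs) T (Ps x))"
    unfolding lists_le_Suc
    by (subst sum.insert[OF fin], force, subst sum.reindex[OF inj]) (simp add: case_prod_unfold o_def)
   also have "... = (\<Sum>c\<in>C. \<Sum>cs\<in>?L ?n. of_real (pd b Ps x \<bullet> c) * G cs x * ipd (c # cs) T (Ps x))"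
    by (simp add: sum.cartesian_product)
   also have "... = (\<Sum>cs\<in>?L ?n. \<Sum>c\<in>C. of_real (pd b Ps x \<bullet> c) * G cs x * ipd (c # cs) T (Ps x))"
    by (rule sum.swap)
   finally show ?thesis by simp
  qed
  also have "(\<Sum>cs\<in>?L ?n. pd b (G cs) x * ipd cs T (Ps x)) =
   (\<Sum>cs\<in>?L (Suc ?n). (if length cs <= ?n then pd b (G cs) x else 0) * ipd cs T (Ps x))"
   by (rule sum.mono_neutral_cong_left) (use finite_lists_le[OF finC] in auto)
  finally show "ipd (b # bs) (%x. q x * T (Ps x)) x =
   (\<Sum>cs\<in>?L (length (b # bs)). G' cs x * ipd cs T (Ps x))"
   unfolding G'_def by (simp add: distrib_right sum.distrib add.commute)
 qed
qed

lemma iter_partial_compose: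
 fixes Ps :: "'e::euclidean_space => 'f::euclidean_space"
 assumes "B <= Basis" "C <= Basis" "span_open B W" "smooth B W Ps" "Ps ` W <= span C" "set bs <= B"
 shows "EX G. (ALL cs. smooth B W (G cs :: 'e => complex)) &
  (ALL T V x. span_open C V & smooth C V T & x \<in> W & Ps x \<in> V -->
   ipd bs (%x. T (Ps x)) x =
   (\<Sum>cs | set cs <= C & length cs <= length bs. G cs x * ipd cs T (Ps x)))"
 using iter_partial_compose_nideal[OF assms(1-5) _ _ smooth_const[OF assms(3), of 1] assms(6), of "{}" "{}"] by simp

section \<open>Contraction in the normal directions and Hadamard's lemma\<close>

definition nscale :: "'e::euclidean_space set => real => 'e => 'e" where
 "nscale N t x = x - (1 - t) *\<^sub>R (\<Sum>b\<in>N. (x \<bullet> b) *\<^sub>R b)"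

definition nstar :: "'e::euclidean_space set => 'e set => bool" where
 "nstar N W \<longleftrightarrow> (ALL x:W. ALL t:{0..1}. nscale N t x \<in> W)"

lemma nscale_inner:
 assumes "N <= Basis" "c \<in> Basis"
 shows "nscale N t x \<bullet> c = (if c \<in> N then t * (x \<bullet> c) else x \<bullet> c)"
 unfolding nscale_def inner_diff_left inner_scaleR_left sum_Basis_inner[OF assms]
 by (simp add: algebra_simps)

lemma nscale_one [simp]: "nscale N 1 x = x"
 by (simp add: nscale_def)

lemma nscale_in_span:
 assumes "B <= Basis" "N <= B" "x \<in> span B"
 shows "nscale N t x \<in> span B"
 unfolding nscale_def using assms
 by (intro span_diff span_scale span_sum) (auto intro: span_base)

lemma nscale_line:
 assumes "N <= Basis" "b \<in> Basis"
 shows "nscale N t (x + s *\<^sub>R b) = nscale N t x + (s * (if b \<in> N then t else 1)) *\<^sub>R b"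
proof (rule euclidean_eqI)
 fix c :: 'a assume c: "c \<in> Basis"
 show "nscale N t (x + s *\<^sub>R b) \<bullet> c = (nscale N t x + (s * (if b \<in> N then t else 1)) *\<^sub>R b) \<bullet> c"
  using assms c by (auto simp: inner_add_left nscale_inner inner_Basis algebra_simps)
qed

lemma continuous_on_nscale:
 assumes "continuous_on A f" "continuous_on A g"
 shows "continuous_on A (%y. nscale N (f y) (g y))"
 unfolding nscale_def by (intro continuous_intros assms)

text \<open>The centre has zero normal coordinates, so the contraction does not increase any
  coordinate of \<open>x - p\<close> in absolute value.\<close>

lemma nstar_ball:
 assumes "N <= B" "B <= Basis" "!!b. b \<in> N ==> p \<bullet> b = 0"
 shows "nstar N (ball p r \<inter> span B)"
 unfolding nstar_def
proof (intro ballI)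
 fix x and t :: real assume x: "x \<in> ball p r \<inter> span B" and t: "t \<in> {0..1}"
 have "norm (nscale N t x - p) <= norm (x - p)"
 proof (rule norm_le_componentwise)
  fix c :: 'a assume c: "c \<in> Basis"
  have "N <= Basis" using assms by auto
  thus "\<bar>(nscale N t x - p) \<bullet> c\<bar> <= \<bar>(x - p) \<bullet> c\<bar>"
   using c assms(3)[of c] t by (auto simp: inner_diff_left nscale_inner abs_mult intro!: mult_left_le_one_le)
 qed
 thus "nscale N t x \<in> ball p r \<inter> span B"
  using x nscale_in_span[OF assms(2,1)] by (auto simp: dist_norm norm_minus_commute)
qed

text \<open>The weight \<open>t ^ j\<close> makes the induction close: a derivative in a normal
  direction brings out one more factor \<open>t\<close> by the chain rule, one in a tangential
  direction none.\<close>

lemma k_smooth_radial_integral: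
 fixes F :: "'e::euclidean_space => complex"
 assumes B: "B <= Basis" and N: "N <= B" and W: "span_open B W" and star: "nstar N W"
  and F: "smooth B W F"
 shows "k_smooth k B W (%x. integral (cbox 0 1) (%t. t ^ j *\<^sub>R F (nscale N t x)))"
 using F
proof (induction k arbitrary: F j)
 case 0
 have "continuous_on (W \<times> cbox 0 1) (%(x, t). t ^ j *\<^sub>R F (nscale N t x))"
  unfolding case_prod_unfold using star
  by (intro continuous_intros continuous_on_compose2[OF smooth_continuous[OF 0]] continuous_on_nscale)
   (auto simp: nstar_def)
 thus ?case unfolding k_smooth.simps by (rule integral_continuous_on_param)
next
 case (Suc k)
 have NB: "N <= Basis" using B N by auto
 have cont: "continuous_on W (%x. integral (cbox 0 1) (%t. t ^ j *\<^sub>R F (nscale N t x)))"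
  by (rule k_smooth_continuous[OF Suc.IH[OF Suc.prems]])
 show ?case
 proof (rule k_smooth_SucI[OF W cont, where g' =
   "%b x. integral (cbox 0 1) (%t. t ^ (if b \<in> N then Suc j else j) *\<^sub>R pd b F (nscale N t x))"])
  fix b assume b: "b \<in> B"
  let ?j = "if b \<in> N then Suc j else j"
  have Fb: "smooth B W (pd b F)" by (rule smooth_partial[OF Suc.prems b])
  show "k_smooth k B W (%x. integral (cbox 0 1) (%t. t ^ ?j *\<^sub>R pd b F (nscale N t x)))"
   by (rule Suc.IH[OF Fb])
  fix x assume x: "x \<in> W"
  obtain d where d: "d > 0" "!!s. \<bar>s\<bar> < d ==> x + s *\<^sub>R b \<in> W"
   using span_open_line[OF W b x] unfolding eventually_nhds_metric dist_norm by auto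
  define U where "U = {-d<..<d}"
  have U: "0 \<in> U" "convex U" "open U" using d by (auto simp: U_def)
  have UW: "nscale N t (x + s *\<^sub>R b) \<in> W" if "s \<in> U" "t \<in> cbox 0 1" for s t
  proof -
   have "x + s *\<^sub>R b \<in> W" using that(1) d(2)[of s] by (auto simp: U_def)
   thus ?thesis using star that(2) by (simp add: nstar_def)
  qed
  have "((%s. integral (cbox 0 1) (%t. t ^ j *\<^sub>R F (nscale N t (x + s *\<^sub>R b)))) has_vector_derivative
    integral (cbox 0 1) (%t. t ^ ?j *\<^sub>R pd b F (nscale N t (x + 0 *\<^sub>R b)))) (at 0 within U)"
  proof (rule leibniz_rule_vector_derivative[OF _ _ _ U(1,2)])
   fix s t :: real assume st: "s \<in> U" "t \<in> cbox 0 1"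
   let ?y = "nscale N t x"
   define ta where "ta = (if b \<in> N then t else 1)"
   have line: "nscale N t (x + s *\<^sub>R b) = ?y + (s * ta) *\<^sub>R b" for s
    unfolding ta_def using NB b B by (intro nscale_line) auto
   have "((%u. F (?y + u *\<^sub>R b)) has_vector_derivative pd b F (?y + (s * ta) *\<^sub>R b)) (at (s * ta))"
    using UW[OF st] unfolding line
    by (intro shifted_line_has_vector_derivative[OF smooth_has_partial[OF Suc.prems b]])
   moreover have "((%s. s * ta) has_vector_derivative ta) (at s)"
    by (auto intro!: derivative_eq_intros simp: has_real_derivative_iff_has_vector_derivative[symmetric])
   ultimately have "((%u. F (?y + u *\<^sub>R b)) \<circ> (%s. s * ta) has_vector_derivative ta *\<^sub>R pd b F (?y + (s * ta) *\<^sub>R b)) (at s)"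
    using vector_diff_chain_at by blast
   hence "((%s. F (nscale N t (x + s *\<^sub>R b))) has_vector_derivative ta *\<^sub>R pd b F (nscale N t (x + s *\<^sub>R b))) (at s within U)"
    unfolding line o_def by (rule has_vector_derivative_at_within)
   from bounded_linear.has_vector_derivative[OF bounded_linear_scaleR_right[of "t ^ j"] this]
   show "((%s. t ^ j *\<^sub>R F (nscale N t (x + s *\<^sub>R b))) has_vector_derivative t ^ ?j *\<^sub>R pd b F (nscale N t (x + s *\<^sub>R b))) (at s within U)"
    by (cases "b \<in> N") (simp_all add: ta_def mult.commute)
  next
   fix s :: real assume s: "s \<in> U"
   show "(%t. t ^ j *\<^sub>R F (nscale N t (x + s *\<^sub>R b))) integrable_on cbox 0 1"
    using UW[OF s]
    by (intro integrable_continuous continuous_intros continuous_on_compose2[OF smooth_continuous[OF Suc.prems]] continuous_on_nscale)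
     auto
  next
   show "continuous_on (U \<times> cbox 0 1) (%(s, t). t ^ ?j *\<^sub>R pd b F (nscale N t (x + s *\<^sub>R b)))"
    unfolding case_prod_unfold using UW
    by (intro continuous_intros continuous_on_compose2[OF smooth_continuous[OF Fb]] continuous_on_nscale)
     auto
  qed
  thus "((%s. integral (cbox 0 1) (%t. t ^ j *\<^sub>R F (nscale N t (x + s *\<^sub>R b)))) has_vector_derivative
    integral (cbox 0 1) (%t. t ^ ?j *\<^sub>R pd b F (nscale N t x))) (at 0)"
   by (simp add: at_within_open[OF U(1,3)])
 qed
qed

text \<open>The path \<open>nscale N t x\<close> leads from the foot of \<open>x\<close> on the
  submanifold, where \<open>F\<close> vanishes, to \<open>x\<close>. The fundamental theorem of
  calculus along it produces the normal coordinates as factors, with the radial integrals of the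
  partial derivatives as cofactors.\<close>

lemma Hadamard:
 fixes F :: "'e::euclidean_space => complex"
 assumes B: "B <= Basis" and N: "N <= B" and W: "span_open B W" and star: "nstar N W"
  and F: "smooth B W F" and zero: "!!x. x \<in> W ==> (!!b. b \<in> N ==> x \<bullet> b = 0) ==> F x = 0"
 shows "nideal B N 1 W F"
proof -
 have NB: "N <= Basis" using B N by auto
 define G where "G b x = integral (cbox 0 1) (%t. t ^ 0 *\<^sub>R pd b F (nscale N t x))" for b x
 have G: "smooth B W (G b)" if "b \<in> N" for b
  unfolding G_def using that N
  by (intro smoothI k_smooth_radial_integral[OF B N W star smooth_partial[OF F]]) auto
 have "F x = (\<Sum>b\<in>N. of_real (x \<bullet> b) * G b x)" if x: "x \<in> W" for x
 proof -
  have inW: "nscale N t x \<in> W" if "t \<in> {0..1}" for t using star x that by (simp add: nstar_def)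
  let ?P = "\<Sum>b\<in>N. (x \<bullet> b) *\<^sub>R b"
  let ?f' = "%t. \<Sum>b\<in>N. (x \<bullet> b) *\<^sub>R pd b F (nscale N t x)"
  have der: "((%t. F (nscale N t x)) has_vector_derivative ?f' t) (at t within {0..1})" if t: "t \<in> {0..1}" for t
  proof -
   have "((%t. nscale N t x) has_derivative (%h. h *\<^sub>R ?P)) (at t within {0..1})"
    unfolding nscale_def by (auto intro!: derivative_eq_intros simp: algebra_simps)
   moreover have "(%t. nscale N t x) ` {0..1} <= span B"
    using inW span_open_subset[OF W] by blast
   hence "(F has_derivative (%v. \<Sum>b\<in>B. (v \<bullet> b) *\<^sub>R pd b F (nscale N t x)))
     (at (nscale N t x) within (%t. nscale N t x) ` {0..1})"
    by (rule has_derivative_subset[OF k_smooth_has_derivative[OF B W smoothD[OF F] inW[OF t]]])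
   ultimately have "(F \<circ> (%t. nscale N t x) has_derivative
     (%v. \<Sum>b\<in>B. (v \<bullet> b) *\<^sub>R pd b F (nscale N t x)) \<circ> (%h. h *\<^sub>R ?P)) (at t within {0..1})"
    by (rule diff_chain_within)
   moreover have "(\<Sum>b\<in>B. (?P \<bullet> b) *\<^sub>R pd b F (nscale N t x)) = ?f' t"
    using finite_Basis_subset[OF B] N
    by (intro sum.mono_neutral_cong_right) (use sum_Basis_inner[OF NB, of _ "%b. x \<bullet> b"] B in auto)
   ultimately show ?thesis unfolding has_vector_derivative_def
    by (simp add: o_def scaleR_sum_right[symmetric] flip: scaleR_scaleR)
  qed
  have 1: "(?f' has_integral (F (nscale N 1 x) - F (nscale N 0 x))) {0..1}"
   by (rule fundamental_theorem_of_calculus[OF _ der]) auto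
  have int: "(%t. pd b F (nscale N t x)) integrable_on cbox 0 1" if "b \<in> N" for b
   by (intro integrable_continuous continuous_on_compose2[OF smooth_continuous[OF smooth_partial[OF F]]] continuous_on_nscale continuous_intros)
    (use inW that N in auto)
  have 2: "(?f' has_integral (\<Sum>b\<in>N. (x \<bullet> b) *\<^sub>R G b x)) (cbox 0 1)"
   by (intro has_integral_sum has_integral_cmul) (use int finite_Basis_subset[OF NB] in \<open>auto simp: G_def\<close>)
  have "F (nscale N 0 x) = 0"
   by (rule zero[OF inW]) (simp_all add: nscale_inner[OF NB] subsetD[OF NB])
  thus ?thesis using has_integral_unique[OF 1] 2 by (simp add: scaleR_conv_of_real)
 qed
 thus ?thesis using G by (auto intro!: exI[of _ G] simp: One_nat_def)
qed

section \<open>Lebesgue measure of a coordinate subspace\<close>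

definition cproj :: "'e::euclidean_space set => 'e => 'e" where
 "cproj B x = (\<Sum>b\<in>B. (x \<bullet> b) *\<^sub>R b)"

text \<open>A strip whose fibres over \<open>span B\<close> are unit cubes. Through it, integrals
  over \<open>span B\<close> become integrals for the Lebesgue measure of the whole space.\<close>

definition cstrip :: "'e::euclidean_space set => 'e set" where
 "cstrip B = {x. ALL b:Basis - B. 0 <= x \<bullet> b & x \<bullet> b <= 1}"

lemma cproj_inner: "B <= Basis ==> c \<in> Basis ==> cproj B x \<bullet> c = (if c \<in> B then x \<bullet> c else 0)"
 unfolding cproj_def by (rule sum_Basis_inner)

lemma cproj_in_span: "cproj B x \<in> span B"
 unfolding cproj_def by (intro span_sum span_scale span_base)

lemma cproj_id: "B <= Basis ==> x \<in> span B ==> cproj B x = x"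
 unfolding cproj_def by (rule span_representation)

lemma linear_cproj: "linear (cproj B)"
 unfolding cproj_def by (intro linearI) (simp_all add: inner_add_left scaleR_add_left sum.distrib scaleR_sum_right)

lemma bounded_linear_cproj: "bounded_linear (cproj B)"
 using linear_cproj by (simp add: linear_conv_bounded_linear)

lemma continuous_cproj: "continuous_on A (cproj B)"
 by (rule linear_continuous_on[OF bounded_linear_cproj])

lemma borel_cproj [measurable]: "cproj B \<in> borel_measurable borel"
 by (rule borel_measurable_continuous_onI[OF continuous_cproj])

lemma borel_cstrip [measurable]: "cstrip B \<in> sets borel"
proof -
 have "cstrip B = (\<Inter>b\<in>Basis - B. {x. 0 <= x \<bullet> b & x \<bullet> b <= 1}) \<inter> UNIV" by (auto simp: cstrip_def)
 moreover have "closed {x::'a. 0 <= x \<bullet> b & x \<bullet> b <= 1}" for b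
  by (intro closed_Collect_conj closed_Collect_le continuous_intros)
 ultimately have "closed (cstrip B)" by auto
 thus ?thesis by simp
qed

text \<open>Fubini for the coordinates in \<open>B\<close> and those outside: the fibres of the
  strip have volume one and disappear.\<close>

lemma coord_lborel_eq:
 assumes "B <= Basis"
 shows "coord_lborel B = distr (density lborel (%x. ennreal (indicator (cstrip B) x))) borel (cproj B)"
proof (rule measure_eqI)
 show "sets (coord_lborel B) = sets (distr (density lborel (%x. ennreal (indicator (cstrip B) x))) borel (cproj B))"
  by (simp add: coord_lborel_def)
 fix A assume "A \<in> sets (coord_lborel B)"
 hence A [measurable]: "A \<in> sets borel" by (simp add: coord_lborel_def)
 interpret P: product_sigma_finite "%_::'a. lborel :: real measure" ..
 define J where "J = Basis - B"
 have fin: "finite B" "finite J" and J: "B \<inter> J = {}" "B \<union> J = Basis"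
  using assms finite_Basis_subset by (auto simp: J_def)
 have m [measurable]: "(%f. \<Sum>b\<in>F. f b *\<^sub>R b) \<in> (\<Pi>\<^sub>M b\<in>F. (lborel :: real measure)) \<rightarrow>\<^sub>M borel" for F :: "'a set"
  by measurable
 have mB: "(%f. (\<Prod>b\<in>J. indicator {0..1} (f b)) * indicator A (\<Sum>b\<in>B. f b *\<^sub>R b) :: ennreal)
   \<in> borel_measurable (\<Pi>\<^sub>M b\<in>B \<union> J. (lborel :: real measure))"
  by measurable
 have "emeasure (distr (density lborel (%x. ennreal (indicator (cstrip B) x))) borel (cproj B)) A
   = (\<integral>\<^sup>+x. ennreal (indicator (cstrip B) x) * indicator A (cproj B x) \<partial>lborel)"
  by (subst emeasure_distr, simp, simp, subst emeasure_density)
   (auto intro!: nn_integral_cong simp: vimage_def indicator_def)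
 also have "... = (\<integral>\<^sup>+f. ennreal (indicator (cstrip B) (\<Sum>b\<in>Basis. f b *\<^sub>R b)) *
    indicator A (cproj B (\<Sum>b\<in>Basis. f b *\<^sub>R b)) \<partial>(\<Pi>\<^sub>M b\<in>Basis. lborel))"
  by (subst lborel_eq[where 'a = 'a], subst nn_integral_distr) simp_all
 also have "... = (\<integral>\<^sup>+f. (\<Prod>b\<in>J. indicator {0..1} (f b)) * indicator A (\<Sum>b\<in>B. f b *\<^sub>R b) \<partial>(\<Pi>\<^sub>M b\<in>B \<union> J. lborel))"
  unfolding J(2)
 proof (intro nn_integral_cong)
  fix f :: "'a => real"
  have i: "(\<Sum>b\<in>Basis. f b *\<^sub>R b) \<bullet> c = f c" if "c \<in> Basis" for c
   using sum_Basis_inner[of Basis c f] that by simp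
  have "cproj B (\<Sum>b\<in>Basis. f b *\<^sub>R b) = (\<Sum>b\<in>B. f b *\<^sub>R b)"
   unfolding cproj_def using assms by (intro sum.cong) (auto simp: i)
  moreover have "ennreal (indicator (cstrip B) (\<Sum>b\<in>Basis. f b *\<^sub>R b)) = (\<Prod>b\<in>J. indicator {0..1} (f b))"
   using fin(2) by (auto simp: cstrip_def J_def i indicator_def split: if_splits)
  ultimately show "ennreal (indicator (cstrip B) (\<Sum>b\<in>Basis. f b *\<^sub>R b)) * indicator A (cproj B (\<Sum>b\<in>Basis. f b *\<^sub>R b)) =
    (\<Prod>b\<in>J. indicator {0..1} (f b)) * indicator A (\<Sum>b\<in>B. f b *\<^sub>R b)" by simp
 qed
 also have "... = (\<integral>\<^sup>+x. \<integral>\<^sup>+y. (\<Prod>b\<in>J. indicator {0..1} (y b)) * indicator A (\<Sum>b\<in>B. x b *\<^sub>R b)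
   \<partial>(\<Pi>\<^sub>M b\<in>J. (lborel :: real measure)) \<partial>(\<Pi>\<^sub>M b\<in>B. lborel))"
 proof (subst P.product_nn_integral_fold[OF J(1) fin mB], intro nn_integral_cong)
  fix x y :: "'a => real"
  have "(\<Prod>b\<in>J. indicator {0..1} (merge B J (x, y) b) :: ennreal) = (\<Prod>b\<in>J. indicator {0..1} (y b))"
   by (intro prod.cong) (use J(1) in \<open>auto simp: merge_def\<close>)
  moreover have "(\<Sum>b\<in>B. merge B J (x, y) b *\<^sub>R b) = (\<Sum>b\<in>B. x b *\<^sub>R b)"
   by (intro sum.cong) (auto simp: merge_def)
  ultimately show "(\<Prod>b\<in>J. indicator {0..1} (merge B J (x, y) b) :: ennreal) * indicator A (\<Sum>b\<in>B. merge B J (x, y) b *\<^sub>R b) =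
    (\<Prod>b\<in>J. indicator {0..1} (y b)) * indicator A (\<Sum>b\<in>B. x b *\<^sub>R b)" by simp
 qed
 also have "... = (\<integral>\<^sup>+x. indicator A (\<Sum>b\<in>B. x b *\<^sub>R b) \<partial>(\<Pi>\<^sub>M b\<in>B. lborel))"
 proof (intro nn_integral_cong)
  fix x :: "'a => real"
  have "(\<integral>\<^sup>+y. (\<Prod>b\<in>J. indicator {0..1} (y b)) \<partial>(\<Pi>\<^sub>M b\<in>J. (lborel :: real measure))) = 1"
   by (subst P.product_nn_integral_prod[OF fin(2)]) auto
  thus "(\<integral>\<^sup>+y. (\<Prod>b\<in>J. indicator {0..1} (y b)) * indicator A (\<Sum>b\<in>B. x b *\<^sub>R b) \<partial>(\<Pi>\<^sub>M b\<in>J. (lborel :: real measure))) =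
   indicator A (\<Sum>b\<in>B. x b *\<^sub>R b)"
   by (subst nn_integral_multc) auto
 qed
 also have "... = emeasure (coord_lborel B) A"
  unfolding coord_lborel_def
  by (subst nn_integral_indicator[symmetric], simp, subst nn_integral_distr) simp_all
 finally show "emeasure (coord_lborel B) A = emeasure (distr (density lborel (%x. ennreal (indicator (cstrip B) x))) borel (cproj B)) A" ..
qed

lemma sets_coord [simp, measurable_cong]: "sets (coord_lborel B) = sets borel"
 by (simp add: coord_lborel_def)

lemma space_coord [simp]: "space (coord_lborel B) = UNIV"
 by (simp add: coord_lborel_def)

lemma integrable_coord:
 fixes g :: "'e::euclidean_space => 'f::{banach, second_countable_topology}"
 assumes "B <= Basis" and [measurable]: "g \<in> borel_measurable borel"
 shows "integrable (coord_lborel B) g \<longleftrightarrow> integrable lborel (%x. indicat_real (cstrip B) x *\<^sub>R g (cproj B x))"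
 unfolding coord_lborel_eq[OF assms(1)]
 by (subst integrable_distr_eq, simp, simp, subst integrable_density) auto

lemma integral_coord:
 fixes g :: "'e::euclidean_space => 'f::{banach, second_countable_topology}"
 assumes "B <= Basis" and [measurable]: "g \<in> borel_measurable borel"
 shows "integral\<^sup>L (coord_lborel B) g = (LINT x|lborel. indicat_real (cstrip B) x *\<^sub>R g (cproj B x))"
 unfolding coord_lborel_eq[OF assms(1)]
 by (subst integral_distr, simp, simp, subst integral_density) auto

lemma emeasure_coord_bounded:
 assumes "B <= Basis" "bounded A" "A \<in> sets borel"
 shows "emeasure (coord_lborel B) A < \<infinity>"
proof -
 obtain R where R: "!!x. x \<in> A ==> norm x <= R" using assms(2) unfolding bounded_iff by blast
 let ?S = "{x \<in> cstrip B. cproj B x \<in> A}"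
 have "bounded ?S"
 proof (rule boundedI)
  fix x assume x: "x \<in> ?S"
  have "norm x <= (\<Sum>b\<in>Basis. \<bar>x \<bullet> b\<bar>)" by (rule norm_le_l1)
  also have "... <= (\<Sum>b\<in>(Basis :: 'a set). R + 1)"
  proof (rule sum_mono)
   fix b :: 'a assume b: "b \<in> Basis"
   have "\<bar>cproj B x \<bullet> b\<bar> <= R" "0 <= R"
    using Basis_le_norm[OF b, of "cproj B x"] R[of "cproj B x"] x norm_ge_zero[of "cproj B x"] by auto
   moreover have "0 <= x \<bullet> b & x \<bullet> b <= 1" if "b ~: B" using x b that by (auto simp: cstrip_def)
   ultimately show "\<bar>x \<bullet> b\<bar> <= R + 1"
    by (cases "b \<in> B") (auto simp: cproj_inner[OF assms(1) b])
  qed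
  finally show "norm x <= (\<Sum>b\<in>(Basis :: 'a set). R + 1)" .
 qed
 have vm: "cproj B -` A \<in> sets borel" using measurable_sets[OF borel_cproj assms(3)] by simp
 have "emeasure (coord_lborel B) A = (\<integral>\<^sup>+x. indicator ?S x \<partial>lborel)"
  unfolding coord_lborel_eq[OF assms(1)]
  by (subst emeasure_distr, simp, simp add: assms(3), subst emeasure_density, simp, simp add: vm,
   rule nn_integral_cong, simp add: indicator_def)
 also have "... = emeasure lborel ?S"
  using vm borel_cstrip[of B] by (subst nn_integral_indicator) (auto simp: vimage_def Collect_conj_eq)
 finally show ?thesis using emeasure_bounded_finite[OF \<open>bounded ?S\<close>] by simp
qed

lemma sigma_finite_coord: "B <= Basis ==> sigma_finite_measure (coord_lborel B)"
proof
 assume B: "B <= Basis"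
 show "EX A. countable A & A <= sets (coord_lborel B) & \<Union> A = space (coord_lborel B) & (ALL a:A. emeasure (coord_lborel B) a ~= \<infinity>)"
 proof (intro exI[of _ "range (%n::nat. cball 0 (real n))"] conjI ballI)
  show "\<Union> (range (%n::nat. cball (0::'a) (real n))) = space (coord_lborel B)"
   using real_arch_simple by auto
  fix a assume "a \<in> range (%n::nat. cball (0::'a) (real n))"
  thus "emeasure (coord_lborel B) a ~= \<infinity>" using emeasure_coord_bounded[OF B, of a] by auto
 qed auto
qed

lemma set_integrable_coord_bounded:
 fixes f :: "'e::euclidean_space => complex"
 assumes "B <= Basis" "bounded K" "K \<in> sets borel" "(%x. indicat_real K x *\<^sub>R f x) \<in> borel_measurable borel"
  "!!x. x \<in> K ==> norm (f x) <= R"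
 shows "set_integrable (coord_lborel B) K f"
 unfolding set_integrable_def
proof (rule integrableI_bounded_set[where A = K and B = R])
 show "AE x in coord_lborel B. x \<in> K --> norm (indicat_real K x *\<^sub>R f x) <= R"
  using assms(5) by auto
qed (use assms emeasure_coord_bounded[OF assms(1-3)] in \<open>auto simp: measurable_completion\<close>)

lemma set_integrable_coord_continuous:
 fixes f :: "'e::euclidean_space => complex"
 assumes "B <= Basis" "compact K" "continuous_on K f"
 shows "set_integrable (coord_lborel B) K f"
proof -
 have "bounded (f ` K)" using compact_continuous_image[OF assms(3,2)] compact_imp_bounded by blast
 then obtain R where "!!x. x \<in> K ==> norm (f x) <= R" unfolding bounded_iff by blast
 moreover have K: "K \<in> sets borel" using assms(2) by (simp add: compact_imp_closed)
 moreover have "(%x. indicat_real K x *\<^sub>R f x) \<in> borel_measurable borel"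
  by (rule borel_measurable_continuous_on_indicator[OF K assms(3)])
 ultimately show ?thesis
  using set_integrable_coord_bounded[OF assms(1) compact_imp_bounded[OF assms(2)] K] by blast
qed

lemma span_open_borel: "span_open B W ==> W \<in> sets borel"
 unfolding openin_open using closed_span[of B] by auto

text \<open>A nonempty relatively open set has positive measure, so the open set where
  \<open>g\<close> is nonzero must be empty.\<close>

lemma coord_zero_integral:
 fixes g :: "'e::euclidean_space => real"
 assumes B: "B <= Basis" and W: "span_open B W" and cont: "continuous_on W g"
  and nonneg: "!!x. x \<in> W ==> 0 <= g x" and int: "set_integrable (coord_lborel B) W g"
  and zero: "(LINT x:W|coord_lborel B. g x) = 0" and x: "x \<in> W"
 shows "g x = 0"
proof (rule ccontr)
 assume "g x ~= 0"
 define V where "V = W \<inter> g -` (- {0})"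
 have V: "span_open B V" unfolding V_def
  by (rule openin_trans[OF continuous_openin_preimage_gen[OF cont] W]) auto
 have "x \<in> V" using x \<open>g x ~= 0\<close> by (simp add: V_def)
 have "AE y in coord_lborel B. indicat_real W y *\<^sub>R g y = 0"
  using integral_nonneg_eq_0_iff_AE[OF int[unfolded set_integrable_def]] zero nonneg
  by (simp add: set_lebesgue_integral_def indicator_def)
 hence "AE y in coord_lborel B. y ~: V" by eventually_elim (auto simp: V_def)
 hence AEV: "AE y in lborel. indicat_real (cstrip B) y = 1 --> cproj B y ~: V"
  unfolding coord_lborel_eq[OF B] using span_open_borel[OF V]
  by (subst (asm) AE_distr_iff, simp, simp) (auto simp: AE_density indicator_def)
 obtain T where T: "open T" "V = span B \<inter> T" using V unfolding openin_open by auto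
 \<comment> \<open>Adding open unit intervals in the complementary directions turns the null set
   \<open>V\<close> into an open null set of the whole space.\<close>
 define Q where "Q = {y. cproj B y \<in> T} \<inter> (\<Inter>b\<in>Basis - B. {y. 0 < y \<bullet> b & y \<bullet> b < 1})"
 have "open {y. cproj B y \<in> T}"
  using open_vimage[OF T(1) continuous_cproj] by (simp add: vimage_def)
 moreover have "open {y::'e. 0 < y \<bullet> b & y \<bullet> b < 1}" for b
  by (intro open_Collect_conj open_Collect_less continuous_intros)
 ultimately have "open Q" unfolding Q_def by (intro open_Int open_INT) auto
 have "cproj B y \<in> V" "y \<in> cstrip B" if "y \<in> Q" for y
  using that T cproj_in_span[of B y] by (auto simp: Q_def cstrip_def less_imp_le)
 hence QV: "!!y. y \<in> Q ==> cproj B y \<in> V & y \<in> cstrip B" by blast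
 from AEV have "AE y in lborel. y ~: Q" by eventually_elim (use QV in \<open>auto simp: indicator_def\<close>)
 hence "emeasure lborel Q = 0"
  using \<open>open Q\<close> AE_iff_measurable[of Q lborel "%y. y ~: Q"] by auto
 hence "negligible Q" using \<open>open Q\<close> by (simp add: negligible_iff_null_sets null_sets_def)
 hence "Q = {}" using \<open>open Q\<close> open_not_negligible by blast
 moreover have "x + (\<Sum>b\<in>Basis - B. (1/2) *\<^sub>R b) \<in> Q" (is "?y \<in> Q")
 proof -
  have xs: "x \<in> span B" using \<open>x \<in> V\<close> span_open_subset[OF V] by blast
  have i: "?y \<bullet> b = (if b \<in> B then x \<bullet> b else 1/2)" if b: "b \<in> Basis" for b
   using sum_Basis_inner[of "Basis - B" b "%_. 1/2"] span_Basis_eq[OF B, of x] xs b by (auto simp: inner_add_left)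
  have "cproj B ?y = x" by (rule euclidean_eqI)
   (use span_Basis_eq[OF B, of x] xs in \<open>auto simp: cproj_inner[OF B] i\<close>)
  thus ?thesis using i \<open>x \<in> V\<close> T by (auto simp: Q_def)
 qed
 ultimately show False by simp
qed

section \<open>Translation invariance and integration by parts\<close>

lemma integral_coord_shift:
 fixes v :: "'e::euclidean_space => complex"
 assumes B: "B <= Basis" and b: "b \<in> B" and [measurable]: "v \<in> borel_measurable borel"
 shows "integral\<^sup>L (coord_lborel B) (%x. v (x + t *\<^sub>R b)) = integral\<^sup>L (coord_lborel B) v"
proof -
 have bB: "b \<in> Basis" using B b by auto
 have st: "t *\<^sub>R b + x \<in> cstrip B \<longleftrightarrow> x \<in> cstrip B" for x
  using b bB by (auto simp: cstrip_def inner_add_left inner_Basis)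
 have "cproj B b = b" by (rule cproj_id[OF B span_base[OF b]])
 hence pr: "cproj B (t *\<^sub>R b + x) = cproj B x + t *\<^sub>R b" for x
  using linear_cproj[of B] by (simp add: linear_add linear_scale)
 have "integral\<^sup>L (coord_lborel B) v = (LINT x|distr lborel borel ((+) (t *\<^sub>R b)). indicat_real (cstrip B) x *\<^sub>R v (cproj B x))"
  by (simp add: integral_coord[OF B] lborel_distr_plus)
 also have "... = (LINT x|lborel. indicat_real (cstrip B) (t *\<^sub>R b + x) *\<^sub>R v (cproj B (t *\<^sub>R b + x)))"
  by (subst integral_distr) auto
 also have "... = integral\<^sup>L (coord_lborel B) (%x. v (x + t *\<^sub>R b))"
  by (subst integral_coord[OF B]) (auto simp: pr st indicator_def)
 finally show ?thesis ..
qed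

lemma has_vector_derivative_quotient:
 assumes "(f has_vector_derivative D) (at 0)"
 shows "((%t. (f t - f 0) /\<^sub>R t) \<longlongrightarrow> D) (at 0)"
proof -
 have "((%h. norm (f h - f 0 - h *\<^sub>R D) / norm h) \<longlongrightarrow> 0) (at 0)"
  using assms unfolding has_vector_derivative_def has_derivative_at by simp
 moreover have "norm (f h - f 0 - h *\<^sub>R D) / norm h = norm ((f h - f 0) /\<^sub>R h - D)" if "h ~= 0" for h
 proof -
  have "(f h - f 0) /\<^sub>R h - D = (f h - f 0 - h *\<^sub>R D) /\<^sub>R h" using that by (simp add: scaleR_diff_right)
  thus ?thesis by (simp add: divide_inverse_commute)
 qed
 hence "\<forall>\<^sub>F h in at 0. norm (f h - f 0 - h *\<^sub>R D) / norm h = norm ((f h - f 0) /\<^sub>R h - D)"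
  by (simp add: eventually_at_filter)
 ultimately have "((%h. norm ((f h - f 0) /\<^sub>R h - D)) \<longlongrightarrow> 0) (at 0)"
  by (rule Lim_transform_eventually)
 thus ?thesis by (simp only: tendsto_norm_zero_iff LIM_zero_iff)
qed

text \<open>Difference quotients have integral zero by translation invariance, and they converge to
  the derivative under a common integrable bound.\<close>

lemma integral_partial_zero:
 fixes v :: "'e::euclidean_space => complex"
 assumes B: "B <= Basis" and b: "b \<in> B" and v: "smooth B (span B) v"
  and K: "compact K" "!!x. x \<in> span B - K ==> v x = 0"
 shows "(LINT x:span B|coord_lborel B. pd b v x) = 0"
proof -
 have nb: "norm b = 1" using B b by auto
 have sp: "span_open B (span B)" by simp
 have sb [measurable]: "span B \<in> sets borel" by (rule span_open_borel[OF sp])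
 let ?D = "pd b v"
 have D0: "?D x = 0" if "x \<in> span B - K" for x
 proof -
  have "span_open B (span B - K)"
   using compact_imp_closed[OF K(1)] by (auto simp: openin_open intro!: exI[of _ "- K"])
  hence "?D x = pd b (%_. 0) x" by (rule partial_deriv_cong[OF _ b that]) (rule K(2))
  thus ?thesis by (simp add: partial_const)
 qed
 have contD: "continuous_on (span B) ?D" by (rule smooth_continuous[OF smooth_partial[OF v b]])
 have "compact (K \<inter> span B)" using K(1) closed_span compact_Int_closed by blast
 hence "bounded (?D ` (K \<inter> span B))"
  by (intro compact_imp_bounded compact_continuous_image continuous_on_subset[OF contD]) auto
 then obtain M0 where M0: "!!x. x \<in> K \<inter> span B ==> norm (?D x) <= M0" unfolding bounded_iff by blast
 define M where "M = max M0 0"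
 have M: "norm (?D x) <= M" if "x \<in> span B" for x
  using M0[of x] D0[of x] that by (cases "x \<in> K") (auto simp: M_def)
 obtain R where R: "!!x. x \<in> K ==> norm x <= R" using compact_imp_bounded[OF K(1)] unfolding bounded_iff by blast
 define w where "w x = indicat_real (span B) x *\<^sub>R v x" for x
 have [measurable]: "w \<in> borel_measurable borel"
  unfolding w_def by (rule borel_measurable_continuous_on_indicator[OF sb smooth_continuous[OF v]])
 have winB: "x + t *\<^sub>R b \<in> span B \<longleftrightarrow> x \<in> span B" for x t
  using span_add_eq2[of "t *\<^sub>R b" B x] span_scale[OF span_base[OF b]] by simp
 define q where "q n x = (w (x + (1 / real (Suc n)) *\<^sub>R b) - w x) * of_nat (Suc n)" for n x
 have wint: "integrable (coord_lborel B) w"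
 proof -
  have "w = (%x. indicat_real (K \<inter> span B) x *\<^sub>R v x)"
   using K(2) by (auto simp: w_def indicator_def fun_eq_iff)
  thus ?thesis
   using set_integrable_coord_continuous[OF B \<open>compact (K \<inter> span B)\<close> continuous_on_subset[OF smooth_continuous[OF v]]]
   by (simp add: set_integrable_def)
 qed
 have shift: "integrable (coord_lborel B) (%x. w (x + t *\<^sub>R b))" for t
 proof -
  let ?K = "(%x. x - t *\<^sub>R b) ` (K \<inter> span B)"
  have "compact ?K" by (intro compact_continuous_image continuous_intros) fact
  have sub: "?K <= span B" using span_diff span_scale[OF span_base[OF b]] by blast
  have "continuous_on ?K (%x. v (x + t *\<^sub>R b))"
   by (rule continuous_on_compose2[OF smooth_continuous[OF v]]) (auto intro!: continuous_intros)
  from set_integrable_coord_continuous[OF B \<open>compact ?K\<close> this]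
  show ?thesis unfolding set_integrable_def
  proof (rule back_subst[of "integrable (coord_lborel B)"], intro ext)
   fix x show "indicat_real ?K x *\<^sub>R v (x + t *\<^sub>R b) = w (x + t *\<^sub>R b)"
   proof (cases "x \<in> span B & x ~: ?K")
    case True
    hence "x + t *\<^sub>R b \<in> span B - K" using winB[of x t] by (force simp: image_iff)
    thus ?thesis using K(2) True by (simp add: w_def)
   next
    case False
    thus ?thesis using sub winB[of x t] by (auto simp: w_def indicator_def)
   qed
  qed
 qed
 have qint: "integral\<^sup>L (coord_lborel B) (q n) = 0" for n
  unfolding q_def using shift wint integral_coord_shift[OF B b, of w] by simp
 let ?d = "%x. indicat_real (span B) x *\<^sub>R ?D x"
 have "(%n. integral\<^sup>L (coord_lborel B) (q n)) \<longlonglongrightarrow> integral\<^sup>L (coord_lborel B) ?d"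
 \<comment> \<open>Every step \<open>1 / Suc n\<close> has length at most one, so the quotients are
   supported in the ball of radius \<open>R + 1\<close>; \<open>M\<close> bounds them by the mean
   value inequality.\<close>
 proof (rule integral_dominated_convergence[where w = "%x. M * indicat_real (cball 0 (R + 1)) x"])
  show "?d \<in> borel_measurable (coord_lborel B)"
   using borel_measurable_continuous_on_indicator[OF sb contD] by simp
  show "q n \<in> borel_measurable (coord_lborel B)" for n unfolding q_def by simp
  show "integrable (coord_lborel B) (%x. M * indicat_real (cball 0 (R + 1)) x)"
   using emeasure_coord_bounded[OF B, of "cball 0 (R + 1)"] by (intro integrable_mult_right integrable_real_indicator) auto
  show "AE x in coord_lborel B. (%n. q n x) \<longlonglongrightarrow> ?d x"
  proof (rule AE_I2)
   fix x
   show "(%n. q n x) \<longlonglongrightarrow> ?d x"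
   proof (cases "x \<in> span B")
    case True
    have "((%t. (v (x + t *\<^sub>R b) - v (x + 0 *\<^sub>R b)) /\<^sub>R (t - 0)) \<longlongrightarrow> ?D x) (at 0)"
     using has_vector_derivative_quotient[OF smooth_has_partial[OF v b True]] by simp
    moreover have "filterlim (%n. 1 / real (Suc n)) (at 0) sequentially"
     unfolding filterlim_at using lim_1_over_n[where 'a = real] LIMSEQ_inverse_real_of_nat by (auto simp: inverse_eq_divide)
    ultimately have "(%n. (v (x + (1 / real (Suc n)) *\<^sub>R b) - v (x + 0 *\<^sub>R b)) /\<^sub>R (1 / real (Suc n) - 0)) \<longlonglongrightarrow> ?D x"
     by (rule filterlim_compose)
    thus ?thesis using True winB by (simp add: q_def w_def scaleR_conv_of_real mult.commute del: of_nat_Suc)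
   next
    case False
    thus ?thesis using winB by (simp add: q_def w_def)
   qed
  qed
  show "AE x in coord_lborel B. norm (q n x) <= M * indicat_real (cball 0 (R + 1)) x" for n
  proof (rule AE_I2)
   fix x
   let ?t = "1 / real (Suc n)"
   show "norm (q n x) <= M * indicat_real (cball 0 (R + 1)) x"
   proof (cases "x \<in> span B & (x \<in> K | x + ?t *\<^sub>R b \<in> K)")
    case True
    have "norm x <= norm (x + ?t *\<^sub>R b) + norm (?t *\<^sub>R b)" using norm_triangle_ineq4[of "x + ?t *\<^sub>R b" "?t *\<^sub>R b"] by simp
    moreover have "norm (?t *\<^sub>R b) <= 1" by (simp add: nb divide_le_eq_1)
    ultimately have "norm x <= norm (x + ?t *\<^sub>R b) + 1" by linarith
    hence xb: "norm x <= R + 1" using True R[of x] R[of "x + ?t *\<^sub>R b"] by auto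
    have "norm (v (x + ?t *\<^sub>R b) - v (x + 0 *\<^sub>R b)) <= M * \<bar>?t\<bar>"
     by (rule vector_derivative_bound[where f' = "%t. ?D (x + t *\<^sub>R b)"])
      (use True winB in \<open>auto intro!: shifted_line_has_vector_derivative[OF smooth_has_partial[OF v b]] M\<close>)
    hence "norm (w (x + ?t *\<^sub>R b) - w x) * real (Suc n) <= M"
     using True winB by (simp add: w_def field_simps del: of_nat_Suc)
    thus ?thesis using xb by (simp add: q_def norm_mult del: of_nat_Suc)
   next
    case False
    hence "w x = 0" "w (x + ?t *\<^sub>R b) = 0" using K(2) winB by (auto simp: w_def indicator_def)
    thus ?thesis by (simp add: q_def M_def)
   qed
  qed
 qed
 hence "integral\<^sup>L (coord_lborel B) ?d = 0" unfolding qint by (simp add: LIMSEQ_const_iff)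
 thus ?thesis by (simp add: set_lebesgue_integral_def)
qed

lemma set_integrable_coord_support:
 fixes f :: "'e::euclidean_space => complex"
 assumes "B <= Basis" "compact K" "K <= W" "continuous_on W f" "!!x. x \<in> W - K ==> f x = 0"
 shows "set_integrable (coord_lborel B) W f"
proof -
 have "(%x. indicat_real W x *\<^sub>R f x) = (%x. indicat_real K x *\<^sub>R f x)"
  using assms(3,5) by (auto simp: fun_eq_iff indicator_def)
 thus ?thesis
  using set_integrable_coord_continuous[OF assms(1,2) continuous_on_subset[OF assms(4,3)]]
  by (simp add: set_integrable_def)
qed

lemma span_open_Diff_compact:
 assumes "span_open B W" "compact K"
 shows "span_open B (W - K)"
proof -
 obtain T where T: "open T" "W = span B \<inter> T" using assms(1) unfolding openin_open by auto
 have "W - K = span B \<inter> (T - K)" using T(2) by auto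
 moreover have "open (T - K)" using T(1) compact_imp_closed[OF assms(2)] by (rule open_Diff)
 ultimately show ?thesis unfolding openin_open by blast
qed

lemma partial_zero_off:
 assumes "span_open B W" "compact K" "b \<in> B" "!!x. x \<in> W - K ==> u x = 0" "x \<in> W - K"
 shows "pd b u x = 0"
proof -
 have "span_open B (W - K)" by (rule span_open_Diff_compact[OF assms(1,2)])
 thus ?thesis
  using partial_deriv_cong[OF _ assms(3,5), of u "%_. 0"] assms(4) by (simp add: partial_const)
qed

lemma smooth_extend_zero:
 fixes u :: "'e::euclidean_space => 'f::real_normed_vector"
 assumes "span_open B W" "compact K" "K <= W" "smooth B W u" "!!x. x \<in> W - K ==> u x = 0"
 shows "smooth B (span B) (%x. if x \<in> W then u x else 0)"
proof (rule smooth_local)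
 fix x assume x: "x \<in> span B"
 show "EX W'. x \<in> W' & span_open B W' & smooth B W' (%x. if x \<in> W then u x else 0)"
 proof (cases "x \<in> W")
  case True
  have "smooth B W (%x. if x \<in> W then u x else 0) \<longleftrightarrow> smooth B W u"
   by (rule smooth_cong[OF assms(1)]) simp
  thus ?thesis using assms(1,4) True by (intro exI[of _ W] conjI) simp_all
 next
  case False
  have o: "span_open B (span B - K)" using span_open_Diff_compact[OF _ assms(2)] by simp
  have "smooth B (span B - K) (%x. if x \<in> W then u x else 0) \<longleftrightarrow> smooth B (span B - K) (%x. 0 :: 'f)"
   by (rule smooth_cong[OF o]) (use assms(5) in simp)
  hence "smooth B (span B - K) (%x. if x \<in> W then u x else 0)" using smooth_const[OF o] by simp
  moreover have "x \<in> span B - K" using x False assms(3) by blast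
  ultimately show ?thesis using o by (intro exI[of _ "span B - K"] conjI)
 qed
qed simp

text \<open>Although \<open>g\<close> lives only on \<open>W\<close>, the product with
  \<open>u\<close> extends smoothly by zero because \<open>u\<close> vanishes off a compact subset
  of \<open>W\<close>.\<close>

lemma coord_by_parts:
 fixes g u :: "'e::euclidean_space => complex"
 assumes B: "B <= Basis" and W: "span_open B W" and K: "compact K" "K <= W" and b: "b \<in> B"
  and g: "smooth B W g" and u: "smooth B W u" "!!x. x \<in> W - K ==> u x = 0"
 shows "(LINT x:W|coord_lborel B. pd b g x * u x) = - (LINT x:W|coord_lborel B. g x * pd b u x)"
proof -
 define v where "v x = (if x \<in> W then g x * u x else 0)" for x
 have v: "smooth B (span B) v"
  unfolding v_def by (rule smooth_extend_zero[OF W K smooth_mult[OF W g u(1)]]) (simp add: u(2))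
 have v0: "v x = 0" if "x \<in> span B - K" for x using u(2) that by (auto simp: v_def)
 have dv: "pd b v x = g x * pd b u x + pd b g x * u x" if "x \<in> W" for x
  using partial_deriv_cong[OF W b that, of v "%x. g x * u x"] partial_mult[OF g u(1) b that] by (simp add: v_def)
 have dv0: "pd b v x = 0" if "x \<in> span B - K" for x
  by (rule partial_zero_off[OF _ K(1) b v0 that]) simp_all
 have 0: "0 = (LINT x:span B|coord_lborel B. pd b v x)"
  by (rule integral_partial_zero[OF B b v K(1) v0, symmetric])
 also have "... = (LINT x:W|coord_lborel B. g x * pd b u x + pd b g x * u x)"
  unfolding set_lebesgue_integral_def
  using dv dv0 K(2) span_open_subset[OF W] by (intro Bochner_Integration.integral_cong) (auto simp: indicator_def)
 also have "... = (LINT x:W|coord_lborel B. g x * pd b u x) + (LINT x:W|coord_lborel B. pd b g x * u x)"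
  using partial_zero_off[OF W K(1) b u(2)]
  by (intro set_integral_add(2) set_integrable_coord_support[OF B K] smooth_continuous[OF smooth_mult[OF W]] g u smooth_partial b)
   (auto simp: u(2))
 finally show ?thesis by (simp add: eq_neg_iff_add_eq_0 add.commute)
qed

lemma coord_iter_parts:
 fixes g u :: "'e::euclidean_space => complex"
 assumes B: "B <= Basis" and W: "span_open B W" and K: "compact K" "K <= W" and bs: "set bs <= B"
  and g: "smooth B W g" and u: "smooth B W u" "!!x. x \<in> W - K ==> u x = 0"
 shows "(LINT x:W|coord_lborel B. ipd bs g x * u x) =
  (-1) ^ length bs * (LINT x:W|coord_lborel B. g x * ipd (rev bs) u x)"
 using bs u
proof (induction bs arbitrary: u)
 case (Cons b bs)
 have b: "b \<in> B" "set bs <= B" using Cons.prems by auto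
 have "(LINT x:W|coord_lborel B. ipd (b # bs) g x * u x) =
   - (LINT x:W|coord_lborel B. ipd bs g x * pd b u x)"
  using coord_by_parts[OF B W K b(1) smooth_iter_partial[OF g b(2)] Cons.prems(2,3)] by simp
 also have "(LINT x:W|coord_lborel B. ipd bs g x * pd b u x) =
  (-1) ^ length bs * (LINT x:W|coord_lborel B. g x * ipd (rev bs) (pd b u) x)"
  by (rule Cons.IH[OF b(2) smooth_partial[OF Cons.prems(2) b(1)] partial_zero_off[OF W K(1) b(1) Cons.prems(3)]])
 finally show ?case by (simp add: iter_partial_append)
qed simp

subsection \<open>A bump function\<close>

text \<open>The functions exp(-1/t) t^(-j), extended by zero. The derivative of each is a
  combination of two others, so the whole family in \<open>j\<close> makes smoothness at zero a
  plain induction.\<close>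

definition flat :: "nat => real => real" where
 "flat j t = (if t > 0 then exp (- inverse t) * inverse t ^ j else 0)"

text \<open>A single term of the exponential series of 1/t. Its degree \<open>j + 2\<close> leaves a
  factor \<open>t ^ 2\<close>, just enough for the difference quotient at zero to tend to
  zero.\<close>

lemma flat_bound: "0 < t ==> flat j t <= fact (j + 2) * t ^ 2"
proof -
 assume t: "0 < t"
 let ?y = "inverse t"
 have y: "?y > 0" using t by simp
 have "(\<Sum>n\<in>{j + 2}. ?y ^ n /\<^sub>R fact n) <= (\<Sum>n. ?y ^ n /\<^sub>R fact n)"
  by (rule sum_le_suminf) (use y summable_exp[of ?y] in \<open>auto simp: summable_exp_generic\<close>)
 hence "?y ^ (j + 2) / fact (j + 2) <= exp ?y" by (simp add: exp_def divide_inverse mult.commute)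
 hence "?y ^ (j + 2) <= fact (j + 2) * exp ?y" by (simp add: divide_le_eq mult.commute)
 hence "?y ^ j * ?y ^ 2 <= fact (j + 2) * exp ?y" by (simp only: power_add)
 hence "exp (- ?y) * (?y ^ j * ?y ^ 2) <= exp (- ?y) * (fact (j + 2) * exp ?y)"
  by (rule mult_left_mono) simp
 also have "... = fact (j + 2) * (exp (- ?y) * exp ?y)" by (simp only: ac_simps)
 also have "exp (- ?y) * exp ?y = 1" by (simp flip: exp_add)
 finally have "exp (- ?y) * (?y ^ j * ?y ^ 2) * t ^ 2 <= fact (j + 2) * t ^ 2"
  using t by (simp add: mult_right_mono)
 moreover have "exp (- ?y) * (?y ^ j * ?y ^ 2) * t ^ 2 = flat j t"
  using t by (simp add: flat_def power_inverse field_simps)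
 ultimately show ?thesis by simp
qed

lemma flat_derivative: "(flat j has_real_derivative flat (j + 2) t - real j * flat (j + 1) t) (at t)"
proof -
 consider "t > 0" | "t < 0" | "t = 0" by linarith
 thus ?thesis
 proof cases
  case 1
  have d1: "((%t. inverse t) has_real_derivative - (inverse t ^ Suc (Suc 0))) (at t)"
   using DERIV_inverse[of t UNIV] 1 by simp
  have "((%t. exp (- inverse t) * inverse t ^ j) has_real_derivative flat (j + 2) t - real j * flat (j + 1) t) (at t)"
   by (rule DERIV_cong[OF DERIV_mult[OF DERIV_chain2[OF DERIV_exp DERIV_minus[OF d1]] DERIV_power[OF d1, of j]]])
    (use 1 in \<open>cases j; simp add: flat_def algebra_simps\<close>)
  thus ?thesis
   by (rule has_field_derivative_transform_within_open[of _ _ _ "{0<..}"]) (use 1 in \<open>auto simp: flat_def\<close>)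
 next
  case 2
  have "((%_. 0) has_real_derivative 0) (at t)" by simp
  hence "(flat j has_real_derivative 0) (at t)"
   by (rule has_field_derivative_transform_within_open[of _ _ _ "{..<0}"]) (use 2 in \<open>auto simp: flat_def\<close>)
  thus ?thesis using 2 by (simp add: flat_def)
 next
  case 3
  have "((%h. (flat j (0 + h) - flat j 0) / h) \<longlongrightarrow> 0) (at 0)"
  proof (rule Lim_null_comparison)
   show "\<forall>\<^sub>F h in at 0. norm ((flat j (0 + h) - flat j 0) / h) <= fact (j + 2) * \<bar>h\<bar>"
   proof (rule always_eventually, rule allI)
    fix h :: real
    show "norm ((flat j (0 + h) - flat j 0) / h) <= fact (j + 2) * \<bar>h\<bar>"
    proof (cases "h > 0")
     case True
     have "flat j h >= 0" using True by (simp add: flat_def)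
     thus ?thesis using flat_bound[OF True, of j] True
      by (simp add: flat_def[of j 0] abs_mult field_simps power2_eq_square)
    next
     case False
     hence "norm ((flat j (0 + h) - flat j 0) / h) = 0" by (simp add: flat_def)
     moreover have "0 <= fact (j + 2) * \<bar>h\<bar>" by (rule mult_nonneg_nonneg) simp_all
     ultimately show ?thesis by (simp only:)
    qed
   qed
   show "((%h. fact (j + 2) * \<bar>h\<bar>) \<longlongrightarrow> 0) (at (0::real))"
    by (intro tendsto_eq_intros) auto
  qed
  thus ?thesis using 3 unfolding DERIV_def by (simp add: flat_def)
 qed
qed

lemma smooth_flat: "smooth {1} UNIV (flat j)"
proof (rule smoothI)
 have sp: "span {1::real} = UNIV" using span_Basis[where 'a = real] by simp
 fix k show "k_smooth k {1} UNIV (flat j)"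
 proof (induction k arbitrary: j)
  case 0
  show ?case unfolding k_smooth.simps
   by (rule DERIV_continuous_on[where D = "%t. flat (j + 2) t - real j * flat (j + 1) t"])
    (rule has_field_derivative_at_within[OF flat_derivative])
 next
  case (Suc k)
  show ?case
  proof (rule k_smooth_SucI[where g' = "%_ t. flat (j + 2) t + (- real j) * flat (j + 1) t"])
   have so: "span_open {1::real} UNIV" by (simp add: sp)
   thus "span_open {1::real} UNIV" .
   show "continuous_on UNIV (flat j)" using Suc.IH k_smooth_continuous by blast
   show "k_smooth k {1} UNIV (%t. flat (j + 2) t + (- real j) * flat (j + 1) t)"
    by (rule k_smooth_add[OF so Suc.IH k_smooth_linear_comp[OF bounded_linear_mult_right so Suc.IH]])
   fix b x :: real assume "b \<in> {1}"
   thus "((%t. flat j (x + t *\<^sub>R b)) has_vector_derivative flat (j + 2) x + (- real j) * flat (j + 1) x) (at 0)"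
    using DERIV_shift[of "flat j" _ 0 x] flat_derivative[of j x]
    by (simp add: has_real_derivative_iff_has_vector_derivative[symmetric] add.commute)
  qed
 qed
qed

text \<open>\<open>flat 0\<close> is composed with a quadratic polynomial that is positive exactly
  inside a ball around \<open>x0\<close>. Positivity at the centre suffices for separating test
  measures.\<close>

lemma bump_exists:
 fixes x0 :: "'e::euclidean_space"
 assumes B: "B <= Basis" and W: "span_open B W" and x0: "x0 \<in> W"
 shows "EX (w :: 'e => real) K. smooth B (span B) w & compact K & K <= W & (ALL x:span B - K. w x = 0) &
  (ALL x. 0 <= w x) & w x0 > 0"
proof -
 obtain r where r: "r > 0" "ball x0 r \<inter> span B <= W"
  using W x0 unfolding openin_contains_ball by blast
 define K where "K = cball x0 (r/2) \<inter> span B"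
 define w where "w x = flat 0 ((r/2)\<^sup>2 - (x - x0) \<bullet> (x - x0))" for x
 have sp: "span_open B (span B)" by simp
 have 1: "smooth B (span B) (%x. (r/2)\<^sup>2 - (x - x0) \<bullet> (x - x0))"
 proof -
  have "smooth B (span B) (%x. x - x0)" by (intro smooth_diff smooth_ident smooth_const sp)
  hence "smooth B (span B) (%x. (x - x0) \<bullet> (x - x0))"
   using k_smooth_bilinear[OF bounded_bilinear_inner sp smoothD smoothD] smoothI by metis
  thus ?thesis by (intro smooth_diff smooth_const sp)
 qed
 have "span {1::real} = UNIV" using span_Basis[where 'a = real] by simp
 hence "smooth B (span B) w" unfolding w_def
  by (intro smooth_compose[OF _ sp _ _ 1 smooth_flat]) auto
 moreover have "compact K" "K <= W"
  unfolding K_def using r by (auto intro!: compact_Int_closed closed_span)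
 moreover have "w x = 0" if "x \<in> span B - K" for x
 proof -
  have "(r/2)\<^sup>2 <= (norm (x - x0))\<^sup>2"
   using that r(1) by (intro power_mono) (auto simp: K_def dist_norm norm_minus_commute)
  thus ?thesis by (simp add: w_def flat_def power2_norm_eq_inner)
 qed
 moreover have "w x0 > 0" using r(1) by (simp add: w_def flat_def)
 ultimately show ?thesis by (intro exI[of _ w] exI[of _ K]) (auto simp: w_def flat_def)
qed

subsection \<open>Jacobians and change of variables\<close>

text \<open>
  The determinant and the change of variables formula of the library need a finite index type; the
  Basis vectors serve as one, and a map of \<open>span B\<close> is extended by the identity in the other
  directions.
\<close>

typedef (overloaded) ('e::euclidean_space) bidx = "Basis :: 'e set"
 using nonempty_Basis by blast

lemma bidx_UNIV: "(UNIV :: 'e::euclidean_space bidx set) = Abs_bidx ` Basis"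
 by (rule type_definition.Abs_image[OF type_definition_bidx, symmetric])

instance bidx :: (euclidean_space) finite
 by standard (simp add: bidx_UNIV)

text \<open>The change of variables formula used below asks for a well-ordered index type; any
  enumeration of the finite type provides one.\<close>

instantiation bidx :: (euclidean_space) wellorder
begin

definition less_eq_bidx :: "'a bidx => 'a bidx => bool" where
 "less_eq_bidx i j \<longleftrightarrow> to_nat_on (UNIV :: 'a bidx set) i <= to_nat_on (UNIV :: 'a bidx set) j"

definition less_bidx :: "'a bidx => 'a bidx => bool" where
 "less_bidx i j \<longleftrightarrow> to_nat_on (UNIV :: 'a bidx set) i < to_nat_on (UNIV :: 'a bidx set) j"

instance
proof
 fix x y z :: "'a bidx"
 have inj: "to_nat_on (UNIV :: 'a bidx set) i = to_nat_on UNIV j ==> i = j" for i j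
  using inj_on_to_nat_on[of "UNIV :: 'a bidx set"] by (simp add: countable_finite inj_on_def)
 show "x < y \<longleftrightarrow> x <= y & ~ y <= x" by (auto simp: less_eq_bidx_def less_bidx_def)
 show "x <= x" by (simp add: less_eq_bidx_def)
 show "x <= y ==> y <= z ==> x <= z" by (simp add: less_eq_bidx_def)
 show "x <= y ==> y <= x ==> x = y" using inj by (simp add: less_eq_bidx_def)
 show "x <= y | y <= x" by (auto simp: less_eq_bidx_def)
 fix P :: "'a bidx => bool" and a
 assume *: "!!x. (!!y. y < x ==> P y) ==> P x"
 show "P a"
  by (rule measure_induct_rule[of "to_nat_on (UNIV :: 'a bidx set)"]) (rule *, simp add: less_bidx_def)
qed

end

definition tovec :: "'e::euclidean_space => real ^ 'e bidx" where
 "tovec x = (\<chi> i. x \<bullet> Rep_bidx i)"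

definition ofvec :: "real ^ 'e bidx => 'e::euclidean_space" where
 "ofvec v = (\<Sum>b\<in>Basis. (v $ Abs_bidx b) *\<^sub>R b)"

lemma Rep_bidx_Basis [simp]: "Rep_bidx i \<in> Basis"
 by (rule Rep_bidx)

lemma ofvec_inner: "b \<in> Basis ==> ofvec v \<bullet> b = v $ Abs_bidx b"
 unfolding ofvec_def using sum_Basis_inner[of Basis b "%b. v $ Abs_bidx b"] by simp

lemma ofvec_tovec [simp]: "ofvec (tovec x) = x"
 by (rule euclidean_eqI) (simp add: ofvec_inner tovec_def Abs_bidx_inverse)

lemma tovec_ofvec [simp]: "tovec (ofvec v) = v"
 by (simp add: vec_eq_iff tovec_def ofvec_inner Rep_bidx_inverse)

lemma linear_tovec: "linear tovec"
 by (rule linearI) (simp_all add: tovec_def vec_eq_iff inner_add_left)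

lemma linear_ofvec: "linear ofvec"
 by (rule linearI) (simp_all add: ofvec_def scaleR_add_left sum.distrib scaleR_sum_right)

lemma ofvec_axis: "ofvec (axis i 1) = Rep_bidx i"
proof -
 have "tovec (Rep_bidx i) = axis i 1"
  by (simp add: vec_eq_iff tovec_def axis_def inner_Basis Rep_bidx_inject)
 thus ?thesis by (metis ofvec_tovec)
qed

lemma bounded_linear_tovec: "bounded_linear tovec" and bounded_linear_ofvec: "bounded_linear ofvec"
 using linear_tovec linear_ofvec by (simp_all add: linear_conv_bounded_linear)

lemma borel_tovec [measurable]: "tovec \<in> borel \<rightarrow>\<^sub>M borel" and borel_ofvec [measurable]: "ofvec \<in> borel \<rightarrow>\<^sub>M borel"
 by (intro borel_measurable_continuous_onI linear_continuous_on bounded_linear_tovec bounded_linear_ofvec)+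

lemma prod_Basis_vec: "(\<Prod>b\<in>(Basis :: (real ^ 'e::euclidean_space bidx) set). f (ofvec b)) = (\<Prod>b\<in>Basis. f b)"
proof -
 have 1: "(Basis :: (real ^ 'e bidx) set) = (%b. axis (Abs_bidx b) 1) ` Basis"
  by (auto simp: Basis_vec_def bidx_UNIV)
 have 2: "inj_on (%b::'e. axis (Abs_bidx b) (1::real)) Basis"
  by (auto simp: inj_on_def axis_eq_axis Abs_bidx_inject)
 show ?thesis
  by (subst 1) (simp add: prod.reindex[OF 2] ofvec_axis Abs_bidx_inverse)
qed

lemma tovec_inner_axis: "tovec x \<bullet> axis i 1 = x \<bullet> Rep_bidx i"
 by (simp add: inner_axis tovec_def)

lemma lborel_tovec: "distr lborel borel (tovec :: 'e::euclidean_space => _) = lborel"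
proof (rule lborel_eqI[symmetric])
 fix l u :: "real ^ 'e bidx" assume lu: "!!b. b \<in> Basis ==> l \<bullet> b <= u \<bullet> b"
 have ax: "v \<bullet> axis i 1 = ofvec v \<bullet> Rep_bidx i" for v :: "real ^ 'e bidx" and i
  using tovec_inner_axis[of "ofvec v" i] by simp
 have "tovec -` box l u = box (ofvec l) (ofvec u)"
 proof (rule Set.set_eqI)
  fix x :: 'e
  have "x \<in> tovec -` box l u \<longleftrightarrow> (ALL i. ofvec l \<bullet> Rep_bidx i < x \<bullet> Rep_bidx i & x \<bullet> Rep_bidx i < ofvec u \<bullet> Rep_bidx i)"
   by (auto simp: box_def Basis_vec_def ax)
  also have "... \<longleftrightarrow> x \<in> box (ofvec l) (ofvec u)"
   by (auto simp: box_def) (metis Abs_bidx_inverse)+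
  finally show "x \<in> tovec -` box l u \<longleftrightarrow> x \<in> box (ofvec l) (ofvec u)" .
 qed
 moreover have "ofvec l \<bullet> b <= ofvec u \<bullet> b" if "b \<in> Basis" for b :: 'e
  using lu[of "axis (Abs_bidx b) 1"] that by (simp add: ax Abs_bidx_inverse)
 ultimately have "emeasure (distr lborel borel (tovec :: 'e => _)) (box l u) = (\<Prod>b\<in>Basis. (ofvec u - ofvec l) \<bullet> b)"
  by (simp add: emeasure_distr)
 also have "(\<Prod>b\<in>Basis. (ofvec u - ofvec l) \<bullet> b) = (\<Prod>b\<in>Basis. (u - l) \<bullet> b)"
  by (rule trans[OF prod_Basis_vec[symmetric] prod.cong[OF refl]])
   (auto simp: Basis_vec_def ofvec_axis inner_diff_left ax)
 finally show "emeasure (distr lborel borel (tovec :: 'e => _)) (box l u) = (\<Prod>b\<in>Basis. (u - l) \<bullet> b)" .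
qed simp

definition lindet :: "('e::euclidean_space => 'e) => real" where
 "lindet L = det (matrix (%v. tovec (L (ofvec v))))"

lemma lindet_compose:
 assumes "linear L" "linear M"
 shows "lindet (%x. L (M x)) = lindet L * lindet M"
proof -
 have lin: "linear (%v. tovec (L (ofvec v)))" if "linear L" for L :: "'a => 'a"
  using linear_compose[OF linear_compose[OF linear_ofvec that] linear_tovec] by (simp add: o_def)
 have "(%v. tovec (L (M (ofvec v)))) = (%v. tovec (L (ofvec v))) \<circ> (%v. tovec (M (ofvec v)))" by (simp add: o_def)
 thus ?thesis unfolding lindet_def using matrix_compose[OF lin[OF assms(2)] lin[OF assms(1)]]
  by (simp add: det_mul)
qed

lemma lindet_ident: "lindet (%x. x) = 1"
 using matrix_id_mat_1 by (simp add: lindet_def id_def[symmetric])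

text \<open>In block form: the columns \<open>D b\<close> for \<open>b\<close> in \<open>B\<close>
  and the identity on the complementary coordinates.\<close>

definition extend_lin :: "'e::euclidean_space set => ('e => 'e) => 'e => 'e" where
 "extend_lin B D v = (\<Sum>b\<in>B. (v \<bullet> b) *\<^sub>R D b) + (v - cproj B v)"

lemma linear_extend_lin: "linear (extend_lin B D)"
 unfolding extend_lin_def using linear_cproj[of B]
 by (intro linearI) (simp_all add: inner_add_left scaleR_add_left sum.distrib scaleR_sum_right linear_add linear_scale algebra_simps)

lemma extend_lin_Basis:
 assumes "B <= Basis" "c \<in> Basis"
 shows "extend_lin B D c = (if c \<in> B then D c else c)"
proof -
 have "(\<Sum>b\<in>B. (c \<bullet> b) *\<^sub>R D b) = (\<Sum>b\<in>B. if b = c then D b else 0)"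
  using assms by (intro sum.cong) (auto simp: inner_Basis)
 also have "... = (if c \<in> B then D c else 0)" using finite_Basis_subset[OF assms(1)] by simp
 finally have 1: "(\<Sum>b\<in>B. (c \<bullet> b) *\<^sub>R D b) = (if c \<in> B then D c else 0)" .
 have "cproj B c = (if c \<in> B then c else 0)"
  by (rule euclidean_eqI) (use assms in \<open>auto simp: cproj_inner inner_Basis\<close>)
 thus ?thesis by (simp add: extend_lin_def 1)
qed

text \<open>The extension fixes the basis vectors outside \<open>B\<close>, so in the Leibniz
  formula every permutation that moves one of them contributes zero.\<close>

lemma lindet_extend:
 fixes B :: "'e::euclidean_space set"
 assumes B: "B <= Basis"
 shows "lindet (extend_lin B D) = (\<Sum>p | p permutes B. of_int (sign p) * (\<Prod>b\<in>B. D b \<bullet> p b))"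
proof -
 define M where "M i j = extend_lin B D (Rep_bidx i) \<bullet> Rep_bidx j" for i j :: "'e bidx"
 define I where "I = {i. Rep_bidx i \<in> B}"
 \<comment> \<open>\<open>jacobian\<close> expands along the differentiated directions, that is,
   along the rows of the transposed matrix.\<close>
 have "transpose (matrix (%v. tovec (extend_lin B D (ofvec v)))) = (\<chi> i j. M i j)"
  by (simp add: transpose_def matrix_def vec_eq_iff ofvec_axis tovec_def M_def)
 hence "lindet (extend_lin B D) = det (\<chi> i j. M i j)"
  unfolding lindet_def using det_transpose[of "matrix (%v. tovec (extend_lin B D (ofvec v)))"] by simp
 also have "... = (\<Sum>p | p permutes UNIV. of_int (sign p) * (\<Prod>i\<in>UNIV. M i (p i)))"
  by (simp add: det_def)
 also have "... = (\<Sum>p | p permutes I. of_int (sign p) * (\<Prod>i\<in>UNIV. M i (p i)))"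
 proof (rule sum.mono_neutral_right)
  show "{p. p permutes I} <= {p. p permutes UNIV}" using permutes_subset by blast
  show "ALL p:{p. p permutes UNIV} - {p. p permutes I}. of_int (sign p) * (\<Prod>i\<in>UNIV. M i (p i)) = 0"
  proof
   fix p assume p: "p \<in> {p. p permutes (UNIV :: 'e bidx set)} - {p. p permutes I}"
   then obtain i where i: "i ~: I" "p i ~= i"
    using permutes_superset[of p UNIV I] by blast
   hence "M i (p i) = 0"
    using extend_lin_Basis[OF B, of "Rep_bidx i" D] by (auto simp: M_def I_def inner_Basis Rep_bidx_inject)
   thus "of_int (sign p) * (\<Prod>i\<in>UNIV. M i (p i)) = 0" by (auto intro!: prod_zero)
  qed
 qed (simp add: finite_permutations)
 also have "... = (\<Sum>p | p permutes I. of_int (sign p) * (\<Prod>i\<in>I. M i (p i)))"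
 proof (intro sum.cong refl arg_cong2[of _ _ _ _ "(*)"])
  fix p assume "p \<in> {p. p permutes I}"
  hence "M i (p i) = 1" if "i ~: I" for i
   using that extend_lin_Basis[OF B, of "Rep_bidx i" D] permutes_not_in[of p I i] by (auto simp: M_def I_def)
  thus "(\<Prod>i\<in>UNIV. M i (p i)) = (\<Prod>i\<in>I. M i (p i))" by (intro prod.mono_neutral_right) auto
 qed
 also have "... = (\<Sum>p | p permutes B. of_int (sign p) * (\<Prod>b\<in>B. D b \<bullet> p b))"
 proof -
  have inj: "inj_on Abs_bidx B" by (intro inj_onI) (metis B Abs_bidx_inverse subsetD)
  have img: "Abs_bidx ` B = I"
   using B by (auto simp: I_def Abs_bidx_inverse image_iff) (metis Rep_bidx_inverse)
  hence bij: "bij_betw Abs_bidx B I" using inj by (simp add: bij_betw_def)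
  have bij': "bij_betw (map_permutation B Abs_bidx) {p. p permutes B} {p. p permutes I}"
   using bij_betw_permutations[OF bij] img
   by (simp add: map_permutation_def[abs_def] restrict_id_def[abs_def] o_def)
  have "(\<Sum>p | p permutes I. of_int (sign p) * (\<Prod>i\<in>I. M i (p i))) =
   (\<Sum>p | p permutes B. of_int (sign (map_permutation B Abs_bidx p)) * (\<Prod>i\<in>I. M i (map_permutation B Abs_bidx p i)))"
   by (rule sum.reindex_bij_betw[OF bij', symmetric])
  also have "... = (\<Sum>p | p permutes B. of_int (sign p) * (\<Prod>b\<in>B. D b \<bullet> p b))"
  proof (intro sum.cong refl arg_cong2[of _ _ _ _ "(*)"])
   fix p assume "p \<in> {p. p permutes B}"
   hence p: "p permutes B" by simp
   show "of_int (sign (map_permutation B Abs_bidx p)) = (of_int (sign p) :: real)"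
    using sign_map_permutation[OF inj p finite_Basis_subset[OF B]] by simp
   have "(\<Prod>i\<in>I. M i (map_permutation B Abs_bidx p i)) = (\<Prod>b\<in>B. M (Abs_bidx b) (map_permutation B Abs_bidx p (Abs_bidx b)))"
    unfolding img[symmetric] by (simp add: prod.reindex[OF inj])
   also have "... = (\<Prod>b\<in>B. D b \<bullet> p b)"
   proof (intro prod.cong refl)
    fix b assume b: "b \<in> B"
    hence "b \<in> Basis" "p b \<in> Basis" using B permutes_in_image[OF p] by auto
    thus "M (Abs_bidx b) (map_permutation B Abs_bidx p (Abs_bidx b)) = D b \<bullet> p b"
     unfolding M_def map_permutation_apply[OF inj b] using b
     by (simp add: Abs_bidx_inverse extend_lin_Basis[OF B])
   qed
   finally show "(\<Prod>i\<in>I. M i (map_permutation B Abs_bidx p i)) = (\<Prod>b\<in>B. D b \<bullet> p b)" .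
  qed
  finally show ?thesis .
 qed
 finally show ?thesis .
qed

lemma jacobian_lindet: "B <= Basis ==> jacobian B ps x = lindet (extend_lin B (%b. pd b ps x))"
 by (simp add: jacobian_def lindet_extend)

lemma partial_in_span:
 fixes g :: "'e::euclidean_space => 'f::euclidean_space"
 assumes "C <= Basis" "span_open B W" "smooth B W g" "g ` W <= span C" "b \<in> B" "x \<in> W"
 shows "pd b g x \<in> span C"
 unfolding span_Basis_eq[OF assms(1)]
proof
 fix c :: 'f assume c: "c \<in> Basis - C"
 have "pd b g x \<bullet> c = pd b (%x. g x \<bullet> c) x"
  by (rule partial_linear_comp[OF bounded_linear_inner_left assms(3,5,6), symmetric])
 also have "... = pd b (%x. 0) x"
 proof (rule partial_deriv_cong[OF assms(2,5,6)])
  fix y assume "y \<in> W"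
  hence "g y \<in> span C" using assms(4) by blast
  thus "g y \<bullet> c = 0" using span_Basis_eq[OF assms(1)] c by blast
 qed
 finally show "pd b g x \<bullet> c = 0" by (simp add: partial_const)
qed

lemma extend_lin_span:
 assumes "B <= Basis" "u \<in> span B"
 shows "extend_lin B D u = (\<Sum>b\<in>B. (u \<bullet> b) *\<^sub>R D b)"
 by (simp add: extend_lin_def cproj_id[OF assms])

lemma extend_lin_normal:
 assumes "B <= Basis"
 shows "extend_lin B D (v - cproj B v) = v - cproj B v"
proof -
 have "(v - cproj B v) \<bullet> b = 0" if "b \<in> B" for b
  using cproj_inner[OF assms, of b v] that assms by (auto simp: inner_diff_left)
 moreover have "cproj B (v - cproj B v) = 0"
  using linear_diff[OF linear_cproj[of B]] cproj_id[OF assms cproj_in_span] by simp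
 ultimately show ?thesis unfolding extend_lin_def by simp
qed

text \<open>All partial derivatives stay in \<open>span B\<close>, so extending by the identity
  respects composition, and the determinant is multiplicative.\<close>

lemma jacobian_compose:
 fixes g :: "'e::euclidean_space => 'e" and f :: "'e => 'e"
 assumes B: "B <= Basis" and W: "span_open B W" and V: "span_open B V" and gWV: "g ` W <= V"
  and g: "smooth B W g" and f: "smooth B V f" and x: "x \<in> W"
 shows "jacobian B (%x. f (g x)) x = jacobian B f (g x) * jacobian B g x"
proof -
 let ?Lf = "extend_lin B (%c. pd c f (g x))" and ?Lg = "extend_lin B (%b. pd b g x)"
 have gs: "pd b g x \<in> span B" if "b \<in> B" for b
  using gWV span_open_subset[OF V] by (intro partial_in_span[OF B W g _ that x]) auto
 have "extend_lin B (%b. pd b (%x. f (g x)) x) v = ?Lf (?Lg v)" for v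
 proof -
  have "?Lf (?Lg v) = (\<Sum>b\<in>B. (v \<bullet> b) *\<^sub>R ?Lf (pd b g x)) + ?Lf (v - cproj B v)"
   unfolding extend_lin_def[of B "%b. pd b g x"]
   using linear_extend_lin[of B "%c. pd c f (g x)"]
   by (simp only: linear_add linear_sum linear_scale)
  also have "... = (\<Sum>b\<in>B. (v \<bullet> b) *\<^sub>R pd b (%x. f (g x)) x) + (v - cproj B v)"
   unfolding extend_lin_normal[OF B]
   by (intro arg_cong2[of _ _ _ _ "(+)"] sum.cong refl)
    (simp add: extend_lin_span[OF B gs] smooth_compose_partial[OF B W V gWV g f _ x])
  finally show ?thesis by (simp add: extend_lin_def)
 qed
 hence "extend_lin B (%b. pd b (%x. f (g x)) x) = (%v. ?Lf (?Lg v))" by blast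
 thus ?thesis
  unfolding jacobian_lindet[OF B] using lindet_compose[OF linear_extend_lin linear_extend_lin] by metis
qed

lemma jacobian_ident: "B <= Basis ==> jacobian B (%x. x) x = 1"
proof -
 assume B: "B <= Basis"
 have "pd b (%x. x) x = b" for b :: 'a by (rule partial_bounded_linear[OF bounded_linear_ident])
 hence "extend_lin B (%b. pd b (%x. x) x) = (%v. v)"
  by (simp add: extend_lin_def cproj_def fun_eq_iff)
 thus ?thesis using jacobian_lindet[OF B, of "%x. x"] lindet_ident by simp
qed

lemma jacobian_cong:
 assumes "span_open B W" "x \<in> W" "!!y. y \<in> W ==> f y = g y"
 shows "jacobian B f x = jacobian B g x"
 unfolding jacobian_def
 using partial_deriv_cong[OF assms(1) _ assms(2,3)] by (intro sum.cong refl arg_cong2[of _ _ _ _ "(*)"] prod.cong) simp_all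

lemma smooth_jacobian:
 assumes "span_open B W" "smooth B W g"
 shows "smooth B W (jacobian B g)"
 unfolding jacobian_def
 by (intro smooth_sum smooth_cmult smooth_prod smooth_inner_const smooth_partial assms)

section \<open>Change of variables on a coordinate subspace\<close>

lemma tovec_integral:
 fixes f :: "'e::euclidean_space => real"
 assumes "set_integrable lborel A f"
 shows "(%v. f (ofvec v)) absolutely_integrable_on (tovec ` A)"
  and "integral (tovec ` A) (%v. f (ofvec v)) = (LINT x:A|lborel. f x)"
proof -
 let ?k = "%x. indicat_real A x *\<^sub>R f x"
 have k: "integrable lborel ?k" using assms by (simp add: set_integrable_def)
 hence km [measurable]: "?k \<in> borel_measurable borel" by simp
 have ind: "indicat_real (tovec ` A) v *\<^sub>R f (ofvec v) = ?k (ofvec v)" for v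
  by (auto simp: indicator_def image_iff) (metis tovec_ofvec)
 have km': "(%v. ?k (ofvec v)) \<in> borel_measurable borel" by (rule measurable_compose[OF borel_ofvec km])
 have 1: "integrable lborel (%v. ?k (ofvec v))"
  by (subst lborel_tovec[symmetric], subst integrable_distr_eq) (use k km' in simp_all)
 have 2: "(LINT v|lborel. ?k (ofvec v)) = (LINT x|lborel. ?k x)"
  by (subst lborel_tovec[symmetric], subst integral_distr) (use km' in simp_all)
 have 3: "integrable lebesgue (%v. ?k (ofvec v))"
  using 1 km' integrable_completion[of "%v. ?k (ofvec v)" lborel] by simp
 thus ai: "(%v. f (ofvec v)) absolutely_integrable_on (tovec ` A)"
  unfolding set_integrable_def ind .
 have "integral (tovec ` A) (%v. f (ofvec v)) = (LINT v:tovec ` A|lebesgue. f (ofvec v))"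
  using set_lebesgue_integral_eq_integral(2)[OF ai] by simp
 also have "... = (LINT v|lborel. ?k (ofvec v))"
  unfolding set_lebesgue_integral_def ind using km' by (intro integral_completion) simp
 finally show "integral (tovec ` A) (%v. f (ofvec v)) = (LINT x:A|lborel. f x)"
  unfolding 2 by (simp add: set_lebesgue_integral_def)
qed

lemma lborel_change_of_variables:
 fixes f :: "'e::euclidean_space => real" and g :: "'e => 'e"
 assumes S: "S \<in> sets borel" and der: "!!x. x \<in> S ==> (g has_derivative g' x) (at x within S)"
  and inj: "inj_on g S" and int: "set_integrable lborel (g ` S) f"
  and int': "set_integrable lborel S (%x. \<bar>lindet (g' x)\<bar> * f (g x))"
 shows "(LINT y:g ` S|lborel. f y) = (LINT x:S|lborel. \<bar>lindet (g' x)\<bar> * f (g x))"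
proof -
 define G where "G v = tovec (g (ofvec v))" for v
 define G' where "G' v w = tovec (g' (ofvec v) (ofvec w))" for v w
 have "tovec ` S = ofvec -` S" by (auto simp: image_iff) (metis tovec_ofvec)
 hence "tovec ` S \<in> sets borel" using measurable_sets[OF borel_ofvec S] by simp
 hence S': "tovec ` S \<in> sets lebesgue" by (simp add: sets_completionI_sets)
 have der': "(G has_derivative G' v) (at v within tovec ` S)" if v: "v \<in> tovec ` S" for v
 proof -
  have im: "ofvec ` tovec ` S = S" by (simp add: image_image)
  have "(ofvec has_derivative ofvec) (at v within tovec ` S)"
   by (rule bounded_linear_imp_has_derivative[OF bounded_linear_ofvec])
  moreover have "(g has_derivative g' (ofvec v)) (at (ofvec v) within ofvec ` tovec ` S)"
   using der v unfolding im by auto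
  ultimately have "(g \<circ> ofvec has_derivative g' (ofvec v) \<circ> ofvec) (at v within tovec ` S)"
   by (rule diff_chain_within)
  from bounded_linear.has_derivative[OF bounded_linear_tovec this]
  show ?thesis by (simp add: G_def[abs_def] G'_def[abs_def] o_def)
 qed
 have inj': "inj_on G (tovec ` S)"
  using inj by (auto simp: inj_on_def G_def) (metis ofvec_tovec)
 have img: "G ` tovec ` S = tovec ` g ` S" by (simp add: G_def image_image)
 have dt: "det (matrix (G' v)) = lindet (g' (ofvec v))" for v
  by (simp add: lindet_def G'_def[abs_def])
 \<comment> \<open>The real integrand is regarded as a vector with one component to match the
   general formula.\<close>
 let ?F = "%v. vec (f (ofvec v)) :: real ^ 1"
 have "?F absolutely_integrable_on G ` tovec ` S"
  using tovec_integral(1)[OF int] unfolding img absolutely_integrable_on_1_iff by simp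
 hence "integral (G ` tovec ` S) ?F = integral (tovec ` S) (%v. \<bar>det (matrix (G' v))\<bar> *\<^sub>R ?F (G v))"
  by (intro integral_change_of_variables[OF S' der' inj']) simp_all
 hence "integral (tovec ` g ` S) (%v. f (ofvec v)) = integral (tovec ` S) (%v. \<bar>lindet (g' (ofvec v))\<bar> * f (g (ofvec v)))"
  unfolding img dt integral_on_1_eq by (simp add: G_def vec_eq_iff)
 thus ?thesis using tovec_integral(2)[OF int] tovec_integral(2)[OF int'] by simp
qed

text \<open>The map is extended to the strip as the identity in the complementary coordinates. It
  remains injective, carries the strip over \<open>A\<close> onto the strip over the image, and has
  the same Jacobian.\<close>

lemma coord_change_of_variables:
 fixes F :: "'e::euclidean_space => complex"
 assumes B: "B <= Basis" and W: "span_open B W" and ps: "smooth B W ps" "ps ` W <= span B" "inj_on ps W"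
  and A: "A \<in> sets borel" "A <= W" and int: "set_integrable (coord_lborel B) (ps ` A) F"
  and int': "set_integrable (coord_lborel B) A (%x. of_real \<bar>jacobian B ps x\<bar> * F (ps x))"
 shows "(LINT y:ps ` A|coord_lborel B. F y) = (LINT x:A|coord_lborel B. of_real \<bar>jacobian B ps x\<bar> * F (ps x))"
proof -
 define S where "S = {x \<in> cstrip B. cproj B x \<in> A}"
 define Ps where "Ps x = ps (cproj B x) + (x - cproj B x)" for x
 define Ps' where "Ps' x = extend_lin B (%b. pd b ps (cproj B x))" for x
 have As: "a \<in> span B" "ps a \<in> span B" if "a \<in> A" for a
  using that A(2) ps(2) span_open_subset[OF W] by blast+
 have S: "S \<in> sets borel"
  using measurable_sets[OF borel_cproj A(1), of B] borel_cstrip[of B] by (simp add: S_def vimage_def Collect_conj_eq)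
 have pP: "cproj B (Ps x) = ps (cproj B x)" if "cproj B x \<in> A" for x
  unfolding Ps_def using cproj_id[OF B] As[OF that] linear_cproj[of B] by (simp add: linear_add linear_diff)
 have PI: "Ps x \<bullet> b = x \<bullet> b" if "cproj B x \<in> A" "b \<in> Basis - B" for x b
  using As(2)[OF that(1)] that(2) span_Basis_eq[OF B] by (simp add: Ps_def inner_add_left inner_diff_left cproj_inner[OF B])
 have PS: "Ps ` S = {y \<in> cstrip B. cproj B y \<in> ps ` A}"
 proof (intro equalityI subsetI)
  fix y assume "y \<in> Ps ` S"
  thus "y \<in> {y \<in> cstrip B. cproj B y \<in> ps ` A}"
   using pP PI by (auto simp: S_def cstrip_def)
 next
  fix y assume y: "y \<in> {y \<in> cstrip B. cproj B y \<in> ps ` A}"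
  then obtain a where a: "a \<in> A" "cproj B y = ps a" by auto
  define x where "x = a + (y - cproj B y)"
  have px: "cproj B x = a"
   unfolding x_def using cproj_id[OF B] As[OF a(1)] cproj_in_span[of B y] linear_cproj[of B]
   by (simp add: linear_add linear_diff)
  have "x \<bullet> b = y \<bullet> b" if "b \<in> Basis - B" for b
   using that As(1)[OF a(1)] span_Basis_eq[OF B, of a]
   by (simp add: x_def inner_add_left inner_diff_left cproj_inner[OF B])
  hence "x \<in> S" using y a(1) by (simp add: S_def px cstrip_def)
  moreover have "Ps x = y" unfolding Ps_def px by (simp add: x_def a(2))
  ultimately show "y \<in> Ps ` S" by blast
 qed
 have inj: "inj_on Ps S"
 proof (rule inj_onI)
  fix x y assume xy: "x \<in> S" "y \<in> S" "Ps x = Ps y"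
  hence "ps (cproj B x) = ps (cproj B y)" using pP by (metis (mono_tags, lifting) S_def mem_Collect_eq)
  hence "cproj B x = cproj B y" using inj_onD[OF ps(3)] xy A(2) by (auto simp: S_def)
  thus "x = y" using xy(3) by (simp add: Ps_def)
 qed
 have der: "(Ps has_derivative Ps' x) (at x within S)" if x: "x \<in> S" for x
 proof -
  have xW: "cproj B x \<in> W" using x A(2) by (auto simp: S_def)
  have "(cproj B has_derivative cproj B) (at x within S)"
   by (rule bounded_linear_imp_has_derivative[OF bounded_linear_cproj])
  moreover have "(ps has_derivative (%v. \<Sum>b\<in>B. (v \<bullet> b) *\<^sub>R pd b ps (cproj B x))) (at (cproj B x) within cproj B ` S)"
   by (rule has_derivative_subset[OF k_smooth_has_derivative[OF B W smoothD[OF ps(1)] xW]]) (auto simp: cproj_in_span)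
  ultimately have "(ps \<circ> cproj B has_derivative (%v. \<Sum>b\<in>B. (v \<bullet> b) *\<^sub>R pd b ps (cproj B x)) \<circ> cproj B) (at x within S)"
   by (rule diff_chain_within)
  moreover have "((%x. x - cproj B x) has_derivative (%x. x - cproj B x)) (at x within S)"
   by (intro bounded_linear_imp_has_derivative bounded_linear_sub bounded_linear_ident bounded_linear_cproj)
  ultimately have "((%x. (ps \<circ> cproj B) x + (x - cproj B x)) has_derivative
    (%v. ((%v. \<Sum>b\<in>B. (v \<bullet> b) *\<^sub>R pd b ps (cproj B x)) \<circ> cproj B) v + (v - cproj B v))) (at x within S)"
   by (rule has_derivative_add)
  moreover have "((%v. \<Sum>b\<in>B. (v \<bullet> b) *\<^sub>R pd b ps (cproj B x)) \<circ> cproj B) v + (v - cproj B v) = Ps' x v" for v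
   unfolding Ps'_def extend_lin_def o_def using B
   by (intro arg_cong2[of _ _ _ _ "(+)"] sum.cong refl) (auto simp: cproj_inner[OF B])
  ultimately show ?thesis by (simp add: Ps_def[abs_def])
 qed
 have lj: "lindet (Ps' x) = jacobian B ps (cproj B x)" for x
  by (simp add: Ps'_def jacobian_lindet[OF B])
 let ?F = "%y. F (cproj B y)" and ?F' = "%x. of_real \<bar>jacobian B ps (cproj B x)\<bar> * F (ps (cproj B x))"
 have m: "(%y. indicat_real (ps ` A) y *\<^sub>R F y) \<in> borel_measurable borel"
  using borel_measurable_integrable[OF int[unfolded set_integrable_def]] by simp
 have m': "(%x. indicat_real A x *\<^sub>R (of_real \<bar>jacobian B ps x\<bar> * F (ps x))) \<in> borel_measurable borel"
  using borel_measurable_integrable[OF int'[unfolded set_integrable_def]] by simp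
 have ie: "indicat_real (cstrip B) y *\<^sub>R (indicat_real (ps ` A) (cproj B y) *\<^sub>R F (cproj B y)) = indicat_real (Ps ` S) y *\<^sub>R ?F y" for y
  unfolding PS by (auto simp: indicator_def)
 have ie': "indicat_real (cstrip B) x *\<^sub>R (indicat_real A (cproj B x) *\<^sub>R ?F' x) = indicat_real S x *\<^sub>R ?F' x" for x
  unfolding S_def by (auto simp: indicator_def)
 have iF: "set_integrable lborel (Ps ` S) ?F"
  using int unfolding set_integrable_def integrable_coord[OF B m] ie .
 have iF': "set_integrable lborel S ?F'"
  using int' unfolding set_integrable_def integrable_coord[OF B m'] ie' .
 have pc: "?F' x = of_real \<bar>lindet (Ps' x)\<bar> * ?F (Ps x)" if "x \<in> S" for x
  using pP[of x] that by (simp add: lj S_def)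
 have iF'': "set_integrable lborel S (%x. of_real \<bar>lindet (Ps' x)\<bar> * ?F (Ps x))"
  using iF' pc by (subst set_integrable_cong[OF refl refl, where f' = ?F']) auto
 \<comment> \<open>\<open>T\<close> stands for the real and the imaginary part, to which the real
   formula is applied separately.\<close>
 have comp: "T (LINT y:Ps ` S|lborel. ?F y) = T (LINT x:S|lborel. ?F' x)"
  if T: "bounded_linear T" for T :: "complex => real"
 proof -
  have tr: "T (of_real a * z) = a * T z" for a z
   using linear_scale[OF bounded_linear.linear[OF T], of a z] by (simp add: scaleR_conv_of_real)
  have ti: "set_integrable lborel X (%x. T (h x))" if "set_integrable lborel X h" for X h
   using integrable_bounded_linear[OF T that[unfolded set_integrable_def]]
   by (simp add: set_integrable_def linear_scale[OF bounded_linear.linear[OF T], unfolded real_scaleR_def])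
  have ts: "T (LINT x:X|lborel. h x) = (LINT x:X|lborel. T (h x))" if "set_integrable lborel X h" for X h
   using integral_bounded_linear[OF T that[unfolded set_integrable_def]]
   by (simp add: set_lebesgue_integral_def linear_scale[OF bounded_linear.linear[OF T], unfolded real_scaleR_def])
  have "T (LINT y:Ps ` S|lborel. ?F y) = (LINT x:S|lborel. \<bar>lindet (Ps' x)\<bar> * T (?F (Ps x)))"
   unfolding ts[OF iF] using ti[OF iF''] unfolding tr by (intro lborel_change_of_variables[OF S der inj ti[OF iF]])
  also have "... = T (LINT x:S|lborel. ?F' x)"
   unfolding ts[OF iF'] using S by (intro set_lebesgue_integral_cong) (auto simp: pc tr)
  finally show ?thesis .
 qed
 have "(LINT y:Ps ` S|lborel. ?F y) = (LINT x:S|lborel. ?F' x)"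
  by (rule complex_eqI[OF comp[OF bounded_linear_Re] comp[OF bounded_linear_Im]])
 thus ?thesis
  unfolding set_lebesgue_integral_def integral_coord[OF B m] integral_coord[OF B m'] ie ie' .
qed

section \<open>Smooth functions and measures on a manifold\<close>

text \<open>Near each point the sign of a nowhere vanishing continuous function is constant. Applied
  to Jacobians this makes the density factors smooth.\<close>

lemma smooth_abs_nonzero:
 assumes W: "span_open B W" and J: "smooth B W J" and nz: "!!x. x \<in> W ==> J x ~= (0::real)"
 shows "smooth B W (%x. \<bar>J x\<bar>)"
proof (rule smooth_local[OF span_open_subset[OF W]])
 fix x assume x: "x \<in> W"
 define s where "s = sgn (J x)"
 define V where "V = W \<inter> (%y. s * J y) -` {0<..}"
 have "continuous_on W (%y. s * J y)" by (intro continuous_intros smooth_continuous[OF J])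
 hence V: "span_open B V"
  unfolding V_def by (intro openin_trans[OF continuous_openin_preimage_gen W]) auto
 have "smooth B V (%y. s * J y)" by (rule smooth_cmult[OF V smooth_subset[OF J]]) (auto simp: V_def)
 moreover have "\<bar>J y\<bar> = s * J y" if "y \<in> V" for y
  using that nz[OF x] by (auto simp: V_def s_def sgn_if zero_less_mult_iff split: if_splits)
 ultimately have "smooth B V (%x. \<bar>J x\<bar>)" using smooth_cong[OF V, of "%x. \<bar>J x\<bar>" "%y. s * J y"] by simp
 moreover have "x \<in> V" using x nz[OF x] by (auto simp: V_def s_def sgn_if)
 ultimately show "EX W'. x \<in> W' & span_open B W' & smooth B W' (%x. \<bar>J x\<bar>)" using V by (intro exI[of _ V] conjI)
qed

locale manifold =
 fixes B :: "'e::euclidean_space set"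
  and \<A> :: "('m::{t2_space, second_countable_topology}, 'e) chart set"
 assumes manifold: "smooth_manifold B \<A>"
begin

abbreviation "df == density_factor B"
abbreviation "\<mu> == coord_lborel B"

lemma B_Basis: "B <= Basis"
 using manifold by (simp add: smooth_manifold_def)

lemma chart_ex: "EX U ph. (U, ph) \<in> \<A> & x \<in> U"
proof -
 have "x \<in> (\<Union>c\<in>\<A>. fst c)" using manifold by (simp add: smooth_manifold_def)
 thus ?thesis by auto
qed

lemma chart:
 assumes "(U, ph) \<in> \<A>"
 shows chart_open: "open U" and chart_span_open: "span_open B (ph ` U)"
  and chart_inj: "inj_on ph U" and chart_cont: "continuous_on U ph"
  and chart_cont_inv: "continuous_on (ph ` U) (inv_into U ph)"
proof -
 have "chart_map B (U, ph)" using manifold assms by (auto simp: smooth_manifold_def)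
 hence c: "open U" "span_open B (ph ` U)" "homeomorphism U (ph ` U) ph (inv_into U ph)"
  by (auto simp: chart_map_def)
 thus "open U" "span_open B (ph ` U)" "continuous_on U ph" "continuous_on (ph ` U) (inv_into U ph)"
  by (auto simp: homeomorphism_def)
 show "inj_on ph U" using homeomorphism_apply1[OF c(3)] by (rule inj_on_inverseI)
qed

lemma chart_inv [simp]: "(U, ph) \<in> \<A> ==> x \<in> U ==> inv_into U ph (ph x) = x"
 using chart_inj inv_into_f_f by metis

lemma chart_image_open:
 assumes c: "(U, ph) \<in> \<A>" and V: "open V" "V <= U"
 shows "span_open B (ph ` V)"
proof -
 have "ph ` V = ph ` U \<inter> inv_into U ph -` V"
 proof (intro equalityI subsetI)
  fix y assume "y \<in> ph ` V"
  thus "y \<in> ph ` U \<inter> inv_into U ph -` V" using V c by auto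
 next
  fix y assume "y \<in> ph ` U \<inter> inv_into U ph -` V"
  thus "y \<in> ph ` V" by (metis IntE f_inv_into_f imageI vimageE)
 qed
 thus ?thesis
  using continuous_openin_preimage_gen[OF chart_cont_inv[OF c] V(1)] openin_trans[OF _ chart_span_open[OF c]] by simp
qed

lemma chart_image_Int_open:
 "(U, ph) \<in> \<A> ==> open W ==> span_open B (ph ` (U \<inter> W))"
 by (rule chart_image_open) (auto intro: chart_open)

lemma chart_transition:
 assumes "(U, ph) \<in> \<A>" "(V, ps) \<in> \<A>"
 shows "smooth B (ph ` (U \<inter> V)) (%y. ps (inv_into U ph y))"
 using manifold assms unfolding smooth_manifold_def smooth_transition_def by (force simp: o_def)

text \<open>Maximality of the atlas admits every compatible chart. Shrinking charts in this way
  keeps later arguments inside a single chart domain.\<close>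

lemma chart_restrict:
 assumes c: "(U, ph) \<in> \<A>" and V: "open V"
 shows "(U \<inter> V, ph) \<in> \<A>"
proof -
 have inv: "inv_into (U \<inter> V) ph y = inv_into U ph y" if "y \<in> ph ` (U \<inter> V)" for y
  using that chart_inj[OF c] inv_into_f_f[of ph "U \<inter> V"] by (auto simp: c inj_on_subset)
 have "homeomorphism (U \<inter> V) (ph ` (U \<inter> V)) ph (inv_into (U \<inter> V) ph)"
  unfolding homeomorphism_def
 proof (intro conjI ballI)
  show "continuous_on (ph ` (U \<inter> V)) (inv_into (U \<inter> V) ph)"
   using continuous_on_subset[OF chart_cont_inv[OF c], of "ph ` (U \<inter> V)"] inv
   by (subst continuous_on_cong[OF refl inv]) auto
  show "continuous_on (U \<inter> V) ph" by (rule continuous_on_subset[OF chart_cont[OF c]]) simp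
  show "inv_into (U \<inter> V) ph ` ph ` (U \<inter> V) = U \<inter> V"
   using inv c by (force simp: image_iff)
  show "inv_into (U \<inter> V) ph (ph x) = x" if "x \<in> U \<inter> V" for x using inv[of "ph x"] c that by simp
  show "ph (inv_into (U \<inter> V) ph y) = y" if "y \<in> ph ` (U \<inter> V)" for y using inv[OF that] that c by auto
 qed simp
 hence cm: "chart_map B (U \<inter> V, ph)"
  using chart_open[OF c] V chart_image_Int_open[OF c V] by (auto simp: chart_map_def)
 have "smooth_transition B (U \<inter> V, ph) d & smooth_transition B d (U \<inter> V, ph)" if d: "d \<in> \<A>" for d
 proof -
  obtain W ps where d': "d = (W, ps)" by (cases d)
  have dA: "(W, ps) \<in> \<A>" using d d' by simp
  have o: "span_open B (ph ` (U \<inter> V \<inter> W))"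
   using chart_image_Int_open[OF c open_Int[OF V chart_open[OF dA]]] by (simp add: Int_assoc)
  have "smooth B (ph ` (U \<inter> V \<inter> W)) (%y. ps (inv_into U ph y))"
   by (rule smooth_subset[OF chart_transition[OF c dA]]) auto
  moreover have "inv_into (U \<inter> V) ph y = inv_into U ph y" if "y \<in> ph ` (U \<inter> V \<inter> W)" for y
   by (rule inv) (use that in auto)
  ultimately have "smooth B (ph ` (U \<inter> V \<inter> W)) (ps \<circ> inv_into (U \<inter> V) ph)"
   by (subst smooth_cong[OF o, of _ "%y. ps (inv_into U ph y)"]) auto
  moreover have "smooth B (ps ` (W \<inter> (U \<inter> V))) (%y. ph (inv_into W ps y))"
   by (rule smooth_subset[OF chart_transition[OF dA c]]) auto
  ultimately show ?thesis by (simp add: smooth_transition_def d' o_def)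
 qed
 thus ?thesis using manifold cm unfolding smooth_manifold_def by blast
qed

lemma chart_in:
 assumes "open W" "x \<in> W"
 shows "EX U ph. (U, ph) \<in> \<A> & x \<in> U & U <= W"
proof -
 obtain U ph where "(U, ph) \<in> \<A>" "x \<in> U" using chart_ex by blast
 thus ?thesis using chart_restrict[OF _ assms(1)] assms(2) by (intro exI[of _ "U \<inter> W"] exI[of _ ph]) auto
qed

lemma smooth_fun_chart:
 "smooth_fun B \<A> W f ==> (U, ph) \<in> \<A> ==> smooth B (ph ` (U \<inter> W)) (%y. f (inv_into U ph y))"
 unfolding smooth_fun_def by (force simp: o_def)

text \<open>Transition maps carry smoothness to all other charts, so one chart around each point is
  enough.\<close>

lemma smooth_funI:
 assumes W: "open W" and f: "!!p. p \<in> W ==> EX U ph V. (U, ph) \<in> \<A> & open V & p \<in> V & V <= U &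
   smooth B (ph ` V) (%y. f (inv_into U ph y))"
 shows "smooth_fun B \<A> W f"
 unfolding smooth_fun_def
proof (clarify, unfold o_def)
 fix U' ph' assume c': "(U', ph') \<in> \<A>"
 show "smooth B (ph' ` (U' \<inter> W)) (%y. f (inv_into U' ph' y))"
 proof (rule smooth_local[OF span_open_subset[OF chart_image_Int_open[OF c' W]]])
  fix y assume "y \<in> ph' ` (U' \<inter> W)"
  then obtain p where p: "p \<in> U'" "p \<in> W" "y = ph' p" by auto
  obtain U ph V where c: "(U, ph) \<in> \<A>" and V: "open V" "p \<in> V" "V <= U"
   and sm: "smooth B (ph ` V) (%y. f (inv_into U ph y))" using f[OF p(2)] by blast
  let ?X = "ph' ` (U' \<inter> V)"
  have X: "span_open B ?X" by (rule chart_image_Int_open[OF c' V(1)])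
  have "smooth B ?X (%y. f (inv_into U ph (ph (inv_into U' ph' y))))"
  proof (rule smooth_compose[OF B_Basis X chart_image_open[OF c V(1,3)] _ _ sm])
   show "(%y. ph (inv_into U' ph' y)) ` ?X <= ph ` V" using c' by auto
   show "smooth B ?X (%y. ph (inv_into U' ph' y))"
    by (rule smooth_subset[OF chart_transition[OF c' c]]) (use V(3) in auto)
  qed
  moreover have "f (inv_into U ph (ph (inv_into U' ph' y))) = f (inv_into U' ph' y)" if "y \<in> ?X" for y
   using that V(3) c c' by (auto simp: subset_iff)
  ultimately have "smooth B ?X (%y. f (inv_into U' ph' y))"
   using smooth_cong[OF X, of "%y. f (inv_into U ph (ph (inv_into U' ph' y)))"] by simp
  thus "EX W'. y \<in> W' & span_open B W' & smooth B W' (%y. f (inv_into U' ph' y))"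
   using X p V(2) by (intro exI[of _ ?X] conjI) auto
 qed
qed

lemma smooth_fun_cong:
 assumes "open W" "!!x. x \<in> W ==> f x = g x"
 shows "smooth_fun B \<A> W f \<longleftrightarrow> smooth_fun B \<A> W g"
proof -
 have "smooth B (ph ` (U \<inter> W)) (f \<circ> inv_into U ph) \<longleftrightarrow> smooth B (ph ` (U \<inter> W)) (g \<circ> inv_into U ph)" if "(U, ph) \<in> \<A>" for U ph
  by (rule smooth_cong[OF chart_image_Int_open[OF that assms(1)]]) (use assms(2) that in auto)
 thus ?thesis unfolding smooth_fun_def by blast
qed

lemma smooth_fun_subset: "smooth_fun B \<A> W f ==> W' <= W ==> smooth_fun B \<A> W' f"
 unfolding smooth_fun_def by (fastforce intro: smooth_subset)

lemma smooth_fun_local: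
 assumes "open W" "!!p. p \<in> W ==> EX V. open V & p \<in> V & smooth_fun B \<A> V f"
 shows "smooth_fun B \<A> W f"
proof (rule smooth_funI[OF assms(1)])
 fix p assume "p \<in> W"
 then obtain V where V: "open V" "p \<in> V" "smooth_fun B \<A> V f" using assms(2) by blast
 obtain U ph where c: "(U, ph) \<in> \<A>" "p \<in> U" using chart_ex by blast
 show "EX U ph V. (U, ph) \<in> \<A> & open V & p \<in> V & V <= U & smooth B (ph ` V) (%y. f (inv_into U ph y))"
  using smooth_fun_chart[OF V(3) c(1)] c V chart_open[OF c(1)]
  by (intro exI[of _ U] exI[of _ ph] exI[of _ "U \<inter> V"]) auto
qed

lemma smooth_fun_chart_comp:
 assumes c: "(U, ph) \<in> \<A>" and W: "open W" "W <= U" and g: "smooth B (ph ` W) g"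
 shows "smooth_fun B \<A> W (%x. g (ph x))"
proof (rule smooth_funI[OF W(1)])
 fix p assume "p \<in> W"
 have "smooth B (ph ` W) (%y. g (ph (inv_into U ph y)))"
  by (subst smooth_cong[OF chart_image_open[OF c W], of _ g]) (use g W(2) c in auto)
 thus "EX U ph' V. (U, ph') \<in> \<A> & open V & p \<in> V & V <= U & smooth B (ph' ` V) (%y. g (ph (inv_into U ph' y)))"
  using c W \<open>p \<in> W\<close> by (intro exI[of _ U] exI[of _ ph] exI[of _ W]) auto
qed

lemma smooth_fun_const: "open W ==> smooth_fun B \<A> W (%x. k)"
 unfolding smooth_fun_def o_def by (auto intro: smooth_const chart_image_Int_open)

lemma smooth_fun_add:
 "open W ==> smooth_fun B \<A> W f ==> smooth_fun B \<A> W g ==> smooth_fun B \<A> W (%x. f x + g x)"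
 unfolding smooth_fun_def o_def by (fast intro: smooth_add chart_image_Int_open)

lemma smooth_fun_mult:
 fixes f g :: "'m => complex"
 shows "open W ==> smooth_fun B \<A> W f ==> smooth_fun B \<A> W g ==> smooth_fun B \<A> W (%x. f x * g x)"
 unfolding smooth_fun_def o_def by (fast intro: smooth_mult chart_image_Int_open)

lemma smooth_fun_cnj:
 assumes "open W" "smooth_fun B \<A> W f"
 shows "smooth_fun B \<A> W (%x. cnj (f x))"
 unfolding smooth_fun_def o_def
proof clarify
 fix U ph assume "(U, ph) \<in> \<A>"
 thus "smooth B (ph ` (U \<inter> W)) (%x. cnj (f (inv_into U ph x)))"
  by (intro smooth_linear_comp[OF bounded_linear_cnj] smooth_fun_chart[OF assms(2)] chart_image_Int_open assms(1))
qed

subsection \<open>Density factors\<close>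

lemma df_eq: "df (U, ph) (V, ps) x = \<bar>jacobian B (%y. ph (inv_into V ps y)) (ps x)\<bar>"
 by (simp add: density_factor_def o_def)

text \<open>Multiplicativity of the Jacobian; it makes the transformation law of densities
  consistent.\<close>

lemma df_cocycle:
 assumes c1: "(U, ph) \<in> \<A>" and c2: "(V, ps) \<in> \<A>" and c3: "(W, th) \<in> \<A>" and x: "x \<in> U \<inter> V \<inter> W"
 shows "df (U, ph) (W, th) x = df (V, ps) (W, th) x * df (U, ph) (V, ps) x"
proof -
 let ?X = "th ` (W \<inter> (U \<inter> V))"
 have X: "span_open B ?X" by (intro chart_image_Int_open[OF c3] open_Int chart_open[OF c1] chart_open[OF c2])
 have xX: "th x \<in> ?X" using x by auto
 have "jacobian B (%y. ph (inv_into W th y)) (th x) = jacobian B (%y. ph (inv_into V ps (ps (inv_into W th y)))) (th x)"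
  by (rule jacobian_cong[OF X xX]) (use c2 c3 in auto)
 also have "... = jacobian B (%y. ph (inv_into V ps y)) (ps (inv_into W th (th x))) * jacobian B (%y. ps (inv_into W th y)) (th x)"
 proof (rule jacobian_compose[OF B_Basis X _ _ _ chart_transition[OF c2 c1] xX])
  show "span_open B (ps ` (V \<inter> U))" by (rule chart_image_Int_open[OF c2 chart_open[OF c1]])
  show "(%y. ps (inv_into W th y)) ` ?X <= ps ` (V \<inter> U)" using c3 by auto
  show "smooth B ?X (%y. ps (inv_into W th y))" by (rule smooth_subset[OF chart_transition[OF c3 c2]]) auto
 qed
 finally show ?thesis using x c3 by (simp add: df_eq abs_mult mult.commute)
qed

lemma df_self: "(U, ph) \<in> \<A> ==> (V, ph) \<in> \<A> ==> x \<in> U \<inter> V ==> df (U, ph) (V, ph) x = 1"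
proof -
 assume c: "(U, ph) \<in> \<A>" "(V, ph) \<in> \<A>" "x \<in> U \<inter> V"
 have "jacobian B (%y. ph (inv_into V ph y)) (ph x) = jacobian B (%y. y) (ph x)"
  by (rule jacobian_cong[OF chart_span_open[OF c(2)]]) (use c in auto)
 thus ?thesis using jacobian_ident[OF B_Basis] by (simp add: df_eq)
qed

lemma df_nonzero:
 assumes "(U, ph) \<in> \<A>" "(V, ps) \<in> \<A>" "x \<in> U \<inter> V"
 shows "df (U, ph) (V, ps) x ~= 0"
 using df_cocycle[OF assms(1,2,1), of x] df_self[OF assms(1,1)] assms(3) by auto

lemma smooth_df:
 assumes c: "(U, ph) \<in> \<A>" "(V, ps) \<in> \<A>"
 shows "smooth_fun B \<A> (U \<inter> V) (%x. of_real (df (U, ph) (V, ps) x) :: complex)"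
proof -
 let ?X = "ps ` (V \<inter> U)"
 have X: "span_open B ?X" by (rule chart_image_Int_open[OF c(2) chart_open[OF c(1)]])
 have "smooth B ?X (%y. \<bar>jacobian B (%y. ph (inv_into V ps y)) y\<bar>)"
  by (rule smooth_abs_nonzero[OF X smooth_jacobian[OF X chart_transition[OF c(2,1)]]])
   (use df_nonzero[OF c] in \<open>auto simp: df_eq\<close>)
 from smooth_fun_chart_comp[OF c(2) _ _ smooth_of_real[OF X this]]
 show ?thesis using c chart_open by (auto simp: df_eq Int_commute)
qed

subsection \<open>Test measures\<close>

definition law :: "(('m, 'e) chart => 'm => complex) => bool" where
 "law om \<longleftrightarrow> (ALL c:\<A>. ALL c':\<A>. ALL x:fst c \<inter> fst c'. om c' x = of_real (df c c' x) * om c x)"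

lemma lawD: "law om ==> (U, ph) \<in> \<A> ==> (V, ps) \<in> \<A> ==> x \<in> U ==> x \<in> V ==>
  om (V, ps) x = of_real (df (U, ph) (V, ps) x) * om (U, ph) x"
proof -
 assume *: "law om" "(U, ph) \<in> \<A>" "(V, ps) \<in> \<A>" "x \<in> U" "x \<in> V"
 have "ALL x:fst (U, ph) \<inter> fst (V, ps). om (V, ps) x = of_real (df (U, ph) (V, ps) x) * om (U, ph) x"
  using bspec[OF bspec[OF *(1)[unfolded law_def] *(2)] *(3)] .
 thus ?thesis using *(4,5) by simp
qed

lemma law_mult:
 assumes "law om"
 shows "law (%c x. f x * om c x)"
 unfolding law_def
proof (intro ballI)
 fix c c' x assume *: "c \<in> \<A>" "c' \<in> \<A>" "x \<in> fst c \<inter> fst c'"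
 have e: "om c' x = of_real (df c c' x) * om c x"
  by (rule bspec[OF bspec[OF bspec[OF assms[unfolded law_def] *(1)] *(2)] *(3)])
 show "f x * om c' x = of_real (df c c' x) * (f x * om c x)" unfolding e by (rule mult.left_commute)
qed

lemma test_measureD:
 assumes "om \<in> test_measures B \<A> W"
 shows tm_law: "law om" and tm_smooth: "c \<in> \<A> ==> smooth_fun B \<A> (fst c) (om c)"
  and tm_zero: "c ~: \<A> | x ~: fst c ==> om c x = 0"
  and tm_supp: "EX K. compact K & K <= W & (ALL c x. x ~: K --> om c x = 0)"
proof -
 note * = assms[unfolded test_measures_def mem_Collect_eq, folded law_def]
 show "law om" "c \<in> \<A> ==> smooth_fun B \<A> (fst c) (om c)" "c ~: \<A> | x ~: fst c ==> om c x = 0"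
  using * by blast+
 show "EX K. compact K & K <= W & (ALL c x. x ~: K --> om c x = 0)"
  using * closure_subset[of "{x. EX c. om c x ~= 0}"]
  by (intro exI[of _ "closure {x. EX c. om c x ~= 0}"]) blast
qed

lemma test_measureI:
 assumes "law om" "!!c. c \<in> \<A> ==> smooth_fun B \<A> (fst c) (om c)" "!!c x. c ~: \<A> | x ~: fst c ==> om c x = 0"
  "compact K" "K <= W" "!!c x. x ~: K ==> om c x = 0"
 shows "om \<in> test_measures B \<A> W"
proof -
 have sub: "closure {x. EX c. om c x ~= 0} <= K"
  using assms(6) by (intro closure_minimal compact_imp_closed assms(4)) auto
 hence "compact (closure {x. EX c. om c x ~= 0})"
  using compact_Int_closed[OF assms(4) closed_closure, of "{x. EX c. om c x ~= 0}"]
  by (simp only: Int_absorb1[OF sub])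
 thus ?thesis unfolding test_measures_def mem_Collect_eq law_def[symmetric]
  using assms(1-3,5) sub by blast
qed

lemma smooth_fun_extend:
 fixes f g :: "'m => complex"
 assumes U: "open U" and K: "compact K" "K <= W" and W: "open W"
  and f: "smooth_fun B \<A> (U \<inter> W) f" and g: "!!x. x \<in> U ==> x \<in> W ==> g x = f x" "!!x. x \<in> U ==> x ~: K ==> g x = 0"
 shows "smooth_fun B \<A> U g"
proof (rule smooth_fun_local[OF U])
 fix p assume p: "p \<in> U"
 show "EX V. open V & p \<in> V & smooth_fun B \<A> V g"
 proof (cases "p \<in> W")
  case True
  thus ?thesis using p U W f smooth_fun_cong[of "U \<inter> W" g f] g(1) by (intro exI[of _ "U \<inter> W"]) auto
 next
  case False
  have o: "open (U - K)" by (rule open_Diff[OF U compact_imp_closed[OF K(1)]])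
  have "smooth_fun B \<A> (U - K) g"
   using smooth_fun_cong[OF o, of g "%_. 0"] g(2) smooth_fun_const[OF o] by auto
  thus ?thesis using False K(2) o p by (intro exI[of _ "U - K"]) auto
 qed
qed

lemma tm_mult:
 assumes om: "om \<in> test_measures B \<A> W" and W: "open W" and f: "smooth_fun B \<A> W f"
 shows "(%c x. f x * om c x) \<in> test_measures B \<A> W"
proof -
 obtain K where K: "compact K" "K <= W" "!!c x. x ~: K ==> om c x = 0" using tm_supp[OF om] by blast
 show ?thesis
 proof (rule test_measureI[OF law_mult[OF tm_law[OF om]] _ _ K(1,2)])
  fix c assume c: "c \<in> \<A>"
  hence o: "open (fst c)" using chart_open by (cases c) auto
  have "smooth_fun B \<A> (fst c \<inter> W) (%x. f x * om c x)"
   by (intro smooth_fun_mult open_Int o W smooth_fun_subset[OF f] smooth_fun_subset[OF tm_smooth[OF om c]]) auto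
  thus "smooth_fun B \<A> (fst c) (%x. f x * om c x)"
   by (rule smooth_fun_extend[OF o K(1,2) W]) (simp_all add: K(3))
 qed (use tm_zero[OF om] K(3) in auto)
qed

lemma tm_mono: "om \<in> test_measures B \<A> W ==> W <= W' ==> om \<in> test_measures B \<A> W'"
 unfolding test_measures_def by blast

text \<open>The measure \<open>rh dy\<close> on one chart domain, extended by zero; its densities in
  the other charts are dictated by the transformation law.\<close>

definition chart_measure :: "('m, 'e) chart => ('e => complex) => ('m, 'e) chart => 'm => complex" where
 "chart_measure c rh c' x = (if c' \<in> \<A> & x \<in> fst c' \<inter> fst c then of_real (df c c' x) * rh (snd c x) else 0)"

lemma chart_measure_self:
 "(V, ph) \<in> \<A> ==> x \<in> V ==> chart_measure (V, ph) rh (V, ph) x = rh (ph x)"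
 by (simp add: chart_measure_def df_self)

lemma law_chart_measure:
 assumes c: "(V, ph) \<in> \<A>"
 shows "law (chart_measure (V, ph) rh)"
 unfolding law_def
proof clarify
 fix U1 ph1 U2 ph2 x assume "(U1, ph1) \<in> \<A>" "(U2, ph2) \<in> \<A>" "x \<in> fst (U1, ph1)" "x \<in> fst (U2, ph2)"
 thus "chart_measure (V, ph) rh (U2, ph2) x = of_real (df (U1, ph1) (U2, ph2) x) * chart_measure (V, ph) rh (U1, ph1) x"
  using df_cocycle[OF c, of U1 ph1 U2 ph2 x] by (simp add: chart_measure_def)
qed

lemma chart_measure_tm:
 assumes c: "(V, ph) \<in> \<A>" and K: "compact K" "K <= V" "K <= W" and rh: "smooth B (ph ` V) rh"
  and z: "!!x. x \<in> V - K ==> rh (ph x) = 0"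
 shows "chart_measure (V, ph) rh \<in> test_measures B \<A> W"
proof (rule test_measureI[OF law_chart_measure[OF c] _ _ K(1,3)])
 have V: "open V" by (rule chart_open[OF c])
 have z': "chart_measure (V, ph) rh c' x = 0" if "x ~: K" for c' x
  using z that by (simp add: chart_measure_def)
 thus "chart_measure (V, ph) rh c' x = 0" if "x ~: K" for c' x using that .
 fix c' assume "c' \<in> \<A>"
 then obtain U' ph' where c': "(U', ph') \<in> \<A>" "c' = (U', ph')" by (cases c') auto
 have U': "open U'" by (rule chart_open[OF c'(1)])
 have "smooth_fun B \<A> (U' \<inter> V) (%x. of_real (df (V, ph) (U', ph') x) * rh (ph x))"
  using smooth_df[OF c c'(1)] smooth_fun_subset[OF smooth_fun_chart_comp[OF c V order_refl rh], of "U' \<inter> V"]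
  by (intro smooth_fun_mult open_Int U' V) (auto simp: Int_commute)
 thus "smooth_fun B \<A> (fst c') (chart_measure (V, ph) rh c')"
  unfolding c'(2) fst_conv
  by (rule smooth_fun_extend[OF U' K(1,2) V _ _ z']) (auto simp: chart_measure_def c'(1))
qed (auto simp: chart_measure_def)

end

section \<open>Pairings and transposes\<close>

lemma set_integral_sum_eq:
 fixes f :: "_ => _ => complex"
 assumes "!!i. i \<in> I ==> set_integrable M A (f i)"
 shows "(LINT x:A|M. \<Sum>i\<in>I. f i x) = (\<Sum>i\<in>I. LINT x:A|M. f i x)"
 unfolding set_lebesgue_integral_def scaleR_sum_right
 by (rule Bochner_Integration.integral_sum) (use assms in \<open>simp add: set_integrable_def\<close>)

lemma indicator_comp_borel:
 fixes k :: "'b::topological_space => complex"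
 assumes "A \<in> sets borel" "continuous_on A f" "k \<in> borel_measurable borel"
 shows "(%x. indicat_real A x *\<^sub>R k (f x)) \<in> borel_measurable borel"
 using measurable_compose[OF borel_measurable_continuous_on_restrict[OF assms(2)] assms(3)] assms(1)
 by (subst (asm) borel_measurable_restrict_space_iff) auto

context manifold
begin

lemma chart_comp_borel:
 fixes k :: "'m => complex"
 assumes c: "(U, ph) \<in> \<A>" and k: "k \<in> borel_measurable borel"
 shows "(%y. indicat_real (ph ` U) y *\<^sub>R k (inv_into U ph y)) \<in> borel_measurable borel"
 by (rule indicator_comp_borel[OF span_open_borel[OF chart_span_open[OF c]] chart_cont_inv[OF c] k])

lemma chart_image_borel:
 assumes c: "(U, ph) \<in> \<A>" and A: "A \<in> sets borel" "A <= U"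
 shows "ph ` A \<in> sets borel"
proof -
 have m: "inv_into U ph \<in> restrict_space borel (ph ` U) \<rightarrow>\<^sub>M borel"
  by (rule borel_measurable_continuous_on_restrict[OF chart_cont_inv[OF c]])
 have "ph ` A = inv_into U ph -` A \<inter> space (restrict_space borel (ph ` U))"
 proof (intro equalityI subsetI)
  fix y assume "y \<in> ph ` A"
  thus "y \<in> inv_into U ph -` A \<inter> space (restrict_space borel (ph ` U))"
   using A(2) c by (auto simp: space_restrict_space)
 next
  fix y assume y: "y \<in> inv_into U ph -` A \<inter> space (restrict_space borel (ph ` U))"
  hence "y \<in> ph ` U" "inv_into U ph y \<in> A" by (auto simp: space_restrict_space)
  thus "y \<in> ph ` A" by (metis f_inv_into_f imageI)
 qed
 hence "ph ` A \<in> sets (restrict_space borel (ph ` U))" using measurable_sets[OF m A(1)] by simp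
 thus ?thesis using span_open_borel[OF chart_span_open[OF c]] by (simp add: sets_restrict_space_iff)
qed

lemma chart_integral_change:
 assumes c: "(U, ph) \<in> \<A>" and d: "(V, ps) \<in> \<A>" and A: "A \<in> sets borel" "A <= U" "A <= V" and et: "law et"
  and i1: "set_integrable \<mu> (ph ` A) (%y. et (U, ph) (inv_into U ph y))"
  and i2: "set_integrable \<mu> (ps ` A) (%y. et (V, ps) (inv_into V ps y))"
 shows "(LINT y:ph ` A|\<mu>. et (U, ph) (inv_into U ph y)) = (LINT y:ps ` A|\<mu>. et (V, ps) (inv_into V ps y))"
proof -
 let ?ta = "%y. ph (inv_into V ps y)" and ?W = "ps ` (V \<inter> U)" and ?F = "%y. et (U, ph) (inv_into U ph y)"
 have W: "span_open B ?W" by (rule chart_image_Int_open[OF d chart_open[OF c]])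
 have img: "?ta ` ps ` A = ph ` A" using A(3) d by (force simp: image_image)
 have eq: "of_real \<bar>jacobian B ?ta y\<bar> * ?F (?ta y) = et (V, ps) (inv_into V ps y)" if y: "y \<in> ps ` A" for y
 proof -
  obtain a where a: "a \<in> A" "y = ps a" using y by blast
  hence "a \<in> U" "a \<in> V" using A by auto
  thus ?thesis using lawD[OF et c d, of a] c d by (simp add: a df_eq)
 qed
 have bm: "ps ` A \<in> sets borel" by (rule chart_image_borel[OF d A(1,3)])
 have "(LINT y:?ta ` ps ` A|\<mu>. ?F y) = (LINT x:ps ` A|\<mu>. of_real \<bar>jacobian B ?ta x\<bar> * ?F (?ta x))"
 proof (rule coord_change_of_variables[OF B_Basis W])
  show "smooth B ?W ?ta" by (rule chart_transition[OF d c])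
  have "?ta ` ?W <= ph ` U" using d by auto
  thus "?ta ` ?W <= span B" using span_open_subset[OF chart_span_open[OF c]] by blast
  show "inj_on ?ta ?W" using chart_inj[OF c] d by (auto simp: inj_on_def)
  show "ps ` A <= ?W" using A by auto
  show "set_integrable \<mu> (?ta ` ps ` A) ?F" unfolding img by (rule i1)
  show "set_integrable \<mu> (ps ` A) (%x. of_real \<bar>jacobian B ?ta x\<bar> * ?F (?ta x))"
   using i2 eq by (subst set_integrable_cong[OF refl refl eq]) auto
 qed (rule bm)
 also have "... = (LINT y:ps ` A|\<mu>. et (V, ps) (inv_into V ps y))"
  using bm eq by (intro set_lebesgue_integral_cong) auto
 finally show ?thesis unfolding img .
qed

lemma piece_sum:
 fixes N :: nat
 assumes c: "(U, ph) \<in> \<A>" and A: "A \<in> sets borel" "A <= U"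
  and A': "!!i. i < N ==> A' i \<in> sets borel" "disjoint_family_on A' {..<N}"
  and z: "!!x. x \<in> U ==> x ~: (\<Union>i<N. A' i) ==> et (U, ph) x = (0::complex)"
  and i: "set_integrable \<mu> (ph ` A) (%y. et (U, ph) (inv_into U ph y))"
 shows "(LINT y:ph ` A|\<mu>. et (U, ph) (inv_into U ph y)) =
  (\<Sum>i<N. LINT y:ph ` (A \<inter> A' i)|\<mu>. et (U, ph) (inv_into U ph y))"
  and "!!i. i < N ==> set_integrable \<mu> (ph ` (A \<inter> A' i)) (%y. et (U, ph) (inv_into U ph y))"
proof -
 let ?F = "%y. et (U, ph) (inv_into U ph y)"
 show si: "set_integrable \<mu> (ph ` (A \<inter> A' i)) ?F" if "i < N" for i
  by (rule set_integrable_subset[OF assms(7)]) (use chart_image_borel[OF c, of "A \<inter> A' i"] A A'(1)[OF that] in auto)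
 have eq: "indicat_real (ph ` A) y *\<^sub>R ?F y = (\<Sum>i<N. indicat_real (ph ` (A \<inter> A' i)) y *\<^sub>R ?F y)" for y
 proof (cases "y \<in> ph ` A")
  case False
  hence "y ~: ph ` (A \<inter> A' i)" for i by auto
  thus ?thesis using False by simp
 next
  case True
  then obtain a where a: "a \<in> A" "y = ph a" by blast
  have aU: "a \<in> U" using a A(2) by auto
  have mem: "y \<in> ph ` (A \<inter> A' i) \<longleftrightarrow> a \<in> A' i" for i
  proof
   assume "y \<in> ph ` (A \<inter> A' i)"
   then obtain a' where "a' \<in> A" "a' \<in> A' i" "ph a = ph a'" using a by auto
   thus "a \<in> A' i" using inj_onD[OF chart_inj[OF c], of a a'] aU A(2) by auto
  qed (use a in auto)
  show ?thesis
  proof (cases "EX i<N. a \<in> A' i")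
   case False
   hence "?F y = 0" using z[OF aU] c aU by (simp add: a(2))
   thus ?thesis by simp
  next
   case True
   then obtain i where i: "i < N" "a \<in> A' i" by blast
   have "a \<in> A' j \<longleftrightarrow> j = i" if "j < N" for j
    using disjoint_family_onD[OF A'(2), of i j] i that by auto
   hence "(\<Sum>i<N. indicat_real (ph ` (A \<inter> A' i)) y *\<^sub>R ?F y) = (\<Sum>j<N. if j = i then ?F y else 0)"
    by (intro sum.cong) (auto simp: indicator_def mem)
   thus ?thesis using i \<open>y \<in> ph ` A\<close> by simp
  qed
 qed
 show "(LINT y:ph ` A|\<mu>. ?F y) = (\<Sum>i<N. LINT y:ph ` (A \<inter> A' i)|\<mu>. ?F y)"
  unfolding set_lebesgue_integral_def eq
  by (rule Bochner_Integration.integral_sum) (use si in \<open>simp add: set_integrable_def\<close>)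
qed

text \<open>Two decompositions have a common refinement, on whose pieces both families of charts are
  available and the change of variables applies. Hence the description in
  \<open>measure_pairing\<close> determines its value.\<close>

lemma has_total_mass_unique:
 assumes et: "law et" and "has_total_mass B \<A> et z" "has_total_mass B \<A> et z'"
 shows "z = z'"
proof -
 obtain N :: nat and U ph A where 1: "!!j. j < N ==> (U j, ph j) \<in> \<A> & A j \<in> sets borel & A j <= U j &
    set_integrable \<mu> (ph j ` A j) (%y. et (U j, ph j) (inv_into (U j) (ph j) y))"
  "disjoint_family_on A {..<N}" "!!c x. c \<in> \<A> ==> x \<in> fst c ==> x ~: (\<Union>j<N. A j) ==> et c x = 0"
  "z = (\<Sum>j<N. LINT y:ph j ` A j|\<mu>. et (U j, ph j) (inv_into (U j) (ph j) y))"
  using assms(2) unfolding has_total_mass_def by blast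
 obtain N' :: nat and U' ph' A' where 2: "!!j. j < N' ==> (U' j, ph' j) \<in> \<A> & A' j \<in> sets borel & A' j <= U' j &
    set_integrable \<mu> (ph' j ` A' j) (%y. et (U' j, ph' j) (inv_into (U' j) (ph' j) y))"
  "disjoint_family_on A' {..<N'}" "!!c x. c \<in> \<A> ==> x \<in> fst c ==> x ~: (\<Union>j<N'. A' j) ==> et c x = 0"
  "z' = (\<Sum>j<N'. LINT y:ph' j ` A' j|\<mu>. et (U' j, ph' j) (inv_into (U' j) (ph' j) y))"
  using assms(3) unfolding has_total_mass_def by blast
 let ?I = "%j i. LINT y:ph j ` (A j \<inter> A' i)|\<mu>. et (U j, ph j) (inv_into (U j) (ph j) y)"
 let ?I' = "%i j. LINT y:ph' i ` (A' i \<inter> A j)|\<mu>. et (U' i, ph' i) (inv_into (U' i) (ph' i) y)"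
 have p: "(LINT y:ph j ` A j|\<mu>. et (U j, ph j) (inv_into (U j) (ph j) y)) = (\<Sum>i<N'. ?I j i)"
  "!!i. i < N' ==> set_integrable \<mu> (ph j ` (A j \<inter> A' i)) (%y. et (U j, ph j) (inv_into (U j) (ph j) y))" if "j < N" for j
  using piece_sum[of "U j" "ph j" "A j" N' A' et] 1(1)[OF that] 2(1,2) 2(3)[of "(U j, ph j)"] by auto
 have p': "(LINT y:ph' i ` A' i|\<mu>. et (U' i, ph' i) (inv_into (U' i) (ph' i) y)) = (\<Sum>j<N. ?I' i j)"
  "!!j. j < N ==> set_integrable \<mu> (ph' i ` (A' i \<inter> A j)) (%y. et (U' i, ph' i) (inv_into (U' i) (ph' i) y))" if "i < N'" for i
  using piece_sum[of "U' i" "ph' i" "A' i" N A et] 2(1)[OF that] 1(1,2) 1(3)[of "(U' i, ph' i)"] by auto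
 have "z = (\<Sum>j<N. \<Sum>i<N'. ?I j i)" unfolding 1(4) using p(1) by simp
 also have "... = (\<Sum>j<N. \<Sum>i<N'. ?I' i j)"
 proof (intro sum.cong refl)
  fix j i assume "j \<in> {..<N}" "i \<in> {..<N'}"
  hence ji: "j < N" "i < N'" by auto
  note a = 1(1)[OF ji(1)] 2(1)[OF ji(2)]
  show "?I j i = ?I' i j"
   unfolding Int_commute[of "A' i"]
   by (rule chart_integral_change[OF _ _ _ _ _ et p(2)[OF ji] p'(2)[OF ji(2,1), unfolded Int_commute[of "A' i"]]])
    (use a in auto)
 qed
 also have "... = (\<Sum>i<N'. \<Sum>j<N. ?I' i j)" by (rule sum.swap)
 also have "... = z'" unfolding 2(4) using p'(1) by simp
 finally show ?thesis .
qed

lemma pairing_chart: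
 assumes c: "(V, ph) \<in> \<A>" and om: "law om"
  and i: "set_integrable \<mu> (ph ` V) (%y. f (inv_into V ph y) * om (V, ph) (inv_into V ph y))"
  and z: "!!c x. c \<in> \<A> ==> x \<in> fst c ==> x ~: V ==> f x * om c x = 0"
 shows "measure_pairing B \<A> f om = (LINT y:ph ` V|\<mu>. f (inv_into V ph y) * om (V, ph) (inv_into V ph y))"
 unfolding measure_pairing_def
proof (rule the_equality)
 let ?et = "%c x. f x * om c x"
 show m: "has_total_mass B \<A> ?et (LINT y:ph ` V|\<mu>. f (inv_into V ph y) * om (V, ph) (inv_into V ph y))"
  unfolding has_total_mass_def
  by (rule exI[of _ "1::nat"], rule exI[of _ "%_. V"], rule exI[of _ "%_. ph"], rule exI[of _ "%_. V"])
   (use c i z chart_open[OF c] in \<open>auto simp: disjoint_family_on_def\<close>)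
 fix z assume "has_total_mass B \<A> ?et z"
 thus "z = (LINT y:ph ` V|\<mu>. f (inv_into V ph y) * om (V, ph) (inv_into V ph y))"
  using has_total_mass_unique[OF law_mult[OF om]] m by blast
qed

lemma chart_image_compact:
 assumes "(V, ph) \<in> \<A>" "compact K" "K <= V"
 shows "compact (ph ` K)" "ph ` K <= ph ` V" "!!y. y \<in> ph ` V - ph ` K ==> inv_into V ph y \<in> V - K"
 using compact_continuous_image[OF continuous_on_subset[OF chart_cont[OF assms(1)] assms(3)] assms(2)] assms
 by auto

lemma pairing_smooth:
 assumes c: "(V, ph) \<in> \<A>" and K: "compact K" "K <= V" and om: "law om" "smooth_fun B \<A> V (om (V, ph))"
  "!!c x. x ~: K ==> om c x = 0" and f: "smooth_fun B \<A> V f"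
 shows "measure_pairing B \<A> f om = (LINT y:ph ` V|\<mu>. f (inv_into V ph y) * om (V, ph) (inv_into V ph y))"
  and "set_integrable \<mu> (ph ` V) (%y. f (inv_into V ph y) * om (V, ph) (inv_into V ph y))"
proof -
 note ci = chart_image_compact[OF c K]
 show i: "set_integrable \<mu> (ph ` V) (%y. f (inv_into V ph y) * om (V, ph) (inv_into V ph y))"
  using smooth_fun_chart[OF f c] smooth_fun_chart[OF om(2) c] om(3) ci(3)
  by (intro set_integrable_coord_support[OF B_Basis ci(1,2)] continuous_intros) (auto dest: smooth_continuous)
 show "measure_pairing B \<A> f om = (LINT y:ph ` V|\<mu>. f (inv_into V ph y) * om (V, ph) (inv_into V ph y))"
  by (rule pairing_chart[OF c om(1) i]) (use om(3) K(2) in auto)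
qed

text \<open>Testing against the complex conjugate of the difference, cut off by a bump, gives the
  integral of a nonnegative continuous function. This separation provides the uniqueness behind
  \<open>transpose_operator\<close>.\<close>

lemma tm_separated:
 assumes U: "open U" and om: "om \<in> test_measures B \<A> U" "om' \<in> test_measures B \<A> U"
  and eq: "!!f. smooth_fun B \<A> U f ==> measure_pairing B \<A> f om = measure_pairing B \<A> f om'"
 shows "om = om'"
proof (intro ext)
 fix c x
 obtain K1 where K1: "compact K1" "K1 <= U" "!!c x. x ~: K1 ==> om c x = 0" using tm_supp[OF om(1)] by blast
 obtain K2 where K2: "compact K2" "K2 <= U" "!!c x. x ~: K2 ==> om' c x = 0" using tm_supp[OF om(2)] by blast
 show "om c x = om' c x"
 proof (cases "c \<in> \<A> & x \<in> fst c & x \<in> U")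
  case False
  thus ?thesis
   using tm_zero[OF om(1), of c x] tm_zero[OF om(2), of c x] K1(2) K1(3)[of x c] K2(2) K2(3)[of x c] by force
 next
  case True
  obtain V ph where V: "(V, ph) \<in> \<A>" "x \<in> V" "V <= U" using chart_in[OF U] True by blast
  have oV: "open V" by (rule chart_open[OF V(1)])
  define de where "de x = om (V, ph) x - om' (V, ph) x" for x
  have sw: "smooth_fun B \<A> V (om (V, ph))" "smooth_fun B \<A> V (om' (V, ph))"
   using tm_smooth[OF om(1) V(1)] tm_smooth[OF om(2) V(1)] by simp_all
  have sde: "smooth_fun B \<A> V de"
   unfolding de_def using smooth_fun_add[OF oV sw(1) smooth_fun_mult[OF oV smooth_fun_const[OF oV, of "-1"] sw(2)]] by simp
  have o: "span_open B (ph ` V)" by (rule chart_span_open[OF V(1)])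
  obtain w :: "'e => real" and L where w: "smooth B (span B) w" "compact L" "L <= ph ` V"
   "!!y. y \<in> span B - L ==> w y = 0" "!!y. 0 <= w y" "w (ph x) > 0"
   using bump_exists[OF B_Basis o, of "ph x"] V(2) by blast
  define K where "K = inv_into V ph ` L"
  have K: "compact K" "K <= V"
   unfolding K_def using w(2,3) V(1)
   by (auto intro!: compact_continuous_image continuous_on_subset[OF chart_cont_inv[OF V(1)]])
  have wz: "w (ph p) = 0" if "p \<in> V - K" for p
   using that w(4)[of "ph p"] V(1) span_open_subset[OF o] by (force simp: K_def)
  \<comment> \<open>This choice turns the difference of the two pairings into the integral of
    \<open>w\<close> times the squared modulus of \<open>de\<close>.\<close>
  define f where "f p = (if p \<in> V then of_real (w (ph p)) * cnj (de p) else 0)" for p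
  have sw2: "smooth B (ph ` V) (%y. of_real (w y) :: complex)"
   by (rule smooth_of_real[OF o smooth_subset[OF w(1) span_open_subset[OF o]]])
  have "smooth_fun B \<A> V (%p. of_real (w (ph p)) * cnj (de p))"
   by (intro smooth_fun_mult smooth_fun_cnj sde oV smooth_fun_chart_comp[OF V(1) oV order_refl sw2])
  hence fV: "smooth_fun B \<A> (U \<inter> V) (%p. of_real (w (ph p)) * cnj (de p))"
   by (rule smooth_fun_subset) simp
  have sf: "smooth_fun B \<A> U f"
   by (rule smooth_fun_extend[OF U K oV fV]) (use wz in \<open>auto simp: f_def\<close>)
  have fz: "f p = 0" if "p ~: K" for p using that wz by (auto simp: f_def)
  let ?g = "%om y. f (inv_into V ph y) * om (V, ph) (inv_into V ph y)"
  have ci: "compact (ph ` K)" "ph ` K <= ph ` V" "!!y. y \<in> ph ` V - ph ` K ==> inv_into V ph y \<in> V - K"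
   by (rule chart_image_compact[OF V(1) K], assumption?)+
  have cf: "continuous_on (ph ` V) (%y. f (inv_into V ph y))"
   using smooth_continuous[OF smooth_fun_chart[OF sf V(1)]] V(3) by (simp add: Int_absorb2)
  have int: "set_integrable \<mu> (ph ` V) (?g om)" "set_integrable \<mu> (ph ` V) (?g om')"
   using smooth_continuous[OF smooth_fun_chart[OF sw(1) V(1)]] smooth_continuous[OF smooth_fun_chart[OF sw(2) V(1)]] fz ci(3)
   by (auto intro!: set_integrable_coord_support[OF B_Basis ci(1,2)] continuous_intros cf)
  have "measure_pairing B \<A> f om = (LINT y:ph ` V|\<mu>. ?g om y)" "measure_pairing B \<A> f om' = (LINT y:ph ` V|\<mu>. ?g om' y)"
   by (rule pairing_chart[OF V(1) tm_law[OF om(1)] int(1)], simp add: f_def,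
     rule pairing_chart[OF V(1) tm_law[OF om(2)] int(2)], simp add: f_def)
  with eq[OF sf] have "(LINT y:ph ` V|\<mu>. ?g om y) - (LINT y:ph ` V|\<mu>. ?g om' y) = 0" by simp
  hence "(LINT y:ph ` V|\<mu>. ?g om y - ?g om' y) = 0" using set_integral_diff(2)[OF int] by simp
  define G where "G y = w y * (cmod (de (inv_into V ph y)))\<^sup>2" for y
  have Geq: "?g om y - ?g om' y = of_real (G y)" if y: "y \<in> ph ` V" for y
  proof -
   obtain p where p: "p \<in> V" "y = ph p" using y by blast
   have "?g om y - ?g om' y = of_real (w y) * (de p * cnj (de p))"
    using p V(1) by (simp add: f_def de_def algebra_simps)
   thus ?thesis using p V(1) by (simp add: G_def complex_norm_square[symmetric])
  qed
  have bo: "ph ` V \<in> sets borel" by (rule span_open_borel[OF o])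
  have "(LINT y:ph ` V|\<mu>. of_real (G y) :: complex) = 0"
   using \<open>(LINT y:ph ` V|\<mu>. ?g om y - ?g om' y) = 0\<close> Geq bo
   by (subst set_lebesgue_integral_cong[where g = "%y. ?g om y - ?g om' y"]) auto
  hence G0: "(LINT y:ph ` V|\<mu>. G y) = 0"
   by (simp only: set_integral_complex_of_real of_real_eq_0_iff)
  have "set_integrable \<mu> (ph ` V) (%y. of_real (G y) :: complex)"
   using set_integral_diff(1)[OF int] Geq by (subst set_integrable_cong[OF refl refl, where f' = "%y. ?g om y - ?g om' y"]) auto
  hence Gi: "set_integrable \<mu> (ph ` V) G"
   by (simp add: set_integrable_def scaleR_conv_of_real complex_of_real_integrable_eq flip: of_real_mult)
  have Gc: "continuous_on (ph ` V) G"
   unfolding G_def using smooth_continuous[OF smooth_fun_chart[OF sde V(1)]] continuous_on_subset[OF smooth_continuous[OF w(1)] span_open_subset[OF o]]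
   by (intro continuous_intros) auto
  have "G (ph x) = 0"
   by (rule coord_zero_integral[OF B_Basis o Gc _ Gi G0]) (use V(2) w(5) in \<open>auto simp: G_def\<close>)
  hence "om (V, ph) x = om' (V, ph) x" using w(6) V by (simp add: G_def de_def)
  moreover obtain U' ps where "c = (U', ps)" "(U', ps) \<in> \<A>" "x \<in> U'" using True by (cases c) auto
  ultimately show ?thesis
   using lawD[OF tm_law[OF om(1)] V(1), of U' ps x] lawD[OF tm_law[OF om(2)] V(1), of U' ps x] V(2) by simp
 qed
qed

section \<open>Transposes of differential operators in a chart\<close>

definition op_transpose :: "nat => ('e list => 'e => complex) => ('e => complex) => 'e => complex" where
 "op_transpose m a rh y =
  (\<Sum>bs | set bs <= B & length bs <= m. (-1) ^ length bs * ipd (rev bs) (%y. a bs y * rh y) y)"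

lemma iter_partial_zero_off:
 assumes "span_open B W" "compact K" "set bs <= B" "!!x. x \<in> W - K ==> u x = 0" "x \<in> W - K"
 shows "ipd bs u x = 0"
 using assms(3,5)
proof (induction bs arbitrary: x)
 case (Cons b bs)
 thus ?case using partial_zero_off[OF assms(1,2), of b "ipd bs u"] by simp
qed (use assms(4) in simp)

lemma smooth_op_transpose:
 assumes "span_open B W" "!!bs. set bs <= B ==> length bs <= m ==> smooth B W (a bs)" "smooth B W rh"
 shows "smooth B W (op_transpose m a rh)"
 unfolding op_transpose_def
 by (intro smooth_sum smooth_cmult smooth_iter_partial smooth_mult assms) auto

lemma op_transpose_zero:
 assumes "span_open B W" "compact K" "!!x. x \<in> W - K ==> rh x = 0" "x \<in> W - K"
 shows "op_transpose m a rh x = 0"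
proof -
 have "ipd (rev bs) (%y. a bs y * rh y) x = 0" if "set bs <= B" for bs
  by (rule iter_partial_zero_off[OF assms(1,2) _ _ assms(4)]) (use that assms(3) in auto)
 thus ?thesis by (simp add: op_transpose_def)
qed

lemma op_transpose_parts:
 assumes W: "span_open B W" and K: "compact K" "K <= W"
  and a: "!!bs. set bs <= B ==> length bs <= m ==> smooth B W (a bs)"
  and rh: "smooth B W rh" "!!x. x \<in> W - K ==> rh x = 0" and g: "smooth B W g"
 shows "(LINT y:W|\<mu>. (\<Sum>bs | set bs <= B & length bs <= m. a bs y * ipd bs g y) * rh y) =
  (LINT y:W|\<mu>. g y * op_transpose m a rh y)"
proof -
 let ?L = "{bs. set bs <= B & length bs <= m}"
 have sm: "smooth B W (%y. a bs y * rh y)" if "bs \<in> ?L" for bs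
  using that by (intro smooth_mult W a rh) auto
 have i1: "set_integrable \<mu> W (%y. ipd bs g y * (a bs y * rh y))" if "bs \<in> ?L" for bs
  using that rh(2)
  by (intro set_integrable_coord_support[OF B_Basis K] smooth_continuous[OF smooth_mult[OF W]] smooth_iter_partial[OF g] sm) auto
 have z: "ipd (rev bs) (%y. a bs y * rh y) x = 0" if "set bs <= B" "x \<in> W - K" for bs x
  by (rule iter_partial_zero_off[OF W K(1) _ _ that(2)]) (use that(1) rh(2) in auto)
 have i2: "set_integrable \<mu> W (%y. (-1) ^ length bs * (g y * ipd (rev bs) (%y. a bs y * rh y) y))" if "bs \<in> ?L" for bs
  using that z
  by (intro set_integrable_coord_support[OF B_Basis K] smooth_continuous[OF smooth_cmult[OF W]] smooth_mult[OF W g] smooth_iter_partial sm) auto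
 have "(\<Sum>bs\<in>?L. a bs y * ipd bs g y) * rh y = (\<Sum>bs\<in>?L. ipd bs g y * (a bs y * rh y))" for y
  unfolding sum_distrib_right by (intro sum.cong refl) (simp only: ac_simps)
 hence "(LINT y:W|\<mu>. (\<Sum>bs\<in>?L. a bs y * ipd bs g y) * rh y) =
   (LINT y:W|\<mu>. \<Sum>bs\<in>?L. ipd bs g y * (a bs y * rh y))"
  by (simp only:)
 also have "... = (\<Sum>bs\<in>?L. LINT y:W|\<mu>. ipd bs g y * (a bs y * rh y))"
  by (rule set_integral_sum_eq[OF i1])
 also have "... = (\<Sum>bs\<in>?L. LINT y:W|\<mu>. (-1) ^ length bs * (g y * ipd (rev bs) (%y. a bs y * rh y) y))"
 proof (intro sum.cong refl)
  fix bs assume bs: "bs \<in> ?L"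
  show "(LINT y:W|\<mu>. ipd bs g y * (a bs y * rh y)) =
   (LINT y:W|\<mu>. (-1) ^ length bs * (g y * ipd (rev bs) (%y. a bs y * rh y) y))"
   using coord_iter_parts[OF B_Basis W K _ g sm[OF bs]] bs rh(2) by simp
 qed
 also have "... = (LINT y:W|\<mu>. \<Sum>bs\<in>?L. (-1) ^ length bs * (g y * ipd (rev bs) (%y. a bs y * rh y) y))"
  by (rule set_integral_sum_eq[OF i2, symmetric])
 also have "... = (LINT y:W|\<mu>. g y * op_transpose m a rh y)"
  by (simp add: op_transpose_def sum_distrib_left mult_ac)
 finally show ?thesis .
qed

text \<open>Integration by parts shows that the formal transpose satisfies the description, and
  separation that nothing else does. Measures supported in one chart domain suffice because
  vanishing along \<open>S\<close> is a local property.\<close>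

lemma transpose_chart:
 assumes U: "open U" and c: "(V, ph) \<in> \<A>" "V <= U"
  and a: "!!bs. set bs <= B ==> length bs <= m ==> smooth B (ph ` V) (a bs)"
  and D: "!!f x. smooth_fun B \<A> U f ==> x \<in> V ==> D f x =
   (\<Sum>bs | set bs <= B & length bs <= m. a bs (ph x) * ipd bs (%y. f (inv_into V ph y)) (ph x))"
  and om: "om \<in> test_measures B \<A> U" and K: "compact K" "K <= V" "!!c x. x ~: K ==> om c x = 0"
 shows "transpose_operator B \<A> U D om =
  chart_measure (V, ph) (op_transpose m a (%y. om (V, ph) (inv_into V ph y)))"
proof -
 let ?rh = "%y. om (V, ph) (inv_into V ph y)"
 let ?om' = "chart_measure (V, ph) (op_transpose m a ?rh)"
 have oV: "open V" and W: "span_open B (ph ` V)" using c(1) chart_open chart_span_open by auto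
 have ci: "compact (ph ` K)" "ph ` K <= ph ` V" "!!y. y \<in> ph ` V - ph ` K ==> inv_into V ph y \<in> V - K"
  by (rule chart_image_compact[OF c(1) K(1,2)], assumption?)+
 have som: "smooth_fun B \<A> V (om (V, ph))" using tm_smooth[OF om c(1)] by simp
 have rh: "smooth B (ph ` V) ?rh" using smooth_fun_chart[OF som c(1)] by simp
 have rh0: "?rh y = 0" if "y \<in> ph ` V - ph ` K" for y using K(3) ci(3)[OF that] by simp
 have sT: "smooth B (ph ` V) (op_transpose m a ?rh)" by (rule smooth_op_transpose[OF W a rh])
 have T0: "op_transpose m a ?rh (ph x) = 0" if "x \<in> V - K" for x
 proof (rule op_transpose_zero[OF W ci(1) rh0])
  show "ph x \<in> ph ` V - ph ` K" using that inj_onD[OF chart_inj[OF c(1)]] K(2) by blast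
 qed
 have tm: "?om' \<in> test_measures B \<A> U"
  by (rule chart_measure_tm[OF c(1) K(1,2) _ sT T0]) (use K(2) c(2) in auto)
 have z': "?om' c x = 0" if "x ~: K" for c x using T0 that by (auto simp: chart_measure_def)
 have pair: "measure_pairing B \<A> (D f) om = measure_pairing B \<A> f ?om'" if f: "smooth_fun B \<A> U f" for f
 proof -
  let ?g = "%y. f (inv_into V ph y)"
  have fV: "smooth_fun B \<A> V f" by (rule smooth_fun_subset[OF f c(2)])
  have g: "smooth B (ph ` V) ?g" using smooth_fun_chart[OF fV c(1)] by simp
  let ?P = "%y. \<Sum>bs | set bs <= B & length bs <= m. a bs y * ipd bs ?g y"
  have P: "smooth B (ph ` V) ?P" by (intro smooth_sum smooth_mult smooth_iter_partial W a g) auto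
  have "smooth_fun B \<A> V (%x. ?P (ph x))" by (rule smooth_fun_chart_comp[OF c(1) oV order_refl P])
  hence DV: "smooth_fun B \<A> V (D f)" using smooth_fun_cong[OF oV, of "D f" "%x. ?P (ph x)"] D[OF f] by simp
  have bo: "ph ` V \<in> sets borel" by (rule span_open_borel[OF W])
  have "measure_pairing B \<A> (D f) om = (LINT y:ph ` V|\<mu>. D f (inv_into V ph y) * ?rh y)"
   by (rule pairing_smooth(1)[OF c(1) K(1,2) tm_law[OF om] som K(3) DV])
  also have "... = (LINT y:ph ` V|\<mu>. ?P y * ?rh y)"
   using bo D[OF f] c(1) by (intro set_lebesgue_integral_cong) auto
  also have "... = (LINT y:ph ` V|\<mu>. ?g y * op_transpose m a ?rh y)"
   by (rule op_transpose_parts[OF W ci(1,2) a rh rh0 g])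
  also have "... = (LINT y:ph ` V|\<mu>. ?g y * ?om' (V, ph) (inv_into V ph y))"
   using bo c(1) by (intro set_lebesgue_integral_cong) (auto simp: chart_measure_self)
  also have "... = measure_pairing B \<A> f ?om'"
   using tm_smooth[OF tm c(1)]
   by (intro pairing_smooth(1)[OF c(1) K(1,2) tm_law[OF tm] _ z' fV, symmetric]) simp
  finally show ?thesis .
 qed
 show ?thesis
  unfolding transpose_operator_def
 proof (rule the_equality)
  show "?om' \<in> test_measures B \<A> U & (ALL f. smooth_fun B \<A> U f --> measure_pairing B \<A> (D f) om = measure_pairing B \<A> f ?om')"
   using tm pair by blast
  fix om'' assume h: "om'' \<in> test_measures B \<A> U & (ALL f. smooth_fun B \<A> U f --> measure_pairing B \<A> (D f) om = measure_pairing B \<A> f om'')"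
  show "om'' = ?om'"
  proof (rule tm_separated[OF U conjunct1[OF h] tm])
   fix f :: "'m => complex" assume f: "smooth_fun B \<A> U f"
   show "measure_pairing B \<A> f om'' = measure_pairing B \<A> f ?om'"
    by (rule trans[OF sym[OF mp[OF spec[OF conjunct2[OF h]] f]] pair[OF f]])
  qed
 qed
qed

lemma Linf_locD:
 assumes "h \<in> Linf_loc B \<A> W" "compact K" "K <= W" "W \<in> sets borel"
 shows "(%x. indicat_real K x *\<^sub>R h x) \<in> borel_measurable borel"
  and "EX R. ALL U ph. (U, ph) \<in> \<A> --> (AE y in \<mu>. y \<in> ph ` (U \<inter> K) --> cmod (h (inv_into U ph y)) <= R)"
proof -
 have "h \<in> borel_measurable (restrict_space borel W)" using assms(1) by (simp add: Linf_loc_def)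
 hence 1: "(%x. indicat_real W x *\<^sub>R h x) \<in> borel_measurable borel"
  using assms(4) by (subst (asm) borel_measurable_restrict_space_iff) auto
 have 2: "(%x. indicat_real K x *\<^sub>R h x) = (%x. indicat_real K x *\<^sub>R (indicat_real W x *\<^sub>R h x))"
  using assms(3) by (auto simp: indicator_def fun_eq_iff)
 show "(%x. indicat_real K x *\<^sub>R h x) \<in> borel_measurable borel"
  unfolding 2 using compact_imp_closed[OF assms(2)]
  by (intro borel_measurable_scaleR borel_measurable_indicator 1) simp
 show "EX R. ALL U ph. (U, ph) \<in> \<A> --> (AE y in \<mu>. y \<in> ph ` (U \<inter> K) --> cmod (h (inv_into U ph y)) <= R)"
 proof -
  obtain R where "ALL (U, ph):\<A>. AE y in \<mu>. y \<in> ph ` (U \<inter> K) --> cmod (h (inv_into U ph y)) <= R"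
   using assms(1-3) unfolding Linf_loc_def by blast
  thus ?thesis by (intro exI[of _ R]) auto
 qed
qed

lemma set_integrable_Linf:
 assumes c: "(V, ph) \<in> \<A>" and K: "compact K" "K <= V" and hm: "(%x. indicat_real K x *\<^sub>R h x) \<in> borel_measurable borel"
  and R: "AE y in \<mu>. y \<in> ph ` K --> cmod (h (inv_into V ph y)) <= R"
  and g: "continuous_on (ph ` V) g" "!!y. y \<in> ph ` V - ph ` K ==> g y = 0"
 shows "set_integrable \<mu> (ph ` V) (%y. h (inv_into V ph y) * g y)"
proof -
 have ci: "compact (ph ` K)" "ph ` K <= ph ` V" "!!y. y \<in> ph ` V - ph ` K ==> inv_into V ph y \<in> V - K"
  by (rule chart_image_compact[OF c K], assumption?)+
 have bo: "ph ` V \<in> sets borel" by (rule span_open_borel[OF chart_span_open[OF c]])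
 have "bounded (g ` ph ` K)"
  by (intro compact_imp_bounded compact_continuous_image continuous_on_subset[OF g(1)] ci)
 then obtain M where M: "!!y. y \<in> ph ` K ==> cmod (g y) <= M" unfolding bounded_iff by blast
 have eq: "indicat_real (ph ` V) y *\<^sub>R (h (inv_into V ph y) * g y) =
  (indicat_real (ph ` V) y *\<^sub>R (indicat_real K (inv_into V ph y) *\<^sub>R h (inv_into V ph y))) * (indicat_real (ph ` V) y *\<^sub>R g y)" for y
 proof (cases "y \<in> ph ` V - ph ` K")
  case False
  thus ?thesis using K(2) c by (auto simp: indicator_def)
 qed (simp add: g(2))
 have meas: "(%y. indicat_real (ph ` V) y *\<^sub>R (h (inv_into V ph y) * g y)) \<in> borel_measurable borel"
  unfolding eq
  by (intro borel_measurable_times chart_comp_borel[OF c hm] borel_measurable_continuous_on_indicator[OF bo g(1)])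
 show ?thesis
  unfolding set_integrable_def
 proof (rule integrableI_bounded_set[where A = "ph ` K" and B = "R * M"])
  show "ph ` K \<in> sets \<mu>" using compact_imp_closed[OF ci(1)] by simp
  thus "emeasure \<mu> (ph ` K) < \<infinity>"
   by (intro emeasure_coord_bounded[OF B_Basis compact_imp_bounded[OF ci(1)]]) simp
  show "AE y in \<mu>. y \<in> ph ` K --> norm (indicat_real (ph ` V) y *\<^sub>R (h (inv_into V ph y) * g y)) <= R * M"
   using R
  proof eventually_elim
   case (elim y)
   show ?case
   proof
    assume y: "y \<in> ph ` K"
    have "norm (h (inv_into V ph y) * g y) <= R * M"
     unfolding norm_mult using elim y M[OF y] by (intro mult_mono') auto
    thus "norm (indicat_real (ph ` V) y *\<^sub>R (h (inv_into V ph y) * g y)) <= R * M"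
     using y ci(2) by (auto simp: indicator_def)
   qed
  qed
  show "AE y in \<mu>. y ~: ph ` K --> indicat_real (ph ` V) y *\<^sub>R (h (inv_into V ph y) * g y) = 0"
   using g(2) by (auto simp: indicator_def)
 qed (use meas in simp)
qed

text \<open>The bridge from the abstract pairing to an ordinary integral over coordinates; later
  statements about \<open>fDh_distribution\<close> all pass through it.\<close>

lemma fDh_chart:
 assumes U: "open U" and c: "(V, ph) \<in> \<A>" "V <= U"
  and a: "!!bs. set bs <= B ==> length bs <= m ==> smooth B (ph ` V) (a bs)"
  and D: "!!f x. smooth_fun B \<A> U f ==> x \<in> V ==> D f x =
   (\<Sum>bs | set bs <= B & length bs <= m. a bs (ph x) * ipd bs (%y. f (inv_into V ph y)) (ph x))"
  and f: "smooth_fun B \<A> U f" and h: "h \<in> Linf_loc B \<A> U"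
  and om: "om \<in> test_measures B \<A> U" and K: "compact K" "K <= V" "!!c x. x ~: K ==> om c x = 0"
 shows "fDh_distribution B \<A> U f D h om =
  (LINT y:ph ` V|\<mu>. h (inv_into V ph y) * op_transpose m a (%y. f (inv_into V ph y) * om (V, ph) (inv_into V ph y)) y)"
proof -
 let ?rh = "%y. f (inv_into V ph y) * om (V, ph) (inv_into V ph y)"
 let ?om' = "chart_measure (V, ph) (op_transpose m a ?rh)"
 have oV: "open V" and W: "span_open B (ph ` V)" using c(1) chart_open chart_span_open by auto
 have ci: "compact (ph ` K)" "ph ` K <= ph ` V" "!!y. y \<in> ph ` V - ph ` K ==> inv_into V ph y \<in> V - K"
  by (rule chart_image_compact[OF c(1) K(1,2)], assumption?)+
 have fom: "(%c x. f x * om c x) \<in> test_measures B \<A> U" by (rule tm_mult[OF om U f])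
 have rh: "smooth B (ph ` V) ?rh"
  using smooth_fun_chart[OF tm_smooth[OF fom c(1)] c(1)] by simp
 have rh0: "?rh y = 0" if "y \<in> ph ` V - ph ` K" for y using K(3) ci(3)[OF that] by simp
 have sT: "smooth B (ph ` V) (op_transpose m a ?rh)" by (rule smooth_op_transpose[OF W a rh])
 have T0: "op_transpose m a ?rh y = 0" if "y \<in> ph ` V - ph ` K" for y
  by (rule op_transpose_zero[OF W ci(1) rh0 that])
 obtain R where R: "AE y in \<mu>. y \<in> ph ` (V \<inter> K) --> cmod (h (inv_into V ph y)) <= R"
  using Linf_locD(2)[OF h K(1)] K(2) c U by force
 have int: "set_integrable \<mu> (ph ` V) (%y. h (inv_into V ph y) * op_transpose m a ?rh y)"
  using Linf_locD(1)[OF h K(1)] K(2) c(2) U R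
  by (intro set_integrable_Linf[OF c(1) K(1,2) _ _ smooth_continuous[OF sT] T0]) (auto simp: Int_absorb1)
 have cm: "?om' (V, ph) (inv_into V ph y) = op_transpose m a ?rh y" if "y \<in> ph ` V" for y
  using that c(1) by (auto simp: chart_measure_self)
 have "transpose_operator B \<A> U D (%c x. f x * om c x) = ?om'"
  by (rule transpose_chart[OF U c a D fom K(1,2)]) (simp_all add: K(3))
 hence "fDh_distribution B \<A> U f D h om = measure_pairing B \<A> h ?om'" by (simp add: fDh_distribution_def)
 also have "... = (LINT y:ph ` V|\<mu>. h (inv_into V ph y) * ?om' (V, ph) (inv_into V ph y))"
  by (rule pairing_chart[OF c(1) law_chart_measure[OF c(1)]])
   (use int cm in \<open>auto simp: chart_measure_def cong: set_integrable_cong\<close>)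
 also have "... = (LINT y:ph ` V|\<mu>. h (inv_into V ph y) * op_transpose m a ?rh y)"
  using span_open_borel[OF W] cm by (intro set_lebesgue_integral_cong) auto
 finally show ?thesis .
qed

end

section \<open>Product coordinates\<close>

lemma bounded_linear_Pair0: "bounded_linear (%y. (0, y))" "bounded_linear (%x. (x, 0))"
 by (intro bounded_linear_Pair bounded_linear_zero bounded_linear_ident)+

lemma smooth_Pair:
 assumes "span_open B W" "smooth B W f" "smooth B W g"
 shows "smooth B W (%x. (f x, g x))"
proof -
 have "smooth B W (%x. (f x, 0) + (0, g x))"
  by (intro smooth_add assms(1) smooth_linear_comp[OF bounded_linear_Pair0(1)]
    smooth_linear_comp[OF bounded_linear_Pair0(2)] assms(2,3))
 thus ?thesis by simp
qed

lemma prod_basis_Basis: "C <= Basis ==> B <= Basis ==> prod_basis C B <= Basis"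
 by (auto simp: prod_basis_def Basis_prod_def)

lemma span_prod_basis:
 assumes "C <= Basis" "B <= Basis"
 shows "span (prod_basis C B) = span C \<times> span B"
proof -
 have "x \<in> span (prod_basis C B) \<longleftrightarrow> fst x \<in> span C & snd x \<in> span B" for x :: "'a \<times> 'b"
  unfolding span_Basis_eq[OF prod_basis_Basis[OF assms]] span_Basis_eq[OF assms(1)] span_Basis_eq[OF assms(2)]
 proof -
  have nz: "(0::'a) ~: Basis" "(0::'b) ~: Basis" by auto
  have "Basis - prod_basis C B = (%u. (u, 0)) ` (Basis - C) \<union> (%v. (0, v)) ` (Basis - B)"
   using nz by (auto simp: prod_basis_def Basis_prod_def)
  thus "(ALL b:Basis - prod_basis C B. x \<bullet> b = 0) \<longleftrightarrow> (ALL b:Basis - C. fst x \<bullet> b = 0) & (ALL b:Basis - B. snd x \<bullet> b = 0)"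
   by (auto simp: inner_prod_def ball_Un)
 qed
 thus ?thesis by (auto simp: mem_Times_iff)
qed

lemma span_open_Times:
 assumes "C <= Basis" "B <= Basis" "span_open C X" "span_open B Y"
 shows "span_open (prod_basis C B) (X \<times> Y)"
 unfolding span_prod_basis[OF assms(1,2)] using openin_Times[OF assms(3,4)] .

lemma Pair0_in_prod_basis: "b \<in> B ==> (0, b) \<in> prod_basis C B"
 by (simp add: prod_basis_def)

text \<open>Derivatives in the directions \<open>(0, b)\<close> do not move the first coordinate.
  This lets smoothness in both variables be used together with operators that act for a fixed group
  element.\<close>

lemma iter_partial_slice:
 "ipd (map (Pair 0) bs) F (s, y) = ipd bs (%y. F (s, y)) y"
 by (induction bs arbitrary: y) (simp_all add: partial_deriv_def)

lemma partial_slice: "pd (0, b) F (s, y) = pd b (%y. F (s, y)) y"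
 using iter_partial_slice[of "[b]" F s y] by simp

lemma smooth_slice:
 fixes C :: "'a::euclidean_space set" and B :: "'e::euclidean_space set"
 assumes "C <= Basis" "B <= Basis" "span_open (prod_basis C B) W" "smooth (prod_basis C B) W F" "s \<in> span C"
 shows "span_open B {y. (s, y) \<in> W}" "smooth B {y. (s, y) \<in> W} (%y. F (s, y))"
proof -
 have "{y. (s, y) \<in> W} = span B \<inter> Pair s -` W"
  using span_open_subset[OF assms(3)] span_prod_basis[OF assms(1,2)] by auto
 moreover have "span_open B (span B \<inter> Pair s -` W)"
  by (rule span_open_preimage[OF _ _ _ assms(3)])
   (use assms(5) in \<open>auto simp: span_prod_basis[OF assms(1,2)] intro!: continuous_intros\<close>)
 ultimately show o: "span_open B {y. (s, y) \<in> W}" by simp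
 show "smooth B {y. (s, y) \<in> W} (%y. F (s, y))"
  by (rule smooth_compose[OF prod_basis_Basis[OF assms(1,2)] o assms(3) _ smooth_Pair[OF o smooth_const[OF o] smooth_ident[OF o]] assms(4)]) auto
qed

lemma smooth_fst_snd:
 assumes "span_open (prod_basis C B) W"
 shows "smooth (prod_basis C B) W fst" "smooth (prod_basis C B) W snd"
 by (intro smooth_bounded_linear bounded_linear_fst bounded_linear_snd assms)+

section \<open>Joint coordinates of the group and the manifold\<close>

locale equivariant = manifold B \<A> + G: manifold C \<H>
 for B :: "'e::euclidean_space set" and \<A> :: "('m::{t2_space, second_countable_topology}, 'e) chart set"
  and C :: "'a::euclidean_space set" and \<H> :: "('h::{t2_space, second_countable_topology}, 'a) chart set" +
 fixes H :: "'h monoid" and act :: "'h => 'm => 'm" and r :: nat and \<pi> :: "'b => 'm"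
  and \<T> :: "('m, 'b) triv set" and lift :: "'h => 'b => 'b"
 assumes Lie: "Lie_group C \<H> H" and action: "smooth_action C \<H> H B \<A> act"
  and eqv: "equivariant_bundle C \<H> H B \<A> act r \<pi> \<T> lift"
begin

abbreviation "PB == prod_basis C B"
abbreviation ginv :: "'h => 'h" where "ginv h == inv\<^bsub>H\<^esub> h"

lemma PB_Basis: "PB <= Basis"
 by (rule prod_basis_Basis[OF G.B_Basis B_Basis])

lemma carrier_UNIV [simp]: "carrier H = UNIV" and group_H: "group H"
 using Lie by (simp_all add: Lie_group_def)

lemma act_inv [simp]: "act (ginv h) (act h x) = x" "act h (act (ginv h) x) = x" "ginv (ginv h) = h"
proof -
 interpret group_action H UNIV act using action by (simp add: smooth_action_def)
 interpret group H by (rule group_H)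
 show "ginv (ginv h) = h" by simp
 thus "act (ginv h) (act h x) = x" "act h (act (ginv h) x) = x"
  using orbit_sym_aux[of h x "act h x"] orbit_sym_aux[of "ginv h" x "act (ginv h) x"] by simp_all
qed

lemma lift_inv [simp]: "lift (ginv h) (lift h e) = e" "lift h (lift (ginv h) e) = e"
proof -
 interpret group_action H UNIV lift using eqv by (simp add: equivariant_bundle_def)
 interpret group H by (rule group_H)
 have "ginv (ginv h) = h" by simp
 thus "lift (ginv h) (lift h e) = e" "lift h (lift (ginv h) e) = e"
  using orbit_sym_aux[of h e "lift h e"] orbit_sym_aux[of "ginv h" e "lift (ginv h) e"] by simp_all
qed

lemma pi_lift [simp]: "\<pi> (lift h e) = act h (\<pi> e)"
 using eqv by (simp add: equivariant_bundle_def)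

lemma cont_act: "continuous_on A (%p. act (fst p) (snd p))"
proof -
 have "continuous_on UNIV (%p. act (fst p) (snd p))"
  using action by (simp add: smooth_action_def smooth_map_def case_prod_unfold)
 thus ?thesis by (rule continuous_on_subset) simp
qed

lemma cont_act_comp: "continuous_on A f ==> continuous_on A g ==> continuous_on A (%x. act (f x) (g x))"
 using continuous_on_compose2[OF cont_act[of UNIV], of A "%x. (f x, g x)"] continuous_on_Pair by auto

lemma cont_ginv: "continuous_on A f ==> continuous_on A (%x. ginv (f x))"
proof -
 have "continuous_on UNIV (%h. ginv h)" using Lie by (simp add: Lie_group_def smooth_map_def)
 thus "continuous_on A f ==> continuous_on A (%x. ginv (f x))" by (rule continuous_on_compose2) auto
qed

lemma open_act_vimage: "open V ==> open {p. act (fst p) (snd p) \<in> V}"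
 using open_vimage[OF _ cont_act[of UNIV]] by (simp add: vimage_def)

lemma open_act_inv_vimage: "open V ==> open {p. act (ginv (fst p)) (snd p) \<in> V}"
 using open_vimage[of V "%p. act (ginv (fst p)) (snd p)"]
 by (simp add: vimage_def cont_act_comp cont_ginv continuous_on_fst continuous_on_snd continuous_on_id)

lemma open_act_fixed: "open V ==> open {x. act h x \<in> V}"
 using open_vimage[of V "act h"] cont_act_comp[OF continuous_on_const continuous_on_id, of UNIV h]
 by (simp add: vimage_def)

lemma joint_image_open:
 assumes c: "(Q, th) \<in> \<H>" "(U, ph) \<in> \<A>" and W: "open W" "W <= Q \<times> U"
 shows "span_open PB (map_prod th ph ` W)"
proof -
 let ?i = "%p. (inv_into Q th (fst p), inv_into U ph (snd p))"
 have o: "span_open PB (th ` Q \<times> ph ` U)"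
  by (intro span_open_Times G.B_Basis B_Basis G.chart_span_open[OF c(1)] chart_span_open[OF c(2)])
 have "continuous_on (th ` Q \<times> ph ` U) ?i"
  by (intro continuous_on_Pair continuous_on_compose2[OF G.chart_cont_inv[OF c(1)]]
    continuous_on_compose2[OF chart_cont_inv[OF c(2)]] continuous_intros) auto
 hence "openin (top_of_set (th ` Q \<times> ph ` U)) ((th ` Q \<times> ph ` U) \<inter> ?i -` W)"
  by (rule continuous_openin_preimage_gen[OF _ W(1)])
 moreover have "(th ` Q \<times> ph ` U) \<inter> ?i -` W = map_prod th ph ` W"
 proof (intro equalityI subsetI)
  fix p assume p: "p \<in> (th ` Q \<times> ph ` U) \<inter> ?i -` W"
  hence "p = map_prod th ph (?i p)" by (cases p) (auto simp: c G.chart_inv[OF c(1)])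
  thus "p \<in> map_prod th ph ` W" using p by blast
 next
  fix p assume "p \<in> map_prod th ph ` W"
  then obtain h x where "(h, x) \<in> W" "p = (th h, ph x)" by auto
  moreover hence "h \<in> Q" "x \<in> U" using W(2) by auto
  ultimately show "p \<in> (th ` Q \<times> ph ` U) \<inter> ?i -` W" using c by simp
 qed
 ultimately show ?thesis using o openin_trans by metis
qed

lemma joint_inv:
 assumes c: "(Q, th) \<in> \<H>" "(U, ph) \<in> \<A>" and hx: "h \<in> Q" "x \<in> U"
 shows "inv_into (Q \<times> U) (map_prod th ph) (th h, ph x) = (h, x)"
proof -
 have "inj_on (map_prod th ph) (Q \<times> U)"
  by (rule map_prod_inj_on[OF G.chart_inj[OF c(1)] chart_inj[OF c(2)]])
 from inv_into_f_f[OF this, of "(h, x)"] show ?thesis using hx by simp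
qed

lemma joint_coords:
 assumes F: "smooth_fun PB (prod_atlas \<H> \<A>) W F" and c: "(Q, th) \<in> \<H>" "(U, ph) \<in> \<A>" and W: "open W"
 shows "smooth PB (map_prod th ph ` (Q \<times> U \<inter> W)) (%p. F (inv_into Q th (fst p), inv_into U ph (snd p)))"
proof -
 have "(Q \<times> U, map_prod th ph) \<in> prod_atlas \<H> \<A>" using c by (auto simp: prod_atlas_def)
 hence 1: "smooth PB (map_prod th ph ` (Q \<times> U \<inter> W)) (F \<circ> inv_into (Q \<times> U) (map_prod th ph))"
  using F unfolding smooth_fun_def by blast
 have o: "span_open PB (map_prod th ph ` (Q \<times> U \<inter> W))"
  by (rule joint_image_open[OF c]) (use W G.chart_open[OF c(1)] chart_open[OF c(2)] in \<open>auto intro: open_Times\<close>)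
 have eq: "(F \<circ> inv_into (Q \<times> U) (map_prod th ph)) p = F (inv_into Q th (fst p), inv_into U ph (snd p))"
  if p: "p \<in> map_prod th ph ` (Q \<times> U \<inter> W)" for p
 proof -
  obtain h x where "h \<in> Q" "x \<in> U" "p = (th h, ph x)" using p by auto
  thus ?thesis using joint_inv[OF c, of h x] chart_inv[OF c(2), of x] G.chart_inv[OF c(1), of h] by simp
 qed
 have "smooth PB (map_prod th ph ` (Q \<times> U \<inter> W)) (F \<circ> inv_into (Q \<times> U) (map_prod th ph)) \<longleftrightarrow>
   smooth PB (map_prod th ph ` (Q \<times> U \<inter> W)) (%p. F (inv_into Q th (fst p), inv_into U ph (snd p)))"
  by (rule smooth_cong[OF o]) (rule eq)
 thus ?thesis using 1 by (rule iffD1)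
qed

lemma act_coords:
 assumes c: "(Q, th) \<in> \<H>" "(U, ph) \<in> \<A>" and d: "(V, ps) \<in> \<A>"
 shows "smooth PB (map_prod th ph ` (Q \<times> U \<inter> {p. act (fst p) (snd p) \<in> V}))
  (%p. ps (act (inv_into Q th (fst p)) (inv_into U ph (snd p))))"
proof -
 have "smooth_map PB (prod_atlas \<H> \<A>) \<A> (%(h, x). act h x)" using action by (simp add: smooth_action_def)
 hence "smooth_fun PB (prod_atlas \<H> \<A>) ((%(h, x). act h x) -` V) (ps \<circ> (%(h, x). act h x))"
  using d by (auto simp: smooth_map_def)
 moreover have "(%(h, x). act h x) -` V = {p. act (fst p) (snd p) \<in> V}" by auto
 ultimately show ?thesis
  using joint_coords[OF _ c open_act_vimage[OF chart_open[OF d]]] by fastforce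
qed

lemma inv_coords:
 assumes c: "(Q, th) \<in> \<H>" and d: "(Q', th') \<in> \<H>"
 shows "span_open C (th ` (Q \<inter> {h. ginv h \<in> Q'}))"
  "smooth C (th ` (Q \<inter> {h. ginv h \<in> Q'})) (%s. th' (ginv (inv_into Q th s)))"
proof -
 have o: "open {h. ginv h \<in> Q'}"
  using open_vimage[OF G.chart_open[OF d] cont_ginv[OF continuous_on_id]] by (simp add: vimage_def)
 show "span_open C (th ` (Q \<inter> {h. ginv h \<in> Q'}))" by (rule G.chart_image_Int_open[OF c o])
 have "smooth_fun C \<H> ((%h. ginv h) -` Q') (th' \<circ> (%h. ginv h))"
  using Lie d by (auto simp: Lie_group_def smooth_map_def)
 thus "smooth C (th ` (Q \<inter> {h. ginv h \<in> Q'})) (%s. th' (ginv (inv_into Q th s)))"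
  using G.smooth_fun_chart[OF _ c] by (fastforce simp: vimage_def o_def)
qed

lemma joint_open: "(Q, th) \<in> \<H> ==> (U, ph) \<in> \<A> ==> open W ==> open (Q \<times> U \<inter> W)"
 by (intro open_Int open_Times G.chart_open chart_open)

text \<open>Inversion followed by the action. A chart of the group around the inverse of the given
  element has to be chosen, so smoothness is checked locally.\<close>

lemma act_inv_coords:
 assumes c: "(Q, th) \<in> \<H>" "(U, ph) \<in> \<A>" and d: "(V, ps) \<in> \<A>"
 shows "smooth PB (map_prod th ph ` (Q \<times> U \<inter> {p. act (ginv (fst p)) (snd p) \<in> V}))
  (%p. ps (act (ginv (inv_into Q th (fst p))) (inv_into U ph (snd p))))" (is "smooth PB ?X ?F")
proof (rule smooth_local)
 have oV: "open {p. act (ginv (fst p)) (snd p) \<in> V}" by (rule open_act_inv_vimage[OF chart_open[OF d]])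
 have X: "span_open PB ?X" by (rule joint_image_open[OF c joint_open[OF c oV]]) auto
 show "?X <= span PB" by (rule span_open_subset[OF X])
 fix p assume "p \<in> ?X"
 then obtain h x where hx: "h \<in> Q" "x \<in> U" "act (ginv h) x \<in> V" "p = (th h, ph x)" by auto
 obtain Q' th' where c': "(Q', th') \<in> \<H>" "ginv h \<in> Q'" using G.chart_ex by blast
 let ?I = "th ` (Q \<inter> {h. ginv h \<in> Q'})"
 \<comment> \<open>Restricts to group elements whose inverses lie in the domain of the second group
   chart.\<close>
 define Y where "Y = ?X \<inter> (?I \<times> span B)"
 have Y: "span_open PB Y" unfolding Y_def
  by (intro openin_Int X span_open_Times G.B_Basis B_Basis inv_coords(1)[OF c(1) c'(1)]) simp
 let ?g = "%p. (th' (ginv (inv_into Q th (fst p))), snd p)"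
 let ?Z = "map_prod th' ph ` (Q' \<times> U \<inter> {p. act (fst p) (snd p) \<in> V})"
 have Z: "span_open PB ?Z"
  by (rule joint_image_open[OF c'(1) c(2) joint_open[OF c'(1) c(2) open_act_vimage[OF chart_open[OF d]]]]) auto
 have fY: "fst q \<in> ?I" if "q \<in> Y" for q using that unfolding Y_def by (simp only: Int_iff mem_Times_iff)
 have g: "smooth PB Y ?g"
 proof (rule smooth_Pair[OF Y _ smooth_fst_snd(2)[OF Y]])
  show "smooth PB Y (%p. th' (ginv (inv_into Q th (fst p))))"
   by (rule smooth_compose[OF G.B_Basis Y inv_coords(1)[OF c(1) c'(1)] _ smooth_fst_snd(1)[OF Y] inv_coords(2)[OF c(1) c'(1)]])
    (use fY in blast)
 qed
 have gY: "?g q \<in> ?Z & ?F q = ps (act (inv_into Q' th' (fst (?g q))) (inv_into U ph (snd (?g q))))" if "q \<in> Y" for q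
 proof -
  from that obtain h' x' where q: "q = (th h', ph x')" "h' \<in> Q" "x' \<in> U" "act (ginv h') x' \<in> V" by (auto simp: Y_def)
  moreover have "ginv h' \<in> Q'"
   using that q inj_onD[OF G.chart_inj[OF c(1)]] by (auto simp: Y_def)
  ultimately show ?thesis
   using c(1) c'(1) by (auto intro!: image_eqI[of _ _ "(ginv h', x')"])
 qed
 have gZ: "?g ` Y <= ?Z" by (rule image_subsetI) (rule conjunct1[OF gY])
 have 1: "smooth PB Y (%p. ps (act (inv_into Q' th' (fst (?g p))) (inv_into U ph (snd (?g p)))))"
  by (rule smooth_compose[OF PB_Basis Y Z gZ g act_coords[OF c'(1) c(2) d]])
 have "smooth PB Y ?F \<longleftrightarrow> smooth PB Y (%p. ps (act (inv_into Q' th' (fst (?g p))) (inv_into U ph (snd (?g p)))))"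
  by (rule smooth_cong[OF Y]) (rule conjunct2[OF gY])
 hence "smooth PB Y ?F" using 1 by (rule iffD2)
 moreover have "p \<in> Y"
 proof -
  have "fst p \<in> ?I" using hx c'(2) by auto
  moreover have "snd p \<in> span B" using hx span_open_subset[OF chart_span_open[OF c(2)]] by auto
  ultimately show ?thesis using \<open>p \<in> ?X\<close> unfolding Y_def by (simp only: Int_iff mem_Times_iff)
 qed
 ultimately show "EX W'. p \<in> W' & span_open PB W' & smooth PB W' ?F" using Y by (intro exI[of _ Y] conjI)
qed

lemma slice_fun:
 assumes F: "smooth_fun PB (prod_atlas \<H> \<A>) W F" and W: "open W"
 shows "smooth_fun B \<A> {x. (h, x) \<in> W} (%x. F (h, x))"
proof (rule smooth_funI)
 show o: "open {x. (h, x) \<in> W}"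
  using open_vimage[OF W, of "Pair h"] by (simp add: vimage_def continuous_on_Pair continuous_on_const continuous_on_id)
 fix p assume p: "p \<in> {x. (h, x) \<in> W}"
 obtain Q th where c: "(Q, th) \<in> \<H>" "h \<in> Q" using G.chart_ex by blast
 obtain U ph where d: "(U, ph) \<in> \<A>" "p \<in> U" using chart_ex by blast
 let ?V = "U \<inter> {x. (h, x) \<in> W}"
 have oV: "open ?V" using chart_open[OF d(1)] o by auto
 let ?X = "map_prod th ph ` (Q \<times> U \<inter> W)"
 have X: "span_open PB ?X" by (rule joint_image_open[OF c(1) d(1) joint_open[OF c(1) d(1) W]]) auto
 have "th h \<in> span C" using c G.chart_span_open[OF c(1)] span_open_subset by blast
 note sl = smooth_slice[OF G.B_Basis B_Basis X joint_coords[OF F c(1) d(1) W] this]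
 have sub: "ph ` ?V <= {y. (th h, y) \<in> ?X}" using c by auto
 have "smooth B (ph ` ?V) (%y. F (h, inv_into U ph y))"
  using smooth_subset[OF sl(2) sub] c G.chart_inv[OF c(1)] by simp
 thus "EX U ph V. (U, ph) \<in> \<A> & open V & p \<in> V & V <= U & smooth B (ph ` V) (%y. F (h, inv_into U ph y))"
  using d p oV by (intro exI[of _ U] exI[of _ ph] exI[of _ ?V]) auto
qed

lemma smooth_fun_act:
 assumes g: "smooth_fun B \<A> W g" and W: "open W"
 shows "smooth_fun B \<A> {x. act h x \<in> W} (%x. g (act h x))"
proof (rule smooth_funI[OF open_act_fixed[OF W]])
 fix p assume p: "p \<in> {x. act h x \<in> W}"
 obtain V ps where d: "(V, ps) \<in> \<A>" "act h p \<in> V" "V <= W" using chart_in[OF W] p by blast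
 obtain U ph where c: "(U, ph) \<in> \<A>" "p \<in> U" "U <= {x. act h x \<in> V}"
  using chart_in[OF open_act_fixed[OF chart_open[OF d(1)]], of p h] d by blast
 have "smooth_map PB (prod_atlas \<H> \<A>) \<A> (%(h, x). act h x)" using action by (simp add: smooth_action_def)
 hence "smooth_fun PB (prod_atlas \<H> \<A>) ((%(h, x). act h x) -` V) (ps \<circ> (%(h, x). act h x))"
  using d by (auto simp: smooth_map_def)
 moreover have "(%(h, x). act h x) -` V = {p. act (fst p) (snd p) \<in> V}" by auto
 ultimately have "smooth_fun B \<A> {x. act h x \<in> V} (%x. ps (act h x))"
  using slice_fun[OF _ open_act_vimage[OF chart_open[OF d(1)]], of "ps \<circ> (%(h, x). act h x)" h] by simp
 from smooth_fun_chart[OF this c(1)] have s: "smooth B (ph ` U) (%y. ps (act h (inv_into U ph y)))"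
  using c(3) by (simp add: Int_absorb2)
 have o: "span_open B (ph ` U)" by (rule chart_span_open[OF c(1)])
 have gV: "smooth B (ps ` V) (%z. g (inv_into V ps z))"
  using smooth_fun_chart[OF g d(1)] Int_absorb2[OF d(3)] by simp
 have im: "(%y. ps (act h (inv_into U ph y))) ` ph ` U <= ps ` V"
  using c by (auto simp: subset_iff)
 have 1: "smooth B (ph ` U) (%y. g (inv_into V ps (ps (act h (inv_into U ph y)))))"
  by (rule smooth_compose[OF B_Basis o chart_span_open[OF d(1)] im s gV])
 have "smooth B (ph ` U) (%y. g (act h (inv_into U ph y))) \<longleftrightarrow>
   smooth B (ph ` U) (%y. g (inv_into V ps (ps (act h (inv_into U ph y)))))"
  by (rule smooth_cong[OF o]) (use c d(1) in \<open>auto simp: subset_iff\<close>)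
 hence "smooth B (ph ` U) (%y. g (act h (inv_into U ph y)))" using 1 by (rule iffD2)
 thus "EX U ph V. (U, ph) \<in> \<A> & open V & p \<in> V & V <= U & smooth B (ph ` V) (%y. g (act h (inv_into U ph y)))"
  using c chart_open[OF c(1)] by blast
qed

subsection \<open>Transported charts and pullback of test measures\<close>

definition tr :: "'h => ('m, 'e) chart => ('m, 'e) chart" where
 "tr h c = (act h ` fst c, snd c \<circ> act (ginv h))"

lemma tr_tr [simp]: "tr (ginv h) (tr h c) = c" "tr h (tr (ginv h) c) = c"
 by (cases c; simp add: tr_def image_image o_def)+

lemma pullback_eq: "pullback_test H act lift h ta c e = ta (tr h c) (lift h e)"
 by (cases c) (simp add: pullback_test_def tr_def)

lemma act_image_eq: "act h ` U = {x. act (ginv h) x \<in> U}"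
 by (auto simp: image_iff) (metis act_inv(2))

lemma inj_act: "inj (act h)"
 by (rule injI) (metis act_inv(1))

lemma inv_into_tr:
 assumes c: "(U, ph) \<in> \<A>" and y: "y \<in> ph ` U"
 shows "inv_into (act h ` U) (ph \<circ> act (ginv h)) y = act h (inv_into U ph y)"
proof -
 have inj: "inj_on (ph \<circ> act (ginv h)) (act h ` U)"
  using chart_inj[OF c] by (auto simp: inj_on_def)
 obtain x where "x \<in> U" "y = ph x" using y by blast
 thus ?thesis using inv_into_f_f[OF inj, of "act h x"] c by simp
qed

text \<open>A transported chart is compatible with the atlas because the action is smooth, so
  maximality contains it. This gives \<open>pullback_test\<close> its meaning, since test measures
  are zero on anything outside the atlas.\<close>

lemma tr_chart:
 assumes "(U, ph) \<in> \<A>"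
 shows "(act h ` U, ph \<circ> act (ginv h)) \<in> \<A>"
proof -
 note c = assms
 have oU: "open (act h ` U)" unfolding act_image_eq by (rule open_act_fixed[OF chart_open[OF c]])
 have img: "(ph \<circ> act (ginv h)) ` act h ` U = ph ` U" by (simp add: image_image)
 have ca: "continuous_on X (act h)" for X h by (rule cont_act_comp[OF continuous_on_const continuous_on_id])
 have "homeomorphism (act h ` U) (ph ` U) (ph \<circ> act (ginv h)) (inv_into (act h ` U) (ph \<circ> act (ginv h)))"
  unfolding homeomorphism_def
 proof (intro conjI ballI)
  show "continuous_on (act h ` U) (ph \<circ> act (ginv h))"
   by (intro continuous_on_compose ca) (simp add: image_image chart_cont[OF c])
  have "continuous_on (ph ` U) (%y. act h (inv_into U ph y))"
   by (rule continuous_on_compose2[OF ca[of UNIV h] chart_cont_inv[OF c]]) simp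
  thus "continuous_on (ph ` U) (inv_into (act h ` U) (ph \<circ> act (ginv h)))"
   by (subst continuous_on_cong[OF refl inv_into_tr[OF c]])
  show "inv_into (act h ` U) (ph \<circ> act (ginv h)) ` ph ` U = act h ` U"
   using inv_into_tr[OF c] c by (force simp: image_iff)
  show "inv_into (act h ` U) (ph \<circ> act (ginv h)) ((ph \<circ> act (ginv h)) x) = x" if "x \<in> act h ` U" for x
   using that inv_into_tr[OF c] c by auto
  show "(ph \<circ> act (ginv h)) (inv_into (act h ` U) (ph \<circ> act (ginv h)) y) = y" if "y \<in> ph ` U" for y
   using that inv_into_tr[OF c] c by auto
 qed (rule img)
 hence cm: "chart_map B (act h ` U, ph \<circ> act (ginv h))"
  using oU chart_span_open[OF c] img by (simp add: chart_map_def)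
 have "smooth_transition B (act h ` U, ph \<circ> act (ginv h)) d & smooth_transition B d (act h ` U, ph \<circ> act (ginv h))"
  if dA: "d \<in> \<A>" for d
 proof -
  obtain V ps where d': "d = (V, ps)" by (cases d)
  have d: "(V, ps) \<in> \<A>" using dA d' by simp
  have oV: "open V" by (rule chart_open[OF d])
  let ?X = "ph ` (U \<inter> {x. act h x \<in> V})"
  have X: "span_open B ?X" by (rule chart_image_Int_open[OF c open_act_fixed[OF oV]])
  have "smooth_fun B \<A> V ps" using smooth_fun_chart_comp[OF d oV order_refl smooth_ident[OF chart_span_open[OF d]]] .
  from smooth_fun_chart[OF smooth_fun_act[OF this oV] c]
  have "smooth B ?X (%y. ps (act h (inv_into U ph y)))" .
  moreover have "(ph \<circ> act (ginv h)) ` (act h ` U \<inter> V) = ?X"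
  proof -
   have "act h ` U \<inter> V = act h ` (U \<inter> {x. act h x \<in> V})" by auto
   thus ?thesis by (simp only: image_image o_def act_inv)
  qed
  moreover have "ps (act h (inv_into U ph y)) = (ps \<circ> inv_into (act h ` U) (ph \<circ> act (ginv h))) y" if "y \<in> ?X" for y
   using that inv_into_tr[OF c, of y h] by auto
  ultimately have 1: "smooth B ((ph \<circ> act (ginv h)) ` (act h ` U \<inter> V)) (ps \<circ> inv_into (act h ` U) (ph \<circ> act (ginv h)))"
   using smooth_cong[OF X, of "%y. ps (act h (inv_into U ph y))" "ps \<circ> inv_into (act h ` U) (ph \<circ> act (ginv h))"] by simp
  have "smooth_fun B \<A> U ph" using smooth_fun_chart_comp[OF c chart_open[OF c] order_refl smooth_ident[OF chart_span_open[OF c]]] .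
  from smooth_fun_chart[OF smooth_fun_act[OF this chart_open[OF c], of "ginv h"] d]
  have "smooth B (ps ` (V \<inter> act h ` U)) ((ph \<circ> act (ginv h)) \<circ> inv_into V ps)" by (simp add: act_image_eq o_def)
  with 1 show ?thesis by (simp add: smooth_transition_def d')
 qed
 thus ?thesis using manifold cm unfolding smooth_manifold_def by blast
qed

lemma tr_in [simp]: "tr h c \<in> \<A> \<longleftrightarrow> c \<in> \<A>"
proof -
 have *: "tr h c \<in> \<A>" if "c \<in> \<A>" for h c using tr_chart[of "fst c" "snd c" h] that by (simp add: tr_def)
 show ?thesis using *[of "tr h c" "ginv h"] *[of c h] by (simp only: tr_tr) blast
qed

lemma fst_tr: "act h x \<in> fst (tr h c) \<longleftrightarrow> x \<in> fst c"
 by (simp add: tr_def inj_image_mem_iff[OF inj_act])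

text \<open>Transporting both charts by the same diffeomorphism leaves the transition map
  unchanged.\<close>

lemma df_tr:
 assumes "(U, ph) \<in> \<A>" "(V, ps) \<in> \<A>" "x \<in> U \<inter> V"
 shows "df (tr h (U, ph)) (tr h (V, ps)) (act h x) = df (U, ph) (V, ps) x"
proof -
 have "jacobian B (%y. (ph \<circ> act (ginv h)) (inv_into (act h ` V) (ps \<circ> act (ginv h)) y)) (ps x) =
  jacobian B (%y. ph (inv_into V ps y)) (ps x)"
  by (rule jacobian_cong[OF chart_span_open[OF assms(2)]]) (use assms inv_into_tr[OF assms(2)] in auto)
 thus ?thesis by (simp add: tr_def df_eq)
qed

definition pb :: "'h => (('m, 'e) chart => 'm => complex) => ('m, 'e) chart => 'm => complex" where
 "pb h om c x = om (tr h c) (act h x)"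

lemma pb_tm:
 assumes om: "om \<in> test_measures B \<A> W" and K: "compact K" "!!c x. x ~: K ==> om c x = 0"
  and W': "act (ginv h) ` K <= W'"
 shows "pb h om \<in> test_measures B \<A> W'"
proof (rule test_measureI[OF _ _ _ _ W'])
 show "compact (act (ginv h) ` K)"
  by (rule compact_continuous_image[OF cont_act_comp[OF continuous_on_const continuous_on_id] K(1)])
 show "pb h om c x = 0" if "x ~: act (ginv h) ` K" for c x
 proof -
  have "act h x ~: K" using that by (metis act_inv(1) imageI)
  thus ?thesis using K(2) by (simp add: pb_def)
 qed
 show "pb h om c x = 0" if "c ~: \<A> | x ~: fst c" for c x
  unfolding pb_def using that tm_zero[OF om, of "tr h c" "act h x"]
  by (simp add: fst_tr)
 show "smooth_fun B \<A> (fst c) (pb h om c)" if "c \<in> \<A>" for c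
 proof -
  have c': "(fst c, snd c) \<in> \<A>" using that by simp
  have t: "tr h c \<in> \<A>" using that by simp
  have "open (fst (tr h c))" using chart_open[of "fst (tr h c)" "snd (tr h c)"] t by simp
  from smooth_fun_act[OF tm_smooth[OF om t] this, of h]
  have "smooth_fun B \<A> {x. act h x \<in> act h ` fst c} (%x. om (tr h c) (act h x))" by (simp add: tr_def)
  thus ?thesis by (simp add: pb_def[abs_def] inj_image_mem_iff[OF inj_act])
 qed
 show "law (pb h om)"
  unfolding law_def
 proof clarify
  fix U ph V ps x assume c: "(U, ph) \<in> \<A>" "(V, ps) \<in> \<A>" "x \<in> fst (U, ph)" "x \<in> fst (V, ps)"
  have t: "tr h (U, ph) = (act h ` U, ph \<circ> act (ginv h))" "tr h (V, ps) = (act h ` V, ps \<circ> act (ginv h))"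
   by (simp_all add: tr_def)
  show "pb h om (V, ps) x = of_real (df (U, ph) (V, ps) x) * pb h om (U, ph) x"
   using lawD[OF tm_law[OF om] tr_chart[OF c(1)] tr_chart[OF c(2)], of "act h x" h] df_tr[OF c(1,2), of x h] c(3,4)
   by (simp add: pb_def t)
 qed
qed

end

section \<open>Bundle-valued test measures\<close>

context equivariant
begin

abbreviation "BT == bundle_test_measures B \<A> r \<pi> \<T>"

lemma vbundle: "vector_bundle B \<A> r \<pi> \<T>"
 using eqv by (simp add: equivariant_bundle_def)

lemma triv_ex: "EX T Ph. (T, Ph) \<in> \<T> & x \<in> T"
proof -
 have "x \<in> (\<Union>t\<in>\<T>. fst t)" using vbundle by (simp add: vector_bundle_def)
 thus ?thesis by auto
qed

lemma triv_open: "(T, Ph) \<in> \<T> ==> open T"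
 using vbundle by (auto simp: vector_bundle_def)

lemma frame:
 assumes t: "(T, Ph) \<in> \<T>" and "x \<in> T" "i < r"
 shows pi_frame: "\<pi> (frame \<pi> (T, Ph) i x) = x"
  and coord_frame: "Ph (frame \<pi> (T, Ph) i x) = (%j. if j = i then 1 else 0)"
proof -
 have bij: "bij_betw (%e. (\<pi> e, Ph e)) (\<pi> -` T) (T \<times> fibre_space r)"
  using vbundle t by (auto simp: vector_bundle_def)
 let ?d = "%j. if j = i then 1 else 0 :: complex"
 have "(x, ?d) \<in> (%e. (\<pi> e, Ph e)) ` (\<pi> -` T)"
  using bij_betw_imp_surj_on[OF bij] assms by (auto simp: fibre_space_def)
 then obtain e where e: "\<pi> e = x" "Ph e = ?d" by auto
 have u: "e' = e" if "\<pi> e' = x & Ph e' = ?d" for e'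
 proof (rule inj_onD[OF bij_betw_imp_inj_on[OF bij]])
  show "(\<pi> e', Ph e') = (\<pi> e, Ph e)" using that e by (simp only: prod.inject)
  show "e' \<in> \<pi> -` T" "e \<in> \<pi> -` T" using that e(1) assms(2) by blast+
 qed
 have "(THE e. \<pi> e = x & Ph e = ?d) = e"
 proof (rule the_equality)
  show "\<pi> e = x & Ph e = ?d" using e by (rule conjI)
 qed (rule u)
 hence "frame \<pi> (T, Ph) i x = e" by (simp only: frame_def snd_conv)
 thus "\<pi> (frame \<pi> (T, Ph) i x) = x" "Ph (frame \<pi> (T, Ph) i x) = ?d" using e by auto
qed

lemma bundle_testD:
 assumes "ta \<in> BT"
 shows bt_zero: "c ~: \<A> | \<pi> e ~: fst c ==> ta c e = 0"
  and bt_smooth: "c \<in> \<A> ==> t \<in> \<T> ==> i < r ==> smooth_fun B \<A> (fst c \<inter> fst t) (%x. ta c (frame \<pi> t i x))"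
  and bt_linear: "c \<in> \<A> ==> t \<in> \<T> ==> \<pi> e \<in> fst c \<inter> fst t ==> ta c e = (\<Sum>i<r. snd t e i * ta c (frame \<pi> t i (\<pi> e)))"
  and bt_law: "c \<in> \<A> ==> c' \<in> \<A> ==> \<pi> e \<in> fst c \<inter> fst c' ==> ta c' e = of_real (df c c' (\<pi> e)) * ta c e"
  and bt_supp: "EX K. compact K & (ALL c e. ta c e ~= 0 --> \<pi> e \<in> K)"
proof -
 note d = assms[unfolded bundle_test_measures_def mem_Collect_eq]
 note d1 = conjunct1[OF d] and d2 = conjunct1[OF conjunct2[OF d]]
  and d3 = conjunct1[OF conjunct2[OF conjunct2[OF d]]] and d4 = conjunct2[OF conjunct2[OF conjunct2[OF d]]]
 show "c ~: \<A> | \<pi> e ~: fst c ==> ta c e = 0" using d1 by blast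
 show "c \<in> \<A> ==> t \<in> \<T> ==> i < r ==> smooth_fun B \<A> (fst c \<inter> fst t) (%x. ta c (frame \<pi> t i x))" using bspec[OF bspec[OF d2]] by blast
 show "c \<in> \<A> ==> t \<in> \<T> ==> \<pi> e \<in> fst c \<inter> fst t ==> ta c e = (\<Sum>i<r. snd t e i * ta c (frame \<pi> t i (\<pi> e)))" using bspec[OF bspec[OF d2]] by blast
 show "c \<in> \<A> ==> c' \<in> \<A> ==> \<pi> e \<in> fst c \<inter> fst c' ==> ta c' e = of_real (df c c' (\<pi> e)) * ta c e" using bspec[OF bspec[OF d3]] by blast
 show "EX K. compact K & (ALL c e. ta c e ~= 0 --> \<pi> e \<in> K)"
  using d4 closure_subset[of "{\<pi> e | e. EX c. ta c e ~= 0}"] by (intro exI conjI) blast+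
qed

lemma bundle_testI:
 assumes "!!c e. c ~: \<A> | \<pi> e ~: fst c ==> ta c e = 0"
  and "!!c t i. c \<in> \<A> ==> t \<in> \<T> ==> i < r ==> smooth_fun B \<A> (fst c \<inter> fst t) (%x. ta c (frame \<pi> t i x))"
  and "!!c t e. c \<in> \<A> ==> t \<in> \<T> ==> \<pi> e \<in> fst c \<inter> fst t ==> ta c e = (\<Sum>i<r. snd t e i * ta c (frame \<pi> t i (\<pi> e)))"
  and "!!c c' e. c \<in> \<A> ==> c' \<in> \<A> ==> \<pi> e \<in> fst c \<inter> fst c' ==> ta c' e = of_real (df c c' (\<pi> e)) * ta c e"
  and "compact K" "!!c e. ta c e ~= 0 ==> \<pi> e \<in> K"
 shows "ta \<in> BT"
proof -
 let ?Z = "{\<pi> e | e. EX c. ta c e ~= 0}"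
 have "?Z <= K" using assms(6) by blast
 from closure_minimal[OF this compact_imp_closed[OF assms(5)]]
 have "K \<inter> closure ?Z = closure ?Z" by (rule Int_absorb1)
 with compact_Int_closed[OF assms(5) closed_closure, of ?Z] have "compact (closure ?Z)" by (simp only:)
 thus ?thesis using assms(1-4) unfolding bundle_test_measures_def mem_Collect_eq by blast
qed

lemma chart_triv_open: "c \<in> \<A> ==> t \<in> \<T> ==> open (fst c \<inter> fst t)"
 using chart_open[of "fst c" "snd c"] triv_open[of "fst t" "snd t"] by auto

lemma bt_lincomb:
 assumes ta: "ta \<in> BT" and ta': "ta' \<in> BT"
 shows "(%c e. ta c e + z * ta' c e) \<in> BT"
proof -
 obtain K K' where K: "compact K" "!!c e. ta c e ~= 0 ==> \<pi> e \<in> K" and K': "compact K'" "!!c e. ta' c e ~= 0 ==> \<pi> e \<in> K'"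
  using bt_supp[OF ta] bt_supp[OF ta'] by blast
 show ?thesis
 proof (rule bundle_testI[OF _ _ _ _ compact_Un[OF K(1) K'(1)]])
  fix c t i assume "c \<in> \<A>" "t \<in> \<T>" "i < r"
  thus "smooth_fun B \<A> (fst c \<inter> fst t) (%x. ta c (frame \<pi> t i x) + z * ta' c (frame \<pi> t i x))"
   by (intro smooth_fun_add smooth_fun_mult smooth_fun_const bt_smooth[OF ta] bt_smooth[OF ta'] chart_triv_open)
 next
  fix c t e assume *: "c \<in> \<A>" "t \<in> \<T>" "\<pi> e \<in> fst c \<inter> fst t"
  show "ta c e + z * ta' c e = (\<Sum>i<r. snd t e i * (ta c (frame \<pi> t i (\<pi> e)) + z * ta' c (frame \<pi> t i (\<pi> e))))"
   unfolding bt_linear[OF ta *] bt_linear[OF ta' *] by (simp add: sum_distrib_left sum.distrib algebra_simps)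
 next
  fix c c' e assume *: "c \<in> \<A>" "c' \<in> \<A>" "\<pi> e \<in> fst c \<inter> fst c'"
  show "ta c' e + z * ta' c' e = of_real (df c c' (\<pi> e)) * (ta c e + z * ta' c e)"
   unfolding bt_law[OF ta *] bt_law[OF ta' *] by (simp add: algebra_simps)
 next
  fix c e assume "ta c e + z * ta' c e ~= 0"
  hence "ta c e ~= 0 | ta' c e ~= 0" by auto
  thus "\<pi> e \<in> K \<union> K'" using K(2) K'(2) by blast
 qed (use bt_zero[OF ta] bt_zero[OF ta'] in auto)
qed

lemma bt_null: "(%c e. 0) \<in> BT"
 by (rule bundle_testI[of _ "{}"]) (auto intro: smooth_fun_const chart_triv_open)

lemma bt_sum: "(!!j. j \<in> J ==> ta j \<in> BT) ==> (%c e. \<Sum>j\<in>J. ta j c e) \<in> BT"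
proof (induction J rule: infinite_finite_induct)
 case (insert j J)
 thus ?case using bt_lincomb[of "ta j" "%c e. \<Sum>j\<in>J. ta j c e" 1] by simp
qed (simp_all add: bt_null)

lemma distribution_lincomb:
 assumes "si \<in> bundle_distributions B \<A> r \<pi> \<T>" "ta \<in> BT" "ta' \<in> BT"
 shows "si (%c e. ta c e + z * ta' c e) = si ta + z * si ta'"
proof -
 have "(%c e. z * ta' c e) \<in> BT" using bt_lincomb[OF bt_null assms(3), of z] by simp
 thus ?thesis using assms unfolding bundle_distributions_def by simp
qed

lemma distribution_sum:
 assumes si: "si \<in> bundle_distributions B \<A> r \<pi> \<T>" and "!!j. j \<in> J ==> ta j \<in> BT"
 shows "si (%c e. \<Sum>j\<in>J. ta j c e) = (\<Sum>j\<in>J. si (ta j))"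
 using assms(2)
proof (induction J rule: infinite_finite_induct)
 case (insert j J)
 thus ?case using distribution_lincomb[OF si, of "ta j" "%c e. \<Sum>j\<in>J. ta j c e" 1] bt_sum[of J ta] by simp
qed (use distribution_lincomb[OF si bt_null bt_null, of 1] in simp_all)

definition tens :: "(('m, 'e) chart => 'm => complex) => ('m, 'b) triv => nat => ('m, 'e) chart => 'b => complex" where
 "tens om t i c e = om c (\<pi> e) * snd t e i"

lemma component_tens: "component \<pi> t i si om = si (tens om t i)"
 by (simp add: component_def tens_def[abs_def])

text \<open>In another trivialization the transition matrix supplies the smooth components; outside
  \<open>T\<close> the support of \<open>om\<close> makes everything vanish.\<close>

lemma tens_bt:
 assumes t: "t \<in> \<T>" and i: "i < r" and om: "om \<in> test_measures B \<A> (fst t)"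
 shows "tens om t i \<in> BT"
proof -
 obtain T Ph where t': "t = (T, Ph)" by (cases t)
 have oT: "open T" using triv_open t t' by auto
 obtain K where K: "compact K" "K <= T" "!!c x. x ~: K ==> om c x = 0" using tm_supp[OF om] unfolding t' fst_conv by blast
 have tr: "EX g::nat => nat => 'm => complex.
    (ALL i<r. ALL j<r. smooth_fun B \<A> (fst u \<inter> T) (g i j)) &
    (ALL e. \<pi> e \<in> fst u \<inter> T --> (ALL i<r. Ph e i = (\<Sum>j<r. g i j (\<pi> e) * snd u e j)))" if "u \<in> \<T>" for u
 proof -
  note v = conjunct2[OF conjunct2[OF vbundle[unfolded vector_bundle_def]]]
  obtain P Ps where u: "u = (P, Ps)" by (cases u)
  show ?thesis
   using bspec[OF bspec[OF v that, unfolded u prod.case] t, unfolded t' prod.case] unfolding u fst_conv snd_conv .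
 qed
 show ?thesis
 proof (rule bundle_testI[OF _ _ _ _ K(1)])
  show "tens om t i c e = 0" if "c ~: \<A> | \<pi> e ~: fst c" for c e using tm_zero[OF om that] by (simp add: tens_def)
  fix c u assume c: "c \<in> \<A>" and u: "u \<in> \<T>"
  obtain g where g: "!!i j. i < r ==> j < r ==> smooth_fun B \<A> (fst u \<inter> T) (g i j)"
   "!!e i. \<pi> e \<in> fst u \<inter> T ==> i < r ==> Ph e i = (\<Sum>j<r. g i j (\<pi> e) * snd u e j)" using tr[OF u] by blast
  have fr: "\<pi> (frame \<pi> u j x) = x" "snd u (frame \<pi> u j x) = (%k. if k = j then 1 else 0)" if "j < r" "x \<in> fst u" for j x
   using frame[of "fst u" "snd u" x j] that u by auto
  have Fr: "Ph (frame \<pi> u j x) i = g i j x" if "j < r" "x \<in> fst u" "x \<in> T" for j x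
   using g(2)[of "frame \<pi> u j x" i] fr[OF that(1,2)] that i by (simp add: if_distrib cong: if_cong)
  show "smooth_fun B \<A> (fst c \<inter> fst u) (%x. tens om t i c (frame \<pi> u j x))" if j: "j < r" for j
  proof (rule smooth_fun_extend[OF chart_triv_open[OF c u] K(1,2) oT])
   have o: "open (fst c \<inter> fst u \<inter> T)" using chart_triv_open[OF c u] oT by auto
   show "smooth_fun B \<A> (fst c \<inter> fst u \<inter> T) (%x. om c x * (if x \<in> fst u \<inter> T then g i j x else 0))"
   proof (rule smooth_fun_mult[OF o smooth_fun_subset[OF tm_smooth[OF om c]]])
    have s: "smooth_fun B \<A> (fst c \<inter> fst u \<inter> T) (g i j)" by (rule smooth_fun_subset[OF g(1)[OF i j]]) auto
    have "smooth_fun B \<A> (fst c \<inter> fst u \<inter> T) (%x. if x \<in> fst u \<inter> T then g i j x else 0) \<longleftrightarrow>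
      smooth_fun B \<A> (fst c \<inter> fst u \<inter> T) (g i j)" by (rule smooth_fun_cong[OF o]) auto
    thus "smooth_fun B \<A> (fst c \<inter> fst u \<inter> T) (%x. if x \<in> fst u \<inter> T then g i j x else 0)" using s by (rule iffD2)
   qed auto
   show "tens om t i c (frame \<pi> u j x) = om c x * (if x \<in> fst u \<inter> T then g i j x else 0)" if "x \<in> fst c \<inter> fst u" "x \<in> T" for x
    using that fr(1)[OF j] Fr[OF j] by (simp add: tens_def t')
   show "tens om t i c (frame \<pi> u j x) = 0" if "x \<in> fst c \<inter> fst u" "x ~: K" for x
    using that fr(1)[OF j] K(3) by (simp add: tens_def)
  qed
  show "tens om t i c e = (\<Sum>j<r. snd u e j * tens om t i c (frame \<pi> u j (\<pi> e)))" if e: "\<pi> e \<in> fst c \<inter> fst u" for e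
  proof (cases "\<pi> e \<in> T")
   case True
   have "(\<Sum>j<r. snd u e j * tens om t i c (frame \<pi> u j (\<pi> e))) = (\<Sum>j<r. snd u e j * (om c (\<pi> e) * g i j (\<pi> e)))"
    using fr(1) Fr e True by (intro sum.cong refl) (simp add: tens_def t')
   thus ?thesis using g(2)[of e i] e True i by (simp add: tens_def t' sum_distrib_left mult_ac)
  next
   case False
   hence "om c (\<pi> e) = 0" by (intro K(3)) (use K(2) in blast)
   moreover have "(\<Sum>j<r. snd u e j * tens om t i c (frame \<pi> u j (\<pi> e))) = (\<Sum>j<r. 0)"
    by (intro sum.cong refl) (use calculation fr(1) e in \<open>simp add: tens_def\<close>)
   ultimately show ?thesis by (simp add: tens_def)
  qed
 next
  fix c c' e assume "c \<in> \<A>" "c' \<in> \<A>" "\<pi> e \<in> fst c \<inter> fst c'"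
  thus "tens om t i c' e = of_real (df c c' (\<pi> e)) * tens om t i c e"
   using lawD[OF tm_law[OF om], of "fst c" "snd c" "fst c'" "snd c'" "\<pi> e"] by (simp add: tens_def)
 next
  fix c e assume "tens om t i c e ~= 0"
  thus "\<pi> e \<in> K" using K(3)[of "\<pi> e" c] by (auto simp: tens_def)
 qed
qed

end

section \<open>Pullback of test measures\<close>

context equivariant
begin

abbreviation "pull == pullback_test H act lift"

text \<open>The coordinate expression of one component of a bundle test measure, on which
  derivatives are taken.\<close>

definition coef :: "('m, 'b) triv => nat => 'm set => ('m => 'e) => (('m, 'e) chart => 'b => complex) => 'e => complex" where
 "coef t i U ph ta y = ta (U, ph) (frame \<pi> t i (inv_into U ph y))"

lemma smooth_coef:
 assumes "ta \<in> BT" "(U, ph) \<in> \<A>" "t \<in> \<T>" "i < r"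
 shows "smooth B (ph ` (U \<inter> fst t)) (coef t i U ph ta)"
proof -
 have "smooth B (ph ` (U \<inter> (U \<inter> fst t))) (coef t i U ph ta)"
  unfolding coef_def[abs_def] using smooth_fun_chart[OF bt_smooth[OF assms(1-4)] assms(2)] by simp
 thus ?thesis by (simp add: Int_assoc[symmetric])
qed

lemma action_matrix:
 assumes "(T, Ph) \<in> \<T>" "(T', Ph') \<in> \<T>"
 obtains a :: "nat => nat => 'h \<times> 'm => complex" where
  "!!i j. i < r ==> j < r ==> smooth_fun PB (prod_atlas \<H> \<A>) {p. snd p \<in> T & act (fst p) (snd p) \<in> T'} (a i j)"
  "!!h e i. \<pi> e \<in> T ==> act h (\<pi> e) \<in> T' ==> i < r ==> Ph' (lift h e) i = (\<Sum>j<r. a i j (h, \<pi> e) * Ph e j)"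
proof -
 note v = conjunct2[OF conjunct2[OF conjunct2[OF eqv[unfolded equivariant_bundle_def]]]]
 have "{(h, x). x \<in> T & act h x \<in> T'} = {p. snd p \<in> T & act (fst p) (snd p) \<in> T'}" by auto
 thus ?thesis
  using bspec[OF bspec[OF v assms(1), unfolded prod.case] assms(2), unfolded prod.case] that by (elim exE) (simp, blast)
qed

text \<open>Pullback is free of Jacobians only as long as charts are transported along; returning to
  a fixed target chart reintroduces the density factor.\<close>

lemma pull_formula:
 assumes ta: "ta \<in> BT" and c: "(U, ph) \<in> \<A>" "\<pi> e \<in> U" and d: "(V, ps) \<in> \<A>" "act h (\<pi> e) \<in> V"
 shows "pull h ta (U, ph) e = of_real \<bar>jacobian B (%y. ps (act h (inv_into U ph y))) (ph (\<pi> e))\<bar> * ta (V, ps) (lift h e)"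
proof -
 have "ta (tr h (U, ph)) (lift h e) = of_real (df (V, ps) (tr h (U, ph)) (\<pi> (lift h e))) * ta (V, ps) (lift h e)"
  by (rule bt_law[OF ta d(1)]) (use c d in \<open>auto simp: fst_tr\<close>)
 moreover have "jacobian B (%y. ps (inv_into (act h ` U) (ph \<circ> act (ginv h)) y)) (ph (\<pi> e)) = jacobian B (%y. ps (act h (inv_into U ph y))) (ph (\<pi> e))"
  by (rule jacobian_cong[OF chart_span_open[OF c(1)]]) (use c inv_into_tr[OF c(1)] in auto)
 ultimately show ?thesis by (simp add: pullback_eq) (simp add: tr_def df_eq)
qed

lemma pull_frame:
 assumes ta: "ta \<in> BT" and c: "(U, ph) \<in> \<A>" "x \<in> U" and d: "(V, ps) \<in> \<A>" "act h x \<in> V"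
  and t: "(T, Ph) \<in> \<T>" "x \<in> T" and t': "(T', Ph') \<in> \<T>" "act h x \<in> T'" and j: "j < r"
  and a: "!!h e i. \<pi> e \<in> T ==> act h (\<pi> e) \<in> T' ==> i < r ==> Ph' (lift h e) i = (\<Sum>j<r. a i j (h, \<pi> e) * Ph e j)"
 shows "pull h ta (U, ph) (frame \<pi> (T, Ph) j x) = of_real \<bar>jacobian B (%y. ps (act h (inv_into U ph y))) (ph x)\<bar> *
  (\<Sum>k<r. a k j (h, x) * ta (V, ps) (frame \<pi> (T', Ph') k (act h x)))"
proof -
 let ?e = "frame \<pi> (T, Ph) j x"
 note f = pi_frame[OF t j] coord_frame[OF t j]
 have "Ph' (lift h ?e) k = a k j (h, x)" if "k < r" for k
  using a[of ?e h k] f t(2) t'(2) that j by (simp add: if_distrib cong: if_cong)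
 hence "ta (V, ps) (lift h ?e) = (\<Sum>k<r. a k j (h, x) * ta (V, ps) (frame \<pi> (T', Ph') k (act h x)))"
  using bt_linear[OF ta d(1) t'(1), of "lift h ?e"] f(1) d(2) t'(2) by simp
 thus ?thesis using pull_formula[OF ta c(1) _ d(1), of ?e h] f(1) c(2) d(2) by simp
qed

text \<open>Near \<open>(h0, x0)\<close> one target chart and one target trivialization serve all
  group elements, and the Jacobian and the matrix of the lift merge into coefficients
  \<open>q\<close> smooth in both variables. None of these data depends on \<open>ta\<close>, so
  test measures may vary as well.\<close>

lemma pull_joint:
 assumes c: "(U, ph) \<in> \<A>" "x0 \<in> U" and t: "(T, Ph) \<in> \<T>" "x0 \<in> T" and j: "j < r"
 obtains Q th V ps T' Ph' Y Ps q where "(Q, th) \<in> \<H>" "h0 \<in> Q" "(V, ps) \<in> \<A>" "(T', Ph') \<in> \<T>" "span_open PB Y"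
  "(th h0, ph x0) \<in> Y" "smooth PB Y Ps" "Ps ` Y <= ps ` (V \<inter> T')" "!!k. k < r ==> smooth PB Y (q k)"
  "Y <= th ` Q \<times> ph ` (U \<inter> T)"
  "!!ta s y. ta \<in> BT ==> (s, y) \<in> Y ==> coef (T, Ph) j U ph (pull (inv_into Q th s) ta) y =
   (\<Sum>k<r. q k (s, y) * coef (T', Ph') k V ps ta (Ps (s, y)))"
proof -
 obtain Q th where g: "(Q, th) \<in> \<H>" "h0 \<in> Q" using G.chart_ex by blast
 obtain V ps where d: "(V, ps) \<in> \<A>" "act h0 x0 \<in> V" using chart_ex by blast
 obtain T' Ph' where t': "(T', Ph') \<in> \<T>" "act h0 x0 \<in> T'" using triv_ex by blast
 obtain a where a: "!!i j. i < r ==> j < r ==> smooth_fun PB (prod_atlas \<H> \<A>) {p. snd p \<in> T & act (fst p) (snd p) \<in> T'} (a i j)"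
  "!!h e i. \<pi> e \<in> T ==> act h (\<pi> e) \<in> T' ==> i < r ==> Ph' (lift h e) i = (\<Sum>j<r. a i j (h, \<pi> e) * Ph e j)"
  by (rule action_matrix[OF t(1) t'(1)], rule that, assumption+)
 let ?W1 = "{p. snd p \<in> T & act (fst p) (snd p) \<in> T'}" and ?W2 = "{p. act (fst p) (snd p) \<in> V}"
 have sT: "open {p :: 'h \<times> 'm. snd p \<in> T}"
  using open_vimage[OF triv_open[OF t(1)] continuous_on_snd[OF continuous_on_id]] by (simp add: vimage_def)
 have W1: "open ?W1" using open_Int[OF sT open_act_vimage[OF triv_open[OF t'(1)]]] by (simp add: Collect_conj_eq)
 define W where "W = Q \<times> U \<inter> (?W1 \<inter> ?W2)"
 have W: "open W" "W <= Q \<times> U" unfolding W_def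
  by (rule joint_open[OF g(1) c(1) open_Int[OF W1 open_act_vimage[OF chart_open[OF d(1)]]]]) auto
 define Y where "Y = map_prod th ph ` W"
 have Y: "span_open PB Y" unfolding Y_def by (rule joint_image_open[OF g(1) c(1) W])
 define Ps where "Ps p = ps (act (inv_into Q th (fst p)) (inv_into U ph (snd p)))" for p
 have sub: "Y <= map_prod th ph ` (Q \<times> U \<inter> ?W1)" "Y <= map_prod th ph ` (Q \<times> U \<inter> ?W2)"
  unfolding Y_def W_def by (rule image_mono; blast)+
 have Ps: "smooth PB Y Ps" unfolding Ps_def
  by (rule smooth_subset[OF act_coords[OF g(1) c(1) d(1)] sub(2)])
 have el: "EX h x. h \<in> Q & x \<in> U & x \<in> T & act h x \<in> V & act h x \<in> T' & p = (th h, ph x) &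
   inv_into Q th (fst p) = h & inv_into U ph (snd p) = x" if "p \<in> Y" for p
  using that c g by (auto simp: Y_def W_def)
 have PsY: "Ps ` Y <= ps ` (V \<inter> T')"
 proof (rule image_subsetI)
  fix p assume "p \<in> Y"
  from el[OF this] show "Ps p \<in> ps ` (V \<inter> T')" by (auto simp: Ps_def)
 qed
 \<comment> \<open>The Jacobian in the point variable alone, with the group coordinate as a
   parameter. It does not vanish, so its absolute value is smooth.\<close>
 define J where "J p = (\<Sum>rh | rh permutes B. of_int (sign rh) * (\<Prod>b\<in>B. pd (0, b) Ps p \<bullet> rh b))" for p
 have sJ: "smooth PB Y J" unfolding J_def
  by (intro smooth_sum smooth_mult smooth_const smooth_prod smooth_inner_const smooth_partial[OF Ps] Y Pair0_in_prod_basis)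
 have Jj: "J (s, y) = jacobian B (%y. Ps (s, y)) y" for s y
  by (simp add: J_def jacobian_def partial_slice)
 have J0: "J p ~= 0" if p: "p \<in> Y" for p
 proof -
  from el[OF p] obtain h x where hx: "h \<in> Q" "x \<in> U" "x \<in> T" "act h x \<in> V" "p = (th h, ph x)" by blast
  have "df (V, ps) (tr h (U, ph)) (act h x) ~= 0"
   unfolding tr_def fst_conv snd_conv by (rule df_nonzero[OF d(1) tr_chart[OF c(1)]]) (use hx in auto)
  moreover have "jacobian B (%y. ps (inv_into (act h ` U) (ph \<circ> act (ginv h)) y)) (ph x) = jacobian B (%y. ps (act h (inv_into U ph y))) (ph x)"
   by (rule jacobian_cong[OF chart_span_open[OF c(1)]]) (use hx c inv_into_tr[OF c(1)] in auto)
  ultimately show ?thesis using hx g by (simp add: Jj Ps_def tr_def df_eq)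
 qed
 define q where "q k p = of_real \<bar>J p\<bar> * a k j (inv_into Q th (fst p), inv_into U ph (snd p))" for k p
 have q: "smooth PB Y (q k)" if "k < r" for k unfolding q_def
  by (intro smooth_mult[OF Y] smooth_of_real[OF Y] smooth_abs_nonzero[OF Y sJ J0]
    smooth_subset[OF joint_coords[OF a(1)[OF that j] g(1) c(1) W1] sub(1)])
 have F: "coef (T, Ph) j U ph (pull (inv_into Q th s) ta) y = (\<Sum>k<r. q k (s, y) * coef (T', Ph') k V ps ta (Ps (s, y)))"
  if ta: "ta \<in> BT" and sy: "(s, y) \<in> Y" for ta s y
 proof -
  from el[OF sy] obtain h x where hx: "h \<in> Q" "x \<in> U" "x \<in> T" "act h x \<in> V" "act h x \<in> T'" "s = th h" "y = ph x"
   "inv_into Q th s = h" "inv_into U ph y = x" by auto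
  show ?thesis
   using pull_frame[OF ta c(1) hx(2) d(1) hx(4) t(1) hx(3) t'(1) hx(5) j a(2)] hx(6-9) d(1) hx(4)
   by (simp add: coef_def q_def Jj Ps_def sum_distrib_left mult.assoc)
 qed
 have p0: "(th h0, ph x0) \<in> Y" unfolding Y_def W_def using c g d t t' by (intro image_eqI[of _ _ "(h0, x0)"]) auto
 have YQ: "Y <= th ` Q \<times> ph ` (U \<inter> T)" unfolding Y_def W_def by auto
 show ?thesis by (rule that[OF g d(1) t'(1) Y p0 Ps PsY q YQ F])
qed

lemma pull_bt:
 assumes ta: "ta \<in> BT"
 shows "pull h ta \<in> BT"
proof -
 obtain K where K: "compact K" "!!c e. ta c e ~= 0 ==> \<pi> e \<in> K" using bt_supp[OF ta] by blast
 show ?thesis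
 proof (rule bundle_testI)
  show "compact (act (ginv h) ` K)"
   by (rule compact_continuous_image[OF cont_act_comp[OF continuous_on_const continuous_on_id] K(1)])
  show "\<pi> e \<in> act (ginv h) ` K" if "pull h ta c e ~= 0" for c e
   using K(2)[OF that[unfolded pullback_eq]] by (intro image_eqI[of _ _ "act h (\<pi> e)"]) auto
  show "pull h ta c e = 0" if "c ~: \<A> | \<pi> e ~: fst c" for c e
   unfolding pullback_eq by (rule bt_zero[OF ta]) (use that in \<open>simp add: fst_tr\<close>)
 next
  fix c c' e assume *: "c \<in> \<A>" "c' \<in> \<A>" "\<pi> e \<in> fst c \<inter> fst c'"
  have "ta (tr h c') (lift h e) = of_real (df (tr h c) (tr h c') (\<pi> (lift h e))) * ta (tr h c) (lift h e)"
   by (rule bt_law[OF ta]) (use * in \<open>simp_all add: fst_tr\<close>)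
  thus "pull h ta c' e = of_real (df c c' (\<pi> e)) * pull h ta c e"
   using df_tr[of "fst c" "snd c" "fst c'" "snd c'" "\<pi> e" h] * by (simp add: pullback_eq)
 next
  fix c t j assume "c \<in> \<A>" "t \<in> \<T>" and j: "j < r"
  moreover obtain U ph T Ph where e: "c = (U, ph)" "t = (T, Ph)" by (cases c, cases t)
  ultimately have c: "(U, ph) \<in> \<A>" and t: "(T, Ph) \<in> \<T>" by auto
  have o: "open (U \<inter> T)" using chart_open[OF c] triv_open[OF t] by auto
  have X: "span_open B (ph ` (U \<inter> T))" by (rule chart_image_open[OF c o]) simp
  have "smooth B (ph ` (U \<inter> T)) (coef (T, Ph) j U ph (pull h ta))"
  proof (rule smooth_local[OF span_open_subset[OF X]])
   fix y assume "y \<in> ph ` (U \<inter> T)"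
   then obtain x where x: "x \<in> U" "x \<in> T" "y = ph x" by auto
   obtain Q th V ps T' Ph' Y Ps q where g: "(Q, th) \<in> \<H>" "h \<in> Q" and d: "(V, ps) \<in> \<A>" and t': "(T', Ph') \<in> \<T>" and Y: "span_open PB Y"
    "(th h, ph x) \<in> Y" and Ps: "smooth PB Y Ps" "Ps ` Y <= ps ` (V \<inter> T')" and q: "!!k. k < r ==> smooth PB Y (q k)"
    and "Y <= th ` Q \<times> ph ` (U \<inter> T)"
    and F: "!!ta s y. ta \<in> BT ==> (s, y) \<in> Y ==> coef (T, Ph) j U ph (pull (inv_into Q th s) ta) y =
     (\<Sum>k<r. q k (s, y) * coef (T', Ph') k V ps ta (Ps (s, y)))"
    by (rule pull_joint[OF c x(1) t x(2) j, of h], rule that, assumption+)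
   have oV: "open (V \<inter> T')" using chart_open[OF d] triv_open[OF t'] by auto
   have s1: "smooth PB Y (%p. coef (T', Ph') k V ps ta (Ps p))" if "k < r" for k
    by (rule smooth_compose[OF B_Basis Y(1) chart_image_open[OF d oV] Ps(2,1)]) (use smooth_coef[OF ta d t' that] in auto)
   have s2: "smooth PB Y (%p. \<Sum>k<r. q k p * coef (T', Ph') k V ps ta (Ps p))"
    by (intro smooth_sum[OF Y(1)] smooth_mult[OF Y(1)] q s1) auto
   have "th h \<in> span C" using g G.chart_span_open[OF g(1)] span_open_subset by blast
   note sl = smooth_slice[OF G.B_Basis B_Basis Y(1) s2 this]
   let ?Z = "{y. (th h, y) \<in> Y}"
   have "smooth B ?Z (coef (T, Ph) j U ph (pull h ta)) \<longleftrightarrow> smooth B ?Z (%y. \<Sum>k<r. q k (th h, y) * coef (T', Ph') k V ps ta (Ps (th h, y)))"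
    by (rule smooth_cong[OF sl(1)]) (use F[OF ta, of "th h"] g in simp)
   hence "smooth B ?Z (coef (T, Ph) j U ph (pull h ta))" using sl(2) by (rule iffD2)
   thus "EX W'. y \<in> W' & span_open B W' & smooth B W' (coef (T, Ph) j U ph (pull h ta))"
    using sl(1) Y(2) x(3) by (intro exI[of _ ?Z]) auto
  qed
  from smooth_fun_chart_comp[OF c o _ this]
  have 1: "smooth_fun B \<A> (U \<inter> T) (%x. coef (T, Ph) j U ph (pull h ta) (ph x))" by simp
  have "smooth_fun B \<A> (U \<inter> T) (%x. pull h ta (U, ph) (frame \<pi> (T, Ph) j x)) \<longleftrightarrow>
    smooth_fun B \<A> (U \<inter> T) (%x. coef (T, Ph) j U ph (pull h ta) (ph x))"
   by (rule smooth_fun_cong[OF o]) (use c in \<open>auto simp: coef_def\<close>)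
  thus "smooth_fun B \<A> (fst c \<inter> fst t) (%x. pull h ta c (frame \<pi> t j x))" unfolding e fst_conv using 1 by (rule iffD2)
 next
  fix c t e assume "c \<in> \<A>" "t \<in> \<T>" "\<pi> e \<in> fst c \<inter> fst t"
  moreover obtain U ph T Ph where e: "c = (U, ph)" "t = (T, Ph)" by (cases c, cases t)
  ultimately have c: "(U, ph) \<in> \<A>" "\<pi> e \<in> U" and t: "(T, Ph) \<in> \<T>" "\<pi> e \<in> T" by auto
  obtain V ps where d: "(V, ps) \<in> \<A>" "act h (\<pi> e) \<in> V" using chart_ex by blast
  obtain T' Ph' where t': "(T', Ph') \<in> \<T>" "act h (\<pi> e) \<in> T'" using triv_ex by blast
  obtain a where a: "!!h e i. \<pi> e \<in> T ==> act h (\<pi> e) \<in> T' ==> i < r ==> Ph' (lift h e) i = (\<Sum>j<r. a i j (h, \<pi> e) * Ph e j)"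
   by (rule action_matrix[OF t(1) t'(1)], rule that, assumption+)
  let ?J = "of_real \<bar>jacobian B (%y. ps (act h (inv_into U ph y))) (ph (\<pi> e))\<bar> :: complex"
  let ?f = "%k. ta (V, ps) (frame \<pi> (T', Ph') k (act h (\<pi> e)))"
  have "pull h ta (U, ph) e = ?J * ta (V, ps) (lift h e)" by (rule pull_formula[OF ta c d])
  also have "ta (V, ps) (lift h e) = (\<Sum>k<r. Ph' (lift h e) k * ?f k)"
   using bt_linear[OF ta d(1) t'(1), of "lift h e"] d(2) t'(2) by simp
  also have "... = (\<Sum>k<r. \<Sum>j<r. Ph e j * (a k j (h, \<pi> e) * ?f k))"
   using a[OF t(2) t'(2)] by (simp add: sum_distrib_right sum_distrib_left mult_ac)
  also have "... = (\<Sum>j<r. Ph e j * (\<Sum>k<r. a k j (h, \<pi> e) * ?f k))"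
   unfolding sum_distrib_left by (rule sum.swap)
  also have "?J * ... = (\<Sum>j<r. Ph e j * (?J * (\<Sum>k<r. a k j (h, \<pi> e) * ?f k)))"
   by (simp add: sum_distrib_left[of ?J] mult.left_commute)
  also have "... = (\<Sum>j<r. Ph e j * pull h ta (U, ph) (frame \<pi> (T, Ph) j (\<pi> e)))"
   using pull_frame[OF ta c d t t' _ a] by (intro sum.cong refl) simp
  finally show "pull h ta c e = (\<Sum>i<r. snd t e i * pull h ta c (frame \<pi> t i (\<pi> e)))" by (simp add: e)
 qed
qed

end

section \<open>Continuity of translation\<close>

lemma iter_partial_diff:
 fixes f g :: "'e::euclidean_space => complex"
 assumes W: "span_open B W" and f: "smooth B W f" and g: "smooth B W g" and bs: "set bs <= B" "x \<in> W"
 shows "ipd bs (%x. f x - g x) x = ipd bs f x - ipd bs g x"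
proof -
 let ?h = "%b. if b then f else (%x. (-1) * g x)"
 have "ipd bs (%x. \<Sum>b\<in>UNIV. ?h b x) x = (\<Sum>b\<in>UNIV. ipd bs (?h b) x)"
  by (rule iter_partial_sum[OF W _ bs]) (use f smooth_cmult[OF W g, of "-1"] in auto)
 thus ?thesis using iter_partial_cmult[OF W g bs, of "-1"] by (simp add: UNIV_bool)
qed

lemma iter_partial_zero: "ipd bs (%x. 0) = (%x. 0)"
 by (induction bs) (auto simp: partial_const)

text \<open>If uniformity failed, bad points along a subsequence would accumulate by compactness.
  Hence convergence along convergent sequences of points is enough.\<close>

lemma uniform_limit_zero_sequentialI:
 fixes F :: "nat => 'e::metric_space => complex"
 assumes L: "compact L" and F: "!!rh y y0. strict_mono rh ==> (!!n. y n \<in> L) ==> y \<longlonglongrightarrow> y0 ==> y0 \<in> L ==>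
  (%n. F (rh n) (y n)) \<longlonglongrightarrow> 0"
 shows "uniform_limit L F (%_. 0) sequentially"
proof (rule uniform_limitI, rule ccontr)
 fix e :: real assume e: "0 < e" and "~ (\<forall>\<^sub>F n in sequentially. ALL x:L. dist (F n x) 0 < e)"
 hence "\<exists>\<^sub>F n in sequentially. EX x:L. e <= cmod (F n x)" by (simp add: not_eventually not_less)
 hence inf: "infinite {n. EX x:L. e <= cmod (F n x)}" by (simp add: frequently_cofinite cofinite_eq_sequentially[symmetric])
 obtain rh :: "nat => nat" where rh: "strict_mono rh" "ALL n. rh n \<in> {n. EX x:L. e <= cmod (F n x)}"
  using infinite_enumerate[OF inf] that by (elim exE conjE)
 hence "ALL n. EX x. x \<in> L & e <= cmod (F (rh n) x)" by auto
 from choice[OF this] obtain y where "ALL n. y n \<in> L & e <= cmod (F (rh n) (y n))" ..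
 hence y: "y n \<in> L" "e <= cmod (F (rh n) (y n))" for n by simp_all
 obtain y0 s where s: "y0 \<in> L" "strict_mono s" "(y \<circ> s) \<longlonglongrightarrow> y0"
  using L y(1) unfolding compact_eq_seq_compact_metric seq_compact_def by blast
 have "(%n. F ((rh \<circ> s) n) ((y \<circ> s) n)) \<longlonglongrightarrow> 0"
  by (rule F[OF strict_mono_o[OF rh(1) s(2)] _ s(3,1)]) (simp add: y)
 from tendsto_norm[OF this] have "(%n. cmod (F (rh (s n)) (y (s n)))) \<longlonglongrightarrow> 0" by (simp add: o_def)
 from LIMSEQ_le_const[OF this, of e] y(2) e show False by fastforce
qed

text \<open>An open set around the limit already contains all but finitely many terms. No metric is
  involved, as it is applied to sequences in the group.\<close>

lemma compact_insert_limit: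
 fixes f :: "nat => 'a::topological_space"
 assumes f: "f \<longlonglongrightarrow> l"
 shows "compact (insert l (range f))"
proof (rule compactI)
 fix C assume C: "ALL t:C. open t" "insert l (range f) <= \<Union>C"
 then obtain c where c: "c \<in> C" "l \<in> c" by auto
 then obtain N where N: "!!n. n >= N ==> f n \<in> c"
  using topological_tendstoD[OF f] C(1) unfolding eventually_sequentially by blast
 have "ALL n. EX d. d \<in> C & f n \<in> d" using C(2) by auto
 then obtain d where d: "ALL n. d n \<in> C & f n \<in> d n" by metis
 have "insert l (range f) <= \<Union>(insert c (d ` {..<N}))"
 proof -
  have "f n \<in> \<Union>(insert c (d ` {..<N}))" for n using N[of n] d by (cases "n < N") auto
  thus ?thesis using c by auto
 qed
 thus "EX C'<=C. finite C' & insert l (range f) <= \<Union>C'"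
  using c(1) d by (intro exI[of _ "insert c (d ` {..<N})"]) auto
qed

context equivariant
begin

abbreviation "null == bundle_test_null B \<A> r \<pi> \<T>"

lemma null_subseq:
 assumes "null ta" "strict_mono rh"
 shows "null (%n. ta (rh n))"
 unfolding bundle_test_null_def
proof (intro conjI ballI, goal_cases)
 case 1
 show ?case using assms(1) unfolding bundle_test_null_def by blast
next
 case (2 c)
 obtain U ph where c: "c = (U, ph)" by (cases c)
 show ?case
  unfolding c prod.case
 proof (intro ballI allI impI)
  fix t L i bs assume *: "t \<in> \<T>" "compact L & L <= U \<inter> fst t & i < r & set bs <= B"
  have "uniform_limit (ph ` L) (%n. ipd bs (%y. ta n (U, ph) (frame \<pi> t i (inv_into U ph y)))) (%_. 0) sequentially"
   using conjunct2[OF assms(1)[unfolded bundle_test_null_def]] 2 * unfolding c by blast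
  thus "uniform_limit (ph ` L) (%n. ipd bs (%y. ta (rh n) (U, ph) (frame \<pi> t i (inv_into U ph y)))) (%_. 0) sequentially"
   by (rule filterlim_compose[OF _ filterlim_subseq[OF assms(2)]])
 qed
qed

lemma coef_diff: "coef t i U ph (%c e. ta c e - ta' c e) = (%y. coef t i U ph ta y - coef t i U ph ta' y)"
 by (simp add: coef_def fun_eq_iff)

lemma coef_tendsto:
 assumes ta: "!!n. ta n \<in> BT" "ta' \<in> BT" "null (%n c e. ta n c e - ta' c e)"
  and c: "(V, ps) \<in> \<A>" and t: "t \<in> \<T>" and k: "k < r" and cs: "set cs <= B"
  and z: "!!n. z n \<in> ps ` (V \<inter> fst t)" "z0 \<in> ps ` (V \<inter> fst t)" "z \<longlonglongrightarrow> z0"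
 shows "(%n. ipd cs (coef t k V ps (ta n)) (z n)) \<longlonglongrightarrow> ipd cs (coef t k V ps ta') z0"
proof -
 let ?X = "ps ` (V \<inter> fst t)"
 have X: "span_open B ?X" by (rule chart_image_open[OF c]) (use chart_triv_open[OF c t] in auto)
 note sm = smooth_coef[OF ta(1) c t k] smooth_coef[OF ta(2) c t k]
 define Z where "Z = insert z0 (range z)"
 have Z: "compact Z" "Z <= ?X" unfolding Z_def using compact_sequence_with_limit[OF z(3)] z(1,2) by auto
 let ?L = "inv_into V ps ` Z"
 have L: "compact ?L" "?L <= V \<inter> fst t"
  using Z(2) c by (auto intro!: compact_continuous_image[OF continuous_on_subset[OF chart_cont_inv[OF c]] Z(1)])
 have "ps (inv_into V ps y) = y" if "y \<in> Z" for y
  by (rule f_inv_into_f) (use Z(2) that in blast)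
 hence LZ: "ps ` ?L = Z" by (force simp: image_image)
 have "uniform_limit (ps ` ?L) (%n. ipd cs (coef t k V ps (%c e. ta n c e - ta' c e))) (%_. 0) sequentially"
  unfolding coef_def[abs_def] using conjunct2[OF ta(3)[unfolded bundle_test_null_def]] c t k cs L by blast
 hence u: "uniform_limit Z (%n. ipd cs (coef t k V ps (%c e. ta n c e - ta' c e))) (%_. 0) sequentially"
  unfolding LZ .
 have 1: "(%n. ipd cs (coef t k V ps (ta n)) (z n) - ipd cs (coef t k V ps ta') (z n)) \<longlonglongrightarrow> 0"
 proof (rule tendstoI)
  fix e :: real assume "0 < e"
  from uniform_limitD[OF u this]
  show "\<forall>\<^sub>F n in sequentially. dist (ipd cs (coef t k V ps (ta n)) (z n) - ipd cs (coef t k V ps ta') (z n)) 0 < e"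
  proof eventually_elim
   case (elim n)
   hence "dist (ipd cs (coef t k V ps (%c e. ta n c e - ta' c e)) (z n)) 0 < e" by (simp add: Z_def)
   thus ?case unfolding coef_diff iter_partial_diff[OF X sm cs z(1)] .
  qed
 qed
 have 2: "(%n. ipd cs (coef t k V ps ta') (z n)) \<longlonglongrightarrow> ipd cs (coef t k V ps ta') z0"
  by (rule continuous_on_tendsto_compose[OF smooth_continuous[OF smooth_iter_partial[OF sm(2) cs]] z(3,2)]) (simp add: z(1))
 from tendsto_add[OF 1 2] show ?thesis by simp
qed

text \<open>Group element, test measure and point vary together. The higher chain rule has
  coefficients independent of the test measure, so only convergence of its derivatives in a fixed
  chart remains.\<close>

lemma pull_coef_tendsto:
 assumes ta: "!!n. ta n \<in> BT" "ta' \<in> BT" "null (%n c e. ta n c e - ta' c e)"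
  and h: "h \<longlonglongrightarrow> h0" and c: "(U, ph) \<in> \<A>" and t: "(T, Ph) \<in> \<T>" and j: "j < r" and bs: "set bs <= B"
  and y: "!!n. y n \<in> ph ` (U \<inter> T)" "y0 \<in> ph ` (U \<inter> T)" "y \<longlonglongrightarrow> y0"
 shows "(%n. ipd bs (coef (T, Ph) j U ph (pull (h n) (ta n))) (y n)) \<longlonglongrightarrow>
  ipd bs (coef (T, Ph) j U ph (pull h0 ta')) y0"
proof -
 obtain x0 where x0: "x0 \<in> U" "x0 \<in> T" "y0 = ph x0" using y(2) by auto
 obtain Q th V ps T' Ph' Y Ps q where g: "(Q, th) \<in> \<H>" "h0 \<in> Q" and d: "(V, ps) \<in> \<A>" and t': "(T', Ph') \<in> \<T>" and Y: "span_open PB Y"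
  "(th h0, ph x0) \<in> Y" and Ps: "smooth PB Y Ps" "Ps ` Y <= ps ` (V \<inter> T')" and q: "!!k. k < r ==> smooth PB Y (q k)"
  and YQ: "Y <= th ` Q \<times> ph ` (U \<inter> T)"
  and F: "!!ta s y. ta \<in> BT ==> (s, y) \<in> Y ==> coef (T, Ph) j U ph (pull (inv_into Q th s) ta) y =
   (\<Sum>k<r. q k (s, y) * coef (T', Ph') k V ps ta (Ps (s, y)))"
  by (rule pull_joint[OF c x0(1) t x0(2) j, of h0], rule that, assumption+)
 let ?bs = "map (Pair (0 :: 'a)) bs" and ?Z = "ps ` (V \<inter> T')"
 have pbs: "set ?bs <= PB" using bs Pair0_in_prod_basis by auto
 have Z: "span_open B ?Z" by (rule chart_image_open[OF d]) (use chart_triv_open[OF d t'] in auto)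
 have Pss: "Ps ` Y <= span B" using Ps(2) span_open_subset[OF Z] by blast
 have "ALL k:{..<r}. EX R. (ALL cs. smooth PB Y (R cs :: 'a \<times> 'e => complex)) &
  (ALL T V x. span_open B V & smooth B V T & x \<in> Y & Ps x \<in> V -->
   ipd ?bs (%x. q k x * T (Ps x)) x =
   (\<Sum>cs | set cs <= B & length cs <= length ?bs. R cs x * ipd cs T (Ps x)))"
  by (use iter_partial_compose_nideal[OF PB_Basis B_Basis Y(1) Ps(1) Pss _ _ q pbs, of "{}" "{}"] in simp)
 from bchoice[OF this] obtain R where R0: "ALL k:{..<r}. (ALL cs. smooth PB Y (R k cs :: 'a \<times> 'e => complex)) &
  (ALL T V x. span_open B V & smooth B V T & x \<in> Y & Ps x \<in> V -->
   ipd ?bs (%x. q k x * T (Ps x)) x =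
   (\<Sum>cs | set cs <= B & length cs <= length ?bs. R k cs x * ipd cs T (Ps x)))" ..
 have Rs: "smooth PB Y (R k cs)" if "k < r" for k cs using R0 that by blast
 have Re: "ipd ?bs (%x. q k x * coef (T', Ph') k V ps ta (Ps x)) p =
   (\<Sum>cs | set cs <= B & length cs <= length bs. R k cs p * ipd cs (coef (T', Ph') k V ps ta) (Ps p))"
  if "k < r" "ta \<in> BT" "p \<in> Y" for k p ta
 proof -
  have k: "k \<in> {..<r}" using that by simp
  note spec[OF spec[OF spec[OF conjunct2[OF bspec[OF R0 k]], where x = "coef (T', Ph') k V ps ta"], where x = ?Z], where x = p]
  from mp[OF this] show ?thesis using that Z subsetD[OF Ps(2) imageI[OF that(3)]] smooth_coef[OF that(2) d t' that(1)] by (simp only: length_map fst_conv simp_thms)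
 qed
 have ex: "ipd bs (coef (T, Ph) j U ph (pull (inv_into Q th s) ta)) y =
   (\<Sum>k<r. \<Sum>cs | set cs <= B & length cs <= length bs. R k cs (s, y) * ipd cs (coef (T', Ph') k V ps ta) (Ps (s, y)))"
  if ta: "ta \<in> BT" and sy: "(s, y) \<in> Y" for ta s y
 proof -
  have s: "s \<in> span C" using sy span_open_subset[OF Y(1)] span_prod_basis[OF G.B_Basis B_Basis] by auto
  have s1: "smooth PB Y (%p. q k p * coef (T', Ph') k V ps ta (Ps p))" if "k < r" for k
   by (rule smooth_mult[OF Y(1) q[OF that] smooth_compose[OF B_Basis Y(1) Z Ps(2,1)]])
    (use smooth_coef[OF ta d t' that] in simp)
  note s2 = smooth_sum[OF Y(1), of "{..<r}", OF s1, simplified]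
  have "ipd bs (coef (T, Ph) j U ph (pull (inv_into Q th s) ta)) y =
   ipd bs (%y. \<Sum>k<r. q k (s, y) * coef (T', Ph') k V ps ta (Ps (s, y))) y"
   by (rule iter_partial_cong[OF smooth_slice(1)[OF G.B_Basis B_Basis Y(1) s2 s] bs]) (use sy F[OF ta] in auto)
  also have "... = ipd ?bs (%p. \<Sum>k<r. q k p * coef (T', Ph') k V ps ta (Ps p)) (s, y)"
   by (rule iter_partial_slice[symmetric])
  also have "... = (\<Sum>k<r. ipd ?bs (%p. q k p * coef (T', Ph') k V ps ta (Ps p)) (s, y))"
   by (rule iter_partial_sum[OF Y(1) s1 pbs sy]) simp
  finally show ?thesis using Re[OF _ ta sy] by simp
 qed
 define p where "p n = (th (h n), y n)" for n
 have hQ: "\<forall>\<^sub>F n in sequentially. h n \<in> Q" by (rule topological_tendstoD[OF h G.chart_open[OF g(1)] g(2)])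
 have plim: "p \<longlonglongrightarrow> (th h0, y0)" unfolding p_def
  by (intro tendsto_Pair y continuous_on_tendsto_compose[OF G.chart_cont[OF g(1)] h g(2) hQ])
 obtain O' where O': "open O'" "Y = span PB \<inter> O'" using Y(1) unfolding openin_open by blast
 have yspan: "y n \<in> span B" for n
  using y(1)[of n] span_open_subset[OF chart_span_open[OF c]] by auto
 have y0O: "(th h0, y0) \<in> O'" using O' Y(2) x0(3) by simp
 have pY: "\<forall>\<^sub>F n in sequentially. h n \<in> Q & p n \<in> Y"
  using hQ topological_tendstoD[OF plim O'(1) y0O]
 proof (eventually_elim)
  case (elim n)
  have "th (h n) \<in> span C" by (rule subsetD[OF span_open_subset[OF G.chart_span_open[OF g(1)]] imageI[OF elim(1)]])
  hence "p n \<in> span PB" by (simp add: p_def span_prod_basis[OF G.B_Basis B_Basis] yspan)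
  thus ?case using elim O' Y(2) x0(3) by auto
 qed
 \<comment> \<open>Finitely many terms may lie outside \<open>Y\<close>; replacing them by the limit
   point changes no limit and gives a sequence entirely in \<open>Y\<close>.\<close>
 define p' where "p' n = (if h n \<in> Q & p n \<in> Y then p n else (th h0, y0))" for n
 have p'Y: "p' n \<in> Y" for n using Y(2) x0(3) by (simp add: p'_def)
 have pp': "\<forall>\<^sub>F n in sequentially. p n = p' n" using pY by eventually_elim (simp add: p'_def)
 have p'lim: "p' \<longlonglongrightarrow> (th h0, y0)" by (rule Lim_transform_eventually[OF plim pp'])
 have cY: "(%n. f (p' n)) \<longlonglongrightarrow> f (th h0, y0)" if "smooth PB Y f" for f :: "'a \<times> 'e => 'z::real_normed_vector"
  by (rule continuous_on_tendsto_compose[OF smooth_continuous[OF that] p'lim]) (use p'Y Y(2) x0(3) in auto)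
 have Psp: "Ps (p' n) \<in> ps ` (V \<inter> fst (T', Ph'))" "Ps (th h0, y0) \<in> ps ` (V \<inter> fst (T', Ph'))" for n
  using Ps(2) p'Y Y(2) x0(3) by auto
 have A: "(%n. \<Sum>k<r. \<Sum>cs | set cs <= B & length cs <= length bs. R k cs (p' n) * ipd cs (coef (T', Ph') k V ps (ta n)) (Ps (p' n)))
  \<longlonglongrightarrow> (\<Sum>k<r. \<Sum>cs | set cs <= B & length cs <= length bs. R k cs (th h0, y0) * ipd cs (coef (T', Ph') k V ps ta') (Ps (th h0, y0)))"
  by (intro tendsto_sum tendsto_mult cY Rs coef_tendsto[OF ta d t' _ _ Psp cY[OF Ps(1)]]) auto
 have B: "(\<Sum>k<r. \<Sum>cs | set cs <= B & length cs <= length bs. R k cs (th h0, y0) * ipd cs (coef (T', Ph') k V ps ta') (Ps (th h0, y0)))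
  = ipd bs (coef (T, Ph) j U ph (pull h0 ta')) y0"
  using ex[OF ta(2), of "th h0" y0] Y(2) x0(3) g by simp
 have C: "\<forall>\<^sub>F n in sequentially. (\<Sum>k<r. \<Sum>cs | set cs <= B & length cs <= length bs. R k cs (p' n) * ipd cs (coef (T', Ph') k V ps (ta n)) (Ps (p' n)))
  = ipd bs (coef (T, Ph) j U ph (pull (h n) (ta n))) (y n)"
  using pY pp'
 proof eventually_elim
  case (elim n)
  thus ?case using ex[OF ta(1)[of n], of "th (h n)" "y n"] g(1) by (simp add: p_def)
 qed
 from Lim_transform_eventually[OF A C] show ?thesis unfolding B .
qed

text \<open>Joint sequential continuity of pullback, the source of both the continuity in
  \<open>h\<close> and the uniformity over compact sets.\<close>

lemma pull_null:
 assumes ta: "!!n. ta n \<in> BT" "ta' \<in> BT" "null (%n c e. ta n c e - ta' c e)" and h: "h \<longlonglongrightarrow> h0"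
 shows "null (%n c e. pull (h n) (ta n) c e - pull h0 ta' c e)"
 unfolding bundle_test_null_def
proof (intro conjI ballI, goal_cases)
 case 1
 obtain K where K: "compact K" "!!n c e. ta n c e - ta' c e ~= 0 ==> \<pi> e \<in> K"
  using conjunct1[OF ta(3)[unfolded bundle_test_null_def]] by blast
 obtain K' where K': "compact K'" "!!c e. ta' c e ~= 0 ==> \<pi> e \<in> K'" using bt_supp[OF ta(2)] by blast
 let ?A = "insert h0 (range h)"
 \<comment> \<open>A compact set containing all supports: the inverses of the sequence and of its
   limit move the compact set \<open>K \<union> K'\<close> only within a compact set.\<close>
 let ?L = "(%p. act (ginv (fst p)) (snd p)) ` (?A \<times> (K \<union> K'))"
 have L: "compact ?L"
  by (intro compact_continuous_image cont_act_comp cont_ginv continuous_intros compact_Times compact_Un K K' compact_insert_limit h)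
 have mem: "\<pi> e \<in> ?L" if "\<pi> (lift k e) \<in> K \<union> K'" "k \<in> ?A" for k e
  by (rule image_eqI[of _ _ "(k, act k (\<pi> e))"]) (use that in simp_all)
 have "\<pi> e \<in> ?L" if "pull (h n) (ta n) c e - pull h0 ta' c e ~= 0" for n c e
 proof (cases "pull h0 ta' c e = 0")
  case True
  hence "ta n (tr (h n) c) (lift (h n) e) ~= 0" using that by (simp add: pullback_eq)
  hence "\<pi> (lift (h n) e) \<in> K \<union> K'"
   using K(2)[of n "tr (h n) c" "lift (h n) e"] K'(2)[of "tr (h n) c" "lift (h n) e"] by fastforce
  thus ?thesis by (rule mem) simp
 next
  case False
  hence "\<pi> (lift h0 e) \<in> K \<union> K'" using K'(2)[of "tr h0 c" "lift h0 e"] by (simp add: pullback_eq)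
  thus ?thesis by (rule mem) simp
 qed
 thus ?case using L by (intro exI[of _ ?L]) blast
next
 case (2 c)
 obtain U ph where c: "c = (U, ph)" by (cases c)
 have cA: "(U, ph) \<in> \<A>" using 2 c by simp
 show ?case
  unfolding c prod.case
 proof (intro ballI allI impI)
  fix t L i bs assume *: "t \<in> \<T>" "compact L & L <= U \<inter> fst t & i < r & set bs <= B"
  obtain T Ph where t: "t = (T, Ph)" by (cases t)
  have tT: "(T, Ph) \<in> \<T>" and L: "compact L" "L <= U \<inter> T" "L <= U" and i: "i < r" and bs: "set bs <= B" using * t by auto
  have X: "span_open B (ph ` (U \<inter> T))" by (rule chart_image_open[OF cA]) (use chart_triv_open[OF cA tT] in auto)
  have LX: "ph ` L <= ph ` (U \<inter> T)" using L(2) by blast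
  let ?f = "%n. coef (T, Ph) i U ph (pull (h n) (ta n))" and ?g = "coef (T, Ph) i U ph (pull h0 ta')"
  have sf: "smooth B (ph ` (U \<inter> T)) (?f n)" for n using smooth_coef[OF pull_bt[OF ta(1)] cA tT i] by simp
  have sg: "smooth B (ph ` (U \<inter> T)) ?g" using smooth_coef[OF pull_bt[OF ta(2)] cA tT i] by simp
  have "uniform_limit (ph ` L) (%n. ipd bs (%y. ?f n y - ?g y)) (%_. 0) sequentially"
  proof (rule uniform_limit_zero_sequentialI)
   show "compact (ph ` L)" by (rule chart_image_compact(1)[OF cA L(1,3)])
   fix rh :: "nat => nat" and y y0 assume rh: "strict_mono rh" and y: "!!n. y n \<in> ph ` L" "y \<longlonglongrightarrow> y0" "y0 \<in> ph ` L"
   have yX: "y n \<in> ph ` (U \<inter> T)" "y0 \<in> ph ` (U \<inter> T)" for n using y LX by auto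
   have "(%n. ipd bs (?f (rh n)) (y n)) \<longlonglongrightarrow> ipd bs ?g y0"
    by (rule pull_coef_tendsto[OF ta(1,2) null_subseq[OF ta(3) rh] LIMSEQ_subseq_LIMSEQ[OF h rh, unfolded o_def] cA tT i bs yX y(2)])
   moreover have "(%n. ipd bs ?g (y n)) \<longlonglongrightarrow> ipd bs ?g y0"
    by (rule continuous_on_tendsto_compose[OF smooth_continuous[OF smooth_iter_partial[OF sg bs]] y(2) yX(2)]) (simp add: yX)
   ultimately have "(%n. ipd bs (?f (rh n)) (y n) - ipd bs ?g (y n)) \<longlonglongrightarrow> 0"
    using tendsto_diff by fastforce
   thus "(%n. ipd bs (%y. ?f (rh n) y - ?g y) (y n)) \<longlonglongrightarrow> 0"
    unfolding iter_partial_diff[OF X sf sg bs yX(1)] .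
  qed
  thus "uniform_limit (ph ` L) (%n. ipd bs (%y. pull (h n) (ta n) (U, ph) (frame \<pi> t i (inv_into U ph y)) -
    pull h0 ta' (U, ph) (frame \<pi> t i (inv_into U ph y)))) (%_. 0) sequentially"
   unfolding t coef_def .
 qed
qed

section \<open>Continuity in the group variable and the weak integral as a distribution\<close>

lemma distribution_null:
 assumes "si \<in> bundle_distributions B \<A> r \<pi> \<T>" "!!n. ta n \<in> BT" "null ta"
 shows "(%n. si (ta n)) \<longlonglongrightarrow> 0"
proof -
 note d = conjunct2[OF conjunct2[OF assms(1)[unfolded bundle_distributions_def mem_Collect_eq]]]
 show ?thesis by (rule mp[OF spec[OF d, where x = ta]]) (use assms(2,3) in simp)
qed

lemma pull_continuous:
 assumes si: "si \<in> bundle_distributions B \<A> r \<pi> \<T>" and ta: "ta \<in> BT"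
 shows "continuous_on UNIV (%h. si (pull h ta))"
proof -
 have "(%n. si (pull (X n) ta)) \<longlonglongrightarrow> si (pull h ta)" if X: "X \<longlonglongrightarrow> h" for X h
 proof -
  have "null (%n c e. ta c e - ta c e)"
   unfolding bundle_test_null_def by (auto intro!: exI[of _ "{}"] uniform_limit_const simp: iter_partial_zero)
  from pull_null[OF ta ta this X]
  have n: "null (%n c e. pull (X n) ta c e - pull h ta c e)" .
  have "(%c e. pull (X n) ta c e - pull h ta c e) \<in> BT" for n
   using bt_lincomb[OF pull_bt[OF ta] pull_bt[OF ta], of "X n" "-1" h] by simp
  from distribution_null[OF si this n]
  have "(%n. si (%c e. pull (X n) ta c e - pull h ta c e)) \<longlonglongrightarrow> 0" .
  moreover have "si (%c e. pull (X n) ta c e - pull h ta c e) = si (pull (X n) ta) - si (pull h ta)" for n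
   using distribution_lincomb[OF si pull_bt[OF ta] pull_bt[OF ta], of "X n" "-1" h] by simp
  ultimately show ?thesis by (simp add: LIM_zero_iff)
 qed
 thus ?thesis
  unfolding continuous_on_eq_continuous_at[OF open_UNIV] isCont_def tendsto_at_iff_sequentially by (simp add: o_def)
qed

text \<open>Elements violating the bound would have a convergent subsequence in the compact set,
  contradicting joint continuity.\<close>

lemma pull_uniform_null:
 assumes si: "si \<in> bundle_distributions B \<A> r \<pi> \<T>" and ta: "!!n. ta n \<in> BT" "null ta" and Om: "compact Om" and e: "0 < e"
 shows "\<forall>\<^sub>F n in sequentially. ALL h:Om. cmod (si (pull h (ta n))) < e"
proof (rule ccontr)
 assume "~ ?thesis"
 hence "\<exists>\<^sub>F n in sequentially. EX h:Om. e <= cmod (si (pull h (ta n)))" by (simp add: not_eventually not_less)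
 hence inf: "infinite {n. EX h:Om. e <= cmod (si (pull h (ta n)))}" by (simp add: frequently_cofinite cofinite_eq_sequentially[symmetric])
 obtain rh :: "nat => nat" where rh: "strict_mono rh" "ALL n. rh n \<in> {n. EX h:Om. e <= cmod (si (pull h (ta n)))}"
  using infinite_enumerate[OF inf] that by (elim exE conjE)
 hence "ALL n. EX h. h \<in> Om & e <= cmod (si (pull h (ta (rh n))))" by auto
 from choice[OF this] obtain k where "ALL n. k n \<in> Om & e <= cmod (si (pull (k n) (ta (rh n))))" ..
 hence k: "k n \<in> Om" "e <= cmod (si (pull (k n) (ta (rh n))))" for n by simp_all
 have "seq_compact Om" using Om by (simp add: compact_imp_seq_compact)
 then obtain h s where s: "strict_mono s" "(k \<circ> s) \<longlonglongrightarrow> h" using k(1) unfolding seq_compact_def by blast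
 let ?ta = "%n. ta (rh (s n))"
 have n: "null (%n c e. ?ta n c e - 0)"
  using null_subseq[OF null_subseq[OF ta(2) rh(1)] s(1)] by simp
 have p0: "pull h (%c e. 0) = (%(c :: ('m, 'e) chart) e. 0)" by (intro ext) (simp only: pullback_eq)
 have nn: "null (%n. pull (k (s n)) (?ta n))"
  using pull_null[OF ta(1) bt_null n, of "k \<circ> s" h] s(2) by (simp add: p0)
 have "(%n. si (pull (k (s n)) (?ta n))) \<longlonglongrightarrow> 0"
  by (rule distribution_null[OF si pull_bt[OF ta(1)] nn])
 from tendsto_norm[OF this] have "(%n. cmod (si (pull (k (s n)) (?ta n)))) \<longlonglongrightarrow> 0" by simp
 from LIMSEQ_le_const[OF this, of e] k(2) e show False by fastforce
qed

text \<open>A smooth density is bounded on compact coordinate balls, so every point has a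
  neighbourhood of finite measure, and finitely many of these cover.\<close>

lemma finite_measure_compact:
 assumes dh: "smooth_measure C \<H> dh" and Om: "compact Om"
 shows "emeasure dh Om < \<infinity>"
proof -
 have sets: "sets dh = sets borel" using dh by (simp add: smooth_measure_def)
 have "EX V. open V & h \<in> V & emeasure dh V < \<infinity>" for h
 proof -
  obtain Q th where g: "(Q, th) \<in> \<H>" "h \<in> Q" using G.chart_ex by blast
  have o: "span_open C (th ` Q)" by (rule G.chart_span_open[OF g(1)])
  obtain O' where O': "open O'" "th ` Q = span C \<inter> O'" using o unfolding openin_open by blast
  then obtain d where d: "d > 0" "cball (th h) d <= O'" using g(2) open_contains_cball by blast
  let ?L = "cball (th h) d \<inter> span C"
  have L: "compact ?L" "?L <= th ` Q" using d O' closed_subspace[OF subspace_span] by auto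
  define V where "V = Q \<inter> th -` ball (th h) d"
  have V: "open V" unfolding V_def by (rule continuous_open_preimage[OF G.chart_cont[OF g(1)] G.chart_open[OF g(1)]]) simp
  have "EX rh::'h => real. smooth_fun C \<H> Q rh & (ALL x:Q. 0 <= rh x) & (ALL A:sets borel. A <= Q -->
     emeasure dh A = (\<integral>\<^sup>+y\<in>th ` A. ennreal (rh (inv_into Q th y)) \<partial>coord_lborel C))"
   using bspec[OF conjunct2[OF dh[unfolded smooth_measure_def]] g(1)] unfolding prod.case .
  then obtain rh :: "'h => real" where rh: "smooth_fun C \<H> Q rh" "ALL A:sets borel. A <= Q -->
     emeasure dh A = (\<integral>\<^sup>+y\<in>th ` A. ennreal (rh (inv_into Q th y)) \<partial>coord_lborel C)" by blast
  have "continuous_on (th ` Q) (%y. rh (inv_into Q th y))"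
   using smooth_continuous[OF G.smooth_fun_chart[OF rh(1) g(1)]] by simp
  hence "compact ((%y. rh (inv_into Q th y)) ` ?L)"
   by (intro compact_continuous_image L(1)) (rule continuous_on_subset[OF _ L(2)])
  then obtain M where M: "!!y. y \<in> ?L ==> rh (inv_into Q th y) <= M"
   using compact_imp_bounded bounded_real by (metis abs_le_D1 imageI)
  have VL: "th ` V <= ?L" using span_open_subset[OF o] by (auto simp: V_def)
  have "emeasure dh V = (\<integral>\<^sup>+y\<in>th ` V. ennreal (rh (inv_into Q th y)) \<partial>coord_lborel C)"
   using rh(2) V by (auto simp: V_def)
  also have "... <= (\<integral>\<^sup>+y. ennreal M * indicator ?L y \<partial>coord_lborel C)"
   using VL M by (intro nn_integral_mono) (auto simp: indicator_def intro!: ennreal_leI)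
  also have "... = ennreal M * emeasure (coord_lborel C) ?L"
   by (rule nn_integral_cmult_indicator) (use compact_imp_closed[OF L(1)] in simp)
  also have "... < \<infinity>"
   using emeasure_coord_bounded[OF G.B_Basis compact_imp_bounded[OF L(1)]] compact_imp_closed[OF L(1)]
   by (simp add: ennreal_mult_less_top)
  finally show ?thesis using V g(2) d(1) by (intro exI[of _ V]) (auto simp: V_def)
 qed
 hence "ALL h. EX V. open V & h \<in> V & emeasure dh V < \<infinity>" ..
 from choice[OF this] obtain V where "ALL h. open (V h) & h \<in> V h & emeasure dh (V h) < \<infinity>" ..
 hence V: "open (V h)" "h \<in> V h" "emeasure dh (V h) < \<infinity>" for h by simp_all
 have cov: "Om <= (\<Union>h\<in>Om. V h)" using V(2) by auto
 obtain D where D: "finite D" "Om <= (\<Union>h\<in>D. V h)"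
  by (rule compactE_image[OF Om V(1) cov])
 have "emeasure dh Om <= emeasure dh (\<Union>h\<in>D. V h)"
  by (rule emeasure_mono[OF D(2)]) (simp add: sets V(1) open_UN borel_open)
 also have "... <= (\<Sum>h\<in>D. emeasure dh (V h))"
  by (rule emeasure_subadditive_finite[OF D(1)]) (use sets V(1) in auto)
 also have "... < \<infinity>" using V(3) D(1) by (simp add: less_top)
 finally show ?thesis .
qed

lemma pull_integrable:
 assumes si: "si \<in> bundle_distributions B \<A> r \<pi> \<T>" and ta: "ta \<in> BT"
  and dh: "smooth_measure C \<H> dh" and Om: "compact Om"
 shows "set_integrable dh Om (%h. si (pull h ta))"
proof -
 have sets: "sets dh = sets borel" using dh by (simp add: smooth_measure_def)
 note c = pull_continuous[OF si ta]
 have "compact ((%h. si (pull h ta)) ` Om)"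
  by (intro compact_continuous_image Om continuous_on_subset[OF c]) simp
 then obtain M where M: "!!h. h \<in> Om ==> cmod (si (pull h ta)) <= M"
  using compact_imp_bounded bounded_iff by (metis imageI)
 have meas: "(%h. si (pull h ta)) \<in> borel_measurable borel"
  by (rule borel_measurable_continuous_onI[OF c])
 have Oms: "Om \<in> sets borel" using compact_imp_closed[OF Om] by simp
 show ?thesis
  unfolding set_integrable_def
 proof (rule integrableI_bounded_set[where A = Om and B = M])
  have "(%h. indicat_real Om h *\<^sub>R si (pull h ta)) \<in> borel_measurable borel"
   by (intro borel_measurable_scaleR borel_measurable_indicator Oms meas)
  thus "(%h. indicat_real Om h *\<^sub>R si (pull h ta)) \<in> borel_measurable dh"
   using measurable_cong_sets[OF sets refl] by blast
 qed (use M Oms sets finite_measure_compact[OF dh Om] in \<open>auto simp: indicator_def\<close>)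
qed

lemma weak_integral_distribution:
 assumes si: "si \<in> bundle_distributions B \<A> r \<pi> \<T>" and dh: "smooth_measure C \<H> dh" and Om: "compact Om"
 shows "weak_integral dh Om (%h. translate H act lift h si) \<in> bundle_distributions B \<A> r \<pi> \<T>"
proof -
 let ?I = "weak_integral dh Om (%h. translate H act lift h si)"
 have I: "?I ta = (LINT h:Om|dh. si (pull h ta))" for ta by (simp add: weak_integral_def translate_def)
 have plin: "si (pull h (%c e. ta c e + z * ta' c e)) = si (pull h ta) + z * si (pull h ta')"
  if "ta \<in> BT" "ta' \<in> BT" for h ta ta' z
  using distribution_lincomb[OF si pull_bt[OF that(1)] pull_bt[OF that(2)], of h z h]
  by (simp add: pullback_eq[abs_def])
 have lin: "?I (%c e. ta c e + z * ta' c e) = ?I ta + z * ?I ta'" if "ta \<in> BT" "ta' \<in> BT" for ta ta' z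
  unfolding I plin[OF that] using pull_integrable[OF si that(1) dh Om] pull_integrable[OF si that(2) dh Om]
  by (subst set_integral_add(2)) auto
 have "?I (%c e. 0) = 0" using lin[OF bt_null bt_null, of 1] by simp
 hence sc: "?I (%c e. z * ta c e) = z * ?I ta" if "ta \<in> BT" for z ta
  using lin[OF bt_null that, of z] by simp
 have "(%n. ?I (ta n)) \<longlonglongrightarrow> 0" if ta: "!!n. ta n \<in> BT" "null ta" for ta
 proof (rule tendstoI)
  fix e :: real assume e: "0 < e"
  \<comment> \<open>The integrand will be bounded by \<open>e / (M + 1)\<close>; the
    \<open>+ 1\<close> covers the case of measure zero and makes the final inequality
    strict.\<close>
  define M where "M = measure dh Om"
  have M: "0 <= M" by (simp add: M_def)
  have "\<forall>\<^sub>F n in sequentially. ALL h:Om. cmod (si (pull h (ta n))) < e / (M + 1)"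
   by (rule pull_uniform_null[OF si ta Om]) (use e M in simp)
  thus "\<forall>\<^sub>F n in sequentially. dist (?I (ta n)) 0 < e"
  proof eventually_elim
   case (elim n)
   have Oms: "Om \<in> sets dh" using compact_imp_closed[OF Om] dh by (simp add: smooth_measure_def)
   note i = pull_integrable[OF si ta(1) dh Om, of n]
   have "cmod (LINT h:Om|dh. si (pull h (ta n))) <= (LINT h:Om|dh. cmod (si (pull h (ta n))))"
    by (rule set_integral_norm_bound[OF i])
   also have "... <= (LINT h:Om|dh. e / (M + 1))"
    using elim finite_measure_compact[OF dh Om] Oms
    by (intro set_integral_mono set_integrable_norm i) (auto simp: set_integrable_def less_imp_le)
   also have "... = M * (e / (M + 1))"
    unfolding set_lebesgue_integral_def using Oms by (simp add: M_def)
   also have "... < e" using e M by (simp add: field_simps)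
   finally show ?case by (simp add: I)
  qed
 qed
 thus ?thesis
  unfolding bundle_distributions_def mem_Collect_eq using lin[of _ _ 1] sc by auto
qed

end

section \<open>Tangential differential operators in coordinates\<close>

definition diffop :: "'e::euclidean_space set => nat => ('e list => 'e => complex) => ('e => complex) => 'e => complex" where
 "diffop B m a g x = (\<Sum>bs | set bs <= B & length bs <= m. a bs x * ipd bs g x)"

text \<open>The binomial theorem for multi-indices written as lists.\<close>

lemma monom_diff: "monom cs (x - z) = (\<Sum>(u, v)\<leftarrow>splits cs. monom u x * ((-1) ^ length v * monom v z))"
proof (induction cs)
 case (Cons c cs)
 have "(\<Sum>(u, v)\<leftarrow>xs. a * f u v) = a * (\<Sum>(u, v)\<leftarrow>xs. f u v)" for a :: complex and f :: "'a list => 'a list => complex" and xs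
  by (induction xs) (auto simp: distrib_left)
 note p = this[symmetric]
 have "monom (c # cs) (x - z) = of_real (x \<bullet> c) * monom cs (x - z) + (- of_real (z \<bullet> c)) * monom cs (x - z)"
  by (simp add: inner_diff_left algebra_simps)
 thus ?case unfolding Cons p
  by (simp add: o_def case_prod_unfold mult_ac)
qed simp

lemma monom_remove1: "c \<in> set cs ==> of_real (x \<bullet> c) * monom (remove1 c cs) x = monom cs x"
 by (induction cs) (auto simp: mult.left_commute)

lemma nideal_monom_ncount:
 assumes W: "span_open B W" and N: "finite N"
 shows "nideal B N (ncount N v) W (monom v)"
proof -
 have "nideal B N (length (filter (%b. b \<in> N) v)) W (monom (filter (%b. b \<in> N) v))"
  by (rule nideal_monom[OF W N]) auto
 from nideal_mult_smooth[OF W smooth_monom[OF W, of "filter (%b. b ~: N) v"] this]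
 have "nideal B N (ncount N v) W (%x. monom (filter (%b. b ~: N) v) x * monom (filter (%b. b \<in> N) v) x)" .
 moreover have "monom (filter (%b. b ~: N) w) x * monom (filter (%b. b \<in> N) w) x = monom w x" for w x
  by (induction w) (auto simp: mult_ac)
 ultimately show ?thesis by simp
qed

lemma monom_zero: "monom cs 0 = (if cs = [] then 1 else 0)"
 by (cases cs) simp_all

text \<open>The value at the origin of the derivative \<open>bs\<close> of the monomial
  \<open>cs\<close>: a product of factorials if the two lists are rearrangements of each other, and
  zero otherwise. The recursion differentiates in the head direction first, which explains
  \<open>rev bs\<close> below.\<close>

fun partial_coeff :: "'a list => 'a list => nat" where
 "partial_coeff [] cs = (if cs = [] then 1 else 0)"
| "partial_coeff (b # bs) cs = count_list cs b * partial_coeff bs (remove1 b cs)"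

lemma partial_monom_shift:
 assumes "b \<in> Basis" "set cs <= Basis"
 shows "pd b (%x. monom cs (x - z)) x = of_nat (count_list cs b) * monom (remove1 b cs) (x - z)"
proof (rule partial_derivI)
 show "((%t::real. monom cs (x + t *\<^sub>R b - z)) has_vector_derivative of_nat (count_list cs b) * monom (remove1 b cs) (x - z)) (at 0)"
  using assms(2)
 proof (induction cs)
  case (Cons c cs)
  have 1: "((%t::real. complex_of_real ((x + t *\<^sub>R b - z) \<bullet> c)) has_vector_derivative of_real (b \<bullet> c)) (at 0)"
   unfolding has_vector_derivative_def by (auto intro!: derivative_eq_intros simp: inner_left_distrib inner_diff_left scaleR_conv_of_real)
  have "((%t::real. monom cs (x + t *\<^sub>R b - z)) has_vector_derivative of_nat (count_list cs b) * monom (remove1 b cs) (x - z)) (at 0)"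
   using Cons by simp
  from has_vector_derivative_mult[OF 1 this]
  have 2: "((%t::real. monom (c # cs) (x + t *\<^sub>R b - z)) has_vector_derivative
   of_real ((x - z) \<bullet> c) * (of_nat (count_list cs b) * monom (remove1 b cs) (x - z)) + of_real (b \<bullet> c) * monom cs (x - z)) (at 0)"
   by simp
  have "of_real ((x - z) \<bullet> c) * (of_nat (count_list cs b) * monom (remove1 b cs) (x - z)) + of_real (b \<bullet> c) * monom cs (x - z)
   = of_nat (count_list (c # cs) b) * monom (remove1 b (c # cs)) (x - z)"
  proof (cases "c = b")
   case True
   thus ?thesis using monom_remove1[of b cs "x - z"] assms(1)
    by (cases "b \<in> set cs") (simp_all add: count_list_0_iff algebra_simps)
  next
   case False
   hence "b \<bullet> c = 0" using inner_Basis[of b c] assms(1) Cons.prems by auto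
   thus ?thesis using False by simp
  qed
  thus ?case using 2 by simp
 qed simp
qed

lemma smooth_monom_shift: "span_open B W ==> smooth B W (%x. monom cs (x - z))"
 by (induction cs) (simp_all add: smooth_const smooth_mult smooth_of_real smooth_inner_const smooth_diff smooth_ident)

lemma iter_partial_monom_shift:
 assumes "B <= Basis" "set bs <= B" "set cs <= B" "z \<in> span B"
 shows "ipd (rev bs) (%x. monom cs (x - z)) z = of_nat (partial_coeff bs cs)"
 using assms(2,3)
proof (induction bs arbitrary: cs)
 case (Cons b bs)
 have o: "span_open B (span B)" by simp
 have "pd b (%x. monom cs (x - z)) = (%x. of_nat (count_list cs b) * monom (remove1 b cs) (x - z))"
  by (rule ext, rule partial_monom_shift) (use Cons.prems assms(1) in auto)
 hence "ipd (rev (b # bs)) (%x. monom cs (x - z)) z =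
   ipd (rev bs) (%x. of_nat (count_list cs b) * monom (remove1 b cs) (x - z)) z"
  by (simp add: iter_partial_append)
 also have "... = of_nat (count_list cs b) * ipd (rev bs) (%x. monom (remove1 b cs) (x - z)) z"
  by (rule iter_partial_cmult[OF o smooth_monom_shift[OF o] _ assms(4)]) (use Cons.prems in auto)
 also have "ipd (rev bs) (%x. monom (remove1 b cs) (x - z)) z = of_nat (partial_coeff bs (remove1 b cs))"
  by (rule Cons.IH) (use Cons.prems set_remove1_subset[of b cs] in auto)
 finally show ?case by simp
qed (simp add: monom_zero)

lemma partial_coeff_mset: "partial_coeff bs cs ~= 0 ==> mset bs = mset cs"
proof (induction bs arbitrary: cs)
 case (Cons b bs)
 hence "b \<in> set cs" "mset bs = mset (remove1 b cs)" using count_notin[of b cs] by fastforce+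
 thus ?case by simp
qed (simp split: if_splits)

lemma partial_coeff_self: "partial_coeff cs cs ~= 0"
 by (induction cs) simp_all

lemma iter_partial_monom_shift_eq:
 assumes "B <= Basis" "set bs <= B" "set cs <= B" "z \<in> span B"
 shows "ipd bs (%x. monom cs (x - z)) z = (if mset bs = mset cs then of_nat (partial_coeff cs cs) else 0)"
proof (cases "mset bs = mset cs")
 case True
 have o: "span_open B (span B)" by simp
 have "ipd bs (%x. monom cs (x - z)) z = ipd (rev cs) (%x. monom cs (x - z)) z"
  by (rule iter_partial_perm[OF assms(1) o smooth_monom_shift[OF o] assms(2,4)]) (simp add: True)
 thus ?thesis using iter_partial_monom_shift[OF assms(1,3,3,4)] True by simp
next
 case False
 thus ?thesis
  using iter_partial_monom_shift[OF assms(1) _ assms(3,4), of "rev bs"] assms(2) partial_coeff_mset[of "rev bs" cs] by auto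
qed

text \<open>
  Coefficients of an operator are not unique, since multi-indices are lists.  Averaging over
  permutations gives a representation whose coefficient at \<open>bs\<close> is a multiple of the value at \<open>z\<close>
 of the operator on the monomial \<open>(x - z)\<^bsup>bs\<^esup>\<close>, which determines its order of vanishing.
\<close>

lemma diffop_symmetrize:
 assumes B: "B <= Basis" and N: "N <= B" and W: "span_open B W"
  and a: "!!bs. set bs <= B ==> length bs <= m ==> smooth B W (a bs)"
  and I: "!!u. set u <= B ==> length u <= m ==> nideal B N (ncount N u) W (diffop B m a (monom u))"
 obtains A where "!!bs. set bs <= B ==> length bs <= m ==> nideal B N (ncount N bs) W (A bs)"
  "!!V g x. span_open B V ==> smooth B V g ==> x \<in> V ==> diffop B m a g x = diffop B m A g x"
proof -
 let ?L = "{bs. set bs <= B & length bs <= m}"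
 have fin: "finite ?L" by (rule finite_lists_le[OF finite_Basis_subset[OF B]])
 have finN: "finite N" using N finite_Basis_subset[OF B] finite_subset by blast
 define S where "S c x = (\<Sum>bs\<in>{bs\<in>?L. mset bs = mset c}. a bs x)" for c x
 define n where "n c = card {bs\<in>?L. mset bs = mset c}" for c
 \<comment> \<open>The sum over all rearrangements of \<open>c\<close>, shared equally among
   them.\<close>
 define A where "A c x = (1 / of_nat (n c)) * S c x" for c x
 have S: "nideal B N (ncount N c) W (S c)" if c: "set c <= B" "length c <= m" for c
 proof -
  \<comment> \<open>Applied to the monomial in \<open>x - z\<close> and evaluated at
    \<open>z\<close>, the operator sees only rearrangements of \<open>c\<close>. The binomial
    expansion then leaves its values on the monomials \<open>monom u\<close>, to which
    \<open>I\<close> applies.\<close>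
  have e: "S c z = (1 / of_nat (partial_coeff c c)) * (\<Sum>(u, v)\<leftarrow>splits c. (-1) ^ length v * (monom v z * diffop B m a (monom u) z))"
   if z: "z \<in> W" for z
  proof -
   have zB: "z \<in> span B" using z span_open_subset[OF W] by blast
   have "diffop B m a (%x. monom c (x - z)) z = (\<Sum>bs\<in>?L. if mset bs = mset c then a bs z * of_nat (partial_coeff c c) else 0)"
    unfolding diffop_def by (intro sum.cong refl) (use iter_partial_monom_shift_eq[OF B _ c(1) zB] in auto)
   also have "... = S c z * of_nat (partial_coeff c c)"
    unfolding S_def sum_distrib_right by (rule sum.inter_filter[OF fin, symmetric])
   finally have 1: "S c z * of_nat (partial_coeff c c) = diffop B m a (%x. monom c (x - z)) z" ..
   have "ipd bs (%x. monom c (x - z)) z = (\<Sum>(u, v)\<leftarrow>splits c. (-1) ^ length v * monom v z * ipd bs (monom u) z)"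
    if bs: "set bs <= B" for bs
   proof -
    have sm: "smooth B W (%x. (-1) ^ length v * monom v z * monom u x)" for u v
     by (rule smooth_cmult[OF W smooth_monom[OF W]])
    have "ipd bs (%x. \<Sum>(u, v)\<leftarrow>xs. (-1) ^ length v * monom v z * monom u x) z = (\<Sum>(u, v)\<leftarrow>xs. (-1) ^ length v * monom v z * ipd bs (monom u) z)" for xs
    proof -
     have "ipd bs (%x. \<Sum>i<length xs. (-1) ^ length (snd (xs ! i)) * monom (snd (xs ! i)) z * monom (fst (xs ! i)) x) z =
      (\<Sum>i<length xs. (-1) ^ length (snd (xs ! i)) * monom (snd (xs ! i)) z * ipd bs (monom (fst (xs ! i))) z)"
      by (subst iter_partial_sum[OF W sm bs z]) (simp add: iter_partial_cmult[OF W smooth_monom[OF W] bs z])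
     thus ?thesis by (simp add: sum_list_sum_nth atLeast0LessThan case_prod_unfold)
    qed
    thus ?thesis unfolding monom_diff by (simp add: mult_ac)
   qed
   hence "diffop B m a (%x. monom c (x - z)) z = (\<Sum>bs\<in>?L. a bs z * (\<Sum>(u, v)\<leftarrow>splits c. (-1) ^ length v * monom v z * ipd bs (monom u) z))"
    unfolding diffop_def by (intro sum.cong refl) auto
   also have "... = (\<Sum>(u, v)\<leftarrow>splits c. (-1) ^ length v * (monom v z * diffop B m a (monom u) z))"
   proof -
    have "(\<Sum>bs\<in>?L. f bs * (\<Sum>(u, v)\<leftarrow>xs. g u v * h u bs)) = (\<Sum>(u, v)\<leftarrow>xs. g u v * (\<Sum>bs\<in>?L. f bs * h u bs))"
     for f and g h :: "'a list => 'a list => complex" and xs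
     by (induction xs) (auto simp: sum.distrib distrib_left sum_distrib_left mult_ac)
    thus ?thesis unfolding diffop_def mult.assoc[symmetric] .
   qed
   finally show ?thesis using 1 partial_coeff_self[of c] by (simp add: field_simps)
  qed
  have "nideal B N (ncount N c) W (%z. (-1) ^ length v * (monom v z * diffop B m a (monom u) z))" if uv: "(u, v) \<in> set (splits c)" for u v
  proof (rule nideal_mult_smooth[OF W smooth_const[OF W]])
   have m: "mset u + mset v = mset c" by (rule splits_mset[OF uv])
   have uB: "set u <= B" "set v <= B" "length u <= m"
    using splits_set[OF uv] c arg_cong[OF m, of size] by auto
   have "ncount N c = ncount N v + ncount N u"
    using arg_cong[OF m, of "%M. size (filter_mset (%b. b \<in> N) M)"] by (simp add: mset_filter[symmetric] del: mset_filter)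
   moreover have "nideal B N (ncount N v) W (monom v)" by (rule nideal_monom_ncount[OF W finN])
   ultimately show "nideal B N (ncount N c) W (%z. monom v z * diffop B m a (monom u) z)"
    using nideal_mult[OF W _ I[OF uB(1,3)]] by (simp del: nideal.simps)
  qed
  hence "nideal B N (ncount N c) W (%z. \<Sum>i<length (splits c). case splits c ! i of (u, v) => (-1) ^ length v * (monom v z * diffop B m a (monom u) z))"
   by (intro nideal_sum[OF W]) (auto simp: case_prod_unfold)
  hence "nideal B N (ncount N c) W (%z. (1 / of_nat (partial_coeff c c)) * (\<Sum>(u, v)\<leftarrow>splits c. (-1) ^ length v * (monom v z * diffop B m a (monom u) z)))"
   by (intro nideal_mult_smooth[OF W smooth_const[OF W]]) (simp add: sum_list_sum_nth atLeast0LessThan case_prod_unfold)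
  thus ?thesis by (subst nideal_cong[OF W e])
 qed
 have A: "nideal B N (ncount N c) W (A c)" if "set c <= B" "length c <= m" for c
  unfolding A_def by (rule nideal_mult_smooth[OF W smooth_const[OF W] S[OF that]])
 have "diffop B m a g x = diffop B m A g x" if V: "span_open B V" "smooth B V g" "x \<in> V" for V g x
 proof -
  \<comment> \<open>After the sums are exchanged, each \<open>a bs\<close> occurs once for every
    rearrangement of \<open>bs\<close>, always with the same derivative, and the division by
    \<open>n bs\<close> cancels this.\<close>
  have "diffop B m A g x = (\<Sum>c\<in>?L. \<Sum>bs\<in>?L. if mset bs = mset c then a bs x * ipd bs g x / of_nat (n bs) else 0)"
   unfolding diffop_def
  proof (intro sum.cong refl)
   fix c assume c: "c \<in> ?L"
   have "A c x * ipd c g x = (\<Sum>bs\<in>{bs\<in>?L. mset bs = mset c}. a bs x * ipd c g x / of_nat (n c))"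
    by (simp add: A_def S_def sum_distrib_right sum_divide_distrib)
   also have "... = (\<Sum>bs\<in>{bs\<in>?L. mset bs = mset c}. a bs x * ipd bs g x / of_nat (n bs))"
   proof (intro sum.cong refl)
    fix bs assume bs: "bs \<in> {bs\<in>?L. mset bs = mset c}"
    hence "ipd c g x = ipd bs g x" "n bs = n c"
     using c by (auto simp: n_def intro!: iter_partial_perm[OF B V(1,2) _ V(3)])
    thus "a bs x * ipd c g x / of_nat (n c) = a bs x * ipd bs g x / of_nat (n bs)" by simp
   qed
   also have "... = (\<Sum>bs\<in>?L. if mset bs = mset c then a bs x * ipd bs g x / of_nat (n bs) else 0)"
    by (rule sum.inter_filter[OF fin])
   finally show "A c x * ipd c g x = (\<Sum>bs\<in>?L. if mset bs = mset c then a bs x * ipd bs g x / of_nat (n bs) else 0)" .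
  qed
  also have "... = (\<Sum>bs\<in>?L. \<Sum>c\<in>?L. if mset bs = mset c then a bs x * ipd bs g x / of_nat (n bs) else 0)"
   by (rule sum.swap)
  also have "... = (\<Sum>bs\<in>?L. a bs x * ipd bs g x)"
  proof (intro sum.cong refl)
   fix bs assume bs: "bs \<in> ?L"
   have "n bs ~= 0" unfolding n_def using bs finite_subset[OF _ fin, of "{bs'\<in>?L. mset bs' = mset bs}"] by (auto simp: card_gt_0_iff)
   moreover have "(\<Sum>c\<in>?L. if mset bs = mset c then a bs x * ipd bs g x / of_nat (n bs) else 0) =
    (\<Sum>c\<in>{c\<in>?L. mset bs = mset c}. a bs x * ipd bs g x / of_nat (n bs))"
    by (rule sum.inter_filter[OF fin, symmetric])
   moreover have "{c\<in>?L. mset bs = mset c} = {c\<in>?L. mset c = mset bs}" by auto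
   ultimately show "(\<Sum>c\<in>?L. if mset bs = mset c then a bs x * ipd bs g x / of_nat (n bs) else 0) = a bs x * ipd bs g x"
    by (simp add: n_def)
  qed
  finally show ?thesis by (simp add: diffop_def)
 qed
 with A show ?thesis by (rule that)
qed

section \<open>Adapted charts\<close>

lemma monom_prod: "monom cs x = (\<Prod>i<length cs. of_real (x \<bullet> (cs ! i)))"
 by (induction cs) (simp_all add: prod.lessThan_Suc_shift del: prod.lessThan_Suc)

locale submanifold = manifold B \<A>
 for B :: "'e::euclidean_space set" and \<A> :: "('m::{t2_space, second_countable_topology}, 'e) chart set" +
 fixes S :: "'m set"
 assumes closed_sub: "closed_submanifold B \<A> S"
begin

definition adapted :: "'m set => ('m => 'e) => 'e set => bool" where
 "adapted V ph N \<longleftrightarrow> (V, ph) \<in> \<A> & N <= B & (ALL x:V. x \<in> S \<longleftrightarrow> (ALL b:N. ph x \<bullet> b = 0))"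

lemma adaptedD:
 assumes "adapted V ph N"
 shows adapted_chart: "(V, ph) \<in> \<A>" and adapted_normal: "N <= B" and adapted_finite: "finite N"
  and adapted_S: "x \<in> V ==> x \<in> S \<longleftrightarrow> (ALL b:N. ph x \<bullet> b = 0)"
 using assms finite_subset[OF _ finite_Basis_subset[OF B_Basis]] by (auto simp: adapted_def)

lemma adapted_restrict: "adapted V ph N ==> open W ==> adapted (V \<inter> W) ph N"
 using chart_restrict by (auto simp: adapted_def)

text \<open>A coordinate ball centred on \<open>S\<close> is star-shaped in the normal directions,
  as Hadamard's lemma requires.\<close>

lemma adapted_star:
 assumes V: "adapted V ph N" and p: "p \<in> V" "p \<in> S" and W: "open W" "p \<in> W"
 obtains V' where "p \<in> V'" "V' <= V" "V' <= W" "adapted V' ph N" "nstar N (ph ` V')"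
proof -
 have c: "(V, ph) \<in> \<A>" by (rule adapted_chart[OF V])
 have X: "span_open B (ph ` (V \<inter> W))" by (rule chart_image_Int_open[OF c W(1)])
 then obtain O' where O': "open O'" "ph ` (V \<inter> W) = span B \<inter> O'" unfolding openin_open by blast
 hence "ph p \<in> O'" using p W by blast
 then obtain e where e: "e > 0" "ball (ph p) e <= O'" using O'(1) open_contains_ball by blast
 define V' where "V' = V \<inter> (W \<inter> (V \<inter> ph -` ball (ph p) e))"
 have o: "open (W \<inter> (V \<inter> ph -` ball (ph p) e))"
  by (intro open_Int W continuous_open_preimage[OF chart_cont[OF c] chart_open[OF c]]) simp
 have "ph ` V' = ball (ph p) e \<inter> span B"
 proof (intro equalityI subsetI)
  fix y assume "y \<in> ph ` V'"
  thus "y \<in> ball (ph p) e \<inter> span B" using span_open_subset[OF chart_span_open[OF c]] by (auto simp: V'_def)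
 next
  fix y assume y: "y \<in> ball (ph p) e \<inter> span B"
  hence "y \<in> ph ` (V \<inter> W)" using e O' by auto
  thus "y \<in> ph ` V'" using y by (auto simp: V'_def)
 qed
 moreover have "nstar N (ball (ph p) e \<inter> span B)"
  by (rule nstar_ball[OF adapted_normal[OF V] B_Basis]) (use adapted_S[OF V p(1)] p(2) in blast)
 ultimately have "nstar N (ph ` V')" by simp
 moreover have "adapted V' ph N" unfolding V'_def by (rule adapted_restrict[OF V o])
 ultimately show ?thesis using that[of V'] p W e(1) by (auto simp: V'_def)
qed

lemma adapted_ex:
 assumes p: "p \<in> S"
 obtains V ph N where "adapted V ph N" "p \<in> V"
proof -
 obtain d where "ALL p:S. EX (U, ph):\<A>. p \<in> U & (EX J<=B. card J = d & ph ` (S \<inter> U) = ph ` U \<inter> span J)"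
  using closed_sub unfolding closed_submanifold_def by blast
 then obtain U ph J where c: "(U, ph) \<in> \<A>" "p \<in> U" and J: "J <= B" "ph ` (S \<inter> U) = ph ` U \<inter> span J"
  using p by blast
 have "x \<in> S \<longleftrightarrow> (ALL b:B - J. ph x \<bullet> b = 0)" if x: "x \<in> U" for x
 proof -
  have "x \<in> S \<longleftrightarrow> ph x \<in> ph ` (S \<inter> U)"
   using x inj_on_image_mem_iff[OF chart_inj[OF c(1)] x, of "S \<inter> U"] by simp
  also have "... \<longleftrightarrow> ph x \<in> span J" using J(2) x by auto
  also have "... \<longleftrightarrow> (ALL b:B - J. ph x \<bullet> b = 0)"
  proof -
   have "ph x \<in> span B" using x span_open_subset[OF chart_span_open[OF c(1)]] by blast
   hence "ALL b:Basis - B. ph x \<bullet> b = 0" using span_Basis_eq[OF B_Basis] by blast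
   thus ?thesis using span_Basis_eq[of J "ph x"] J(1) B_Basis by blast
  qed
  finally show ?thesis .
 qed
 hence "adapted U ph (B - J)" using c by (auto simp: adapted_def)
 thus ?thesis using that c(2) by blast
qed

text \<open>Hadamard's lemma puts each factor that vanishes on \<open>S\<close> into the ideal of
  the normal coordinates; products and sums follow. The neighbourhood shrinks because the given
  representation is only local.\<close>

lemma ideal_nideal:
 assumes f: "f \<in> ideal_power B \<A> S k W" and V: "adapted V ph N" and p: "p \<in> V" "p \<in> W" "p \<in> S"
 obtains V' where "p \<in> V'" "V' <= V" "V' <= W" "adapted V' ph N" "nideal B N k (ph ` V') (%y. f (inv_into V ph y))"
proof -
 note f2 = conjunct2[OF f[unfolded ideal_power_def mem_Collect_eq]]
 obtain V0 and M :: nat and a g where V0: "open V0" "p \<in> V0" "V0 <= W"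
  and ag: "ALL j<M. smooth_fun B \<A> V0 (a j) & (ALL i<k. smooth_fun B \<A> V0 (g j i) & (ALL x:S \<inter> V0. g j i x = 0))"
  and F: "ALL x:V0. f x = (\<Sum>j<M. a j x * (\<Prod>i<k. g j i x))"
  using bspec[OF f2 p(2)] that by (elim exE conjE)
 have a: "smooth_fun B \<A> V0 (a j)" if "j < M" for j using ag that by simp
 have g: "smooth_fun B \<A> V0 (g j i)" "!!x. x \<in> S ==> x \<in> V0 ==> g j i x = 0" if "j < M" "i < k" for i j
  using ag that by simp_all
 obtain V' where V': "p \<in> V'" "V' <= V" "V' <= V0" "adapted V' ph N" "nstar N (ph ` V')"
  by (rule adapted_star[OF V p(1,3) V0(1,2)])
 let ?i = "inv_into V ph"
 have c: "(V, ph) \<in> \<A>" "(V', ph) \<in> \<A>" using V V'(4) adapted_chart by auto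
 have X: "span_open B (ph ` V')" by (rule chart_span_open[OF c(2)])
 have sm: "smooth B (ph ` V') (%y. u (?i y))" if "smooth_fun B \<A> V0 u" for u :: "'m => complex"
  by (rule smooth_subset[OF smooth_fun_chart[OF that c(1)]]) (use V'(2,3) in auto)
 have iV: "?i y \<in> V'" "ph (?i y) = y" if "y \<in> ph ` V'" for y using that V'(2) c(1) by (auto simp: subset_iff)
 have "nideal B N 1 (ph ` V') (%y. g j i (?i y))" if ji: "j < M" "i < k" for j i
 proof (rule Hadamard[OF B_Basis adapted_normal[OF V] X V'(5) sm[OF g(1)[OF ji]]])
  fix y assume y: "y \<in> ph ` V'" "!!b. b \<in> N ==> y \<bullet> b = 0"
  hence "?i y \<in> S" using adapted_S[OF V'(4) iV(1)[OF y(1)]] iV(2)[OF y(1)] by simp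
  thus "g j i (?i y) = 0" using g(2)[OF ji] iV(1)[OF y(1)] V'(3) by blast
 qed
 hence "nideal B N l (ph ` V') (%y. \<Prod>i<l. g j i (?i y))" if "j < M" "l <= k" for j l
  using that(2)
 proof (induction l)
  case (Suc l)
  have "nideal B N (l + 1) (ph ` V') (%y. (\<Prod>i<l. g j i (?i y)) * g j l (?i y))"
   by (intro nideal_mult[OF X]) (use Suc that in auto)
  thus ?case by (simp del: nideal.simps)
 qed (simp add: smooth_const[OF X])
 hence "nideal B N k (ph ` V') (%y. \<Sum>j<M. a j (?i y) * (\<Prod>i<k. g j i (?i y)))"
  by (intro nideal_sum[OF X] nideal_mult_smooth[OF X] sm a) auto
 moreover have "f (?i y) = (\<Sum>j<M. a j (?i y) * (\<Prod>i<k. g j i (?i y)))" if "y \<in> ph ` V'" for y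
  using F iV(1)[OF that] V'(3) by blast
 ultimately have "nideal B N k (ph ` V') (%y. f (?i y))" by (subst nideal_cong[OF X])
 thus ?thesis using that[of V'] V'(1-4) V0(3) by blast
qed

text \<open>Expansion into monomials supplies the factors that the sheaf definition asks for. Only
  points of \<open>S\<close> need an argument.\<close>

lemma ideal_powerI:
 assumes W: "open W" and f: "smooth_fun B \<A> W f"
  and loc: "!!p. p \<in> S ==> p \<in> W ==> EX V ph N. adapted V ph N & p \<in> V & V <= W & nideal B N k (ph ` V) (%y. f (inv_into V ph y))"
 shows "f \<in> ideal_power B \<A> S k W"
 unfolding ideal_power_def mem_Collect_eq
proof (intro conjI f ballI)
 fix p assume p: "p \<in> W"
 show "EX V. open V & p \<in> V & V <= W & (EX (M::nat) a g. (ALL j<M. smooth_fun B \<A> V (a j) &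
  (ALL i<k. smooth_fun B \<A> V (g j i) & (ALL x:S \<inter> V. g j i x = 0))) & (ALL x:V. f x = (\<Sum>j<M. a j x * (\<Prod>i<k. g j i x))))"
 proof (cases "p \<in> S")
  case False
  have "closed S" using closed_sub by (simp add: closed_submanifold_def)
  hence o: "open (W - S)" using W by auto
  have "smooth_fun B \<A> (W - S) f" by (rule smooth_fun_subset[OF f]) auto
  \<comment> \<open>Away from the closed set \<open>S\<close> every function lies in every power:
    the constant one vanishes on the empty set.\<close>
  thus ?thesis using o p False smooth_fun_const[OF o]
   by (intro exI[of _ "W - S"] conjI exI[of _ "1::nat"] exI[of _ "%_. f"] exI[of _ "%_ _ _. 1"]) auto
 next
  case True
  then obtain V ph N where V: "adapted V ph N" "p \<in> V" "V <= W" and n: "nideal B N k (ph ` V) (%y. f (inv_into V ph y))"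
   using loc p by blast
  have c: "(V, ph) \<in> \<A>" by (rule adapted_chart[OF V(1)])
  have X: "span_open B (ph ` V)" and o: "open V" by (rule chart_span_open[OF c], rule chart_open[OF c])
  obtain e where e: "!!cs. smooth B (ph ` V) (e cs)"
   "!!y. y \<in> ph ` V ==> f (inv_into V ph y) = (\<Sum>cs | set cs <= N & length cs = k. e cs y * monom cs y)"
   using nideal_expand[OF X n] by blast
  have "finite {cs. set cs <= N & length cs = k}" by (rule finite_lists_length_eq[OF adapted_finite[OF V(1)]])
  from finite_distinct_list[OF this] obtain xs where "set xs = {cs. set cs <= N & length cs = k} & distinct xs" ..
  hence xs: "set xs = {cs. set cs <= N & length cs = k}" "distinct xs" by simp_all
  have len: "length (xs ! j) = k" "set (xs ! j) <= N" if "j < length xs" for j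
   using nth_mem[OF that] xs(1) by auto
  let ?a = "%j x. e (xs ! j) (ph x)" and ?g = "%j i x. complex_of_real (ph x \<bullet> (xs ! j ! i))"
  have 1: "f x = (\<Sum>j<length xs. ?a j x * (\<Prod>i<k. ?g j i x))" if x: "x \<in> V" for x
  proof -
   have "f x = (\<Sum>cs\<in>set xs. e cs (ph x) * monom cs (ph x))"
    using e(2)[of "ph x"] x c xs(1) by simp
   also have "... = (\<Sum>j<length xs. ?a j x * monom (xs ! j) (ph x))"
    unfolding sum.distinct_set_conv_list[OF xs(2)] by (simp add: sum_list_sum_nth atLeast0LessThan)
   also have "... = (\<Sum>j<length xs. ?a j x * (\<Prod>i<k. ?g j i x))"
    using len by (intro sum.cong refl) (simp add: monom_prod)
   finally show ?thesis .
  qed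
  have 2: "smooth_fun B \<A> V (?a j)" for j by (rule smooth_fun_chart_comp[OF c o order_refl e(1)])
  have 3: "smooth_fun B \<A> V (?g j i)" for j i by (rule smooth_fun_chart_comp[OF c o order_refl smooth_coord[OF X]])
  have 4: "?g j i x = 0" if "j < length xs" "i < k" "x \<in> S" "x \<in> V" for j i x
  proof -
   have "xs ! j ! i \<in> N" using len[OF that(1)] nth_mem[of i "xs ! j"] that(2) by auto
   thus ?thesis using adapted_S[OF V(1) that(4)] that(3) by simp
  qed
  show ?thesis
   using o V(2,3) 1 2 3 4 by (intro exI[of _ V] conjI exI[of _ "length xs"] exI[of _ ?a] exI[of _ ?g]) auto
 qed
qed

text \<open>Tangentiality is tested on the coordinate monomials, which lie in the power |u|_N of the
  ideal; \<open>diffop_symmetrize\<close> converts the outcome into orders of vanishing of the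
  coefficients.\<close>

lemma tangential_normal_form:
 assumes U: "open U" and D: "diff_operator B \<A> U D" and tan: "tangential B \<A> S U D"
  and V: "adapted V ph N" and p: "p \<in> V" "p \<in> U" "p \<in> S"
 obtains V' m A where "p \<in> V'" "V' <= V" "V' <= U" "adapted V' ph N"
  "!!bs. set bs <= B ==> length bs <= m ==> nideal B N (ncount N bs) (ph ` V') (A bs)"
  "!!W f x. open W ==> W <= U ==> smooth_fun B \<A> W f ==> x \<in> W ==> x \<in> V' ==>
   D f x = diffop B m A (%y. f (inv_into V ph y)) (ph x)"
proof -
 have c: "(V, ph) \<in> \<A>" by (rule adapted_chart[OF V])
 obtain m where "ALL (V, ph):\<A>. EX a::'e list => 'm => complex.
  (ALL bs. set bs <= B & length bs <= m --> smooth_fun B \<A> (U \<inter> V) (a bs)) &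
  (ALL W f. open W & W <= U & smooth_fun B \<A> W f -->
    (ALL x:W \<inter> V. D f x = (\<Sum>bs | set bs <= B & length bs <= m. a bs x * ipd bs (f \<circ> inv_into V ph) (ph x))))"
  using D[unfolded diff_operator_def] ..
 from bspec[OF this c, unfolded prod.case] obtain a :: "'e list => 'm => complex" where
  a0: "ALL bs. set bs <= B & length bs <= m --> smooth_fun B \<A> (U \<inter> V) (a bs)"
  and Da: "ALL W f. open W & W <= U & smooth_fun B \<A> W f -->
    (ALL x:W \<inter> V. D f x = (\<Sum>bs | set bs <= B & length bs <= m. a bs x * ipd bs (f \<circ> inv_into V ph) (ph x)))"
  using that by (elim exE conjE)
 have a: "smooth_fun B \<A> (U \<inter> V) (a bs)" if "set bs <= B" "length bs <= m" for bs using a0 that by simp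
 define a' where "a' bs y = a bs (inv_into V ph y)" for bs y
 have Da': "D f x = diffop B m a' (%y. f (inv_into V ph y)) (ph x)"
  if "open W" "W <= U" "smooth_fun B \<A> W f" "x \<in> W" "x \<in> V" for W f x
 proof -
  have "ALL x:W \<inter> V. D f x = (\<Sum>bs | set bs <= B & length bs <= m. a bs x * ipd bs (f \<circ> inv_into V ph) (ph x))"
   by (rule mp[OF spec[OF spec[OF Da]]]) (use that in simp)
  thus ?thesis using that(4,5) c by (simp add: diffop_def a'_def o_def)
 qed
 define V1 where "V1 = V \<inter> U"
 have V1: "adapted V1 ph N" unfolding V1_def by (rule adapted_restrict[OF V U])
 have c1: "(V1, ph) \<in> \<A>" and o1: "open V1" using adapted_chart[OF V1] chart_open by auto
 have X1: "span_open B (ph ` V1)" by (rule chart_span_open[OF c1])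
 let ?L = "{u. set u <= B & length u <= m}"
 have "ALL u:?L. EX V'. p \<in> V' & open V' & nideal B N (ncount N u) (ph ` (V1 \<inter> V')) (diffop B m a' (monom u))"
 proof
  fix u assume u: "u \<in> ?L"
  let ?f = "%x. monom u (ph x)"
  have sf: "smooth_fun B \<A> V1 ?f" by (rule smooth_fun_chart_comp[OF c1 o1 order_refl smooth_monom[OF X1]])
  have "nideal B N (ncount N u) (ph ` V1) (monom u)" by (rule nideal_monom_ncount[OF X1 adapted_finite[OF V]])
  hence "nideal B N (ncount N u) (ph ` V1) (%y. ?f (inv_into V1 ph y))"
   by (subst nideal_cong[OF X1, of _ "monom u"]) (use c1 in auto)
  hence "?f \<in> ideal_power B \<A> S (ncount N u) V1"
   using V1 by (intro ideal_powerI[OF o1 sf]) blast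
  hence Df: "D ?f \<in> ideal_power B \<A> S (ncount N u) V1"
   by (rule bspec[OF mp[OF spec[OF spec[OF tan[unfolded tangential_def]]]], rotated]) (use o1 V1_def in simp)
  have pV1: "p \<in> V1" using p by (simp add: V1_def)
  obtain V' where V': "p \<in> V'" "V' <= V1" "adapted V' ph N" "nideal B N (ncount N u) (ph ` V') (%y. D ?f (inv_into V1 ph y))"
   by (rule ideal_nideal[OF Df V1 pV1 pV1 p(3)])
  have X': "span_open B (ph ` V')" by (rule chart_span_open[OF adapted_chart[OF V'(3)]])
  have "diffop B m a' (monom u) y = D ?f (inv_into V1 ph y)" if y: "y \<in> ph ` V'" for y
  proof -
   obtain x where x: "x \<in> V'" "y = ph x" using y by blast
   have xV: "x \<in> V1" "x \<in> V" "y \<in> ph ` V1" using x V'(2) by (auto simp: V1_def)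
   have "D ?f x = diffop B m a' (%y. ?f (inv_into V ph y)) (ph x)"
    by (rule Da'[OF o1 _ sf xV(1,2)]) (simp add: V1_def)
   also have "... = diffop B m a' (monom u) y"
    unfolding diffop_def x(2)[symmetric]
    by (intro sum.cong refl arg_cong2[where f = "(*)"] iter_partial_cong[OF X1 _ xV(3)]) (use c in \<open>auto simp: V1_def\<close>)
   finally show ?thesis using xV(1) c1 x(2) by simp
  qed
  hence "nideal B N (ncount N u) (ph ` V') (diffop B m a' (monom u))"
   using V'(4) by (subst nideal_cong[OF X'])
  thus "EX V'. p \<in> V' & open V' & nideal B N (ncount N u) (ph ` (V1 \<inter> V')) (diffop B m a' (monom u))"
   using V' chart_open[OF adapted_chart[OF V'(3)]] by (intro exI[of _ V']) (simp add: Int_absorb1)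
 qed
 from bchoice[OF this] obtain Vu where Vu: "ALL u:?L. p \<in> Vu u & open (Vu u) &
  nideal B N (ncount N u) (ph ` (V1 \<inter> Vu u)) (diffop B m a' (monom u))" ..
 have fin: "finite ?L" by (rule finite_lists_le[OF finite_Basis_subset[OF B_Basis]])
 \<comment> \<open>There are finitely many monomials of degree at most \<open>m\<close>, so their
   neighbourhoods can be intersected.\<close>
 define V2 where "V2 = V1 \<inter> (\<Inter>u\<in>?L. Vu u)"
 have oI: "open (\<Inter>u\<in>?L. Vu u)" using fin Vu by (intro open_INT) auto
 have V2: "adapted V2 ph N" unfolding V2_def by (rule adapted_restrict[OF V1 oI])
 have X2: "span_open B (ph ` V2)" by (rule chart_span_open[OF adapted_chart[OF V2]])
 have p2: "p \<in> V2" using p Vu by (auto simp: V2_def V1_def)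
 have sub2: "V2 <= V" "V2 <= U" "V2 <= V1" by (auto simp: V2_def V1_def)
 have sa: "smooth B (ph ` V2) (a' bs)" if "set bs <= B" "length bs <= m" for bs
  unfolding a'_def by (rule smooth_subset[OF smooth_fun_chart[OF a[OF that] c]]) (use sub2 in auto)
 have I: "nideal B N (ncount N u) (ph ` V2) (diffop B m a' (monom u))" if u: "set u <= B" "length u <= m" for u
 proof -
  have uL: "u \<in> ?L" using u by simp
  hence "ph ` V2 <= ph ` (V1 \<inter> Vu u)" unfolding V2_def by (intro image_mono) blast
  thus ?thesis using bspec[OF Vu uL] nideal_subset by blast
 qed
 obtain A where A: "!!bs. set bs <= B ==> length bs <= m ==> nideal B N (ncount N bs) (ph ` V2) (A bs)"
  "!!V g x. span_open B V ==> smooth B V g ==> x \<in> V ==> diffop B m a' g x = diffop B m A g x"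
  by (rule diffop_symmetrize[OF B_Basis adapted_normal[OF V] X2 sa I], assumption+, rule that, assumption+)
 have "D f x = diffop B m A (%y. f (inv_into V ph y)) (ph x)"
  if W: "open W" "W <= U" "smooth_fun B \<A> W f" "x \<in> W" "x \<in> V2" for W f x
 proof -
  have "x \<in> V" using W(5) sub2 by blast
  from Da'[OF W(1-4) this] show ?thesis
   using A(2)[OF chart_image_Int_open[OF c W(1)] smooth_fun_chart[OF W(3) c], of "ph x"] W(4) \<open>x \<in> V\<close> by simp
 qed
 thus ?thesis using that[OF p2 sub2(1,2) V2, of m A] A(1) by blast
qed

end

section \<open>Functionals vanishing along the submanifold\<close>

context submanifold
begin

text \<open>\<open>diff_operator\<close> demands an expression in every chart of the atlas; the
  higher chain rule for the transition maps provides the coefficients.\<close>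

lemma chart_diff_operator:
 assumes c: "(U, ph) \<in> \<A>" and e: "smooth B (ph ` U) e" and w: "set w <= B"
 shows "diff_operator B \<A> U (%f x. e (ph x) * ipd w (%y. f (inv_into U ph y)) (ph x))"
 unfolding diff_operator_def
proof (rule exI[of _ "length w"], rule ballI)
 fix d assume "d \<in> \<A>"
 moreover obtain V ps where d': "d = (V, ps)" by (cases d)
 ultimately have d: "(V, ps) \<in> \<A>" by simp
 let ?X = "ph ` (U \<inter> V)" and ?Ps = "%y. ps (inv_into U ph y)"
 have X: "span_open B ?X" by (rule chart_image_Int_open[OF c chart_open[OF d]])
 have o: "open (U \<inter> V)" using chart_open c d by auto
 have "?Ps ` ?X <= ps ` V" using c by auto
 hence im: "?Ps ` ?X <= span B" using span_open_subset[OF chart_span_open[OF d]] by (rule subset_trans)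
 obtain G where G: "ALL cs. smooth B ?X (G cs :: 'e => complex)"
  "ALL T Y y. span_open B Y & smooth B Y T & y \<in> ?X & ?Ps y \<in> Y -->
   ipd w (%y. T (?Ps y)) y = (\<Sum>cs | set cs <= B & length cs <= length w. G cs y * ipd cs T (?Ps y))"
  using iter_partial_compose[OF B_Basis B_Basis X chart_transition[OF c d] im w] that by (elim exE conjE)
 show "case d of (V, ps) => EX a. (ALL bs. set bs <= B & length bs <= length w --> smooth_fun B \<A> (U \<inter> V) (a bs)) &
  (ALL W f. open W & W <= U & smooth_fun B \<A> W f --> (ALL x:W \<inter> V.
    e (ph x) * ipd w (%y. f (inv_into U ph y)) (ph x) =
    (\<Sum>bs | set bs <= B & length bs <= length w. a bs x * ipd bs (f \<circ> inv_into V ps) (ps x))))"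
  unfolding d' prod.case
 proof (intro exI[of _ "%bs x. e (ph x) * G bs (ph x)"] conjI allI impI ballI)
  fix bs
  show "smooth_fun B \<A> (U \<inter> V) (%x. e (ph x) * G bs (ph x))"
   by (rule smooth_fun_chart_comp[OF c o _ smooth_mult[OF X smooth_subset[OF e] spec[OF G(1)]]]) auto
 next
  fix W and f :: "'m => complex" and x assume W: "open W & W <= U & smooth_fun B \<A> W f" and x: "x \<in> W \<inter> V"
  let ?T = "%z. f (inv_into V ps z)"
  have "ipd w (%y. f (inv_into U ph y)) (ph x) = ipd w (%y. ?T (?Ps y)) (ph x)"
   by (rule iter_partial_cong[OF X w]) (use W x c d in auto)
  also have "... = (\<Sum>cs | set cs <= B & length cs <= length w. G cs (ph x) * ipd cs ?T (?Ps (ph x)))"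
   by (rule mp[OF spec[OF spec[OF spec[OF G(2), of ?T], of "ps ` (V \<inter> W)"]]], intro conjI chart_image_Int_open[OF d] smooth_fun_chart[OF _ d])
    (use W x c in \<open>auto simp: subset_iff\<close>)
  finally show "e (ph x) * ipd w (%y. f (inv_into U ph y)) (ph x) =
    (\<Sum>bs | set bs <= B & length bs <= length w. e (ph x) * G bs (ph x) * ipd bs (f \<circ> inv_into V ps) (ps x))"
   using W x c by (auto simp: sum_distrib_left mult.assoc o_def subset_iff)
 qed
qed

text \<open>The derivative costs at most as many orders as it has normal directions, and the
  monomial restores them.\<close>

lemma monom_tangential:
 assumes U: "adapted U ph N" and w: "set w <= B" and gm: "set gm <= N" "ncount N w <= length gm"
 shows "tangential B \<A> S U (%f x. monom gm (ph x) * ipd w (%y. f (inv_into U ph y)) (ph x))"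
 unfolding tangential_def
proof (intro allI impI ballI)
 fix k W and f :: "'m => complex" assume W: "open W & W <= U" and f: "f \<in> ideal_power B \<A> S k W"
 have c: "(U, ph) \<in> \<A>" by (rule adapted_chart[OF U])
 have X: "span_open B (ph ` W)" by (rule chart_image_open[OF c]) (use W in auto)
 let ?F = "%y. f (inv_into U ph y)"
 have "smooth_fun B \<A> W f" using f by (simp add: ideal_power_def)
 from smooth_fun_chart[OF this c] have F: "smooth B (ph ` W) ?F" using W by (simp add: Int_absorb1)
 show "(%x. monom gm (ph x) * ipd w ?F (ph x)) \<in> ideal_power B \<A> S k W"
 proof (rule ideal_powerI)
  show "open W" using W by simp
  show "smooth_fun B \<A> W (%x. monom gm (ph x) * ipd w ?F (ph x))"
   by (rule smooth_fun_chart_comp[OF c _ _ smooth_mult[OF X smooth_monom[OF X] smooth_iter_partial[OF F w]]]) (use W in auto)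
  fix p assume p: "p \<in> S" "p \<in> W"
  obtain V where V: "p \<in> V" "V <= U" "V <= W" "adapted V ph N" "nideal B N k (ph ` V) ?F"
   by (rule ideal_nideal[OF f U _ p(2,1)]) (use W p(2) in auto)
  have cV: "(V, ph) \<in> \<A>" by (rule adapted_chart[OF V(4)])
  have Y: "span_open B (ph ` V)" by (rule chart_span_open[OF cV])
  have 1: "nideal B N (k - ncount N w) (ph ` V) (ipd w ?F)"
  \<comment> \<open>If the derivative has more than \<open>k\<close> normal directions, only
    smoothness of its result is left, and the monomial alone has degree at least
    \<open>k\<close>.\<close>
  proof (cases "ncount N w <= k")
   case True
   thus ?thesis by (intro nideal_iter_partial[OF Y B_Basis adapted_normal[OF U] w]) (simp add: V(5) del: nideal.simps)
  next
   case False
   thus ?thesis using smooth_iter_partial[OF smooth_subset[OF F image_mono[OF V(3)]] w] by simp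
  qed
  have "nideal B N (length gm + (k - ncount N w)) (ph ` V) (%y. monom gm y * ipd w ?F y)"
   by (rule nideal_mult[OF Y nideal_monom[OF Y adapted_finite[OF U] gm(1)] 1])
  hence 2: "nideal B N k (ph ` V) (%y. monom gm y * ipd w ?F y)"
   by (rule nideal_antimono[OF Y, rotated]) (use gm(2) in simp)
  have "nideal B N k (ph ` V) (%y. monom gm (ph (inv_into V ph y)) * ipd w ?F (ph (inv_into V ph y))) \<longleftrightarrow>
    nideal B N k (ph ` V) (%y. monom gm y * ipd w ?F y)"
   by (rule nideal_cong[OF Y]) (use cV in auto)
  thus "EX V ph' N. adapted V ph' N & p \<in> V & V <= W & nideal B N k (ph' ` V)
    (%y. monom gm (ph (inv_into V ph' y)) * ipd w ?F (ph (inv_into V ph' y)))"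
   using V 2 by blast
 qed
qed

lemma bounded_Linf_loc:
 assumes "H \<in> borel_measurable borel" "!!x. cmod (H x) <= R"
 shows "H \<in> Linf_loc B \<A> W"
 using assms unfolding Linf_loc_def by (auto intro!: measurable_restrict_space1 exI[of _ R])

text \<open>Boundedness everywhere, rather than almost everywhere, gives local boundedness in all
  charts at once.\<close>

definition good_terms :: "nat => 'e set => (('m => complex) \<times> 'e list \<times> 'e list) list => bool" where
 "good_terms k N xs \<longleftrightarrow> (ALL (H, v, gm):set xs. H \<in> borel_measurable borel & (EX R. ALL x. cmod (H x) <= R) &
  set v <= B & set gm <= N & k + ncount N v <= length gm)"

text \<open>
  The functionals \<open>om \<mapsto> \<integral> H \<partial>\<^sup>v (y\<^bsup>gm\<^esup> om) dy\<close> in the chart \<open>(V, ph)\<close>, where \<open>gm\<close> consists of at least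
  \<open>k + |v|\<^sub>N\<close> normal directions: \<open>k\<close> of them form the factor vanishing to order \<open>k\<close>, the others make the
  operator tangential.
\<close>

definition good :: "nat => 'm set => ('m => 'e) => 'e set => 'm set => ((('m, 'e) chart => 'm => complex) => complex) => bool" where
 "good k V ph N W u \<longleftrightarrow> (EX xs. good_terms k N xs & (ALL om:test_measures B \<A> W. u om = (\<Sum>(H, v, gm)\<leftarrow>xs.
  LINT y:ph ` V|\<mu>. H (inv_into V ph y) * ipd v (%y. monom gm y * om (V, ph) (inv_into V ph y)) y)))"

lemma good_mono: "good k V ph N W u ==> W' <= W ==> good k V ph N W' u"
 unfolding good_def using tm_mono by blast

lemma good_cong: "good k V ph N W u ==> (!!om. om \<in> test_measures B \<A> W ==> u' om = u om) ==> good k V ph N W u'"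
 unfolding good_def by simp

lemma good_add:
 assumes "good k V ph N W u" "good k V ph N W u'"
 shows "good k V ph N W (%om. u om + u' om)"
proof -
 let ?P = "%xs u. good_terms k N xs & (ALL om:test_measures B \<A> W. u om = (\<Sum>(H, v, gm)\<leftarrow>xs.
  LINT y:ph ` V|\<mu>. H (inv_into V ph y) * ipd v (%y. monom gm y * om (V, ph) (inv_into V ph y)) y))"
 obtain xs where xs: "?P xs u" using assms(1) unfolding good_def ..
 obtain ys where ys: "?P ys u'" using assms(2) unfolding good_def ..
 have "?P (xs @ ys) (%om. u om + u' om)" using xs ys by (simp add: good_terms_def ball_Un)
 thus ?thesis unfolding good_def by (rule exI)
qed

lemma good_zero: "good k V ph N W (%om. 0)"
 unfolding good_def by (rule exI[of _ "[]"]) (simp add: good_terms_def)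

lemma good_sum_list: "(!!i. i \<in> set xs ==> good k V ph N W (u i)) ==> good k V ph N W (%om. \<Sum>i\<leftarrow>xs. u i om)"
 by (induction xs) (simp_all add: good_zero good_add)

text \<open>The first \<open>k\<close> factors of the monomial become the function \<open>f\<close>,
  the remaining ones, at least as many as the normal directions of \<open>v\<close>, make the
  operator tangential.\<close>

lemma good_vanishes:
 assumes g: "good k V ph N W u" and V: "adapted V ph N" and W: "open W" "W <= V"
 shows "EX (M::nat) f D h. (ALL j<M. f j \<in> ideal_power B \<A> S k W & diff_operator B \<A> W (D j) & tangential B \<A> S W (D j) &
   h j \<in> Linf_loc B \<A> W) & (ALL om:test_measures B \<A> W. u om = (\<Sum>j<M. fDh_distribution B \<A> W (f j) (D j) (h j) om))"
proof -
 obtain xs where xs: "good_terms k N xs" and u: "ALL om:test_measures B \<A> W. u om = (\<Sum>(H, v, gm)\<leftarrow>xs.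
  LINT y:ph ` V|\<mu>. H (inv_into V ph y) * ipd v (%y. monom gm y * om (V, ph) (inv_into V ph y)) y)"
  using g[unfolded good_def] by (elim exE conjE)
 have Wa: "adapted W ph N" using adapted_restrict[OF V W(1)] W(2) by (simp add: Int_absorb1)
 have c: "(W, ph) \<in> \<A>" and cV: "(V, ph) \<in> \<A>" using Wa V adapted_chart by auto
 have X: "span_open B (ph ` W)" by (rule chart_span_open[OF c])
 define f where "f = (%(H :: 'm => complex, v :: 'e list, gm) x. monom (take k gm) (ph x))"
 define D where "D = (%(H :: 'm => complex, v, gm) g x. monom (drop k gm) (ph x) * ipd (rev v) (%y. g (inv_into W ph y :: 'm) :: complex) (ph x))"
 \<comment> \<open>The sign here and the reversal of \<open>v\<close> in \<open>D\<close> undo the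
   transposition contained in \<open>fDh_distribution\<close>.\<close>
 define h where "h = (%(H :: 'm => complex, v :: 'e list, gm :: 'e list) x. (-1) ^ length v * H x :: complex)"
 have 1: "f t \<in> ideal_power B \<A> S k W & diff_operator B \<A> W (D t) & tangential B \<A> S W (D t) & h t \<in> Linf_loc B \<A> W &
   (ALL om:test_measures B \<A> W. fDh_distribution B \<A> W (f t) (D t) (h t) om =
   (case t of (H, v, gm) => LINT y:ph ` V|\<mu>. H (inv_into V ph y) * ipd v (%y. monom gm y * om (V, ph) (inv_into V ph y)) y))"
  if t: "t \<in> set xs" for t
 proof -
  obtain H v gm where e: "t = (H, v, gm)" by (cases t)
  obtain R where H: "H \<in> borel_measurable borel" "!!x. cmod (H x) <= R" and v: "set v <= B" and gm: "set gm <= N" "k + ncount N v <= length gm"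
   using xs t e unfolding good_terms_def by blast
  have gm1: "set (take k gm) <= N" "length (take k gm) = k" using gm set_take_subset[of k gm] by auto
  have gm2: "set (drop k gm) <= N" "ncount N (rev v) <= length (drop k gm)" using gm set_drop_subset[of k gm] by (auto simp: rev_filter[symmetric])
  have sf: "smooth_fun B \<A> W (f t)" unfolding f_def e prod.case by (rule smooth_fun_chart_comp[OF c W(1) order_refl smooth_monom[OF X]])
  have 2: "f t \<in> ideal_power B \<A> S k W"
  proof (rule ideal_powerI[OF W(1) sf])
   fix p assume "p \<in> W"
   have "nideal B N k (ph ` W) (%y. f t (inv_into W ph y)) \<longleftrightarrow> nideal B N k (ph ` W) (monom (take k gm))"
    by (rule nideal_cong[OF X]) (use c in \<open>auto simp: f_def e\<close>)
   moreover have "nideal B N k (ph ` W) (monom (take k gm))"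
    using nideal_monom[OF X adapted_finite[OF V] gm1(1)] gm1(2) by simp
   ultimately show "EX V ph N. adapted V ph N & p \<in> V & V <= W & nideal B N k (ph ` V) (%y. f t (inv_into V ph y))"
    using Wa \<open>p \<in> W\<close> by blast
  qed
  have 3: "diff_operator B \<A> W (D t)" unfolding D_def e prod.case
   by (rule chart_diff_operator[OF c smooth_monom[OF X]]) (use v in simp)
  have 4: "tangential B \<A> S W (D t)" unfolding D_def e prod.case
   by (rule monom_tangential[OF Wa _ gm2]) (use v in simp)
  have 5: "h t \<in> Linf_loc B \<A> W"
   by (rule bounded_Linf_loc[of _ R]) (use H in \<open>auto simp: h_def e norm_mult norm_power\<close>)
  have 6: "fDh_distribution B \<A> W (f t) (D t) (h t) om =
    (LINT y:ph ` V|\<mu>. H (inv_into V ph y) * ipd v (%y. monom gm y * om (V, ph) (inv_into V ph y)) y)"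
   if om: "om \<in> test_measures B \<A> W" for om
  proof -
   obtain K where K: "compact K" "K <= W" "!!c x. x ~: K ==> om c x = 0" using tm_supp[OF om] by blast
   define a where "a bs y = (if bs = rev v then monom (drop k gm) y else 0)" for bs y
   let ?g = "%y. monom gm y * om (V, ph) (inv_into V ph y)"
   have sa: "smooth B (ph ` W) (a bs)" for bs
    by (cases "bs = rev v") (simp_all add: a_def[abs_def] smooth_const[OF X] smooth_monom[OF X])
   have fin: "finite {bs. set bs <= B & length bs <= length v}" by (rule finite_lists_le[OF finite_Basis_subset[OF B_Basis]])
   have inL: "rev v \<in> {bs. set bs <= B & length bs <= length v}" using v by simp
   have T: "op_transpose (length v) a rh y = (-1) ^ length v * ipd v (%y. monom (drop k gm) y * rh y) y" for rh y
    unfolding op_transpose_def by (subst sum.remove[OF fin inL], subst sum.neutral) (auto simp: a_def iter_partial_zero)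
   have eqW: "inv_into W ph y = inv_into V ph y" "inv_into V ph y \<in> W" if "y \<in> ph ` W" for y using that W(2) c cV by auto
   have "fDh_distribution B \<A> W (f t) (D t) (h t) om = (LINT y:ph ` W|\<mu>. h t (inv_into W ph y) *
     op_transpose (length v) a (%y. f t (inv_into W ph y) * om (W, ph) (inv_into W ph y)) y)"
    using K by (intro fDh_chart[OF W(1) c order_refl sa _ sf 5 om])
     (auto simp: D_def e a_def if_distrib[of "%c. c * _"] sum.delta[OF fin] v cong: if_cong)
   also have "... = (LINT y:ph ` W|\<mu>. H (inv_into V ph y) * ipd v ?g y)"
   proof (rule set_lebesgue_integral_cong)
    show "ph ` W \<in> sets \<mu>" using span_open_borel[OF X] by simp
    show "ALL y. y \<in> ph ` W --> h t (inv_into W ph y) * op_transpose (length v) a (%y. f t (inv_into W ph y) * om (W, ph) (inv_into W ph y)) y =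
      H (inv_into V ph y) * ipd v ?g y"
    proof (intro allI impI)
     fix y assume y: "y \<in> ph ` W"
     have "ipd v (%y. monom (drop k gm) y * (f t (inv_into W ph y) * om (W, ph) (inv_into W ph y))) y = ipd v ?g y"
     proof (rule iter_partial_cong[OF X v y])
      fix z assume z: "z \<in> ph ` W"
      have "om (V, ph) (inv_into V ph z) = om (W, ph) (inv_into V ph z)"
       using lawD[OF tm_law[OF om] c cV, of "inv_into V ph z"] df_self[OF c cV] eqW(2)[OF z] W(2) by auto
      moreover have "f t (inv_into W ph z) = monom (take k gm) z" using z c by (auto simp: f_def e)
      moreover have "monom gm z = monom (take k gm) z * monom (drop k gm) z" by (simp flip: monom_simps(3))
      ultimately show "monom (drop k gm) z * (f t (inv_into W ph z) * om (W, ph) (inv_into W ph z)) = ?g z"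
       by (simp add: eqW(1)[OF z])
     qed
     thus "h t (inv_into W ph y) * op_transpose (length v) a (%y. f t (inv_into W ph y) * om (W, ph) (inv_into W ph y)) y =
      H (inv_into V ph y) * ipd v ?g y"
      by (simp add: T h_def e eqW(1)[OF y])
    qed
   qed
   also have "... = (LINT y:ph ` V|\<mu>. H (inv_into V ph y) * ipd v ?g y)"
   proof -
    have ci: "compact (ph ` K)" "!!y. y \<in> ph ` V - ph ` K ==> inv_into V ph y \<in> V - K"
     using chart_image_compact[OF cV K(1)] K(2) W(2) by auto
    have "ipd v ?g y = 0" if "y \<in> ph ` V - ph ` K" for y
     by (rule iter_partial_zero_off[OF chart_span_open[OF cV] ci(1) v _ that]) (use ci(2) K(3) in auto)
    hence "indicat_real (ph ` W) y *\<^sub>R (H (inv_into V ph y) * ipd v ?g y) = indicat_real (ph ` V) y *\<^sub>R (H (inv_into V ph y) * ipd v ?g y)" for y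
     using K(2) W(2) by (cases "y \<in> ph ` V") (auto simp: indicator_def)
    thus ?thesis unfolding set_lebesgue_integral_def by (simp only:)
   qed
   finally show ?thesis .
  qed
  show ?thesis using 2 3 4 5 6 by (simp add: e)
 qed
 let ?n = "length xs"
 have A: "u om = (\<Sum>j<?n. fDh_distribution B \<A> W (f (xs ! j)) (D (xs ! j)) (h (xs ! j)) om)" if om: "om \<in> test_measures B \<A> W" for om
 proof -
  have "(\<Sum>j<?n. fDh_distribution B \<A> W (f (xs ! j)) (D (xs ! j)) (h (xs ! j)) om) = (\<Sum>t\<leftarrow>xs. fDh_distribution B \<A> W (f t) (D t) (h t) om)"
   by (simp add: sum_list_sum_nth atLeast0LessThan)
  also have "... = u om" unfolding bspec[OF u om] using 1 om by (intro arg_cong[where f = sum_list] map_cong refl) simp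
  finally show ?thesis ..
 qed
 have C: "ALL j<?n. f (xs ! j) \<in> ideal_power B \<A> S k W & diff_operator B \<A> W (D (xs ! j)) & tangential B \<A> S W (D (xs ! j)) & h (xs ! j) \<in> Linf_loc B \<A> W"
  using 1 by simp
 show ?thesis
  by (rule exI[of _ ?n], rule exI[of _ "%j. f (xs ! j)"], rule exI[of _ "%j. D (xs ! j)"], rule exI[of _ "%j. h (xs ! j)"])
   (rule conjI[OF C], rule ballI, rule A)
qed

end

section \<open>Averages of translates\<close>

lemma set_integral_sum_list:
 fixes f :: "'t => 'x => complex"
 assumes "!!t. t \<in> set ts ==> set_integrable M A (f t)"
 shows "set_integrable M A (%x. \<Sum>t\<leftarrow>ts. f t x)" "(LINT x:A|M. \<Sum>t\<leftarrow>ts. f t x) = (\<Sum>t\<leftarrow>ts. LINT x:A|M. f t x)"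
 using assms by (induction ts) (auto simp: set_integrable_def[of _ _ "%_. 0"] set_integral_add)

lemma set_integral_zero_off:
 fixes f :: "'x => complex"
 assumes "A <= A'" "!!x. x \<in> A' - A ==> f x = 0"
 shows "(LINT x:A|M. f x) = (LINT x:A'|M. f x)"
 unfolding set_lebesgue_integral_def using assms by (intro Bochner_Integration.integral_cong) (auto simp: indicator_def)

text \<open>Fubini with \<open>u\<close> independent of \<open>h\<close>: integrating the bounded
  kernel over \<open>h\<close> first produces a single bounded function \<open>Hf\<close>, chosen
  before \<open>u\<close>.\<close>

lemma (in equivariant) average_term:
 assumes c: "(V, ph) \<in> \<A>" and V0: "open V0" "V0 <= V" and g: "(Q, th) \<in> \<H>" and P: "open P" "P <= Q"
  and hh: "hh \<in> borel_measurable borel" "!!x. cmod (hh x) <= R"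
  and E: "continuous_on (th ` P \<times> ph ` V0) E" "!!p. p \<in> th ` P \<times> ph ` V0 ==> cmod (E p) <= R'"
  and Om: "Om \<in> sets borel" "Om <= P" and dh: "sets dh = sets borel" "emeasure dh Om < \<infinity>"
 obtains Hf where "Hf \<in> borel_measurable borel" "EX R. ALL x. cmod (Hf x) <= R"
  "!!K u. compact K ==> K <= V0 ==> continuous_on (ph ` V) u ==> (!!y. y \<in> ph ` V - ph ` K ==> u y = 0) ==>
   set_integrable dh Om (%h. LINT y:ph ` V|\<mu>. hh (act (ginv h) (inv_into V ph y)) * (E (th h, y) * u y)) &
   (LINT h:Om|dh. LINT y:ph ` V|\<mu>. hh (act (ginv h) (inv_into V ph y)) * (E (th h, y) * u y)) =
   (LINT y:ph ` V|\<mu>. Hf (inv_into V ph y) * u y)"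
proof -
 let ?A = "P \<times> ph ` V0" and ?B = "ph ` V" and ?i = "inv_into V ph"
 have V0B: "ph ` V0 <= ?B" and Bb: "?B \<in> sets borel" using V0(2) span_open_borel[OF chart_span_open[OF c]] by auto
 have A: "?A \<in> sets borel"
  using pair_measureI[of P borel "ph ` V0" borel, unfolded borel_prod] P(1) span_open_borel[OF chart_image_open[OF c V0]] by simp
 \<comment> \<open>The kernel is cut off to the set where chart inverses and coefficient are
   controlled, so it is Borel and bounded on the whole product.\<close>
 define kk where "kk p = (indicat_real ?A p *\<^sub>R hh (act (ginv (fst p)) (?i (snd p)))) * (indicat_real ?A p *\<^sub>R E (th (fst p), snd p))" for p
 have ca: "continuous_on ?A (%p. act (ginv (fst p)) (?i (snd p)))"
  by (intro cont_act_comp cont_ginv continuous_on_compose2[OF chart_cont_inv[OF c]] continuous_intros) (use V0B in auto)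
 have ce: "continuous_on ?A (%p. E (th (fst p), snd p))"
  by (rule continuous_on_compose2[OF E(1)]) (use P(2) in \<open>auto intro!: continuous_intros continuous_on_compose2[OF G.chart_cont[OF g]]\<close>)
 have kb: "kk \<in> borel_measurable borel"
  unfolding kk_def[abs_def] by (intro borel_measurable_times indicator_comp_borel[OF A ca hh(1)] borel_measurable_continuous_on_indicator[OF A ce])
 have kbd: "cmod (kk p) <= \<bar>R\<bar> * \<bar>R'\<bar>" for p
 proof (cases "p \<in> ?A")
  case True
  have "cmod (hh x) <= \<bar>R\<bar>" for x using hh(2)[of x] by linarith
  moreover have "cmod (E (th (fst p), snd p)) <= \<bar>R'\<bar>" using E(2)[of "(th (fst p), snd p)"] True by (auto simp: mem_Times_iff intro: order_trans)
  ultimately show ?thesis using True by (simp add: kk_def norm_mult mult_mono')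
 qed (simp add: kk_def)
 \<comment> \<open>Restriction to \<open>Om\<close> yields a finite measure, as needed for the
   product with the coordinate measure.\<close>
 define M1 where "M1 = restrict_space dh Om"
 have Oms: "Om \<inter> space dh \<in> sets dh" using Om(1) dh(1) sets_eq_imp_space_eq[OF dh(1)] by simp
 interpret M1: finite_measure M1
  by (rule finite_measureI) (use dh(2) Om(1) Oms dh(1) sets_eq_imp_space_eq[OF dh(1)] in \<open>simp add: M1_def emeasure_restrict_space space_restrict_space less_top[symmetric]\<close>)
 interpret M2: sigma_finite_measure \<mu> by (rule sigma_finite_coord[OF B_Basis])
 interpret P2: pair_sigma_finite M1 \<mu> ..
 have i1: "(%h. h) \<in> M1 \<rightarrow>\<^sub>M borel" unfolding M1_def
  by (rule measurable_restrict_space1) (use dh(1) in \<open>simp add: measurable_def sets_eq_imp_space_eq\<close>)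
 have "(%p. (fst p, snd p)) \<in> M1 \<Otimes>\<^sub>M \<mu> \<rightarrow>\<^sub>M borel \<Otimes>\<^sub>M borel"
  by (intro measurable_Pair measurable_compose[OF measurable_fst i1] measurable_compose[OF measurable_snd measurable_ident_sets]) simp
 from measurable_compose[OF this[unfolded borel_prod] kb] have km: "kk \<in> borel_measurable (M1 \<Otimes>\<^sub>M \<mu>)" by simp
 define Hy where "Hy y = (LINT h|M1. kk (h, y))" for y
 have "(%(y, h). kk (h, y)) \<in> borel_measurable (\<mu> \<Otimes>\<^sub>M M1)"
  using measurable_compose[OF measurable_pair_swap' km] by (simp add: case_prod_unfold)
 from M1.borel_measurable_lebesgue_integral[OF this] have Hym: "Hy \<in> borel_measurable borel"
  unfolding Hy_def[abs_def] using measurable_cong_sets[OF sets_coord refl] by blast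
 have Hyb: "cmod (Hy y) <= \<bar>R\<bar> * \<bar>R'\<bar> * measure M1 (space M1)" for y
 proof -
  have "cmod (Hy y) <= (LINT h|M1. cmod (kk (h, y)))" unfolding Hy_def by (rule integral_norm_bound)
  also have "... <= (LINT h|M1. \<bar>R\<bar> * \<bar>R'\<bar>)" by (rule integral_mono') (simp_all add: kbd)
  finally show ?thesis by (simp add: mult_ac)
 qed
 define Hf where "Hf x = indicat_real V x *\<^sub>R Hy (ph x)" for x
 have 1: "Hf \<in> borel_measurable borel"
  unfolding Hf_def[abs_def] by (rule indicator_comp_borel[OF _ chart_cont[OF c] Hym]) (use chart_open[OF c] in simp)
 have 2: "EX R. ALL x. cmod (Hf x) <= R"
  using Hyb by (intro exI[of _ "\<bar>R\<bar> * \<bar>R'\<bar> * measure M1 (space M1)"]) (auto simp: Hf_def indicator_def)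
 have 3: "set_integrable dh Om (%h. LINT y:?B|\<mu>. hh (act (ginv h) (?i y)) * (E (th h, y) * u y)) &
   (LINT h:Om|dh. LINT y:?B|\<mu>. hh (act (ginv h) (?i y)) * (E (th h, y) * u y)) = (LINT y:?B|\<mu>. Hf (?i y) * u y)"
  if K: "compact K" "K <= V0" and u: "continuous_on ?B u" and z: "!!y. y \<in> ?B - ph ` K ==> u y = 0" for K u
 proof -
  have KV: "K <= V" using K(2) V0(2) by blast
  have ck: "compact (ph ` K)" by (rule chart_image_compact(1)[OF c K(1) KV])
  obtain C0 where C0: "!!y. y \<in> ph ` K ==> cmod (u y) <= C0"
   using compact_imp_bounded[OF compact_continuous_image[OF continuous_on_subset[OF u image_mono[OF KV]] ck]] unfolding bounded_iff by auto
  define U where "U y = indicat_real ?B y *\<^sub>R u y" for y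
  have Um: "U \<in> borel_measurable \<mu>"
   using borel_measurable_continuous_on_indicator[OF Bb u] unfolding U_def[abs_def] by simp
  let ?F = "%p. kk p * U (snd p)"
  have Uz: "U y = 0" if "y ~: ph ` K" for y using z that by (auto simp: U_def indicator_def)
  have FI: "integrable (M1 \<Otimes>\<^sub>M \<mu>) ?F"
  proof (rule integrableI_bounded_set[where A = "space M1 \<times> ph ` K" and B = "\<bar>R\<bar> * \<bar>R'\<bar> * C0"])
   have ks: "ph ` K \<in> sets \<mu>" using compact_imp_closed[OF ck] by simp
   thus "space M1 \<times> ph ` K \<in> sets (M1 \<Otimes>\<^sub>M \<mu>)" by auto
   show "emeasure (M1 \<Otimes>\<^sub>M \<mu>) (space M1 \<times> ph ` K) < \<infinity>"
    using M1.finite_emeasure_space emeasure_coord_bounded[OF B_Basis compact_imp_bounded[OF ck]] ks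
    by (auto simp: M2.emeasure_pair_measure_Times ennreal_mult_eq_top_iff top.not_eq_extremum[symmetric])
   show "?F \<in> borel_measurable (M1 \<Otimes>\<^sub>M \<mu>)" by (intro borel_measurable_times km measurable_compose[OF measurable_snd Um])
   have "norm (?F p) <= \<bar>R\<bar> * \<bar>R'\<bar> * C0" if "p \<in> space M1 \<times> ph ` K" for p
    unfolding norm_mult by (intro mult_mono' kbd) (use that C0 KV in \<open>auto simp: U_def\<close>)
   thus "AE p in M1 \<Otimes>\<^sub>M \<mu>. p \<in> space M1 \<times> ph ` K --> norm (?F p) <= \<bar>R\<bar> * \<bar>R'\<bar> * C0" by simp
   show "AE p in M1 \<Otimes>\<^sub>M \<mu>. p ~: space M1 \<times> ph ` K --> ?F p = 0"
    by (rule AE_I2, rule impI) (metis Uz SigmaI mem_Times_iff mult_zero_right prod.collapse space_pair_measure)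
  qed
  have eq: "(LINT y|\<mu>. ?F (h, y)) = (LINT y:?B|\<mu>. hh (act (ginv h) (?i y)) * (E (th h, y) * u y))" if "h \<in> Om" for h
   unfolding set_lebesgue_integral_def
  proof (intro Bochner_Integration.integral_cong refl)
   fix y
   show "?F (h, y) = indicat_real ?B y *\<^sub>R (hh (act (ginv h) (?i y)) * (E (th h, y) * u y))"
   proof (cases "y \<in> ph ` K")
    case True
    hence "y \<in> ph ` V0" "y \<in> ?B" using K(2) V0(2) by auto
    moreover have "h \<in> P" using that Om(2) by blast
    ultimately show ?thesis by (simp add: kk_def U_def)
   next
    case False
    thus ?thesis using Uz[OF False] z[of y] by (auto simp: indicator_def)
   qed
  qed
  have oi: "integrable M1 (%h. LINT y|\<mu>. ?F (h, y))" by (rule P2.integrable_fst'[OF FI])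
  have sp: "indicat_real Om h *\<^sub>R (LINT y|\<mu>. ?F (h, y)) = indicat_real Om h *\<^sub>R (LINT y:?B|\<mu>. hh (act (ginv h) (?i y)) * (E (th h, y) * u y))" for h
   using eq by (auto simp: indicator_def)
  have "(LINT h|M1. LINT y|\<mu>. ?F (h, y)) = (LINT y|\<mu>. LINT h|M1. ?F (h, y))"
   by (rule P2.Fubini_integral[symmetric]) (use FI in \<open>simp add: case_prod_unfold\<close>)
  also have "... = (LINT y:?B|\<mu>. Hf (?i y) * u y)"
   unfolding set_lebesgue_integral_def by (intro Bochner_Integration.integral_cong refl) (auto simp: Hf_def Hy_def U_def indicator_def c)
  finally show ?thesis
   using oi unfolding M1_def integrable_restrict_space[OF Oms] integral_restrict_space[OF Oms] set_integrable_def set_lebesgue_integral_def[of dh] sp by simp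
 qed
 show ?thesis by (rule that[OF 1 2 3])
qed

text \<open>The Leibniz rule separates the smooth factors \<open>e cs gm\<close> from the monomials,
  which stay together with \<open>rh\<close> under the derivative \<open>v\<close>. As
  \<open>v\<close> is part of \<open>rev cs\<close>, the degree of the monomial remains large
  enough.\<close>

lemma (in manifold) op_transpose_expand:
 assumes W: "span_open B W" and rh: "smooth B W rh" and e: "!!cs gm. smooth B W (e cs gm)"
  and F: "!!cs y. set cs <= B ==> length cs <= m ==> y \<in> W ==> a cs y * b y = (\<Sum>gm\<in>Ga cs. e cs gm y * monom (t gm) y)"
  and y: "y \<in> W"
 shows "op_transpose m a (%y. b y * rh y) y = (\<Sum>cs | set cs <= B & length cs <= m. \<Sum>gm\<in>Ga cs. \<Sum>(u, v)\<leftarrow>splits (rev cs).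
  (-1) ^ length cs * ipd u (e cs gm) y * ipd v (%y. monom (t gm) y * rh y) y)"
 unfolding op_transpose_def
proof (intro sum.cong refl)
 fix cs assume cs: "cs \<in> {bs. set bs <= B & length bs <= m}"
 have rc: "set (rev cs) <= B" using cs by simp
 have sg: "smooth B W (%y. monom (t gm) y * rh y)" for gm by (rule smooth_mult[OF W smooth_monom[OF W] rh])
 have "ipd (rev cs) (%y. a cs y * (b y * rh y)) y = ipd (rev cs) (%y. \<Sum>gm\<in>Ga cs. e cs gm y * (monom (t gm) y * rh y)) y"
 proof (rule iter_partial_cong[OF W rc y])
  fix z assume z: "z \<in> W"
  have "a cs z * (b z * rh z) = (\<Sum>gm\<in>Ga cs. e cs gm z * monom (t gm) z) * rh z" using F[of cs z] cs z by (simp flip: mult.assoc)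
  thus "a cs z * (b z * rh z) = (\<Sum>gm\<in>Ga cs. e cs gm z * (monom (t gm) z * rh z))" by (simp add: sum_distrib_right mult.assoc)
 qed
 also have "... = (\<Sum>gm\<in>Ga cs. \<Sum>(u, v)\<leftarrow>splits (rev cs). ipd u (e cs gm) y * ipd v (%y. monom (t gm) y * rh y) y)"
  by (simp add: iter_partial_sum[OF W smooth_mult[OF W e sg] rc y] iter_partial_mult[OF W e sg rc y])
 finally show "(-1) ^ length cs * ipd (rev cs) (%y. a cs y * (b y * rh y)) y = (\<Sum>gm\<in>Ga cs. \<Sum>(u, v)\<leftarrow>splits (rev cs).
  (-1) ^ length cs * ipd u (e cs gm) y * ipd v (%y. monom (t gm) y * rh y) y)"
  by (simp add: sum_distrib_left case_prod_unfold sum_list_const_mult mult.assoc)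
qed

lemma span_open_ball:
 assumes "span_open B X" "q \<in> X"
 obtains e where "e > 0" "ball q e \<inter> span B <= X"
proof -
 obtain O' where "open O'" "X = span B \<inter> O'" using assms(1) unfolding openin_open by blast
 thus ?thesis using that open_contains_ball[of O'] assms(2) by blast
qed

lemma inner_Pair0: "p \<bullet> (0, b) = snd p \<bullet> b"
 by (simp add: inner_prod_def)

section \<open>Coefficients of translated operators\<close>

locale setting = equivariant B \<A> C \<H> H act r \<pi> \<T> lift + submanifold B \<A> S
 for B :: "'e::euclidean_space set" and \<A> :: "('m::{t2_space, second_countable_topology}, 'e) chart set"
  and C :: "'a::euclidean_space set" and \<H> :: "('h::{t2_space, second_countable_topology}, 'a) chart set"
  and H :: "'h monoid" and act :: "'h => 'm => 'm" and r :: nat and \<pi> :: "'b => 'm"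
  and \<T> :: "('m, 'b) triv set" and lift :: "'h => 'b => 'b" and S :: "'m set" +
 assumes act_S: "act h ` S <= S"
begin

text \<open>
  Coordinates \<open>(s, y)\<close> near \<open>(h\<^sub>0, p)\<close>: the coefficients of \<open>D\<close> in the chart \<open>ph \<circ> h\<close>, multiplied by
  \<open>f\<close> and \<open>al\<close>, are smooth in \<open>(s, y)\<close> and vanish to order \<open>k + |cs|\<^sub>N\<close> in the normal directions of \<open>y\<close>.
\<close>

lemma joint_coefficients:
 assumes p: "p \<in> S" "p \<in> V" and V: "adapted V ph N"
  and U: "open U" "act (ginv h0) p \<in> U" and f: "f \<in> ideal_power B \<A> S k U"
  and D: "diff_operator B \<A> U D" "tangential B \<A> S U D"
  and al: "smooth_fun PB (prod_atlas \<H> \<A>) W al" and W: "open W" "(h0, act (ginv h0) p) \<in> W" and g: "(Q, th) \<in> \<H>" "h0 \<in> Q"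
 obtains Y m a K where "span_open PB Y" "(th h0, ph p) \<in> Y" "Y <= th ` Q \<times> ph ` V" "compact K" "K <= U"
  "!!cs. smooth PB Y (a cs)"
  "!!cs. nideal PB (Pair 0 ` N) (k + ncount N cs) Y (%q. a cs q * (f (act (ginv (inv_into Q th (fst q))) (inv_into V ph (snd q))) *
   al (inv_into Q th (fst q), act (ginv (inv_into Q th (fst q))) (inv_into V ph (snd q)))))"
  "!!h x. h \<in> Q ==> x \<in> V ==> (th h, ph x) \<in> Y ==> act (ginv h) x \<in> K & (h, act (ginv h) x) \<in> W"
  "!!h x F. h \<in> Q ==> x \<in> V ==> (th h, ph x) \<in> Y ==> smooth_fun B \<A> U F ==> D F (act (ginv h) x) =
   diffop B m (%cs y. a cs (th h, y)) (%y. F (act (ginv h) (inv_into V ph y))) (ph x)"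
proof -
 define q0 where "q0 = act (ginv h0) p"
 have q0: "q0 \<in> S" "q0 \<in> U" "act h0 q0 = p" using act_S p U by (auto simp: q0_def)
 have c: "(V, ph) \<in> \<A>" by (rule adapted_chart[OF V])
 obtain V1 ph1 N1 where V1: "adapted V1 ph1 N1" "q0 \<in> V1" by (rule adapted_ex[OF q0(1)])
 obtain V2 m A where V2: "q0 \<in> V2" "V2 <= V1" "V2 <= U" "adapted V2 ph1 N1"
  and A: "!!bs. set bs <= B ==> length bs <= m ==> nideal B N1 (ncount N1 bs) (ph1 ` V2) (A bs)"
  and DA: "!!W f x. open W ==> W <= U ==> smooth_fun B \<A> W f ==> x \<in> W ==> x \<in> V2 ==>
   D f x = diffop B m A (%y. f (inv_into V1 ph1 y)) (ph1 x)"
  by (rule tangential_normal_form[OF U(1) D V1(1,2) q0(2,1)], rule that, assumption+)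
 obtain V' where V': "q0 \<in> V'" "V' <= V1" "adapted V' ph1 N1" "nideal B N1 k (ph1 ` V') (%y. f (inv_into V1 ph1 y))"
  by (rule ideal_nideal[OF f V1 q0(2,1)])
 \<comment> \<open>A common neighbourhood for the normal form of \<open>D\<close> and the expansion
   of \<open>f\<close>.\<close>
 define V3 where "V3 = V2 \<inter> V'"
 have V3: "q0 \<in> V3" "V3 <= V1" "V3 <= V2" "adapted V3 ph1 N1" "nideal B N1 k (ph1 ` V3) (%y. f (inv_into V1 ph1 y))"
  using V2 V' adapted_restrict[OF V2(4) chart_open[OF adapted_chart[OF V'(3)]]] nideal_subset[OF V'(4), of "ph1 ` V3"] by (auto simp: V3_def)
 let ?i = "inv_into V1 ph1" and ?j = "inv_into Q th" and ?N1 = "Pair (0 :: 'a) ` N1" and ?N = "Pair (0 :: 'a) ` N"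
 have c1: "(V1, ph1) \<in> \<A>" and c3: "(V3, ph1) \<in> \<A>" using V1 V3 adapted_chart by auto
 have X3: "span_open B (ph1 ` V3)" and o3: "open V3" by (rule chart_span_open[OF c3], rule chart_open[OF c3])
 have i3: "?i (ph1 x) = x" if "x \<in> V3" for x using that V3(2) c1 by auto
 have sub3: "V3 <= U" "ph1 ` V3 <= ph1 ` V2" using V3(3) V2(3) by auto
 have NB: "?N1 <= PB" "?N <= PB" using adapted_normal[OF V1(1)] adapted_normal[OF V] by (auto intro!: Pair0_in_prod_basis)
 obtain d where d: "d > 0" "ball (ph1 q0) d \<inter> span B <= ph1 ` V3" by (rule span_open_ball[OF X3 imageI[OF V3(1)]])
 \<comment> \<open>All translated points are kept in the compact image \<open>K\<close> of this
   ball, since \<open>Linf_loc\<close> gives bounds on compact sets only.\<close>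
 define L where "L = cball (ph1 q0) (d/2) \<inter> span B"
 have L: "compact L" "L <= ph1 ` V3" using d closed_subspace[OF subspace_span] by (auto simp: L_def)
 define K where "K = ?i ` L"
 have "?i y \<in> U" if "y \<in> L" for y using subsetD[OF L(2) that] i3 sub3(1) by auto
 hence KU: "K <= U" by (auto simp: K_def)
 have "ph1 ` V3 <= ph1 ` V1" using V3(2) by blast
 hence "continuous_on L ?i" using L(2) by (intro continuous_on_subset[OF chart_cont_inv[OF c1]]) (rule subset_trans)
 hence "compact K" unfolding K_def by (rule compact_continuous_image[OF _ L(1)])
 note K = this KU
 define V4 where "V4 = V3 \<inter> ph1 -` ball (ph1 q0) (d/2)"
 have o4: "open V4" unfolding V4_def by (rule continuous_open_preimage[OF chart_cont[OF c3] o3]) simp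
 have V4K: "V4 <= K"
 proof
  fix x assume x: "x \<in> V4"
  hence "ph1 x \<in> L" using span_open_subset[OF X3] by (auto simp: V4_def L_def)
  moreover have "?i (ph1 x) = x" using x by (intro i3) (simp add: V4_def)
  ultimately show "x \<in> K" unfolding K_def by (metis image_eqI)
 qed
 define P1 where "P1 = {p. act (fst p) (snd p) \<in> V} \<inter> W"
 have oP1: "open P1" unfolding P1_def by (intro open_Int open_act_vimage[OF chart_open[OF c]] W(1))
 define X1 where "X1 = map_prod th ph1 ` (Q \<times> V3 \<inter> P1)"
 have X1: "span_open PB X1" unfolding X1_def by (rule joint_image_open[OF g(1) c3 joint_open[OF g(1) c3 oP1]]) auto
 have x1: "(th h0, ph1 q0) \<in> X1" unfolding X1_def P1_def using g V3(1) p q0 W(2) by (intro image_eqI[of _ _ "(h0, q0)"]) (auto simp: q0_def)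
 obtain e1 where e1: "e1 > 0" "ball (th h0, ph1 q0) e1 \<inter> span PB <= X1" by (rule span_open_ball[OF X1 x1])
 \<comment> \<open>A ball centred at a point over \<open>S\<close> is star-shaped in the normal
   directions of the point variable, so Hadamard's lemma applies with the group coordinate as a
   parameter.\<close>
 define B1 where "B1 = ball (th h0, ph1 q0) e1 \<inter> span PB"
 have B1: "span_open PB B1" unfolding B1_def by (simp add: openin_open_Int Int_commute)
 have B1X: "B1 <= X1" using e1 by (simp add: B1_def)
 have el: "EX h x. h \<in> Q & x \<in> V3 & act h x \<in> V & (h, x) \<in> W & z = (th h, ph1 x) & ?j (fst z) = h & ?i (snd z) = x" if "z \<in> B1" for z
 proof -
  have "z \<in> X1" using B1X that ..
  thus ?thesis using g i3 by (auto simp: X1_def P1_def)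
 qed
 have star1: "nstar ?N1 B1" unfolding B1_def
  by (rule nstar_ball[OF NB(1) PB_Basis]) (use adapted_S[OF V1(1,2)] q0(1) in \<open>auto simp: inner_Pair0\<close>)
 define Ps where "Ps z = ph (act (?j (fst z)) (?i (snd z)))" for z
 have Ps: "smooth PB B1 Ps" unfolding Ps_def
  by (rule smooth_subset[OF act_coords[OF g(1) c1 c]]) (use B1X V3(2) in \<open>auto simp: X1_def P1_def\<close>)
 have PsV: "Ps ` B1 <= span B"
 proof
  fix y assume "y \<in> Ps ` B1"
  then obtain z where "z \<in> B1" "y = Ps z" by blast
  with el[of z] show "y \<in> span B" using span_open_subset[OF chart_span_open[OF c]] by (auto simp: Ps_def)
 qed
 \<comment> \<open>The invariance of \<open>S\<close> enters: a point on \<open>S\<close> is moved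
   to \<open>S\<close>, so the normal components of \<open>Ps\<close> vanish where the normal
   coordinates of the source do.\<close>
 have PsN: "nideal PB ?N1 1 B1 (%z. of_real (Ps z \<bullet> b))" if b: "b \<in> N" for b
 proof (rule Hadamard[OF PB_Basis NB(1) B1 star1 smooth_of_real[OF B1 smooth_inner_const[OF B1 Ps]]])
  fix z assume z: "z \<in> B1" "!!b. b \<in> ?N1 ==> z \<bullet> b = 0"
  obtain h x where hx: "x \<in> V3" "act h x \<in> V" "z = (th h, ph1 x)" "?j (fst z) = h" "?i (snd z) = x" by (use el[OF z(1)] in \<open>elim exE conjE\<close>) (rule that)
  have "ph1 x \<bullet> b1 = 0" if "b1 \<in> N1" for b1 using z(2)[OF imageI[OF that]] hx(3) by (simp add: inner_Pair0)
  hence "x \<in> S" using adapted_S[OF V3(4) hx(1)] by blast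
  hence "act h x \<in> S" by (rule subsetD[OF act_S imageI])
  thus "complex_of_real (Ps z \<bullet> b) = 0" using adapted_S[OF V hx(2)] hx(4,5) b by (simp add: Ps_def)
 qed
 let ?L = "{bs. set bs <= B & length bs <= m}"
 have "ALL bs:?L. EX G. (ALL cs. nideal PB ?N1 (ncount N cs - ncount ?N1 (map (Pair 0) bs)) B1 (G cs)) &
  (ALL T Y z. span_open B Y & smooth B Y T & z \<in> B1 & Ps z \<in> Y --> ipd (map (Pair (0 :: 'a)) bs) (%z. T (Ps z)) z =
   (\<Sum>cs | set cs <= B & length cs <= length (map (Pair (0 :: 'a)) bs). G cs z * ipd cs T (Ps z)))"
  by (intro ballI iter_partial_compose_nideal[OF PB_Basis B_Basis B1 Ps PsV NB(1) PsN smooth_const[OF B1, of 1], unfolded mult_1_left]) (use Pair0_in_prod_basis in auto)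
 from bchoice[OF this] obtain G where G: "ALL bs:?L. (ALL cs. nideal PB ?N1 (ncount N cs - ncount ?N1 (map (Pair 0) bs)) B1 (G bs cs)) &
  (ALL T Y z. span_open B Y & smooth B Y T & z \<in> B1 & Ps z \<in> Y --> ipd (map (Pair (0 :: 'a)) bs) (%z. T (Ps z)) z =
   (\<Sum>cs | set cs <= B & length cs <= length (map (Pair (0 :: 'a)) bs). G bs cs z * ipd cs T (Ps z)))" ..
 have nc: "ncount ?N1 (map (Pair (0 :: 'a)) bs) = ncount N1 bs" for bs by (induction bs) auto
 have snd1: "nideal PB ?N1 n B1 (%z. F (snd z))" if "nideal B N1 n (ph1 ` V3) F" for F n
 proof (rule nideal_compose[OF B_Basis B1 X3 _ smooth_fst_snd(2)[OF B1] _ that])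
  show "snd ` B1 <= ph1 ` V3" using B1X by (auto simp: X1_def)
  show "nideal PB ?N1 1 B1 (%z. of_real (snd z \<bullet> b))" if "b \<in> N1" for b
   using nideal_monom[OF B1 finite_subset[OF NB(1) finite_Basis_subset[OF PB_Basis]], of "[(0, b)]"] that
   by (simp add: monom_def[abs_def] inner_Pair0 del: nideal.simps)
 qed
 \<comment> \<open>The coefficients of \<open>D\<close> after the substitution \<open>Ps\<close>.
   The factor \<open>A bs\<close> has order |bs|_N and \<open>G bs cs\<close> at least |cs|_N -
   |bs|_N, which add up to at least |cs|_N.\<close>
 define a0 where "a0 cs z = (\<Sum>bs\<in>?L. A bs (snd z) * (if length cs <= length bs then G bs cs z else 0))" for cs z
 have a0: "nideal PB ?N1 (ncount N cs) B1 (a0 cs)" for cs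
  unfolding a0_def
 proof (rule nideal_sum[OF B1])
  fix bs assume bs: "bs \<in> ?L"
  have "nideal PB ?N1 (ncount N cs - ncount N1 bs) B1 (G bs cs)"
   using spec[OF conjunct1[OF bspec[OF G bs]], of cs] unfolding nc .
  hence 1: "nideal PB ?N1 (ncount N cs - ncount N1 bs) B1 (%z. if length cs <= length bs then G bs cs z else 0)"
   using nideal_zero[OF B1] by (cases "length cs <= length bs") (simp_all del: nideal.simps)
  have 2: "nideal PB ?N1 (ncount N1 bs) B1 (%z. A bs (snd z))"
   by (rule snd1[OF nideal_subset[OF A sub3(2)]]) (use bs in auto)
  show "nideal PB ?N1 (ncount N cs) B1 (%z. A bs (snd z) * (if length cs <= length bs then G bs cs z else 0))"
   by (rule nideal_antimono[OF B1 _ nideal_mult[OF B1 2 1]]) simp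
 qed
 have a1: "nideal PB ?N1 (ncount N cs + k) B1 (%z. a0 cs z * (f (?i (snd z)) * al (?j (fst z), ?i (snd z))))" for cs
 proof -
  have "smooth PB B1 (%z. al (?j (fst z), ?i (snd z)))"
   by (rule smooth_subset[OF joint_coords[OF al g(1) c1 W(1)]]) (use B1X V3(2) in \<open>auto simp: X1_def P1_def\<close>)
  from nideal_mult_smooth[OF B1 this snd1[OF V3(5)]]
  have "nideal PB ?N1 k B1 (%z. f (?i (snd z)) * al (?j (fst z), ?i (snd z)))" by (simp add: mult.commute)
  from nideal_mult[OF B1 a0 this] show ?thesis .
 qed
 define Z where "Z z = ph1 (act (ginv (?j (fst z))) (inv_into V ph (snd z)))" for z
 define X2 where "X2 = map_prod th ph ` (Q \<times> V \<inter> {p. act (ginv (fst p)) (snd p) \<in> V4})"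
 have X2: "span_open PB X2" unfolding X2_def
  by (rule joint_image_open[OF g(1) c joint_open[OF g(1) c open_act_inv_vimage[OF o4]]]) auto
 have V43: "V4 <= V3" by (auto simp: V4_def)
 have Z: "smooth PB X2 Z" unfolding Z_def
  by (rule smooth_subset[OF act_inv_coords[OF g(1) c c3]]) (use V43 in \<open>auto simp: X2_def\<close>)
 \<comment> \<open>So far the coefficients are functions of \<open>h\<close> and the point before
   translation; \<open>ze\<close> expresses them through \<open>h\<close> and the translated
   point.\<close>
 define ze where "ze z = (fst z, Z z)" for z
 have ze: "smooth PB X2 ze" unfolding ze_def by (rule smooth_Pair[OF X2 smooth_fst_snd(1)[OF X2] Z])
 have el2: "EX h x. h \<in> Q & x \<in> V & act (ginv h) x \<in> V4 & z = (th h, ph x) & ?j (fst z) = h & inv_into V ph (snd z) = x &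
  ze z = (th h, ph1 (act (ginv h) x)) & ?i (snd (ze z)) = act (ginv h) x" if "z \<in> X2" for z
  using that g(1) c i3 V43 unfolding X2_def by (auto simp: ze_def Z_def subset_iff)
 have zes: "ze ` X2 <= span PB"
 proof
  fix y assume "y \<in> ze ` X2"
  then obtain z where "z \<in> X2" "y = ze z" by blast
  with el2[of z] show "y \<in> span PB" unfolding span_prod_basis[OF G.B_Basis B_Basis]
   using span_open_subset[OF G.chart_span_open[OF g(1)]] span_open_subset[OF X3] V43 by (auto simp: subset_iff)
 qed
 have Y2: "span_open PB (X2 \<inter> ze -` B1)" by (rule span_open_preimage[OF X2 smooth_continuous[OF ze] zes B1])
 have pX2: "(th h0, ph p) \<in> X2" unfolding X2_def V4_def using g p V3(1) d(1)
  by (intro image_eqI[of _ _ "(h0, p)"]) (auto simp: q0_def)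
 have "ze (th h0, ph p) = (th h0, ph1 q0)" using g p c by (simp add: ze_def Z_def q0_def)
 moreover have "(th h0, ph1 q0) \<in> B1"
  using e1(1) g V3(1) span_open_subset[OF G.chart_span_open[OF g(1)]] span_open_subset[OF X3]
  by (auto simp: B1_def span_prod_basis[OF G.B_Basis B_Basis])
 ultimately have "(th h0, ph p) \<in> X2 \<inter> ze -` B1" using pX2 by simp
 from span_open_ball[OF Y2 this] obtain e2 where e2: "e2 > 0" "ball (th h0, ph p) e2 \<inter> span PB <= X2 \<inter> ze -` B1" .
 define Y where "Y = ball (th h0, ph p) e2 \<inter> span PB"
 have Y: "span_open PB Y" unfolding Y_def by (simp add: openin_open_Int Int_commute)
 have YX: "Y <= X2" "ze ` Y <= B1" using e2 by (auto simp: Y_def)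
 have starY: "nstar ?N Y" unfolding Y_def
  by (rule nstar_ball[OF NB(2) PB_Basis]) (use adapted_S[OF V p(2)] p(1) in \<open>auto simp: inner_Pair0\<close>)
 have zeY: "smooth PB Y ze" by (rule smooth_subset[OF ze YX(1)])
 \<comment> \<open>The same argument for the inverse translation, which also maps \<open>S\<close>
   into itself.\<close>
 have zeN: "nideal PB ?N 1 Y (%z. of_real (ze z \<bullet> b))" if b: "b \<in> ?N1" for b
 proof (rule Hadamard[OF PB_Basis NB(2) Y starY smooth_of_real[OF Y smooth_inner_const[OF Y zeY]]])
  fix z assume z: "z \<in> Y" "!!b. b \<in> ?N ==> z \<bullet> b = 0"
  obtain h x where hx: "x \<in> V" "act (ginv h) x \<in> V4" "z = (th h, ph x)" "ze z = (th h, ph1 (act (ginv h) x))" by (use el2[OF subsetD[OF YX(1) z(1)]] in \<open>elim exE conjE\<close>) (rule that)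
  have "ph x \<bullet> b1 = 0" if "b1 \<in> N" for b1 using z(2)[OF imageI[OF that]] hx(3) by (simp add: inner_Pair0)
  hence "x \<in> S" by (intro iffD2[OF adapted_S[OF V hx(1)]] ballI)
  hence xS: "act (ginv h) x \<in> S" by (rule subsetD[OF act_S[of "ginv h"] imageI])
  obtain b1 where b1: "b = (0, b1)" "b1 \<in> N1" using b by auto
  have "ph1 (act (ginv h) x) \<bullet> b1 = 0" by (rule bspec[OF iffD1[OF adapted_S[OF V3(4) subsetD[OF V43 hx(2)]] xS] b1(2)])
  thus "complex_of_real (ze z \<bullet> b) = 0" unfolding hx(4) b1(1) inner_Pair0 by simp
 qed
 define a where "a cs z = a0 cs (ze z)" for cs z
 have sa: "smooth PB Y (a cs)" for cs
  unfolding a_def by (rule smooth_compose[OF PB_Basis Y B1 YX(2) zeY nideal_smooth[OF B1 a0]])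
 have na: "nideal PB ?N (k + ncount N cs) Y (%z. a cs z * (f (act (ginv (?j (fst z))) (inv_into V ph (snd z))) *
   al (?j (fst z), act (ginv (?j (fst z))) (inv_into V ph (snd z)))))" (is "nideal PB ?N _ Y ?R") for cs
 proof -
  have n: "nideal PB ?N (ncount N cs + k) Y (%z. a0 cs (ze z) * (f (?i (snd (ze z))) * al (?j (fst (ze z)), ?i (snd (ze z)))))"
   by (rule nideal_compose[OF PB_Basis Y B1 YX(2) zeY zeN a1])
  have "nideal PB ?N (ncount N cs + k) Y ?R \<longleftrightarrow> nideal PB ?N (ncount N cs + k) Y (%z. a0 cs (ze z) * (f (?i (snd (ze z))) * al (?j (fst (ze z)), ?i (snd (ze z)))))"
  proof (rule nideal_cong[OF Y])
   fix z assume "z \<in> Y"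
   hence "z \<in> X2" using YX(1) by blast
   from el2[OF this] show "?R z = a0 cs (ze z) * (f (?i (snd (ze z))) * al (?j (fst (ze z)), ?i (snd (ze z))))"
    by (auto simp: a_def ze_def)
  qed
  thus ?thesis using n by (simp add: add.commute del: nideal.simps)
 qed
 have hx: "act (ginv h) x \<in> V4" "(h, act (ginv h) x) \<in> W" "(th h, ph1 (act (ginv h) x)) \<in> B1" "ze (th h, ph x) = (th h, ph1 (act (ginv h) x))"
  if "h \<in> Q" "x \<in> V" "(th h, ph x) \<in> Y" for h x
 proof -
  have z: "(th h, ph x) \<in> X2" "ze (th h, ph x) \<in> B1" using that(3) YX by auto
  have j: "?j (th h) = h" "inv_into V ph (ph x) = x" using that(1,2) g(1) c by auto
  from el2[OF z(1)] j show 1: "act (ginv h) x \<in> V4" by auto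
  from el2[OF z(1)] j show 2: "ze (th h, ph x) = (th h, ph1 (act (ginv h) x))" by auto
  with z(2) show "(th h, ph1 (act (ginv h) x)) \<in> B1" by simp
  from el[OF this] j i3[OF subsetD[OF V43 1]] show "(h, act (ginv h) x) \<in> W" by auto
 qed
 have DF: "D F (act (ginv h) x) = diffop B m (%cs y. a cs (th h, y)) (%y. F (act (ginv h) (inv_into V ph y))) (ph x)"
  if h: "h \<in> Q" "x \<in> V" "(th h, ph x) \<in> Y" and F: "smooth_fun B \<A> U F" for h x F
 proof -
  note hx = hx[OF h]
  define w where "w = act (ginv h) x"
  have w: "w \<in> V3" "w \<in> U" "(th h, ph1 w) \<in> B1" "act h w = x" using hx V43 sub3 by (auto simp: w_def)
  let ?T = "%y. F (act (ginv h) (inv_into V ph y))"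
  let ?Y = "ph ` (V \<inter> {x. act (ginv h) x \<in> U})"
  have YT: "span_open B ?Y" "smooth B ?Y ?T"
   by (rule chart_image_Int_open[OF c open_act_fixed[OF U(1)]], rule smooth_fun_chart[OF smooth_fun_act[OF F U(1)] c])
  have hC: "th h \<in> span C" using span_open_subset[OF G.chart_span_open[OF g(1)]] h(1) by blast
  note so = smooth_slice(1)[OF G.B_Basis B_Basis B1 Ps hC]
  have Psw: "Ps (th h, ph1 w) = ph x" using i3[OF w(1)] g(1) h(1) w(4) by (simp add: Ps_def)
  have xY: "ph x \<in> ?Y" using h(2) w(2) by (auto simp: w_def)
  have it: "ipd bs (%y. F (?i y)) (ph1 w) = (\<Sum>cs\<in>?L. (if length cs <= length bs then G bs cs (th h, ph1 w) else 0) * ipd cs ?T (ph x))"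
   if bs: "bs \<in> ?L" for bs
  proof -
   have "ipd bs (%y. F (?i y)) (ph1 w) = ipd bs (%y. ?T (Ps (th h, y))) (ph1 w)"
   proof (rule iter_partial_cong[OF so _ _])
    fix y assume "y \<in> {y. (th h, y) \<in> B1}"
    then obtain h' x' where "h' \<in> Q" "act h' x' \<in> V" "?j (th h) = h'" "?i y = x'" using el by fastforce
    thus "F (?i y) = ?T (Ps (th h, y))" using c G.chart_inv[OF g(1) h(1)] by (simp add: Ps_def)
   qed (use bs w in auto)
   also have "... = ipd (map (Pair 0) bs) (%z. ?T (Ps z)) (th h, ph1 w)" by (rule iter_partial_slice[symmetric])
   also have "... = (\<Sum>cs | set cs <= B & length cs <= length bs. G bs cs (th h, ph1 w) * ipd cs ?T (ph x))"
    using mp[OF spec[OF spec[OF spec[OF conjunct2[OF bspec[OF G bs]], of ?T], of ?Y], of "(th h, ph1 w)"]] YT w(3) xY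
    by (simp add: Psw)
   also have "... = (\<Sum>cs\<in>?L. (if length cs <= length bs then G bs cs (th h, ph1 w) else 0) * ipd cs ?T (ph x))"
    by (intro sum.mono_neutral_cong_left finite_lists_le[OF finite_Basis_subset[OF B_Basis]]) (use bs in auto)
   finally show ?thesis .
  qed
  have "D F w = diffop B m A (%y. F (?i y)) (ph1 w)" by (rule DA[OF U(1) order_refl F w(2)]) (use w(1) V3(3) in blast)
  also have "... = (\<Sum>bs\<in>?L. \<Sum>cs\<in>?L. A bs (ph1 w) * (if length cs <= length bs then G bs cs (th h, ph1 w) else 0) * ipd cs ?T (ph x))"
   unfolding diffop_def using it by (intro sum.cong refl) (simp add: sum_distrib_left mult.assoc)
  also have "... = diffop B m (%cs y. a cs (th h, y)) ?T (ph x)"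
   unfolding diffop_def a_def hx(4) a0_def w_def[symmetric] by (subst sum.swap) (simp add: sum_distrib_right)
  finally show ?thesis by (simp add: w_def)
 qed
 have pY: "(th h0, ph p) \<in> Y" using e2(1) pX2 span_open_subset[OF X2] by (auto simp: Y_def)
 have YQ: "Y <= th ` Q \<times> ph ` V" using YX(1) by (auto simp: X2_def)
 show ?thesis by (rule that[OF Y pY YQ K sa na _ DF]) (use hx V4K in blast)+
qed

end

section \<open>Local averages over the group\<close>

context setting
begin

text \<open>All measurable parts of \<open>P\<close> with finite measure are allowed, so that a set
  covered by several \<open>P\<close> can be cut into disjoint pieces. Integrability is carried
  along because additivity of the integral needs it.\<close>

definition averaged :: "nat => 'm set => ('m => 'e) => 'e set => 'h measure => 'h set => 'm set =>
  ('h => (('m, 'e) chart => 'm => complex) => complex) => bool" where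
 "averaged k V ph N dh P V0 u \<longleftrightarrow> open P & open V0 & (ALL Om. Om \<in> sets borel & Om <= P & emeasure dh Om < \<infinity> -->
  good k V ph N V0 (%om. LINT h:Om|dh. u h om) & (ALL om:test_measures B \<A> V0. set_integrable dh Om (%h. u h om)))"

lemma averaged_mono:
 assumes u: "averaged k V ph N dh P V0 u" and "open P'" "P' <= P" "open V0'" "V0' <= V0"
  and eq: "!!h om. h \<in> P' ==> om \<in> test_measures B \<A> V0' ==> u' h om = u h om"
 shows "averaged k V ph N dh P' V0' u'"
 unfolding averaged_def
proof (intro conjI allI impI ballI assms(2,4))
 fix Om assume Om: "Om \<in> sets borel & Om <= P' & emeasure dh Om < \<infinity>"
 hence u': "good k V ph N V0 (%om. LINT h:Om|dh. u h om)" "!!om. om \<in> test_measures B \<A> V0 ==> set_integrable dh Om (%h. u h om)"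
  using u assms(3) unfolding averaged_def by auto
 have i: "indicat_real Om h *\<^sub>R u' h om = indicat_real Om h *\<^sub>R u h om" if "om \<in> test_measures B \<A> V0'" for h om
  using eq[OF _ that, of h] Om by (cases "h \<in> Om") auto
 show "good k V ph N V0' (%om. LINT h:Om|dh. u' h om)"
  by (rule good_cong[OF good_mono[OF u'(1) assms(5)]]) (simp add: set_lebesgue_integral_def i)
 show "set_integrable dh Om (%h. u' h om)" if "om \<in> test_measures B \<A> V0'" for om
  using u'(2)[OF tm_mono[OF that assms(5)]] by (simp add: set_integrable_def i[OF that])
qed

lemma averaged_add:
 assumes "averaged k V ph N dh P V0 u" "averaged k V ph N dh P' V0' u'"
 shows "averaged k V ph N dh (P \<inter> P') (V0 \<inter> V0') (%h om. u h om + u' h om)"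
 unfolding averaged_def
proof (intro conjI allI impI ballI)
 show "open (P \<inter> P')" "open (V0 \<inter> V0')" using assms unfolding averaged_def by auto
 fix Om assume Om: "Om \<in> sets borel & Om <= P \<inter> P' & emeasure dh Om < \<infinity>"
 hence g: "good k V ph N V0 (%om. LINT h:Om|dh. u h om)" "good k V ph N V0' (%om. LINT h:Om|dh. u' h om)"
  and i: "!!om. om \<in> test_measures B \<A> V0 ==> set_integrable dh Om (%h. u h om)" "!!om. om \<in> test_measures B \<A> V0' ==> set_integrable dh Om (%h. u' h om)"
  using assms unfolding averaged_def by auto
 note m = tm_mono[OF _ Int_lower1] tm_mono[OF _ Int_lower2]
 show "good k V ph N (V0 \<inter> V0') (%om. LINT h:Om|dh. u h om + u' h om)"
  by (rule good_cong[OF good_add[OF good_mono[OF g(1) Int_lower1] good_mono[OF g(2) Int_lower2]]])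
   (rule set_integral_add(2)[OF i(1)[OF m(1)] i(2)[OF m(2)]])
 show "set_integrable dh Om (%h. u h om + u' h om)" if "om \<in> test_measures B \<A> (V0 \<inter> V0')" for om
  by (rule set_integral_add(1)[OF i(1)[OF m(1)[OF that]] i(2)[OF m(2)[OF that]]])
qed

lemma averaged_zero: "averaged k V ph N dh UNIV UNIV (%h om. 0)"
 by (simp add: averaged_def good_zero set_integrable_def)

lemma averaged_Un:
 assumes "averaged k V ph N dh P V0 u" "averaged k V ph N dh P' V0' u" and dh: "sets dh = sets borel"
 shows "averaged k V ph N dh (P \<union> P') (V0 \<inter> V0') u"
 unfolding averaged_def
proof (intro conjI allI impI ballI)
 show o: "open (P \<union> P')" "open (V0 \<inter> V0')" using assms unfolding averaged_def by auto
 have oP: "open P" using assms(1) by (simp add: averaged_def)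
 fix Om assume Om: "Om \<in> sets borel & Om <= P \<union> P' & emeasure dh Om < \<infinity>"
 let ?A = "Om \<inter> P" and ?B = "Om - P"
 have A: "?A \<in> sets borel" "?A <= P" "?A \<in> sets dh" and Bs: "?B \<in> sets borel" "?B <= P'" "?B \<in> sets dh" using Om oP dh by auto
 have "emeasure dh ?A <= emeasure dh Om" "emeasure dh ?B <= emeasure dh Om" using Om dh by (auto intro!: emeasure_mono)
 hence f: "emeasure dh ?A < \<infinity>" "emeasure dh ?B < \<infinity>" using Om by (auto intro: le_less_trans)
 have g: "good k V ph N V0 (%om. LINT h:?A|dh. u h om)" "good k V ph N V0' (%om. LINT h:?B|dh. u h om)"
  and i: "!!om. om \<in> test_measures B \<A> V0 ==> set_integrable dh ?A (%h. u h om)" "!!om. om \<in> test_measures B \<A> V0' ==> set_integrable dh ?B (%h. u h om)"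
  using assms(1,2) A Bs f unfolding averaged_def by auto
 note m = tm_mono[OF _ Int_lower1] tm_mono[OF _ Int_lower2]
 have U: "?A \<union> ?B = Om" "?A \<inter> ?B = {}" by auto
 show "good k V ph N (V0 \<inter> V0') (%om. LINT h:Om|dh. u h om)"
  by (rule good_cong[OF good_add[OF good_mono[OF g(1) Int_lower1] good_mono[OF g(2) Int_lower2]]])
   (rule set_integral_Un[OF U(2) i(1)[OF m(1)] i(2)[OF m(2)], unfolded U(1)])
 show "set_integrable dh Om (%h. u h om)" if "om \<in> test_measures B \<A> (V0 \<inter> V0')" for om
  by (rule set_integrable_Un[OF i(1)[OF m(1)[OF that]] i(2)[OF m(2)[OF that]] A(3) Bs(3), unfolded U(1)])
qed

text \<open>Both neighbourhoods may depend on \<open>h\<close>; the one in the manifold becomes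
  uniform only once finitely many of the \<open>P\<close> cover the compact set.\<close>

definition averages_near where
 "averages_near k V ph N dh h p u \<longleftrightarrow> (EX P V0. h \<in> P & p \<in> V0 & averaged k V ph N dh P V0 u)"

lemma averages_near_zero: "averages_near k V ph N dh h p (%h om. 0)"
 unfolding averages_near_def by (rule exI[of _ UNIV], rule exI[of _ UNIV]) (simp add: averaged_zero)

lemma averages_near_sum:
 assumes "!!i. i \<in> I ==> averages_near k V ph N dh h p (u i)"
 shows "averages_near k V ph N dh h p (%h om. \<Sum>i\<in>I. u i h om)"
 using assms
proof (induction I rule: infinite_finite_induct)
 case (insert i I)
 obtain P V0 P' V0' where "h \<in> P" "p \<in> V0" "averaged k V ph N dh P V0 (u i)"
  "h \<in> P'" "p \<in> V0'" "averaged k V ph N dh P' V0' (%h om. \<Sum>i\<in>I. u i h om)"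
  using insert unfolding averages_near_def by (meson insertCI)
 thus ?case
  using averaged_add[of k V ph N dh P V0 "u i" P' V0' "%h om. \<Sum>i\<in>I. u i h om"] insert(1,2) unfolding averages_near_def
  by (intro exI[of _ "P \<inter> P'"] exI[of _ "V0 \<inter> V0'"]) simp
qed (simp_all add: averages_near_zero)

lemma averages_near_cong:
 assumes "averages_near k V ph N dh h p u" "open O'" "(h, p) \<in> O'"
  and eq: "!!P V0 h om. P \<times> V0 <= O' ==> open V0 ==> h \<in> P ==> om \<in> test_measures B \<A> V0 ==> u' h om = u h om"
 shows "averages_near k V ph N dh h p u'"
proof -
 obtain P V0 where a: "h \<in> P" "p \<in> V0" "averaged k V ph N dh P V0 u" using assms(1) unfolding averages_near_def by (elim exE conjE)
 obtain P' V' where b: "open P'" "open V'" "(h, p) \<in> P' \<times> V'" "P' \<times> V' <= O'" by (rule open_prod_elim[OF assms(2,3)])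
 have o: "open (P \<inter> P')" "open (V0 \<inter> V')" using a(3) b unfolding averaged_def by auto
 have "averaged k V ph N dh (P \<inter> P') (V0 \<inter> V') u'"
  by (rule averaged_mono[OF a(3) o(1) _ o(2)]) (use eq[of "P \<inter> P'" "V0 \<inter> V'", OF _ o(2)] b(4) in auto)
 thus ?thesis using a b unfolding averages_near_def by (intro exI[of _ "P \<inter> P'"] exI[of _ "V0 \<inter> V'"]) auto
qed

lemma pb_mult_tm:
 assumes al: "smooth_fun PB (prod_atlas \<H> \<A>) W al" and W: "open W" and om: "om \<in> test_measures B \<A> V0" and V0: "open V0"
  and VW: "!!x. x \<in> V0 ==> (h, act (ginv h) x) \<in> W"
 shows "(%c x. al (h, x) * pb h om c x) \<in> test_measures B \<A> (act (ginv h) ` V0)"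
proof -
 obtain K where K: "compact K" "K <= V0" "!!c x. x ~: K ==> om c x = 0" using tm_supp[OF om] by blast
 have o: "open (act (ginv h) ` V0)" unfolding act_image_eq by (rule open_act_fixed[OF V0])
 show ?thesis
  by (rule tm_mult[OF pb_tm[OF om K(1,3)] o smooth_fun_subset[OF slice_fun[OF al W]]]) (use K(2) VW in auto)
qed

text \<open>For \<open>h\<close> near \<open>h0\<close> the distribution is evaluated in the chart
  \<open>ph\<close> composed with the translation by \<open>h\<close>. There the integral becomes a
  finite sum in which \<open>h\<close> enters only through a bounded kernel and smooth coefficients,
  exactly the shape that \<open>average_term\<close> integrates.\<close>

lemma operator_averages:
 assumes p: "p \<in> S" "p \<in> V" and V: "adapted V ph N"
  and U: "open U" "act (ginv h0) p \<in> U" and f: "f \<in> ideal_power B \<A> S k U"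
  and D: "diff_operator B \<A> U D" "tangential B \<A> S U D" and hh: "hh \<in> Linf_loc B \<A> U"
  and al: "smooth_fun PB (prod_atlas \<H> \<A>) W al" and W: "open W" "(h0, act (ginv h0) p) \<in> W" and dh: "sets dh = sets borel"
 shows "averages_near k V ph N dh h0 p (%h om. fDh_distribution B \<A> U f D hh (%c x. al (h, x) * pb h om c x))"
proof -
 obtain Q th where g: "(Q, th) \<in> \<H>" "h0 \<in> Q" using G.chart_ex by blast
 let ?j = "inv_into Q th" and ?i = "inv_into V ph" and ?N = "Pair (0 :: 'a) ` N"
 obtain Y m a K where Y: "span_open PB Y" "(th h0, ph p) \<in> Y" "Y <= th ` Q \<times> ph ` V" and K: "compact K" "K <= U"
  and sa: "!!cs. smooth PB Y (a cs)"
  and na: "!!cs. nideal PB ?N (k + ncount N cs) Y (%q. a cs q * (f (act (ginv (?j (fst q))) (?i (snd q))) * al (?j (fst q), act (ginv (?j (fst q))) (?i (snd q)))))"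
  and hx: "!!h x. h \<in> Q ==> x \<in> V ==> (th h, ph x) \<in> Y ==> act (ginv h) x \<in> K & (h, act (ginv h) x) \<in> W"
  and DF: "!!h x F. h \<in> Q ==> x \<in> V ==> (th h, ph x) \<in> Y ==> smooth_fun B \<A> U F ==> D F (act (ginv h) x) =
   diffop B m (%cs y. a cs (th h, y)) (%y. F (act (ginv h) (?i y))) (ph x)"
  by (rule joint_coefficients[OF p V U f D al W g], rule that, assumption+)
 have c: "(V, ph) \<in> \<A>" by (rule adapted_chart[OF V])
 let ?L = "{cs. set cs <= B & length cs <= m}" and ?Ga = "%cs. {gm. set gm <= ?N & length gm = k + ncount N cs}"
 \<comment> \<open>The expansion into monomials of degree k + |cs|_N is made in the joint
   coordinates, so the coefficients are smooth in the group variable too.\<close>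
 have "ALL cs. EX e. (ALL gm. smooth PB Y (e gm)) & (ALL q:Y. a cs q * (f (act (ginv (?j (fst q))) (?i (snd q))) *
   al (?j (fst q), act (ginv (?j (fst q))) (?i (snd q)))) = (\<Sum>gm\<in>?Ga cs. e gm q * monom gm q))"
  by (intro allI nideal_expand[OF Y(1) na])
 from choice[OF this] obtain e where e: "ALL cs. (ALL gm. smooth PB Y (e cs gm)) & (ALL q:Y. a cs q * (f (act (ginv (?j (fst q))) (?i (snd q))) *
   al (?j (fst q), act (ginv (?j (fst q))) (?i (snd q)))) = (\<Sum>gm\<in>?Ga cs. e cs gm q * monom gm q))" ..
 obtain d where d: "d > 0" "ball (th h0, ph p) d \<inter> span PB <= Y" by (rule span_open_ball[OF Y(1,2)])
 define Cb where "Cb = cball (th h0, ph p) (d/2) \<inter> span PB"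
 have Cb: "compact Cb" "Cb <= Y" using d closed_subspace[OF subspace_span] by (auto simp: Cb_def)
 \<comment> \<open>Radius \<open>d/4\<close> in each factor keeps the product inside the compact
   ball \<open>Cb\<close> of radius \<open>d/2\<close>, on which the coefficients are
   bounded.\<close>
 define P where "P = Q \<inter> th -` ball (th h0) (d/4)"
 define V0 where "V0 = V \<inter> (V \<inter> ph -` ball (ph p) (d/4))"
 have oP: "open P" "P <= Q" "h0 \<in> P" unfolding P_def using d(1) g
  by (auto intro!: continuous_open_preimage[OF G.chart_cont[OF g(1)] G.chart_open[OF g(1)]])
 have oV: "open (V \<inter> ph -` ball (ph p) (d/4))" by (rule continuous_open_preimage[OF chart_cont[OF c] chart_open[OF c]]) simp
 have c0: "(V0, ph) \<in> \<A>" unfolding V0_def by (rule chart_restrict[OF c oV])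
 have V0: "open V0" "V0 <= V" "p \<in> V0" using chart_open[OF c0] d(1) p by (auto simp: V0_def)
 have X0: "span_open B (ph ` V0)" by (rule chart_span_open[OF c0])
 have PV: "th ` P \<times> ph ` V0 <= Cb"
 proof clarify
  fix h x assume h: "h \<in> P" "x \<in> V0"
  have "dist (th h0, ph p) (th h, ph x) <= dist (th h0) (th h) + dist (ph p) (ph x)"
   unfolding dist_Pair_Pair by (rule sqrt_sum_squares_le_sum) auto
  thus "(th h, ph x) \<in> Cb" using h span_open_subset[OF G.chart_span_open[OF g(1)]] span_open_subset[OF chart_span_open[OF c]]
   by (auto simp: Cb_def P_def V0_def span_prod_basis[OF G.B_Basis B_Basis])
 qed
 have hY: "(th h, y) \<in> Y" if "h \<in> P" "y \<in> ph ` V0" for h y using that PV Cb(2) by blast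
 have sl: "smooth B (ph ` V0) (%y. F (th h, y))" if h: "h \<in> P" and F: "smooth PB Y F" for h and F :: "'a \<times> 'e => complex"
 proof (rule smooth_subset[OF smooth_slice(2)[OF G.B_Basis B_Basis Y(1) F]])
  show "th h \<in> span C" using h oP(2) span_open_subset[OF G.chart_span_open[OF g(1)]] by blast
 qed (use hY[OF h] in auto)
 define hh1 where "hh1 x = indicat_real K x *\<^sub>R hh x" for x
 have hh1: "hh1 \<in> borel_measurable borel" unfolding hh1_def[abs_def] using Linf_locD(1)[OF hh K] U(1) by simp
 obtain R where R: "ALL U ph. (U, ph) \<in> \<A> --> (AE y in \<mu>. y \<in> ph ` (U \<inter> K) --> cmod (hh (inv_into U ph y)) <= R)"
  using Linf_locD(2)[OF hh K] U(1) by auto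
 \<comment> \<open>\<open>hh\<close> obeys the bound \<open>R\<close> only almost everywhere. The
   truncation is bounded everywhere and differs from \<open>hh\<close> on \<open>K\<close> only on
   sets that are null in each chart.\<close>
 define hh0 where "hh0 x = (if cmod (hh1 x) <= R then hh1 x else 0)" for x
 have hh0: "hh0 \<in> borel_measurable borel" "!!x. cmod (hh0 x) <= \<bar>R\<bar>"
  unfolding hh0_def[abs_def] using hh1 by (auto intro!: measurable_If)
 have "finite (Sigma ?L ?Ga)"
  using finite_lists_le[OF finite_Basis_subset[OF B_Basis]] finite_lists_length_eq[OF finite_imageI[OF adapted_finite[OF V]]]
  by (intro finite_SigmaI) auto
 from finite_distinct_list[OF this] obtain xs where "set xs = Sigma ?L ?Ga & distinct xs" ..
 hence xs: "set xs = Sigma ?L ?Ga" "distinct xs" by simp_all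
 \<comment> \<open>The terms of the Leibniz expansion, listed independently of \<open>h\<close> and
   \<open>om\<close>: coefficient, remaining derivative and monomial. \<open>map snd\<close> turns
   the joint normal directions back into directions of \<open>span B\<close>.\<close>
 define ts where "ts = concat (map (%(cs, gm). map (%(u, v).
  (%q. (-1) ^ length cs * ipd (map (Pair (0 :: 'a)) u) (e cs gm) q, v, map snd gm)) (splits (rev cs))) xs)"
 have ts: "smooth PB Y E & set v <= B & set gm <= N & k + ncount N v <= length gm" if t: "(E, v, gm) \<in> set ts" for E v gm
 proof -
  obtain cs gm' u where *: "(cs, gm') \<in> set xs" "(u, v) \<in> set (splits (rev cs))" "gm = map snd gm'"
   "E = (%q. (-1) ^ length cs * ipd (map (Pair (0 :: 'a)) u) (e cs gm') q)" using t unfolding ts_def by auto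
  have cs: "set cs <= B" "set gm' <= ?N" "length gm' = k + ncount N cs" using *(1) xs(1) by auto
  have uv: "set u <= B" "set v <= B" using splits_set[OF *(2)] cs by auto
  \<comment> \<open>A part of \<open>cs\<close> has at most |cs|_N normal directions, so degree k +
    |cs|_N covers the required k + |v|_N.\<close>
  have "mset v <=# mset cs" using splits_mset[OF *(2)] by (metis mset_rev mset_subset_eq_add_right)
  hence "ncount N v <= ncount N cs" using size_mset_mono[OF multiset_filter_mono] by (metis mset_filter size_mset)
  moreover have "set (map (Pair (0 :: 'a)) u) <= PB" using uv(1) by (auto intro!: Pair0_in_prod_basis)
  ultimately show ?thesis using cs uv *(3,4) e
   by (auto intro!: smooth_mult smooth_const smooth_iter_partial Y(1))
 qed
 define u where "u = (%(E :: 'a \<times> 'e => complex, v, gm) h om. LINT y:ph ` V|\<mu>. hh0 (act (ginv h) (?i y)) *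
  (E (th h, y) * ipd v (%y. monom gm y * om (V, ph) (?i y)) y))"
 have formula: "fDh_distribution B \<A> U f D hh (%c x. al (h, x) * pb h om c x) = (\<Sum>t\<leftarrow>ts. u t h om)"
  if h: "h \<in> P" and om: "om \<in> test_measures B \<A> V0" for h om
 proof -
  obtain K0 where K0: "compact K0" "K0 <= V0" "!!c x. x ~: K0 ==> om c x = 0" using tm_supp[OF om] by blast
  let ?V = "act (ginv h) ` V0" and ?ph = "ph \<circ> act h"
  have ch: "(?V, ?ph) \<in> \<A>" using tr_chart[OF c0, of "ginv h"] by simp
  have im: "?ph ` ?V = ph ` V0" by (simp add: image_image)
  define w where "w y = act (ginv h) (inv_into V0 ph y)" for y
  have inv: "inv_into ?V ?ph y = w y" "w y = act (ginv h) (?i y)" "w y \<in> ?V" if "y \<in> ph ` V0" for y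
   using inv_into_tr[OF c0 that, of "ginv h"] that c c0 V0(2) by (auto simp: w_def)
  have VK: "x \<in> K" "(h, x) \<in> W" if x: "x \<in> ?V" for x
  proof -
   obtain x' where x': "x' \<in> V0" "x = act (ginv h) x'" using x by blast
   thus "x \<in> K" "(h, x) \<in> W" using hx[of h x'] h oP(2) V0(2) hY[OF h, of "ph x'"] by auto
  qed
  have VU: "?V <= U" using VK K(2) by blast
  have tmV: "(%c x. al (h, x) * pb h om c x) \<in> test_measures B \<A> ?V"
   by (rule pb_mult_tm[OF al W(1) om V0(1)]) (use VK in auto)
  have pb0: "al (h, x) * pb h om c x = 0" if "x ~: act (ginv h) ` K0" for c x
   using K0(3)[of "act h x"] that by (metis act_inv(1) imageI mult_zero_right pb_def)
  define rh where "rh y = om (V, ph) (?i y)" for y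
  have rh0: "rh y = om (V0, ph) (inv_into V0 ph y)" if "y \<in> ph ` V0" for y
   using lawD[OF tm_law[OF om] c0 c, of "inv_into V0 ph y"] df_self[OF c0 c] that V0(2) c c0 by (auto simp: rh_def)
  have "smooth B (ph ` V0) (%y. om (V0, ph) (inv_into V0 ph y))" using smooth_fun_chart[OF tm_smooth[OF om c0] c0] by simp
  hence srh: "smooth B (ph ` V0) rh" using smooth_cong[OF X0, of rh, OF rh0] by (rule iffD2[rotated])
  define gt where "gt = (%(E, v, gm) y. E (th h, y) * ipd v (%y. monom gm y * rh y) y)"
  have gt: "continuous_on (ph ` V0) (gt t)" "!!y. y \<in> ph ` V - ph ` K0 ==> gt t y = 0" if t: "t \<in> set ts" for t
  proof -
   obtain E v gm where e: "t = (E, v, gm)" by (cases t)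
   note Ev = ts[OF t[unfolded e]]
   have "smooth B (ph ` V0) (gt t)" unfolding gt_def e prod.case
    using Ev by (intro smooth_mult[OF X0] sl[OF h] smooth_iter_partial smooth_monom[OF X0] srh) auto
   thus "continuous_on (ph ` V0) (gt t)" by (rule smooth_continuous)
   fix y assume y: "y \<in> ph ` V - ph ` K0"
   have K0V: "K0 <= V" using K0(2) V0(2) by blast
   have "ipd v (%y. monom gm y * rh y) y = 0"
    by (rule iter_partial_zero_off[OF chart_span_open[OF c] chart_image_compact(1)[OF c K0(1) K0V] _ _ y])
     (use Ev chart_image_compact(3)[OF c K0(1) K0V] K0(3) in \<open>auto simp: rh_def\<close>)
   thus "gt t y = 0" by (simp add: gt_def e)
  qed
  let ?b = "%y. f (w y) * al (h, w y)"
  have opt: "op_transpose m (%cs y. a cs (th h, y)) (%y. f (inv_into ?V ?ph y) * (al (h, inv_into ?V ?ph y) * pb h om (?V, ?ph) (inv_into ?V ?ph y))) y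
   = (\<Sum>t\<leftarrow>ts. gt t y)" if y: "y \<in> ph ` V0" for y
  proof -
   have "op_transpose m (%cs y. a cs (th h, y)) (%y. f (inv_into ?V ?ph y) * (al (h, inv_into ?V ?ph y) * pb h om (?V, ?ph) (inv_into ?V ?ph y))) y =
     op_transpose m (%cs y. a cs (th h, y)) (%y. ?b y * rh y) y"
    unfolding op_transpose_def
   proof (rule sum.cong[OF refl], rule arg_cong2[where f = "(*)"], rule refl, rule iter_partial_cong[OF X0 _ y])
    fix cs z assume z: "z \<in> ph ` V0"
    have "tr h (?V, ?ph) = (V0, ph)" using tr_tr(2)[of h "(V0, ph)"] by (simp add: tr_def o_def image_image)
    hence "pb h om (?V, ?ph) (w z) = rh z" using rh0[OF z] by (simp add: pb_def w_def)
    thus "a cs (th h, z) * (f (inv_into ?V ?ph z) * (al (h, inv_into ?V ?ph z) * pb h om (?V, ?ph) (inv_into ?V ?ph z))) =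
     a cs (th h, z) * (?b z * rh z)" by (simp add: inv(1)[OF z])
   qed simp
   also have "... = (\<Sum>cs\<in>?L. \<Sum>gm\<in>?Ga cs. \<Sum>(u, v)\<leftarrow>splits (rev cs).
    (-1) ^ length cs * ipd u (%y. e cs gm (th h, y)) y * ipd v (%y. monom (map snd gm) y * rh y) y)"
   proof (rule op_transpose_expand[OF X0 srh _ _ y])
    show "smooth B (ph ` V0) (%y. e cs gm (th h, y))" for cs gm
     by (rule sl[OF h spec[OF conjunct1[OF spec[OF e]]]])
    fix cs z assume z: "z \<in> ph ` V0"
    have "monom gm (th h, z) = monom (map snd gm) z" if "set gm <= ?N" for gm
     using that by (induction gm) (auto simp: inner_Pair0)
    hence m: "(\<Sum>gm\<in>?Ga cs. e cs gm (th h, z) * monom gm (th h, z)) = (\<Sum>gm\<in>?Ga cs. e cs gm (th h, z) * monom (map snd gm) z)"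
     by (intro sum.cong refl) auto
    have jh: "?j (th h) = h" using h oP(2) g(1) by auto
    show "a cs (th h, z) * ?b z = (\<Sum>gm\<in>?Ga cs. e cs gm (th h, z) * monom (map snd gm) z)"
     using bspec[OF conjunct2[OF spec[OF e, of cs]] hY[OF h z]] unfolding m by (simp add: jh inv(2)[OF z])
   qed
   also have "... = (\<Sum>(cs, gm)\<leftarrow>xs. \<Sum>(u, v)\<leftarrow>splits (rev cs).
    (-1) ^ length cs * ipd u (%y. e cs gm (th h, y)) y * ipd v (%y. monom (map snd gm) y * rh y) y)"
    by (subst sum.Sigma) (use finite_lists_le[OF finite_Basis_subset[OF B_Basis]] finite_lists_length_eq[OF finite_imageI[OF adapted_finite[OF V]]]
     in \<open>auto simp: sum.distinct_set_conv_list[OF xs(2), symmetric] xs(1)\<close>)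
   also have "... = (\<Sum>t\<leftarrow>ts. gt t y)"
   proof -
    have "(\<Sum>t\<leftarrow>concat (map F xs). gt t y) = (\<Sum>x\<leftarrow>xs. \<Sum>t\<leftarrow>F x. gt t y)" for F and xs :: "('e list \<times> ('a \<times> 'e) list) list"
     by (induction xs) simp_all
    thus ?thesis unfolding ts_def gt_def by (simp add: o_def case_prod_unfold iter_partial_slice)
   qed
   finally show ?thesis .
  qed
  have "fDh_distribution B \<A> U f D hh (%c x. al (h, x) * pb h om c x) = (LINT y:?ph ` ?V|\<mu>. hh (inv_into ?V ?ph y) *
   op_transpose m (%cs y. a cs (th h, y)) (%y. f (inv_into ?V ?ph y) * (al (h, inv_into ?V ?ph y) * pb h om (?V, ?ph) (inv_into ?V ?ph y))) y)"
  proof (rule fDh_chart[OF U(1) ch VU _ _ _ hh tm_mono[OF tmV VU]])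
   show "smooth B (?ph ` ?V) (%y. a cs (th h, y))" for cs unfolding im by (rule sl[OF h sa])
   show "smooth_fun B \<A> U f" using f by (simp add: ideal_power_def)
   show "compact (act (ginv h) ` K0)"
    by (rule compact_continuous_image[OF cont_act_comp[OF continuous_on_const continuous_on_id] K0(1)])
   show "act (ginv h) ` K0 <= ?V" using K0(2) by blast
   show "al (h, x) * pb h om c x = 0" if "x ~: act (ginv h) ` K0" for c x by (rule pb0[OF that])
   fix F :: "'m => complex" and x assume F: "smooth_fun B \<A> U F" and x: "x \<in> ?V"
   then obtain x' where x': "x' \<in> V0" "x = act (ginv h) x'" by blast
   have y: "ph x' \<in> ph ` V0" using x' by blast
   have "D F x = diffop B m (%cs y. a cs (th h, y)) (%y. F (act (ginv h) (?i y))) (ph x')"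
    unfolding x'(2) by (rule DF) (use h oP(2) V0(2) x' hY[OF h y] F in auto)
   also have "... = (\<Sum>bs\<in>?L. a bs (th h, ph x') * ipd bs (%y. F (inv_into ?V ?ph y)) (ph x'))"
    unfolding diffop_def by (intro sum.cong refl arg_cong2[where f = "(*)"] iter_partial_cong[OF X0 _ y]) (auto simp: inv)
   finally show "D F x = (\<Sum>bs\<in>?L. a bs (th h, ?ph x) * ipd bs (%y. F (inv_into ?V ?ph y)) (?ph x))" by (simp add: x')
  qed
  also have "... = (LINT y:ph ` V0|\<mu>. hh1 (w y) * (\<Sum>t\<leftarrow>ts. gt t y))"
   unfolding im using span_open_borel[OF X0]
   by (intro set_lebesgue_integral_cong allI impI) (simp_all only: sets_coord opt inv(1) hh1_def indicator_simps(1)[OF VK(1)[OF inv(3)]] scaleR_one)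
  also have "... = (LINT y:ph ` V0|\<mu>. hh0 (w y) * (\<Sum>t\<leftarrow>ts. gt t y))"
  proof -
   have cw: "continuous_on (ph ` V0) w" unfolding w_def
    by (rule cont_act_comp[OF continuous_on_const chart_cont_inv[OF c0]])
   have "continuous_on (ph ` V0) (%y. \<Sum>t\<leftarrow>zs. gt t y)" if "set zs <= set ts" for zs
    using that gt(1) by (induction zs) (auto intro: continuous_on_add)
   note cg = this[OF order_refl]
   have me: "(%y. indicat_real (ph ` V0) y *\<^sub>R (k (w y) * (\<Sum>t\<leftarrow>ts. gt t y))) \<in> borel_measurable \<mu>"
    if "k \<in> borel_measurable borel" for k :: "'m => complex"
   proof -
    have "(%y. indicat_real (ph ` V0) y *\<^sub>R (k (w y) * (\<Sum>t\<leftarrow>ts. gt t y))) =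
      (%y. (indicat_real (ph ` V0) y *\<^sub>R k (w y)) * (indicat_real (ph ` V0) y *\<^sub>R (\<Sum>t\<leftarrow>ts. gt t y)))" by (auto simp: indicator_def)
    thus ?thesis
     using borel_measurable_times[OF indicator_comp_borel[OF span_open_borel[OF X0] cw that] borel_measurable_continuous_on_indicator[OF span_open_borel[OF X0] cg]]
     by simp
   qed
   \<comment> \<open>The bound \<open>R\<close> holds in all charts of the atlas, in particular in
     the transported chart, whatever \<open>h\<close> is.\<close>
   have "AE y in \<mu>. y \<in> ?ph ` (?V \<inter> K) --> cmod (hh (inv_into ?V ?ph y)) <= R" using R ch by blast
   hence ae: "AE y in \<mu>. indicat_real (ph ` V0) y *\<^sub>R (hh1 (w y) * (\<Sum>t\<leftarrow>ts. gt t y)) = indicat_real (ph ` V0) y *\<^sub>R (hh0 (w y) * (\<Sum>t\<leftarrow>ts. gt t y))"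
   proof eventually_elim
    case (elim y)
    show ?case
    proof (cases "y \<in> ph ` V0")
     case True
     have "?V \<inter> K = ?V" using VK(1) by blast
     hence "cmod (hh (w y)) <= R" using elim True im inv(1)[OF True] by simp
     thus ?thesis using VK(1)[OF inv(3)[OF True]] by (simp add: hh0_def hh1_def)
    qed simp
   qed
   show ?thesis unfolding set_lebesgue_integral_def by (rule integral_cong_AE[OF me[OF hh1] me[OF hh0(1)] ae])
  qed
  also have "... = (LINT y:ph ` V0|\<mu>. \<Sum>t\<leftarrow>ts. hh0 (w y) * gt t y)" by (simp add: sum_list_const_mult)
  also have "... = (\<Sum>t\<leftarrow>ts. LINT y:ph ` V0|\<mu>. hh0 (w y) * gt t y)"
  proof (rule set_integral_sum_list(2))
   fix t assume t: "t \<in> set ts"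
   show "set_integrable \<mu> (ph ` V0) (%y. hh0 (w y) * gt t y)"
    unfolding w_def
   proof (rule set_integrable_Linf[OF c0 K0(1,2) _ _ gt(1)[OF t]])
    have "continuous_on UNIV (%x. act (ginv h) x)" by (rule cont_act_comp[OF continuous_on_const continuous_on_id])
    from measurable_compose[OF borel_measurable_continuous_onI[OF this] hh0(1)]
    show "(%x. indicat_real K0 x *\<^sub>R hh0 (act (ginv h) x)) \<in> borel_measurable borel"
     using compact_imp_closed[OF K0(1)] by simp
   qed (use hh0(2) gt(2)[OF t] V0(2) in auto)
  qed
  also have "... = (\<Sum>t\<leftarrow>ts. u t h om)"
  proof (intro arg_cong[where f = sum_list] map_cong refl)
   fix t assume t: "t \<in> set ts"
   obtain E v gm where e: "t = (E, v, gm)" by (cases t)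
   have "(LINT y:ph ` V0|\<mu>. hh0 (w y) * gt t y) = (LINT y:ph ` V0|\<mu>. hh0 (act (ginv h) (?i y)) * gt t y)"
    using span_open_borel[OF X0] inv(2) by (intro set_lebesgue_integral_cong) auto
   also have "... = (LINT y:ph ` V|\<mu>. hh0 (act (ginv h) (?i y)) * gt t y)"
   proof (rule set_integral_zero_off[OF image_mono[OF V0(2)]])
    fix y assume "y \<in> ph ` V - ph ` V0"
    hence "y \<in> ph ` V - ph ` K0" using image_mono[OF K0(2), of ph] by blast
    thus "hh0 (act (ginv h) (?i y)) * gt t y = 0" by (simp only: gt(2)[OF t] mult_zero_right)
   qed
   finally show "(LINT y:ph ` V0|\<mu>. hh0 (w y) * gt t y) = u t h om" by (simp add: u_def gt_def e rh_def)
  qed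
  finally show ?thesis .
 qed
 have "averaged k V ph N dh P V0 (%h om. fDh_distribution B \<A> U f D hh (%c x. al (h, x) * pb h om c x))"
  unfolding averaged_def
 proof (intro conjI allI impI oP(1) V0(1))
  fix Om assume Om: "Om \<in> sets borel & Om <= P & emeasure dh Om < \<infinity>"
  have 1: "good k V ph N V0 (%om. LINT h:Om|dh. u t h om) & (ALL om:test_measures B \<A> V0. set_integrable dh Om (%h. u t h om))"
   if t: "t \<in> set ts" for t
  proof -
   obtain E v gm where e: "t = (E, v, gm)" by (cases t)
   have Ev: "smooth PB Y E" "set v <= B" "set gm <= N" "k + ncount N v <= length gm" using ts[of E v gm] t e by auto
   have cE: "continuous_on Cb E" by (rule continuous_on_subset[OF smooth_continuous[OF Ev(1)] Cb(2)])
   obtain R' where R': "!!q. q \<in> Cb ==> cmod (E q) <= R'"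
    using compact_imp_bounded[OF compact_continuous_image[OF cE Cb(1)]] unfolding bounded_iff by auto
   obtain Hf where Hf: "Hf \<in> borel_measurable borel" "EX R. ALL x. cmod (Hf x) <= R"
    "!!K u. compact K ==> K <= V0 ==> continuous_on (ph ` V) u ==> (!!y. y \<in> ph ` V - ph ` K ==> u y = 0) ==>
     set_integrable dh Om (%h. LINT y:ph ` V|\<mu>. hh0 (act (ginv h) (?i y)) * (E (th h, y) * u y)) &
     (LINT h:Om|dh. LINT y:ph ` V|\<mu>. hh0 (act (ginv h) (?i y)) * (E (th h, y) * u y)) = (LINT y:ph ` V|\<mu>. Hf (?i y) * u y)"
   proof (rule average_term[OF c V0(1,2) g(1) oP(1,2) hh0 continuous_on_subset[OF cE PV] _ _ _ dh])
    show "cmod (E q) <= R'" if "q \<in> th ` P \<times> ph ` V0" for q using R' PV that by blast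
   qed (use Om in auto)
   have 2: "set_integrable dh Om (%h. u t h om) & (LINT h:Om|dh. u t h om) =
     (LINT y:ph ` V|\<mu>. Hf (?i y) * ipd v (%y. monom gm y * om (V, ph) (?i y)) y)" if om: "om \<in> test_measures B \<A> V0" for om
   proof -
    obtain K0 where K0: "compact K0" "K0 <= V0" "!!c x. x ~: K0 ==> om c x = 0" using tm_supp[OF om] by blast
    have K0V: "K0 <= V" using K0(2) V0(2) by blast
    note X = chart_span_open[OF c]
    have "smooth B (ph ` V) (%y. om (V, ph) (?i y))" using smooth_fun_chart[OF tm_smooth[OF om c] c] by simp
    from smooth_iter_partial[OF smooth_mult[OF X smooth_monom[OF X] this] Ev(2)]
    have uc: "continuous_on (ph ` V) (ipd v (%y. monom gm y * om (V, ph) (?i y)))" by (rule smooth_continuous)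
    have "ipd v (%y. monom gm y * om (V, ph) (?i y)) y = 0" if "y \<in> ph ` V - ph ` K0" for y
     by (rule iter_partial_zero_off[OF X chart_image_compact(1)[OF c K0(1) K0V] Ev(2) _ that])
      (use chart_image_compact(3)[OF c K0(1) K0V] K0(3) in auto)
    from Hf(3)[OF K0(1,2) uc this] show ?thesis unfolding u_def e prod.case .
   qed
   have "good k V ph N V0 (%om. LINT h:Om|dh. u t h om)"
    unfolding good_def by (rule exI[of _ "[(Hf, v, gm)]"]) (use 2 Hf(1,2) Ev in \<open>auto simp: good_terms_def\<close>)
   thus ?thesis using 2 by blast
  qed
  have i: "set_integrable dh Om (%h. u t h om)" if "t \<in> set ts" "om \<in> test_measures B \<A> V0" for t om using 1 that by blast
  have eq: "indicat_real Om h *\<^sub>R fDh_distribution B \<A> U f D hh (%c x. al (h, x) * pb h om c x) = indicat_real Om h *\<^sub>R (\<Sum>t\<leftarrow>ts. u t h om)"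
   if "om \<in> test_measures B \<A> V0" for h om using formula[OF _ that, of h] Om by (cases "h \<in> Om") auto
  have "good k V ph N V0 (%om. \<Sum>t\<leftarrow>ts. LINT h:Om|dh. u t h om)" using 1 by (intro good_sum_list) blast
  thus "good k V ph N V0 (%om. LINT h:Om|dh. fDh_distribution B \<A> U f D hh (%c x. al (h, x) * pb h om c x))"
  proof (rule good_cong)
   fix om assume om: "om \<in> test_measures B \<A> V0"
   have "(LINT h:Om|dh. fDh_distribution B \<A> U f D hh (%c x. al (h, x) * pb h om c x)) = (LINT h:Om|dh. \<Sum>t\<leftarrow>ts. u t h om)"
    unfolding set_lebesgue_integral_def eq[OF om] ..
   also have "... = (\<Sum>t\<leftarrow>ts. LINT h:Om|dh. u t h om)" by (rule set_integral_sum_list(2)[OF i[OF _ om]])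
   finally show "(LINT h:Om|dh. fDh_distribution B \<A> U f D hh (%c x. al (h, x) * pb h om c x)) = (\<Sum>t\<leftarrow>ts. LINT h:Om|dh. u t h om)" .
  qed
  show "ALL om:test_measures B \<A> V0. set_integrable dh Om (%h. fDh_distribution B \<A> U f D hh (%c x. al (h, x) * pb h om c x))"
   using set_integral_sum_list(1)[OF i] by (auto simp: set_integrable_def eq)
 qed
 thus ?thesis unfolding averages_near_def using oP(3) V0(3) by blast
qed

end

section \<open>Bundle components and the covering of the compact set\<close>

context setting
begin

text \<open>The matrix of the lift writes the pullback of a single component as a sum of components
  at the source point. Its entries are smooth in \<open>(h, x)\<close> and play the role of
  \<open>al\<close> in \<open>operator_averages\<close>.\<close>

lemma tensor_averages:
 assumes t': "(T', Ph') \<in> \<T>" "i < r" and p: "p \<in> S" "p \<in> T'" "p \<in> V" and V: "adapted V ph N"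
  and si: "si \<in> bundle_distributions B \<A> r \<pi> \<T>" "vanishes_along B \<A> r \<pi> \<T> S k si" and dh: "sets dh = sets borel"
 shows "averages_near k V ph N dh h0 p (%h om. si (pull h (tens om (T', Ph') i)))"
proof -
 \<comment> \<open>The vanishing of \<open>si\<close> is used at this point of \<open>S\<close>, in
   a trivialization around it, whereas the conclusion concerns \<open>p\<close>.\<close>
 define q0 where "q0 = act (ginv h0) p"
 have q0: "q0 \<in> S" "act h0 q0 = p" using act_S p(1) by (auto simp: q0_def)
 obtain T Ph where t: "(T, Ph) \<in> \<T>" "q0 \<in> T" using triv_ex by blast
 obtain a where a: "!!i j. i < r ==> j < r ==> smooth_fun PB (prod_atlas \<H> \<A>) {p. snd p \<in> T & act (fst p) (snd p) \<in> T'} (a i j)"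
  "!!h e i. \<pi> e \<in> T ==> act h (\<pi> e) \<in> T' ==> i < r ==> Ph' (lift h e) i = (\<Sum>j<r. a i j (h, \<pi> e) * Ph e j)"
  by (rule action_matrix[OF t(1) t'(1)], rule that, assumption+)
 let ?W = "{p. snd p \<in> T & act (fst p) (snd p) \<in> T'}"
 let ?O = "%U. {p. snd p \<in> T' & act (ginv (fst p)) (snd p) \<in> U}"
 have os: "open {p :: 'h \<times> 'm. snd p \<in> X}" if "open X" for X
  using open_vimage[OF that continuous_on_snd[OF continuous_on_id]] by (simp add: vimage_def)
 have W: "open ?W"
  using open_Int[OF os[OF triv_open[OF t(1)]] open_act_vimage[OF triv_open[OF t'(1)]]] by (simp add: Collect_conj_eq)
 have O: "open (?O U)" "q0 \<in> U ==> (h0, p) \<in> ?O U" if "open U" for U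
  using open_Int[OF os[OF triv_open[OF t'(1)]] open_act_inv_vimage[OF that]] p(2) by (simp_all add: Collect_conj_eq q0_def)
 have tm: "(%c x. a i j (h, x) * pb h om c x) \<in> test_measures B \<A> U"
  if "j < r" "P \<times> V0 <= ?O U" "U <= T" "open V0" "h \<in> P" "om \<in> test_measures B \<A> V0" for j P V0 U h om
 proof -
  have V0: "act (ginv h) x \<in> U" "x \<in> T'" if "x \<in> V0" for x using \<open>P \<times> V0 <= ?O U\<close> \<open>h \<in> P\<close> that by auto
  show ?thesis
   by (rule tm_mono[OF pb_mult_tm[OF a(1)[OF t'(2) that(1)] W that(6,4)]]) (use V0 that(3) in auto)
 qed
 have 1: "averages_near k V ph N dh h0 p (%h om. si (tens (%c x. a i j (h, x) * pb h om c x) (T, Ph) j))" if j: "j < r" for j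
 proof -
  have "scalar_vanishes B \<A> S k T (component \<pi> (T, Ph) j si)" using si(2) t(1) j unfolding vanishes_along_def by force
  hence "ALL p:S \<inter> T. EX U. open U & p \<in> U & U <= T & (EX (M::nat) f D h.
   (ALL l<M. f l \<in> ideal_power B \<A> S k U & diff_operator B \<A> U (D l) & tangential B \<A> S U (D l) & h l \<in> Linf_loc B \<A> U) &
   (ALL om:test_measures B \<A> U. component \<pi> (T, Ph) j si om = (\<Sum>l<M. fDh_distribution B \<A> U (f l) (D l) (h l) om)))"
   unfolding scalar_vanishes_def .
  from bspec[OF this, of q0] obtain U and M :: nat and f D hh where U: "open U" "q0 \<in> U" "U <= T"
   and l: "ALL l<M. f l \<in> ideal_power B \<A> S k U & diff_operator B \<A> U (D l) & tangential B \<A> S U (D l) & hh l \<in> Linf_loc B \<A> U"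
   and eq: "ALL om:test_measures B \<A> U. component \<pi> (T, Ph) j si om = (\<Sum>l<M. fDh_distribution B \<A> U (f l) (D l) (hh l) om)"
   using q0(1) t(2) by (elim meta_impE exE conjE) simp_all
  have "averages_near k V ph N dh h0 p (%h om. \<Sum>l<M. fDh_distribution B \<A> U (f l) (D l) (hh l) (%c x. a i j (h, x) * pb h om c x))"
  proof (rule averages_near_sum)
   fix l' assume "l' \<in> {..<M}"
   hence "f l' \<in> ideal_power B \<A> S k U" "diff_operator B \<A> U (D l')" "tangential B \<A> S U (D l')" "hh l' \<in> Linf_loc B \<A> U" using l by simp_all
   thus "averages_near k V ph N dh h0 p (%h om. fDh_distribution B \<A> U (f l') (D l') (hh l') (%c x. a i j (h, x) * pb h om c x))"
    by (rule operator_averages[OF p(1,3) V U(1) U(2)[unfolded q0_def] _ _ _ _ a(1)[OF t'(2) j] W _ dh]) (use U q0 t p in \<open>auto simp: q0_def\<close>)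
  qed
  thus ?thesis
  proof (rule averages_near_cong[OF _ O(1)[OF U(1)] O(2)[OF U(1,2)]])
   fix P V0 h om assume *: "P \<times> V0 <= ?O U" "open V0" "h \<in> P" "om \<in> test_measures B \<A> V0"
   show "si (tens (%c x. a i j (h, x) * pb h om c x) (T, Ph) j) = (\<Sum>l<M. fDh_distribution B \<A> U (f l) (D l) (hh l) (%c x. a i j (h, x) * pb h om c x))"
    using bspec[OF eq tm[OF j *(1) U(3) *(2-4)]] by (simp only: component_tens)
  qed
 qed
 from averages_near_sum[of "{..<r}", OF 1]
 have "averages_near k V ph N dh h0 p (%h om. \<Sum>j<r. si (tens (%c x. a i j (h, x) * pb h om c x) (T, Ph) j))" by simp
 thus ?thesis
 proof (rule averages_near_cong[OF _ O(1)[OF triv_open[OF t(1)]] O(2)[OF triv_open[OF t(1)] t(2)]])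
  fix P V0 h om assume *: "P \<times> V0 <= ?O T" "open V0" "h \<in> P" "om \<in> test_measures B \<A> V0"
  have "pull h (tens om (T', Ph') i) c e = (\<Sum>j<r. tens (%c x. a i j (h, x) * pb h om c x) (T, Ph) j c e)" for c e
  proof (cases "act h (\<pi> e) \<in> V0")
   case True
   hence "act h (\<pi> e) \<in> T'" "act (ginv h) (act h (\<pi> e)) \<in> T" using * by auto
   thus ?thesis using a(2)[of e h i] t'(2) by (simp add: pullback_eq tens_def pb_def sum_distrib_left mult_ac)
  next
   case False
   hence "om (tr h c) (act h (\<pi> e)) = 0" using tm_supp[OF *(4)] by blast
   thus ?thesis by (simp add: pullback_eq tens_def pb_def)
  qed
  hence "pull h (tens om (T', Ph') i) = (%c e. \<Sum>j<r. tens (%c x. a i j (h, x) * pb h om c x) (T, Ph) j c e)" by (intro ext)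
  thus "si (pull h (tens om (T', Ph') i)) = (\<Sum>j<r. si (tens (%c x. a i j (h, x) * pb h om c x) (T, Ph) j))"
   using tm[OF _ *(1) order_refl *(2-4)] t(1)
   by (simp only:) (rule distribution_sum[OF si(1) tens_bt], simp_all)
 qed
qed

lemma averaged_UN:
 assumes "finite D" "!!h. h \<in> D ==> p \<in> V0 h & averaged k V ph N dh (P h) (V0 h) u" and dh: "sets dh = sets borel"
 shows "EX V0. p \<in> V0 & averaged k V ph N dh (\<Union>h\<in>D. P h) V0 u"
 using assms(1,2)
proof (induction D)
 case empty
 have "averaged k V ph N dh {} UNIV u"
  using good_zero[of k V ph N UNIV] by (auto simp: averaged_def set_integrable_def set_lebesgue_integral_def)
 thus ?case by auto
next
 case (insert h D)
 then obtain V1 where "p \<in> V1" "averaged k V ph N dh (\<Union>h\<in>D. P h) V1 u" by (meson insertI2)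
 hence "averaged k V ph N dh (P h \<union> (\<Union>h\<in>D. P h)) (V0 h \<inter> V1) u"
  using averaged_Un[OF _ _ dh] insert.prems by blast
 thus ?case using \<open>p \<in> V1\<close> insert.prems by (intro exI[of _ "V0 h \<inter> V1"]) simp
qed

text \<open>For a fixed point of \<open>S\<close>, every group element has a neighbourhood over
  which averages are good. Finitely many of these cover the compact set, and the corresponding
  neighbourhoods of the point are intersected.\<close>

theorem weak_integral_vanishes:
 assumes si: "si \<in> bundle_distributions B \<A> r \<pi> \<T>" "vanishes_along B \<A> r \<pi> \<T> S k si"
  and dh: "smooth_measure C \<H> dh" and Om: "compact Om"
 shows "vanishes_along B \<A> r \<pi> \<T> S k (weak_integral dh Om (%h. translate H act lift h si))"
 unfolding vanishes_along_def scalar_vanishes_def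
proof (intro ballI allI impI)
 fix t i p assume t: "t \<in> \<T>" and i: "i < r" and p: "p \<in> S \<inter> fst t"
 obtain T Ph where e: "t = (T, Ph)" by (cases t)
 have tT: "(T, Ph) \<in> \<T>" "p \<in> S" "p \<in> T" using t p e by auto
 have sdh: "sets dh = sets borel" using dh by (simp add: smooth_measure_def)
 \<comment> \<open>The adapted chart at \<open>p\<close> is chosen before \<open>h\<close>, so the
   local averages have a common form and can be added.\<close>
 obtain V ph N where V: "adapted V ph N" "p \<in> V" by (rule adapted_ex[OF tT(2)])
 let ?u = "%h om. si (pull h (tens om t i))"
 have "ALL h. EX X. h \<in> fst X & p \<in> snd X & averaged k V ph N dh (fst X) (snd X) ?u"
 proof
  fix h
  obtain P V0 where "h \<in> P" "p \<in> V0" "averaged k V ph N dh P V0 ?u"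
   using tensor_averages[OF tT(1) i tT(2,3) V(2,1) si sdh, of h] unfolding averages_near_def e by (elim exE conjE)
  thus "EX X. h \<in> fst X & p \<in> snd X & averaged k V ph N dh (fst X) (snd X) ?u"
   by (intro exI[of _ "(P, V0)"]) simp
 qed
 from choice[OF this] obtain X where X: "ALL h. h \<in> fst (X h) & p \<in> snd (X h) & averaged k V ph N dh (fst (X h)) (snd (X h)) ?u" ..
 have o: "open (fst (X h))" for h using X unfolding averaged_def by simp
 have cov: "Om <= (\<Union>h\<in>Om. fst (X h))" using X by auto
 obtain D where D: "finite D" "Om <= (\<Union>h\<in>D. fst (X h))" by (rule compactE_image[OF Om o cov])
 have "EX V0. p \<in> V0 & averaged k V ph N dh (\<Union>h\<in>D. fst (X h)) V0 ?u"
  by (rule averaged_UN[OF D(1) _ sdh, of p "%h. snd (X h)"]) (simp add: X)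
 then obtain V0 where "p \<in> V0 & averaged k V ph N dh (\<Union>h\<in>D. fst (X h)) V0 ?u" ..
 hence V0: "p \<in> V0" "averaged k V ph N dh (\<Union>h\<in>D. fst (X h)) V0 ?u" by simp_all
 have "Om \<in> sets borel" using compact_imp_closed[OF Om] by simp
 hence g: "good k V ph N V0 (%om. LINT h:Om|dh. ?u h om)" and o0: "open V0"
  using V0(2) D(2) finite_measure_compact[OF dh Om] unfolding averaged_def by simp_all
 let ?W = "V \<inter> (V0 \<inter> T)"
 have W: "open ?W" "?W <= V" using chart_open[OF adapted_chart[OF V(1)]] o0 triv_open[OF tT(1)] by auto
 have "good k V ph N ?W (component \<pi> t i (weak_integral dh Om (%h. translate H act lift h si)))"
  by (rule good_cong[OF good_mono[OF g]]) (auto simp: component_tens weak_integral_def translate_def)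
 note gv = good_vanishes[OF this V(1) W]
 show "EX U. open U & p \<in> U & U <= fst t & (EX (M::nat) f D h. (ALL j<M. f j \<in> ideal_power B \<A> S k U &
   diff_operator B \<A> U (D j) & tangential B \<A> S U (D j) & h j \<in> Linf_loc B \<A> U) &
   (ALL om:test_measures B \<A> U. component \<pi> t i (weak_integral dh Om (%h. translate H act lift h si)) om =
    (\<Sum>j<M. fDh_distribution B \<A> U (f j) (D j) (h j) om)))"
  by (intro exI[of _ ?W] conjI gv W(1)) (use V(2) V0(1) tT(3) e in auto)
qed

end

theorem proposition7p20:
  fixes B :: "'e::euclidean_space set"
    and \<A> :: "('m::{t2_space, second_countable_topology}, 'e) chart set"
    and S :: "'m set"
    and C :: "'a::euclidean_space set"
    and \<H> :: "('h::{t2_space, second_countable_topology}, 'a) chart set"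
    and H :: "'h monoid"
    and act :: "'h \<Rightarrow> 'm \<Rightarrow> 'm"
    and r :: nat
    and \<pi> :: "'b \<Rightarrow> 'm"
    and \<T> :: "('m, 'b) triv set"
    and lift :: "'h \<Rightarrow> 'b \<Rightarrow> 'b"
    and dh :: "'h measure"
    and \<Omega> :: "'h set"
    and k :: nat
    and \<sigma> :: "(('m, 'e) chart \<Rightarrow> 'b \<Rightarrow> complex) \<Rightarrow> complex"
  assumes "smooth_manifold B \<A>"
    and "closed_submanifold B \<A> S"
    and "Lie_group C \<H> H"
    and "smooth_action C \<H> H B \<A> act"
    and "\<And>h. act h ` S \<subseteq> S"
    and "equivariant_bundle C \<H> H B \<A> act r \<pi> \<T> lift"
    and "smooth_measure C \<H> dh"
    and "compact \<Omega>" and "\<Omega> \<in> sets dh"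
    and "\<sigma> \<in> bundle_distributions B \<A> r \<pi> \<T>"
    and "vanishes_along B \<A> r \<pi> \<T> S k \<sigma>"
  shows "weak_integral dh \<Omega> (\<lambda>h. translate H act lift h \<sigma>) \<in> bundle_distributions B \<A> r \<pi> \<T> \<and>
    vanishes_along B \<A> r \<pi> \<T> S k (weak_integral dh \<Omega> (\<lambda>h. translate H act lift h \<sigma>))"
proof -
  interpret setting B \<A> C \<H> H act r \<pi> \<T> lift S
    by unfold_locales (use assms in \<open>simp_all add: Lie_group_def\<close>)
  show ?thesis
    using weak_integral_distribution[OF assms(10,7,8)] weak_integral_vanishes[OF assms(10,11,7,8)] by blast
qed

end
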